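(* Let $(H,\Delta)$ be a compact quantum group admitting a finite-dimensional representation $V$ whose $K_1$-class in $K_1(H)$ is not trivial, and let $A$ be a unital C*-algebra equipped with a free coaction $\delta\colon A\to A\otimes_{\min}H$. If $(A,\delta)=(H,\Delta)$ or $A$ admits a character, then the associated finitely generated projective left $(A\circledast^\delta H)^{\mathrm{co}H}$-module $$\mathcal{P}_H\big(A\circledast^\delta H\big)\,\Box\, V$$ is not stably free.
   Context: All $*$-homomorphisms between unital C*-algebras are unital. "cls" means closed linear span. A character is a unital $*$-homomorphism to $\mathbb{C}$. A compact quantum group $(H,\Delta)$ is a unital C*-algebra $H$ with an injective coassociative $*$-homomorphism $\Delta\colon H\to H\otimes_{\min}H$ such that $\{\Delta(g)(1\otimes h)\mid g,h\in H\}^{cls}=H\otimes_{\min}H=\{(g\otimes1)\Delta(h)\mid g,h\in H\}^{cls}$. $\mathcal{O}(H)\subseteq H$ is the dense Hopf $*$-algebra spanned by matrix coefficients of irreducible unitary corepresentations of $H$. A coaction (action of $(H,\Delta)$) on a unital C*-algebra $A$ is an injective $*$-homomorphism $\delta\colon A\to A\otimes_{\min}H$ with $(\delta\otimes\mathrm{id})\circ\delta=(\mathrm{id}\otimes\Delta)\circ\delta$ and $\{\delta(a)(1\otimes h)\mid a\in A,h\in H\}^{cls}=A\otimes_{\min}H$. It is free iff $\{(x\otimes1)\delta(y)\mid x,y\in A\}^{cls}=A\otimes_{\min}H$. The coproduct $\Delta$ is itself a free coaction of $(H,\Delta)$ on $H$. The equivariant noncommutative join is $A\circledast^\delta H:=\{f\in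 C([0,1],A\otimes_{\min}H)\mid f(0)\in\mathbb{C}\otimes H,\ f(1)\in\delta(A)\}$, with the free action of $(H,\Delta)$ induced by $f\mapsto(\mathrm{id}\otimes\Delta)\circ f$. For a unital C*-algebra $B$ with a coaction $\delta_B$ of $(H,\Delta)$: the fixed-point subalgebra is $B^{\mathrm{co}H}:=\{b\in B\mid\delta_B(b)=b\otimes1\}$; the Peter–Weyl subalgebra is $\mathcal{P}_H(B):=\{b\in B\mid\delta_B(b)\in B\otimes\mathcal{O}(H)\}$ (algebraic tensor product). A finite-dimensional representation $V$ of $(H,\Delta)$ is a finite-dimensional left $\mathcal{O}(H)$-comodule with coaction ${}_V\Delta\colon V\to\mathcal{O}(H)\otimes V$; the cotensor product is $\mathcal{P}_H(B)\Box V:=\{t\in\mathcal{P}_H(B)\otimes V\mid(\delta_B\otimes\mathrm{id})(t)=(\mathrm{id}\otimes{}_V\Delta)(t)\}$, a left $B^{\mathrm{co}H}$-module, which is finitely generated projective when the action on $B$ is free. The $K_1$-class of $V$ is the class in $K_1(H)$ of the invertible matrix $U_V=(u_{ij})\in GL_{\dim V}(H)$ defined by ${}_V\Delta(e_i)=\sum_j u_{ij}\otimes e_j$ for a basis $(e_i)$ of $V$. A left module $M$ over a ring $R$ is stably free iff $M\oplus R^m\cong R^n$ for some $m,n\in\mathbb{N}$. *)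

theory Defs
  imports "HOL-Analysis.Analysis" "HOL-Library.Function_Algebras"
begin

section \<open>Complex vector spaces and unital C*-algebras\<close>

class scaleC =
  fixes scaleC :: "complex \<Rightarrow> 'a \<Rightarrow> 'a" (infixr \<open>*\<^sub>C\<close> 75)

class complex_vector = scaleC + ab_group_add +
  assumes scaleC_add_right: "c *\<^sub>C (x + y) = c *\<^sub>C x + c *\<^sub>C y"
    and scaleC_add_left: "(c + d) *\<^sub>C x = c *\<^sub>C x + d *\<^sub>C x"
    and scaleC_scaleC: "c *\<^sub>C (d *\<^sub>C x) = (c * d) *\<^sub>C x"
    and scaleC_one: "1 *\<^sub>C x = x"

interpretation complex_vector: vector_space "scaleC :: complex \<Rightarrow> 'a \<Rightarrow> 'a::complex_vector"
  by unfold_locales (simp_all add: scaleC_add_right scaleC_add_left scaleC_scaleC scaleC_one)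

interpretation complex_vector: vector_space_pair
  "scaleC :: complex \<Rightarrow> 'a \<Rightarrow> 'a::complex_vector" "scaleC :: complex \<Rightarrow> 'b \<Rightarrow> 'b::complex_vector"
  by unfold_locales

abbreviation cspan :: "'a::complex_vector set \<Rightarrow> 'a set"
  where "cspan \<equiv> module.span scaleC"

abbreviation csubspace :: "'a::complex_vector set \<Rightarrow> bool"
  where "csubspace \<equiv> module.subspace scaleC"

abbreviation cindependent :: "'a::complex_vector set \<Rightarrow> bool"
  where "cindependent S \<equiv> \<not> module.dependent scaleC S"

abbreviation clinear :: "('a::complex_vector \<Rightarrow> 'b::complex_vector) \<Rightarrow> bool"
  where "clinear \<equiv> Vector_Spaces.linear scaleC scaleC"

definition cbilinear :: "('a::complex_vector \<Rightarrow> 'b::complex_vector \<Rightarrow> 'c::complex_vector) \<Rightarrow> bool"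
  where "cbilinear f \<longleftrightarrow> (\<forall>a. clinear (f a)) \<and> (\<forall>b. clinear (\<lambda>a. f a b))"

instantiation complex :: complex_vector
begin
definition scaleC_complex :: "complex \<Rightarrow> complex \<Rightarrow> complex"
  where "scaleC_complex c x = c * x"
instance
  by standard (simp_all add: scaleC_complex_def algebra_simps)
end

instantiation "fun" :: (type, complex_vector) complex_vector
begin
definition scaleC_fun :: "complex \<Rightarrow> ('a \<Rightarrow> 'b) \<Rightarrow> 'a \<Rightarrow> 'b"
  where "scaleC_fun c f = (\<lambda>x. c *\<^sub>C f x)"
instance
  by standard
    (simp_all add: scaleC_fun_def fun_eq_iff scaleC_add_right scaleC_add_left scaleC_scaleC scaleC_one)
end

text \<open>Nonzero unital C*-algebras (\<^class>\<open>real_normed_algebra_1\<close> demands \<open>norm 1 = 1\<close>).\<close>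

class cstar_algebra = complex_vector + banach + real_normed_algebra_1 +
  fixes star :: "'a \<Rightarrow> 'a"
  assumes scaleR_scaleC: "r *\<^sub>R x = complex_of_real r *\<^sub>C x"
    and mult_scaleC_left: "(c *\<^sub>C x) * y = c *\<^sub>C (x * y)"
    and mult_scaleC_right: "x * (c *\<^sub>C y) = c *\<^sub>C (x * y)"
    and norm_scaleC: "norm (c *\<^sub>C x) = cmod c * norm x"
    and star_star: "star (star x) = x"
    and star_add: "star (x + y) = star x + star y"
    and star_scaleC: "star (c *\<^sub>C x) = cnj c *\<^sub>C star x"
    and star_mult: "star (x * y) = star y * star x"
    and cstar_identity: "norm (star x * x) = (norm x)\<^sup>2"

instantiation complex :: cstar_algebra
begin
definition star_complex :: "complex \<Rightarrow> complex"
  where "star_complex = cnj"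
instance
  by standard
    (simp_all add: scaleC_complex_def star_complex_def scaleR_conv_of_real norm_mult power2_eq_square)
end

definition cstar_hom :: "('a::cstar_algebra \<Rightarrow> 'b::cstar_algebra) \<Rightarrow> bool"
  where "cstar_hom f \<longleftrightarrow> clinear f \<and> (\<forall>x y. f (x * y) = f x * f y)
    \<and> (\<forall>x. f (star x) = star (f x)) \<and> f 1 = 1"

abbreviation cls :: "'a::cstar_algebra set \<Rightarrow> 'a set"
  where "cls S \<equiv> closure (cspan S)"


section \<open>The algebraic tensor product\<close>

text \<open>Formal sums of pairs, identified when no bilinear form separates them.\<close>

definition atensor_rel ::
    "('a::complex_vector \<times> 'b::complex_vector) list \<Rightarrow> ('a \<times> 'b) list \<Rightarrow> bool"
  where "atensor_rel xs ys \<longleftrightarrow> (\<forall>\<beta> :: 'a \<Rightarrow> 'b \<Rightarrow> complex. cbilinear \<beta> \<longrightarrow>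
    (\<Sum>(a, b)\<leftarrow>xs. \<beta> a b) = (\<Sum>(a, b)\<leftarrow>ys. \<beta> a b))"

quotient_type (overloaded) ('a, 'b) atensor =
    "('a::complex_vector \<times> 'b::complex_vector) list" / atensor_rel
  by (rule equivpI) (auto simp: reflp_def symp_def transp_def atensor_rel_def)

lemma cbilinear_scaleC_left: "cbilinear f \<Longrightarrow> f (c *\<^sub>C a) b = c *\<^sub>C f a b"
  unfolding cbilinear_def using complex_vector.linear_scale[of "\<lambda>a. f a b"] by auto

lemma sum_list_scaleC_left:
  assumes "cbilinear f"
  shows "(\<Sum>(a, b)\<leftarrow>map (\<lambda>(a, b). (c *\<^sub>C a, b)) xs. f a b) = c *\<^sub>C (\<Sum>(a, b)\<leftarrow>xs. f a b)"
  using assms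
  by (induction xs) (auto simp: cbilinear_scaleC_left scaleC_add_right)

instantiation atensor :: (complex_vector, complex_vector) complex_vector
begin

lift_definition zero_atensor :: "('a, 'b) atensor" is "[]" .

lift_definition plus_atensor :: "('a, 'b) atensor \<Rightarrow> ('a, 'b) atensor \<Rightarrow> ('a, 'b) atensor"
  is "(@)" by (simp add: atensor_rel_def)

lift_definition scaleC_atensor :: "complex \<Rightarrow> ('a, 'b) atensor \<Rightarrow> ('a, 'b) atensor"
  is "\<lambda>c. map (\<lambda>(a, b). (c *\<^sub>C a, b))"
  by (simp add: atensor_rel_def sum_list_scaleC_left del: map_map)

definition uminus_atensor :: "('a, 'b) atensor \<Rightarrow> ('a, 'b) atensor"
  where "uminus_atensor x = (-1) *\<^sub>C x"

definition minus_atensor :: "('a, 'b) atensor \<Rightarrow> ('a, 'b) atensor \<Rightarrow> ('a, 'b) atensor"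
  where "minus_atensor x y = x + (- y)"

instance
proof
  fix x y z :: "('a, 'b) atensor" and c d :: complex
  show "x + y + z = x + (y + z)"
    by transfer (simp add: atensor_rel_def)
  show "x + y = y + x"
    by transfer (simp add: atensor_rel_def add.commute)
  show "0 + x = x"
    by transfer (simp add: atensor_rel_def)
  show "- x + x = 0"
    unfolding uminus_atensor_def
    by transfer (simp add: atensor_rel_def sum_list_scaleC_left scaleC_complex_def
      del: map_map complex_vector.scale_minus_left)
  show "x - y = x + - y"
    by (rule minus_atensor_def)
  show "c *\<^sub>C (x + y) = c *\<^sub>C x + c *\<^sub>C y"
    by transfer (simp add: atensor_rel_def)
  show "(c + d) *\<^sub>C x = c *\<^sub>C x + d *\<^sub>C x"
    by transfer (simp add: atensor_rel_def sum_list_scaleC_left del: map_map, simp add: scaleC_add_left)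
  show "c *\<^sub>C (d *\<^sub>C x) = (c * d) *\<^sub>C x"
    by transfer (simp add: atensor_rel_def sum_list_scaleC_left scaleC_scaleC del: map_map)
  show "1 *\<^sub>C x = x"
    by transfer (simp add: atensor_rel_def sum_list_scaleC_left scaleC_one del: map_map)
qed

end

lift_definition atens :: "'a::complex_vector \<Rightarrow> 'b::complex_vector \<Rightarrow> ('a, 'b) atensor"
  is "\<lambda>a b. [(a, b)]" .

text \<open>The linear map induced by \<open>f\<close>; independent of the representing formal sum when \<open>f\<close> is bilinear.\<close>

definition atensor_lift ::
    "('a::complex_vector \<Rightarrow> 'b::complex_vector \<Rightarrow> 'c::complex_vector) \<Rightarrow> ('a, 'b) atensor \<Rightarrow> 'c"
  where "atensor_lift f t = (\<Sum>(a, b)\<leftarrow>rep_atensor t. f a b)"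

definition atensor_map ::
    "('a::complex_vector \<Rightarrow> 'c::complex_vector) \<Rightarrow> ('b::complex_vector \<Rightarrow> 'd::complex_vector)
      \<Rightarrow> ('a, 'b) atensor \<Rightarrow> ('c, 'd) atensor"
  where "atensor_map f g = atensor_lift (\<lambda>a b. atens (f a) (g b))"

lemma functional_separates:
  fixes v :: "'a::complex_vector"
  assumes "v \<noteq> 0"
  shows "\<exists>\<phi> :: 'a \<Rightarrow> complex. clinear \<phi> \<and> \<phi> v = 1"
proof -
  have "cindependent {v}"
    using assms by simp
  from complex_vector.linear_independent_extend[OF this, of "\<lambda>_. 1"] show ?thesis
    by auto
qed

lemma atensor_rel_bilinear:
  fixes f :: "'a::complex_vector \<Rightarrow> 'b::complex_vector \<Rightarrow> 'c::complex_vector"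
  assumes f: "cbilinear f" and rel: "atensor_rel xs ys"
  shows "(\<Sum>(a, b)\<leftarrow>xs. f a b) = (\<Sum>(a, b)\<leftarrow>ys. f a b)" (is "?x = ?y")
proof (rule ccontr)
  assume "?x \<noteq> ?y"
  then obtain \<phi> :: "'c \<Rightarrow> complex" where \<phi>: "clinear \<phi>" "\<phi> (?x - ?y) = 1"
    using functional_separates[of "?x - ?y"] by auto
  have bil: "cbilinear (\<lambda>a b. \<phi> (f a b))"
    unfolding cbilinear_def
  proof (intro conjI allI)
    show "clinear (\<lambda>b. \<phi> (f a b))" for a
      using Vector_Spaces.linear_compose[OF _ \<phi>(1), of scaleC "f a"] f by (simp add: cbilinear_def comp_def)
    show "clinear (\<lambda>a. \<phi> (f a b))" for b
      using Vector_Spaces.linear_compose[OF _ \<phi>(1), of scaleC "\<lambda>a. f a b"] f by (simp add: cbilinear_def comp_def)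
  qed
  have push: "\<phi> (\<Sum>(a, b)\<leftarrow>zs. f a b) = (\<Sum>(a, b)\<leftarrow>zs. \<phi> (f a b))" for zs
    using \<phi>(1)
    by (induction zs) (auto simp: complex_vector.linear_0 complex_vector.linear_add)
  have "\<phi> ?x = \<phi> ?y"
    using rel bil unfolding atensor_rel_def push by blast
  then show False
    using \<phi> by (simp add: complex_vector.linear_diff)
qed

lemma atensor_lift_abs:
  "cbilinear f \<Longrightarrow> atensor_lift f (abs_atensor xs) = (\<Sum>(a, b)\<leftarrow>xs. f a b)"
  unfolding atensor_lift_def
  by (rule atensor_rel_bilinear) (use Quotient3_rep_abs[OF Quotient3_atensor] in \<open>auto simp: atensor_rel_def\<close>)

lemma atensor_lift_atens: "cbilinear f \<Longrightarrow> atensor_lift f (atens a b) = f a b"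
  by (simp add: atens.abs_eq atensor_lift_abs)


section \<open>The minimal tensor product\<close>

text \<open>The spatial norm is formed in the Hilbert spaces \<open>\<ell>\<^sup>2(I)\<close>, with \<open>\<ell>\<^sup>2(I) \<otimes> \<ell>\<^sup>2(J) = \<ell>\<^sup>2(I \<times> J)\<close>.
  Operators are total functions of which only the values on \<open>\<ell>\<^sup>2\<close> matter.\<close>

definition ell2 :: "('i \<Rightarrow> complex) set"
  where "ell2 = {x. (\<lambda>i. (cmod (x i))\<^sup>2) summable_on UNIV}"

definition ell2_norm :: "('i \<Rightarrow> complex) \<Rightarrow> real"
  where "ell2_norm x = sqrt (\<Sum>\<^sub>\<infinity>i. (cmod (x i))\<^sup>2)"

definition ell2_inner :: "('i \<Rightarrow> complex) \<Rightarrow> ('i \<Rightarrow> complex) \<Rightarrow> complex"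
  where "ell2_inner x y = (\<Sum>\<^sub>\<infinity>i. cnj (x i) * y i)"

definition bounded_op :: "(('i \<Rightarrow> complex) \<Rightarrow> 'i \<Rightarrow> complex) \<Rightarrow> bool"
  where "bounded_op T \<longleftrightarrow> (\<forall>x\<in>ell2. T x \<in> ell2)
    \<and> (\<forall>x\<in>ell2. \<forall>y\<in>ell2. T (x + y) = T x + T y)
    \<and> (\<forall>c. \<forall>x\<in>ell2. T (c *\<^sub>C x) = c *\<^sub>C T x)
    \<and> (\<exists>K. \<forall>x\<in>ell2. ell2_norm (T x) \<le> K * ell2_norm x)"

definition op_norm :: "(('i \<Rightarrow> complex) \<Rightarrow> 'i \<Rightarrow> complex) \<Rightarrow> real"
  where "op_norm T = Sup {ell2_norm (T x) | x. x \<in> ell2 \<and> ell2_norm x \<le> 1}"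

definition faithful_rep :: "('a::cstar_algebra \<Rightarrow> ('i \<Rightarrow> complex) \<Rightarrow> 'i \<Rightarrow> complex) \<Rightarrow> bool"
  where "faithful_rep \<pi> \<longleftrightarrow> (\<forall>a. bounded_op (\<pi> a))
    \<and> (\<forall>x\<in>ell2. (\<forall>a b. \<pi> (a + b) x = \<pi> a x + \<pi> b x) \<and> (\<forall>c a. \<pi> (c *\<^sub>C a) x = c *\<^sub>C \<pi> a x)
        \<and> (\<forall>a b. \<pi> (a * b) x = \<pi> a (\<pi> b x)) \<and> \<pi> 1 x = x)
    \<and> (\<forall>a. \<forall>x\<in>ell2. \<forall>y\<in>ell2. ell2_inner (\<pi> (star a) x) y = ell2_inner x (\<pi> a y))
    \<and> (\<forall>a. (\<forall>x\<in>ell2. \<pi> a x = 0) \<longrightarrow> a = 0)"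

definition ell2_tensor :: "('i \<Rightarrow> complex) \<Rightarrow> ('j \<Rightarrow> complex) \<Rightarrow> 'i \<times> 'j \<Rightarrow> complex"
  where "ell2_tensor x y = (\<lambda>(i, j). x i * y j)"

definition op_tensor :: "(('i \<Rightarrow> complex) \<Rightarrow> 'i \<Rightarrow> complex) \<Rightarrow> (('j \<Rightarrow> complex) \<Rightarrow> 'j \<Rightarrow> complex)
    \<Rightarrow> ('i \<times> 'j \<Rightarrow> complex) \<Rightarrow> 'i \<times> 'j \<Rightarrow> complex"
  where "op_tensor S T = (SOME X. bounded_op X \<and>
    (\<forall>x\<in>ell2. \<forall>y\<in>ell2. X (ell2_tensor x y) = ell2_tensor (S x) (T y)))"

definition spatial_norm :: "('a::cstar_algebra \<Rightarrow> ('i \<Rightarrow> complex) \<Rightarrow> 'i \<Rightarrow> complex)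
    \<Rightarrow> ('b::cstar_algebra \<Rightarrow> ('j \<Rightarrow> complex) \<Rightarrow> 'j \<Rightarrow> complex) \<Rightarrow> ('a, 'b) atensor \<Rightarrow> real"
  where "spatial_norm \<pi> \<rho> t = op_norm (\<Sum>(a, b)\<leftarrow>rep_atensor t. op_tensor (\<pi> a) (\<rho> b))"

text \<open>\<open>min_tensor t\<close>: the type \<open>'c\<close> is the minimal (spatial) tensor product of \<open>'a\<close> and \<open>'b\<close>, with
  elementary tensors \<open>t a b\<close>. The spatial norm does not depend on the choice of the faithful
  representations, and every C*-algebra carried by the type \<open>'a\<close> has a faithful representation
  on \<open>\<ell>\<^sup>2('a)\<close>.\<close>

definition min_tensor ::
    "('a::cstar_algebra \<Rightarrow> 'b::cstar_algebra \<Rightarrow> 'c::cstar_algebra) \<Rightarrow> bool"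
  where "min_tensor t \<longleftrightarrow> cbilinear t
    \<and> (\<forall>a b a' b'. t a b * t a' b' = t (a * a') (b * b'))
    \<and> (\<forall>a b. star (t a b) = t (star a) (star b))
    \<and> t 1 1 = 1
    \<and> cls {t a b | a b. True} = UNIV
    \<and> (\<exists>(\<pi> :: 'a \<Rightarrow> ('a \<Rightarrow> complex) \<Rightarrow> 'a \<Rightarrow> complex) (\<rho> :: 'b \<Rightarrow> ('b \<Rightarrow> complex) \<Rightarrow> 'b \<Rightarrow> complex).
        faithful_rep \<pi> \<and> faithful_rep \<rho> \<and> (\<forall>x. norm (atensor_lift t x) = spatial_norm \<pi> \<rho> x))"

text \<open>Threefold tensor products: both bracketings are realised on the same C*-algebra.\<close>

definition min_tensor3 ::
    "('a::cstar_algebra \<Rightarrow> 'b::cstar_algebra \<Rightarrow> 'ab::cstar_algebra)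
      \<Rightarrow> ('ab \<Rightarrow> 'c::cstar_algebra \<Rightarrow> 'abc::cstar_algebra)
      \<Rightarrow> ('b \<Rightarrow> 'c \<Rightarrow> 'bc::cstar_algebra) \<Rightarrow> ('a \<Rightarrow> 'bc \<Rightarrow> 'abc) \<Rightarrow> bool"
  where "min_tensor3 tab tab_c tbc ta_bc \<longleftrightarrow>
    min_tensor tab \<and> min_tensor tab_c \<and> min_tensor tbc \<and> min_tensor ta_bc
    \<and> (\<forall>a b c. tab_c (tab a b) c = ta_bc a (tbc b c))"

text \<open>The continuous extension of \<open>f \<otimes> g\<close> to the minimal tensor products.\<close>

definition min_tensor_map ::
    "('a::cstar_algebra \<Rightarrow> 'b::cstar_algebra \<Rightarrow> 'ab::cstar_algebra)
      \<Rightarrow> ('c::cstar_algebra \<Rightarrow> 'd::cstar_algebra \<Rightarrow> 'cd::cstar_algebra)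
      \<Rightarrow> ('a \<Rightarrow> 'c) \<Rightarrow> ('b \<Rightarrow> 'd) \<Rightarrow> 'ab \<Rightarrow> 'cd"
  where "min_tensor_map t t' f g =
    (THE F. bounded_linear F \<and> (\<forall>a b. F (t a b) = t' (f a) (g b)))"


section \<open>Compact quantum groups and coactions\<close>

definition compact_quantum_group ::
    "('h::cstar_algebra \<Rightarrow> 'h \<Rightarrow> 'hh::cstar_algebra) \<Rightarrow> ('hh \<Rightarrow> 'h \<Rightarrow> 'hhh::cstar_algebra)
      \<Rightarrow> ('h \<Rightarrow> 'hh \<Rightarrow> 'hhh) \<Rightarrow> ('h \<Rightarrow> 'hh) \<Rightarrow> bool"
  where "compact_quantum_group t t' t'' \<Delta> \<longleftrightarrow> min_tensor3 t t' t t''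
    \<and> cstar_hom \<Delta> \<and> inj \<Delta>
    \<and> min_tensor_map t t' \<Delta> id \<circ> \<Delta> = min_tensor_map t t'' id \<Delta> \<circ> \<Delta>
    \<and> cls {\<Delta> g * t 1 h | g h. True} = UNIV
    \<and> cls {t g 1 * \<Delta> h | g h. True} = UNIV"

definition coaction ::
    "('h::cstar_algebra \<Rightarrow> 'h \<Rightarrow> 'hh::cstar_algebra) \<Rightarrow> ('h \<Rightarrow> 'hh)
      \<Rightarrow> ('a::cstar_algebra \<Rightarrow> 'h \<Rightarrow> 'ah::cstar_algebra) \<Rightarrow> ('ah \<Rightarrow> 'h \<Rightarrow> 'ahh::cstar_algebra)
      \<Rightarrow> ('a \<Rightarrow> 'hh \<Rightarrow> 'ahh) \<Rightarrow> ('a \<Rightarrow> 'ah) \<Rightarrow> bool"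
  where "coaction t \<Delta> s s' s'' \<delta> \<longleftrightarrow> min_tensor3 s s' t s''
    \<and> cstar_hom \<delta> \<and> inj \<delta>
    \<and> min_tensor_map s s' \<delta> id \<circ> \<delta> = min_tensor_map s s'' id \<Delta> \<circ> \<delta>
    \<and> cls {\<delta> a * s 1 h | a h. True} = UNIV"

definition free_coaction ::
    "('a::cstar_algebra \<Rightarrow> 'h::cstar_algebra \<Rightarrow> 'ah::cstar_algebra) \<Rightarrow> ('a \<Rightarrow> 'ah) \<Rightarrow> bool"
  where "free_coaction s \<delta> \<longleftrightarrow> cls {s x 1 * \<delta> y | x y. True} = UNIV"

text \<open>A corepresentation on \<open>\<complex>\<^sup>n\<close> is given by the upper left \<open>n \<times> n\<close> block of \<open>u\<close>. It makes \<open>\<complex>\<^sup>n\<close> a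
  left comodule via \<open>e\<^sub>i \<mapsto> \<Sum>\<^sub>j u\<^sub>i\<^sub>j \<otimes> e\<^sub>j\<close>.\<close>

definition unitary_corep ::
    "('h::cstar_algebra \<Rightarrow> 'h \<Rightarrow> 'hh::cstar_algebra) \<Rightarrow> ('h \<Rightarrow> 'hh) \<Rightarrow> nat \<Rightarrow> (nat \<Rightarrow> nat \<Rightarrow> 'h) \<Rightarrow> bool"
  where "unitary_corep t \<Delta> n u \<longleftrightarrow> (\<forall>i<n. \<forall>j<n.
      \<Delta> (u i j) = (\<Sum>k<n. t (u i k) (u k j))
      \<and> (\<Sum>k<n. u i k * star (u j k)) = (if i = j then 1 else 0)
      \<and> (\<Sum>k<n. star (u k i) * u k j) = (if i = j then 1 else 0))"

definition Cn :: "nat \<Rightarrow> (nat \<Rightarrow> complex) set"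
  where "Cn n = {w. \<forall>i\<ge>n. w i = 0}"

text \<open>\<open>W\<close> is invariant if the coaction maps it into \<open>H \<otimes> W\<close>; here \<open>H \<otimes> \<complex>\<^sup>n\<close> is written as \<open>H\<^sup>n\<close>.\<close>

definition invariant_subspace ::
    "nat \<Rightarrow> (nat \<Rightarrow> nat \<Rightarrow> 'h::cstar_algebra) \<Rightarrow> (nat \<Rightarrow> complex) set \<Rightarrow> bool"
  where "invariant_subspace n u W \<longleftrightarrow> csubspace W \<and> W \<subseteq> Cn n \<and>
    (\<forall>w\<in>W. (\<lambda>j. if j < n then \<Sum>i<n. w i *\<^sub>C u i j else 0)
        \<in> cspan {\<lambda>j. w' j *\<^sub>C h | w' h. w' \<in> W})"

definition irreducible_corep :: "nat \<Rightarrow> (nat \<Rightarrow> nat \<Rightarrow> 'h::cstar_algebra) \<Rightarrow> bool"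
  where "irreducible_corep n u \<longleftrightarrow> n > 0 \<and> (\<forall>W. invariant_subspace n u W \<longrightarrow> W = {0} \<or> W = Cn n)"

text \<open>\<open>\<O>(H)\<close>. Irreducible unitary corepresentations of a compact quantum group are
  finite-dimensional.\<close>

definition hopf_algebra ::
    "('h::cstar_algebra \<Rightarrow> 'h \<Rightarrow> 'hh::cstar_algebra) \<Rightarrow> ('h \<Rightarrow> 'hh) \<Rightarrow> 'h set"
  where "hopf_algebra t \<Delta> =
    cspan {u i j | n u i j. unitary_corep t \<Delta> n u \<and> irreducible_corep n u \<and> i < n \<and> j < n}"

definition atensor_of :: "'a::complex_vector set \<Rightarrow> 'b::complex_vector set \<Rightarrow> ('a, 'b) atensor set"
  where "atensor_of X Y = cspan {atens x y | x y. x \<in> X \<and> y \<in> Y}"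

text \<open>The counit of \<open>\<O>(H)\<close>; values outside \<open>\<O>(H)\<close> are irrelevant.\<close>

definition is_counit ::
    "('h::cstar_algebra \<Rightarrow> 'h \<Rightarrow> 'hh::cstar_algebra) \<Rightarrow> ('h \<Rightarrow> 'hh) \<Rightarrow> ('h \<Rightarrow> complex) \<Rightarrow> bool"
  where "is_counit t \<Delta> \<epsilon> \<longleftrightarrow> clinear \<epsilon> \<and>
    (\<forall>h \<in> hopf_algebra t \<Delta>. \<forall>z \<in> atensor_of (hopf_algebra t \<Delta>) (hopf_algebra t \<Delta>).
      atensor_lift t z = \<Delta> h \<longrightarrow>
        atensor_lift (\<lambda>x y. \<epsilon> x *\<^sub>C y) z = h \<and> atensor_lift (\<lambda>x y. \<epsilon> y *\<^sub>C x) z = h)"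

text \<open>Left comodules over the coalgebra \<open>\<O>(H)\<close>: coassociative and counital.\<close>

definition left_comodule ::
    "('h::cstar_algebra \<Rightarrow> 'h \<Rightarrow> 'hh::cstar_algebra) \<Rightarrow> ('h \<Rightarrow> 'hh)
      \<Rightarrow> ('v::complex_vector \<Rightarrow> ('h, 'v) atensor) \<Rightarrow> bool"
  where "left_comodule t \<Delta> cV \<longleftrightarrow> clinear cV
    \<and> range cV \<subseteq> atensor_of (hopf_algebra t \<Delta>) UNIV
    \<and> (\<forall>v. atensor_map \<Delta> id (cV v) = atensor_lift (\<lambda>h w. atensor_map (t h) id (cV w)) (cV v))
    \<and> (\<exists>\<epsilon>. is_counit t \<Delta> \<epsilon> \<and> (\<forall>v. atensor_lift (\<lambda>h w. \<epsilon> h *\<^sub>C w) (cV v) = v))"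


section \<open>Fixed points, Peter--Weyl subalgebra and associated modules\<close>

text \<open>Here \<open>B\<close> is a subalgebra of the ambient type, and \<open>tB b h\<close> is the elementary tensor
  \<open>b \<otimes> h\<close> in the codomain of the coaction \<open>\<delta>B\<close>.\<close>

definition fixed_points :: "'b set \<Rightarrow> ('b \<Rightarrow> 'h::cstar_algebra \<Rightarrow> 'bh) \<Rightarrow> ('b \<Rightarrow> 'bh) \<Rightarrow> 'b set"
  where "fixed_points B tB \<delta>B = {b \<in> B. \<delta>B b = tB b 1}"

definition peter_weyl :: "'h set \<Rightarrow> 'b set \<Rightarrow> ('b \<Rightarrow> 'h::cstar_algebra \<Rightarrow> 'bh::complex_vector)
    \<Rightarrow> ('b \<Rightarrow> 'bh) \<Rightarrow> 'b set"
  where "peter_weyl OH B tB \<delta>B = {b \<in> B. \<delta>B b \<in> cspan {tB b' h | b' h. b' \<in> B \<and> h \<in> OH}}"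

definition cotensor ::
    "'b::complex_vector set \<Rightarrow> ('b \<Rightarrow> 'h::cstar_algebra \<Rightarrow> 'bh::complex_vector) \<Rightarrow> ('b \<Rightarrow> 'bh)
      \<Rightarrow> ('v::complex_vector \<Rightarrow> ('h, 'v) atensor) \<Rightarrow> ('b, 'v) atensor set"
  where "cotensor P tB \<delta>B cV = {z \<in> atensor_of P UNIV.
    atensor_map \<delta>B id z = atensor_lift (\<lambda>b v. atensor_map (tB b) id (cV v)) z}"

definition left_action :: "'b::{complex_vector, ring_1} \<Rightarrow> ('b, 'v::complex_vector) atensor \<Rightarrow> ('b, 'v) atensor"
  where "left_action r = atensor_map (\<lambda>b. r * b) id"

text \<open>\<open>R\<^sup>n\<close> as sequences vanishing from index \<open>n\<close> on.\<close>

definition free_module :: "'r::ring_1 set \<Rightarrow> nat \<Rightarrow> (nat \<Rightarrow> 'r) set"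
  where "free_module R n = {x. (\<forall>i<n. x i \<in> R) \<and> (\<forall>i\<ge>n. x i = 0)}"

definition stably_free :: "'r::ring_1 set \<Rightarrow> ('r \<Rightarrow> 'm \<Rightarrow> 'm) \<Rightarrow> 'm::ab_group_add set \<Rightarrow> bool"
  where "stably_free R act M \<longleftrightarrow> (\<exists>m n (f :: 'm \<times> (nat \<Rightarrow> 'r) \<Rightarrow> nat \<Rightarrow> 'r).
    bij_betw f (M \<times> free_module R m) (free_module R n)
    \<and> (\<forall>p \<in> M \<times> free_module R m. \<forall>q \<in> M \<times> free_module R m. f (p + q) = f p + f q)
    \<and> (\<forall>r\<in>R. \<forall>x\<in>M. \<forall>y \<in> free_module R m. f (act r x, \<lambda>i. r * y i) = (\<lambda>i. r * f (x, y) i)))"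


section \<open>The equivariant join\<close>

text \<open>\<open>C([0,1], X)\<close>, with functions extended constantly to the real line, so that the pointwise
  operations of the function type restrict to it.\<close>

definition C01 :: "(real \<Rightarrow> 'x::topological_space) set"
  where "C01 = {f. continuous_on {0..1} f \<and> (\<forall>s<0. f s = f 0) \<and> (\<forall>s>1. f s = f 1)}"

definition join ::
    "('a::cstar_algebra \<Rightarrow> 'h::cstar_algebra \<Rightarrow> 'ah::cstar_algebra) \<Rightarrow> ('a \<Rightarrow> 'ah) \<Rightarrow> (real \<Rightarrow> 'ah) set"
  where "join s \<delta> = {f \<in> C01. f 0 \<in> {s (c *\<^sub>C 1) h | c h. True} \<and> f 1 \<in> range \<delta>}"

text \<open>For \<open>B \<subseteq> C([0,1], A \<otimes> H)\<close>, the tensor product \<open>B \<otimes> H\<close> is taken inside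
  \<open>C([0,1], A \<otimes> H) \<otimes> H = C([0,1], A \<otimes> H \<otimes> H)\<close>.\<close>

definition join_tensor :: "('ah \<Rightarrow> 'h \<Rightarrow> 'ahh) \<Rightarrow> (real \<Rightarrow> 'ah) \<Rightarrow> 'h \<Rightarrow> real \<Rightarrow> 'ahh"
  where "join_tensor s' f h = (\<lambda>x. s' (f x) h)"

definition join_coaction ::
    "('h::cstar_algebra \<Rightarrow> 'hh::cstar_algebra) \<Rightarrow> ('a::cstar_algebra \<Rightarrow> 'h \<Rightarrow> 'ah::cstar_algebra)
      \<Rightarrow> ('a \<Rightarrow> 'hh \<Rightarrow> 'ahh::cstar_algebra) \<Rightarrow> (real \<Rightarrow> 'ah) \<Rightarrow> real \<Rightarrow> 'ahh"
  where "join_coaction \<Delta> s s'' f = min_tensor_map s s'' id \<Delta> \<circ> f"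


section \<open>Topological \<open>K\<^sub>1\<close>\<close>

text \<open>\<open>GL\<^sub>n\<close> consists of infinite matrices that agree with the identity outside the \<open>n \<times> n\<close> block, so
  the stabilisation \<open>U \<mapsto> U \<oplus> 1\<close> is an inclusion and \<open>GL\<^sub>\<infinity>\<close> a union.\<close>

definition mat_id :: "nat \<Rightarrow> nat \<Rightarrow> 'h::cstar_algebra"
  where "mat_id i j = (if i = j then 1 else 0)"

definition block_matrix :: "nat \<Rightarrow> (nat \<Rightarrow> nat \<Rightarrow> 'h::cstar_algebra) \<Rightarrow> bool"
  where "block_matrix n U \<longleftrightarrow> (\<forall>i j. \<not> (i < n \<and> j < n) \<longrightarrow> U i j = mat_id i j)"

definition GL :: "nat \<Rightarrow> (nat \<Rightarrow> nat \<Rightarrow> 'h::cstar_algebra) set"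
  where "GL n = {U. block_matrix n U \<and> (\<exists>W. block_matrix n W \<and> (\<forall>i<n. \<forall>j<n.
    (\<Sum>k<n. U i k * W k j) = mat_id i j \<and> (\<Sum>k<n. W i k * U k j) = mat_id i j))}"

definition GL_path :: "(nat \<Rightarrow> nat \<Rightarrow> 'h::cstar_algebra) \<Rightarrow> (nat \<Rightarrow> nat \<Rightarrow> 'h) \<Rightarrow> bool"
  where "GL_path U W \<longleftrightarrow> (\<exists>n (\<gamma> :: real \<Rightarrow> nat \<Rightarrow> nat \<Rightarrow> 'h).
    (\<forall>i j. continuous_on {0..1} (\<lambda>s. \<gamma> s i j)) \<and> \<gamma> ` {0..1} \<subseteq> GL n \<and> \<gamma> 0 = U \<and> \<gamma> 1 = W)"

definition K1_class :: "(nat \<Rightarrow> nat \<Rightarrow> 'h::cstar_algebra) \<Rightarrow> (nat \<Rightarrow> nat \<Rightarrow> 'h) set"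
  where "K1_class U = {W \<in> (\<Union>n. GL n). GL_path U W}"

text \<open>The underlying set of \<open>K\<^sub>1(H) = \<pi>\<^sub>0(GL\<^sub>\<infinity>(H))\<close>; its neutral element is \<^term>\<open>K1_class mat_id\<close>.\<close>

definition K1 :: "(nat \<Rightarrow> nat \<Rightarrow> 'h::cstar_algebra) set set"
  where "K1 = K1_class ` (\<Union>n. GL n)"

text \<open>\<open>U\<close> is the coefficient matrix of the comodule \<open>V\<close> in the basis \<open>e\<^sub>0, \<dots>, e\<^sub>n\<^sub>-\<^sub>1\<close>.\<close>

definition rep_matrix ::
    "('v::complex_vector \<Rightarrow> ('h::cstar_algebra, 'v) atensor) \<Rightarrow> nat \<Rightarrow> (nat \<Rightarrow> 'v)
      \<Rightarrow> (nat \<Rightarrow> nat \<Rightarrow> 'h) \<Rightarrow> bool"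
  where "rep_matrix cV n e U \<longleftrightarrow>
    inj_on e {..<n} \<and> cindependent (e ` {..<n}) \<and> cspan (e ` {..<n}) = UNIV
    \<and> block_matrix n U \<and> (\<forall>i<n. cV (e i) = (\<Sum>j<n. atens (U i j) (e j)))"

end

(* Suppose P box V plus R^m is isomorphic to R^N over the fixed-point algebra R of the join. With the
   Haar state one writes every equivariant row over A (x) H as (a (x) 1)(1 (x) U) with a unique row a
   over A. So the basis that corresponds to the standard basis of R^N becomes an N x (n+m) matrix G of
   continuous A-valued functions on [0,1]. It is invertible: on [0,1) because the module contains all
   rows that vanish at 1, and near 1 because freeness of the coaction makes the fibre at 1 generate
   A^n over A. An equivariant homomorphism theta: A -> H (the given isomorphism, or
   (phi (x) id) delta for a character phi) turns G into a path of invertible matrices over H whose value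
   at 0 is scalar and whose value at 1 is S (U + 1) with S scalar. As scalar invertible matrices are
   connected to the identity, U is trivial in K_1(H).

   The minimal tensor product is given by one spatial norm only, so functoriality rests on comparing
   matrix coefficients of tensors in different representations; existence of the Haar state follows
   from a quantitative form of the argument of Maes and Van Daele and compactness. *)

theory Submission
  imports "Jordan_Normal_Form.Determinant" "HOL-Computational_Algebra.Fundamental_Theorem_Algebra" Defs
begin

section \<open>The norm of a C*-algebra\<close>

text \<open>Stable freeness provides a purely algebraic isomorphism, so no continuity of it may be
  assumed; only the images of the standard basis are used, and these are continuous functions
  anyway. The delicate end is 1: the fibre of the fixed-point algebra there is small, so linear
  independence over that algebra says nothing directly about invertibility at 1. Hence a left
  inverse is built on all of [0,1] with coefficients in C([0,1],A), the right inverse identity is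
  proved for x < 1 after multiplying by factors 1 - x, and it reaches 1 by continuity. An
  equivariant map to H is needed because an element p of H with \<Delta>(p) = r \<otimes> 1 has r
  scalar; this turns the condition at 1, which lives in \<delta>(A), into a scalar matrix times U.
  The matrix U comes from an arbitrary basis of V and is only known to be invertible, so its inverse
  W does the work of the antipode. Faithful representations are only assumed injective; uniqueness
  of the C*-norm makes them isometric.\<close>

lemma star_diff: "star (x - y) = star x - star (y::'a::cstar_algebra)"
proof -
  have "star (x + (-1) *\<^sub>C y) = star x + (-1) *\<^sub>C star y" by (simp only: star_add star_scaleC) simp
  then show ?thesis by simp
qed

lemma star_zero [simp]: "star (0::'a::cstar_algebra) = 0"
  using star_diff[of 0 "0::'a"] by simp

lemma star_one [simp]: "star (1::'a::cstar_algebra) = 1"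
  by (metis mult.right_neutral star_mult star_star mult.left_neutral)

lemma star_power: "star (x ^ k) = star (x::'a::cstar_algebra) ^ k"
  by (induction k) (simp_all add: star_mult power_commutes)

lemma norm_star [simp]: "norm (star x) = norm (x::'a::cstar_algebra)"
proof -
  have le: "norm x \<le> norm (star x)" for x :: 'a
  proof (cases "x = 0")
    case False
    have "norm x * norm x \<le> norm (star x) * norm x"
      using cstar_identity[of x] norm_mult_ineq[of "star x" x] by (simp add: power2_eq_square)
    then show ?thesis using False by simp
  qed simp
  show ?thesis using le[of x] le[of "star x"] by (simp add: star_star)
qed

lemma star_sum: "star (\<Sum>i\<in>I. f i) = (\<Sum>i\<in>I. star (f i :: 'a::cstar_algebra))"
  by (induction I rule: infinite_finite_induct) (simp_all add: star_add)

section \<open>Seminorms on a C*-algebra and the spectral radius\<close>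

definition alg_seminorm :: "('a::cstar_algebra \<Rightarrow> real) \<Rightarrow> bool"
  where "alg_seminorm N \<longleftrightarrow> (\<forall>x y. N (x + y) \<le> N x + N y) \<and> (\<forall>c x. N (c *\<^sub>C x) = cmod c * N x)
    \<and> (\<forall>x y. N (x * y) \<le> N x * N y) \<and> N 1 \<le> 1"

text \<open>The instances are the norm itself, operator norms of representations, and norms pulled
  back along homomorphisms.\<close>

definition cstar_seminorm :: "('a::cstar_algebra \<Rightarrow> real) \<Rightarrow> bool"
  where "cstar_seminorm N \<longleftrightarrow> alg_seminorm N \<and> (\<forall>x. N (star x * x) = (N x)\<^sup>2)"

context
  fixes N :: "'a::cstar_algebra \<Rightarrow> real"
  assumes N: "alg_seminorm N"
begin

lemma alg_seminorm_add: "N (x + y) \<le> N x + N y" using N by (auto simp: alg_seminorm_def)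
lemma alg_seminorm_scale: "N (c *\<^sub>C x) = cmod c * N x" using N by (auto simp: alg_seminorm_def)
lemma alg_seminorm_mult: "N (x * y) \<le> N x * N y" using N by (auto simp: alg_seminorm_def)
lemma alg_seminorm_one: "N 1 \<le> 1" using N by (auto simp: alg_seminorm_def)
lemma alg_seminorm_zero: "N 0 = 0" using alg_seminorm_scale[of 0 0] by simp
lemma alg_seminorm_minus: "N (- x) = N x" using alg_seminorm_scale[of "-1" x] by simp
lemma alg_seminorm_diff: "N (x - y) \<le> N x + N y" using alg_seminorm_add[of x "- y"] by (simp add: alg_seminorm_minus)
lemma alg_seminorm_nonneg: "0 \<le> N x" using alg_seminorm_add[of x "- x"] by (simp add: alg_seminorm_minus alg_seminorm_zero)
lemma alg_seminorm_mult3: "N (x * y * z) \<le> N x * N y * N z"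
  by (meson alg_seminorm_mult alg_seminorm_nonneg mult_right_mono order_trans)

text \<open>Gelfand's formula without completeness. If \<open>N h > s\<close>, put \<open>r\<^sub>0 = 1 / N h\<close>. The inverses of
  \<open>1 - (z h)\<^sup>m\<close> for \<open>m = 2\<^sup>k\<close> are averages of values of the resolvent on \<open>\<bar>z\<bar> \<le> r\<^sub>0\<close>, so
  they are Lipschitz uniformly in \<open>k\<close>; they tend to \<open>1\<close> for \<open>\<bar>z\<bar> < r\<^sub>0\<close> but not for \<open>z = r\<^sub>0\<close>.\<close>

lemma resolvent_lipschitz:
  fixes R :: "complex \<Rightarrow> 'a"
  assumes R: "\<And>z. cmod z \<le> r \<Longrightarrow> R z * (1 - z *\<^sub>C h) = 1 \<and> (1 - z *\<^sub>C h) * R z = 1"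
  shows "\<exists>L. \<forall>z w. cmod z \<le> r \<longrightarrow> cmod w \<le> r \<longrightarrow> N (R z - R w) \<le> L * cmod (z - w)"
proof -
  \<comment> \<open>The first resolvent identity; it uses \<open>R z\<close> as a left inverse and
    \<open>R w\<close> as a right inverse.\<close>
  have diff: "R z - R w = (z - w) *\<^sub>C (R z * h * R w)" if "cmod z \<le> r" "cmod w \<le> r" for z w
  proof -
    have "R z * ((1 - w *\<^sub>C h) - (1 - z *\<^sub>C h)) * R w = R z * ((1 - w *\<^sub>C h) * R w) - (R z * (1 - z *\<^sub>C h)) * R w"
      by (simp only: algebra_simps)
    also have "\<dots> = R z - R w" using R that by simp
    finally have 1: "R z * ((1 - w *\<^sub>C h) - (1 - z *\<^sub>C h)) * R w = R z - R w" .
    have "(1 - w *\<^sub>C h) - (1 - z *\<^sub>C h) = (z - w) *\<^sub>C h" by (simp add: complex_vector.scale_left_diff_distrib)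
    with 1 show ?thesis by (simp add: mult_scaleC_left mult_scaleC_right)
  qed
  have Ndiff: "N (R z - R w) \<le> cmod (z - w) * (N (R z) * N h * N (R w))" if "cmod z \<le> r" "cmod w \<le> r" for z w
    unfolding diff[OF that] alg_seminorm_scale by (intro mult_left_mono alg_seminorm_mult3) simp
  \<comment> \<open>The algebra need not be complete for \<open>N\<close>, so boundedness of
    \<open>R\<close> comes from compactness of the disc: near a limit point \<open>l\<close> the
    identity bounds \<open>N (R z)\<close> by \<open>N (R l)\<close> plus half of
    \<open>N (R z)\<close> itself, and that half is absorbed.\<close>
  have "\<exists>K. \<forall>z. cmod z \<le> r \<longrightarrow> N (R z) \<le> K"
  proof (rule ccontr)
    assume "\<not> ?thesis"
    then have "\<forall>n::nat. \<exists>z. cmod z \<le> r \<and> N (R z) > real n" by (meson not_le)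
    then obtain z where z: "\<And>n::nat. cmod (z n) \<le> r" "\<And>n. N (R (z n)) > real n" by metis
    have "compact (cball (0::complex) r)" by simp
    then obtain l \<sigma> where l: "l \<in> cball (0::complex) r" "strict_mono \<sigma>" "(z \<circ> \<sigma>) \<longlonglongrightarrow> l"
      unfolding compact_def using z(1) by (metis mem_cball_0)
    have lr: "cmod l \<le> r" using l(1) by simp
    let ?c = "N h * N (R l)"
    have c0: "?c \<ge> 0" by (simp add: alg_seminorm_nonneg)
    have "(\<lambda>n. cmod (z (\<sigma> n) - l) * ?c) \<longlonglongrightarrow> 0"
      using l(3) by (intro tendsto_mult_left_zero tendsto_norm_zero) (simp add: LIM_zero o_def)
    then have "\<forall>\<^sub>F n in sequentially. cmod (z (\<sigma> n) - l) * ?c < 1/2"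
      by (rule order_tendstoD) simp
    then have "\<forall>\<^sub>F n in sequentially. N (R (z (\<sigma> n))) \<le> 2 * N (R l)"
    proof eventually_elim
      case (elim n)
      let ?x = "R (z (\<sigma> n))"
      have "N ?x \<le> N (R l) + N (?x - R l)" using alg_seminorm_add[of "R l" "?x - R l"] by simp
      also have "N (?x - R l) \<le> N ?x * (cmod (z (\<sigma> n) - l) * ?c)"
        using Ndiff[OF z(1) lr, of "\<sigma> n"] by (simp add: algebra_simps)
      also have "\<dots> \<le> N ?x * (1/2)" using elim by (intro mult_left_mono) (auto simp: alg_seminorm_nonneg)
      finally show ?case by simp
    qed
    moreover obtain m :: nat where m: "2 * N (R l) \<le> real m" using real_arch_simple by blast
    have "\<forall>\<^sub>F n in sequentially. n \<ge> m" by (rule eventually_ge_at_top)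
    ultimately have "\<forall>\<^sub>F n in sequentially. False"
    proof eventually_elim
      case (elim n)
      have "real m \<le> real (\<sigma> n)" using elim(2) seq_suble[OF l(2), of n] by simp
      then show ?case using z(2)[of "\<sigma> n"] elim(1) m by linarith
    qed
    then show False by simp
  qed
  then obtain K where K: "\<And>z. cmod z \<le> r \<Longrightarrow> N (R z) \<le> K" by blast
  have "N (R z - R w) \<le> (K * N h * K) * cmod (z - w)" if "cmod z \<le> r" "cmod w \<le> r" for z w
  proof -
    have "N (R z) * N h * N (R w) \<le> K * N h * K"
      using K[OF that(1)] K[OF that(2)] alg_seminorm_nonneg[of "R z"] alg_seminorm_nonneg[of "R w"] alg_seminorm_nonneg[of h]
      by (intro mult_mono) auto
    from mult_left_mono[OF this, of "cmod (z - w)"] Ndiff[OF that] show ?thesis by (simp add: algebra_simps)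
  qed
  then show ?thesis by blast
qed

lemma power_resolvent:
  fixes R :: "complex \<Rightarrow> 'a"
  assumes R: "\<And>z. cmod z \<le> r \<Longrightarrow> R z * (1 - z *\<^sub>C h) = 1"
    and L: "\<And>z w. cmod z \<le> r \<Longrightarrow> cmod w \<le> r \<Longrightarrow> N (R z - R w) \<le> L * cmod (z - w)"
  shows "\<exists>f. (\<forall>z. cmod z \<le> r \<longrightarrow> f z * (1 - (z *\<^sub>C h) ^ (2 ^ k)) = 1)
    \<and> (\<forall>z w. cmod z \<le> r \<longrightarrow> cmod w \<le> r \<longrightarrow> N (f z - f w) \<le> L * cmod (z - w))"
proof (induction k)
  case 0
  show ?case using R L by (intro exI[of _ R]) simp
next
  case (Suc k)
  then obtain f where f: "\<And>z. cmod z \<le> r \<Longrightarrow> f z * (1 - (z *\<^sub>C h) ^ (2 ^ k)) = 1"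
    and fL: "\<And>z w. cmod z \<le> r \<Longrightarrow> cmod w \<le> r \<Longrightarrow> N (f z - f w) \<le> L * cmod (z - w)" by blast
  \<comment> \<open>\<omega> is a root of -1 of order 2^k: replacing z by \<omega> z flips the sign
    of x = (z h)^(2^k), and 1/(1 - x^2) is the mean of 1/(1 - x) and 1/(1 + x). As \<omega> has
    modulus 1, the mean keeps the Lipschitz constant.\<close>
  define \<omega> where "\<omega> = cis (pi / 2 ^ k)"
  have w: "\<omega> ^ (2 ^ k) = -1" "cmod \<omega> = 1" by (simp_all add: \<omega>_def Complex.DeMoivre)
  have pw: "(c *\<^sub>C x) ^ m = (c ^ m) *\<^sub>C (x ^ m)" for c m and x :: 'a
    by (induction m) (simp_all add: mult_scaleC_left mult_scaleC_right)
  define g where "g z = (1/2) *\<^sub>C (f z + f (\<omega> * z))" for z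
  show ?case
  proof (intro exI[of _ g] conjI allI impI)
    fix z assume z: "cmod z \<le> r"
    then have wz: "cmod (\<omega> * z) \<le> r" by (simp add: norm_mult w)
    define x where "x = (z *\<^sub>C h) ^ (2 ^ k)"
    have xw: "((\<omega> * z) *\<^sub>C h) ^ (2 ^ k) = - x"
      unfolding x_def pw power_mult_distrib w by simp
    have sq: "(z *\<^sub>C h) ^ (2 ^ Suc k) = x * x"
      unfolding x_def by (simp add: power_add[symmetric] mult_2)
    have f1: "f z * (1 - x) = 1" using f[OF z] by (simp add: x_def)
    have f2: "f (\<omega> * z) * (1 + x) = 1" using f[OF wz] by (simp add: xw)
    have "(f z + f (\<omega> * z)) * (1 - x * x) = (f z * (1 - x)) * (1 + x) + (f (\<omega> * z) * (1 + x)) * (1 - x)"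
      by (simp add: algebra_simps)
    also have "\<dots> = 2" using f1 f2 by simp
    finally have "(f z + f (\<omega> * z)) * (1 - x * x) = 2 *\<^sub>C 1"
      by (metis complex_vector.scale_one complex_vector.scale_left_distrib one_add_one)
    then show "g z * (1 - (z *\<^sub>C h) ^ (2 ^ Suc k)) = 1"
      unfolding sq g_def mult_scaleC_left by simp
  next
    fix z v assume zv: "cmod z \<le> r" "cmod v \<le> r"
    then have wz: "cmod (\<omega> * z) \<le> r" "cmod (\<omega> * v) \<le> r" by (simp_all add: norm_mult w)
    have "g z - g v = (1/2) *\<^sub>C ((f z - f v) + (f (\<omega> * z) - f (\<omega> * v)))"
      by (simp add: g_def complex_vector.scale_right_diff_distrib[symmetric] algebra_simps)
    then have "N (g z - g v) \<le> 1/2 * (N (f z - f v) + N (f (\<omega> * z) - f (\<omega> * v)))"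
      by (simp add: alg_seminorm_scale alg_seminorm_add)
    also have "\<dots> \<le> 1/2 * (L * cmod (z - v) + L * cmod (\<omega> * z - \<omega> * v))"
      using fL[OF zv] fL[OF wz] by simp
    also have "\<omega> * z - \<omega> * v = \<omega> * (z - v)" by (simp add: algebra_simps)
    finally show "N (g z - g v) \<le> L * cmod (z - v)" by (simp add: norm_mult w)
  qed
qed

lemma scaleC_power: "(c *\<^sub>C x) ^ m = (c ^ m) *\<^sub>C ((x::'a) ^ m)"
  by (induction m) (simp_all add: mult_scaleC_left mult_scaleC_right)

text \<open>Invertibility of 1 - z h makes no reference to \<open>N\<close>, so the same s bounds h
  in every seminorm that satisfies the power condition; self-adjoint elements satisfy it for each
  C*-seminorm.\<close>

theorem spectral_radius_bound:
  assumes h: "\<And>k. N (h ^ (2 ^ k)) = N h ^ (2 ^ k)"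
    and inv: "\<And>z. cmod z * s \<le> 1 \<Longrightarrow> \<exists>R. R * (1 - z *\<^sub>C h) = 1 \<and> (1 - z *\<^sub>C h) * R = 1"
    and s: "s \<ge> 0"
  shows "N h \<le> s"
proof (rule ccontr)
  assume "\<not> N h \<le> s"
  then have hs: "N h > s" by simp
  then have h0: "N h > 0" using s by linarith
  define r where "r = 1 / N h"
  have r0: "r > 0" and rh: "r * N h = 1" using h0 by (simp_all add: r_def)
  have "cmod z * s \<le> 1" if "cmod z \<le> r" for z
  proof -
    have "cmod z * s \<le> r * N h" using that hs s h0 r0 by (intro mult_mono) auto
    then show ?thesis using rh by simp
  qed
  then obtain R where R: "\<And>z. cmod z \<le> r \<Longrightarrow> R z * (1 - z *\<^sub>C h) = 1 \<and> (1 - z *\<^sub>C h) * R z = 1"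
    using inv by metis
  obtain L where L: "\<And>z w. cmod z \<le> r \<Longrightarrow> cmod w \<le> r \<Longrightarrow> N (R z - R w) \<le> L * cmod (z - w)"
    using resolvent_lipschitz[OF R] by blast
  \<comment> \<open>The point r - d lies inside the disc, so high powers of (r - d) h are small in
    \<open>N\<close>, while d is so small that the inverses of 1 - (z h)^(2^k) change by at most 1/8
    between r - d and the boundary point r, for every k.\<close>
  define d where "d = min (r/2) (1 / (8 * (\<bar>L\<bar> + 1)))"
  have d: "0 < d" "d < r" "\<bar>L\<bar> * d \<le> 1/8"
  proof -
    show "0 < d" "d < r" using r0 by (auto simp: d_def)
    have "\<bar>L\<bar> * d \<le> \<bar>L\<bar> * (1 / (8 * (\<bar>L\<bar> + 1)))" by (intro mult_left_mono) (auto simp: d_def)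
    also have "\<dots> \<le> 1/8" by (simp add: field_simps)
    finally show "\<bar>L\<bar> * d \<le> 1/8" .
  qed
  define t where "t = (r - d) * N h"
  have t: "0 \<le> t" "t < 1" using d h0 rh mult_strict_right_mono[OF d(2) h0] by (auto simp: t_def left_diff_distrib)
  obtain k where k: "t ^ k < 1/8" using real_arch_pow_inv[of "1/8" t] t by auto
  have "t ^ (2 ^ k) \<le> t ^ k" using t by (intro power_decreasing) (auto intro: less_imp_le)
  then have q: "t ^ (2 ^ k) \<le> 1/8" using k by simp
  obtain f where f: "\<And>z. cmod z \<le> r \<Longrightarrow> f z * (1 - (z *\<^sub>C h) ^ (2 ^ k)) = 1"
    and fL: "\<And>z w. cmod z \<le> r \<Longrightarrow> cmod w \<le> r \<Longrightarrow> N (f z - f w) \<le> L * cmod (z - w)"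
    using power_resolvent[of r R h L k] R L by blast
  have Npow: "N ((of_real x *\<^sub>C h) ^ (2 ^ k)) = (x * N h) ^ (2 ^ k)" if "x \<ge> 0" for x :: real
    unfolding scaleC_power alg_seminorm_scale h using that by (simp add: norm_power power_mult_distrib)
  let ?u = "complex_of_real (r - d)" and ?v = "complex_of_real r"
  have uv: "cmod ?u \<le> r" "cmod ?v \<le> r"
    using d r0 unfolding norm_of_real by linarith+
  let ?x = "(?u *\<^sub>C h) ^ (2 ^ k)" and ?y = "(?v *\<^sub>C h) ^ (2 ^ k)"
  have Nx: "N ?x \<le> 1/8" using Npow[of "r - d"] d q by (simp add: t_def)
  have Ny: "N ?y = 1" using Npow[of r] r0 rh by simp
  have "f ?u - 1 = f ?u * ?x"
    using f[OF uv(1)] by (metis (no_types) eq_diff_eq add.commute add_diff_cancel_right' diff_diff_eq2 mult.right_neutral right_diff_distrib)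
  then have "N (f ?u - 1) \<le> N (f ?u) * (1/8)"
    using alg_seminorm_mult[of "f ?u" ?x] mult_left_mono[OF Nx alg_seminorm_nonneg[of "f ?u"]] by simp
  moreover have "N (f ?u) \<le> 1 + N (f ?u - 1)" using alg_seminorm_add[of 1 "f ?u - 1"] alg_seminorm_one by simp
  ultimately have 1: "N (f ?u - 1) \<le> 1/7" by simp
  have "N (f ?v - f ?u) \<le> L * cmod (?v - ?u)" using fL uv by blast
  also have "?v - ?u = complex_of_real d" by simp
  also have "L * cmod (complex_of_real d) \<le> \<bar>L\<bar> * d" using d unfolding norm_of_real by (intro mult_mono) auto
  finally have 2: "N (f ?v - f ?u) \<le> 1/8" using d by simp
  have "N (f ?v - 1) \<le> N (f ?v - f ?u) + N (f ?u - 1)" using alg_seminorm_add[of "f ?v - f ?u" "f ?u - 1"] by simp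
  then have 3: "N (f ?v - 1) \<le> 1/3" using 1 2 by simp
  \<comment> \<open>At the boundary point \<open>N ?y\<close> is 1, but this identity bounds it by
    1/3 times 2.\<close>
  have "?y = (f ?v - 1) * (1 - ?y)"
    using f[OF uv(2)] by (simp add: left_diff_distrib)
  then have "N ?y \<le> N (f ?v - 1) * N (1 - ?y)" by (metis alg_seminorm_mult)
  also have "\<dots> \<le> 1/3 * (1 + N ?y)"
    using 3 alg_seminorm_diff[of 1 ?y] alg_seminorm_one alg_seminorm_nonneg by (intro mult_mono) (auto intro: order_trans)
  finally show False using Ny by simp
qed

end

lemma neumann:
  fixes x :: "'a::{real_normed_algebra_1,banach}"
  assumes "norm x < 1"
  shows "\<exists>R. R * (1 - x) = 1 \<and> (1 - x) * R = 1"
proof -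
  define R where "R = (\<Sum>n. x ^ n)"
  have sm: "summable (\<lambda>n. x ^ n)" by (rule complete_algebra_summable_geometric[OF assms])
  have 1: "R = 1 + x * R"
    using suminf_split_head[OF sm] suminf_mult[OF sm, of x] by (simp add: R_def)
  have "R = 1 + R * x"
    using suminf_split_head[OF sm] suminf_mult2[OF sm, of x] by (simp add: R_def power_commutes)
  then have "R * (1 - x) = 1" by (simp add: right_diff_distrib) (metis add_diff_cancel_right')
  moreover have "(1 - x) * R = 1" using 1 by (simp add: left_diff_distrib) (metis add_diff_cancel_right')
  ultimately show ?thesis by blast
qed

lemma alg_seminorm_norm: "alg_seminorm (norm :: 'a::cstar_algebra \<Rightarrow> real)"
  by (simp add: alg_seminorm_def norm_triangle_ineq norm_scaleC norm_mult_ineq)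

lemma cstar_seminorm_norm: "cstar_seminorm (norm :: 'a::cstar_algebra \<Rightarrow> real)"
  by (simp add: cstar_seminorm_def alg_seminorm_norm cstar_identity)

lemma cstar_seminorm_power2:
  assumes N: "cstar_seminorm N" and h: "star h = h"
  shows "N (h ^ (2 ^ k)) = N h ^ (2 ^ k)"
proof (induction k)
  case (Suc k)
  have "N (h ^ (2 ^ Suc k)) = N (star (h ^ (2 ^ k)) * h ^ (2 ^ k))"
    by (simp add: star_power h power_add[symmetric] mult_2)
  also have "\<dots> = (N (h ^ (2 ^ k)))\<^sup>2" using N by (simp add: cstar_seminorm_def)
  finally show ?case using Suc by (simp add: power_mult[symmetric] mult.commute)
qed simp

text \<open>For self-adjoint h the Neumann series in the complete norm gives the invertibility that
  bounds \<open>N h\<close>; the C*-identity reduces the general case to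
  \<open>star a * a\<close>.\<close>

lemma cstar_seminorm_le_norm:
  assumes N: "cstar_seminorm N"
  shows "N a \<le> norm a"
proof -
  have sn: "alg_seminorm N" using N by (simp add: cstar_seminorm_def)
  have sa: "N h \<le> norm h" if h: "star h = h" for h
  proof (rule field_le_epsilon)
    fix e :: real assume e: "e > 0"
    show "N h \<le> norm h + e"
    proof (rule spectral_radius_bound[OF sn cstar_seminorm_power2[OF N h]])
      fix z :: complex assume z: "cmod z * (norm h + e) \<le> 1"
      \<comment> \<open>The Neumann series needs a strict inequality; the added e supplies
        it.\<close>
      have "cmod z * norm h < 1"
      proof (cases "cmod z = 0")
        case False
        then have "cmod z * norm h < cmod z * (norm h + e)" using e by (intro mult_strict_left_mono) auto
        then show ?thesis using z by simp
      qed simp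
      then show "\<exists>R. R * (1 - z *\<^sub>C h) = 1 \<and> (1 - z *\<^sub>C h) * R = 1"
        by (intro neumann) (simp add: norm_scaleC)
    qed (use e in auto)
  qed
  have "(N a)\<^sup>2 = N (star a * a)" using N by (simp add: cstar_seminorm_def)
  also have "\<dots> \<le> norm (star a * a)" by (rule sa) (simp add: star_mult star_star)
  finally have "(N a)\<^sup>2 \<le> (norm a)\<^sup>2" by (simp add: cstar_identity)
  then show ?thesis by (rule power2_le_imp_le) simp
qed

text \<open>From (h - i \<mu>)(h + i \<mu>) = h^2 + \<mu>^2. This estimate stands in for reality of
  the spectrum, both for resolvents and for the values of states.\<close>

lemma norm_selfadjoint_shift:
  fixes h :: "'a::cstar_algebra"
  assumes h: "star h = h"
  shows "(norm (h + (\<i> * of_real \<mu>) *\<^sub>C 1))\<^sup>2 \<le> (norm h)\<^sup>2 + \<mu>\<^sup>2"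
proof -
    let ?m = "\<i> * complex_of_real \<mu>"
    have "(norm (h + ?m *\<^sub>C 1))\<^sup>2 = norm (star (h + ?m *\<^sub>C 1) * (h + ?m *\<^sub>C 1))" by (simp add: cstar_identity)
    also have "star (h + ?m *\<^sub>C 1) * (h + ?m *\<^sub>C 1) = (h - ?m *\<^sub>C 1) * (h + ?m *\<^sub>C 1)"
      by (simp add: star_add star_scaleC h)
    also have "\<dots> = star h * h - (?m * ?m) *\<^sub>C 1"
      by (simp add: algebra_simps mult_scaleC_left mult_scaleC_right h scaleC_scaleC)
    also have "- (?m * ?m) = complex_of_real (\<mu>\<^sup>2)" by (simp add: power2_eq_square algebra_simps)
    then have "?m * ?m = - complex_of_real (\<mu>\<^sup>2)" by (metis minus_minus)
    then have "star h * h - (?m * ?m) *\<^sub>C 1 = star h * h + complex_of_real (\<mu>\<^sup>2) *\<^sub>C 1" by simp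
    also have "norm \<dots> \<le> norm (star h * h) + norm (complex_of_real (\<mu>\<^sup>2) *\<^sub>C (1::'a))" by (rule norm_triangle_ineq)
    also have "\<dots> = (norm h)\<^sup>2 + \<mu>\<^sup>2" by (simp add: cstar_identity norm_scaleC norm_power)
    finally show ?thesis .
qed

lemma selfadjoint_resolvent:
  fixes h :: "'a::cstar_algebra"
  assumes h: "star h = h" and z: "\<not> (Im z = 0 \<and> \<bar>Re z\<bar> \<le> norm h)"
  shows "\<exists>R. R * (h - z *\<^sub>C 1) = 1 \<and> (h - z *\<^sub>C 1) * R = 1"
proof -
  \<comment> \<open>\<open>\<parallel>h + i\<mu>\<parallel>\<^sup>2 \<le> \<parallel>h\<parallel>\<^sup>2 + \<mu>\<^sup>2\<close>, and a shift by a suitable \<open>i\<mu>\<close> brings \<open>z\<close> outside this radius.\<close>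
  have "\<exists>\<mu>::real. (norm h)\<^sup>2 + \<mu>\<^sup>2 < (cmod (z + \<i> * of_real \<mu>))\<^sup>2"
  proof (cases "Im z = 0")
    case True
    then have "norm h < \<bar>Re z\<bar>" using z by simp
    then have "(norm h)\<^sup>2 < \<bar>Re z\<bar>\<^sup>2" by (intro power_strict_mono) auto
    then have "(norm h)\<^sup>2 + 0\<^sup>2 < (cmod (z + \<i> * of_real 0))\<^sup>2"
      using True by (simp add: cmod_power2)
    then show ?thesis by blast
  next
    case False
    \<comment> \<open>Chosen so that the cross term 2 \<mu> Im z in the squared modulus of z + i
      \<mu> exceeds (norm h)^2 by 1.\<close>
    define \<mu> where "\<mu> = ((norm h)\<^sup>2 + 1) / (2 * Im z)"
    have "(cmod (z + \<i> * of_real \<mu>))\<^sup>2 = (Re z)\<^sup>2 + (Im z)\<^sup>2 + 2 * Im z * \<mu> + \<mu>\<^sup>2"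
      by (subst cmod_power2) (simp add: power2_eq_square algebra_simps)
    also have "2 * Im z * \<mu> = (norm h)\<^sup>2 + 1" using False by (simp add: \<mu>_def)
    finally have "(norm h)\<^sup>2 + \<mu>\<^sup>2 < (cmod (z + \<i> * of_real \<mu>))\<^sup>2"
      using zero_le_power2[of "Re z"] zero_le_power2[of "Im z"] by linarith
    then show ?thesis by blast
  qed
  then obtain \<mu> :: real where \<mu>: "(norm h)\<^sup>2 + \<mu>\<^sup>2 < (cmod (z + \<i> * of_real \<mu>))\<^sup>2" by blast
  define w where "w = z + \<i> * of_real \<mu>"
  define k where "k = h + (\<i> * of_real \<mu>) *\<^sub>C 1"
  have "(norm k)\<^sup>2 < (cmod w)\<^sup>2" using norm_selfadjoint_shift[OF h, of \<mu>] \<mu> by (simp add: w_def k_def)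
  then have kw: "norm k < cmod w" by (rule power_less_imp_less_base) simp
  then have w0: "w \<noteq> 0" by auto
  have "norm ((1 / w) *\<^sub>C k) < 1" using kw w0 by (simp add: norm_scaleC norm_divide divide_simps)
  from neumann[OF this] obtain R where R: "R * (1 - (1/w) *\<^sub>C k) = 1" "(1 - (1/w) *\<^sub>C k) * R = 1" by blast
  have e: "h - z *\<^sub>C 1 = (-w) *\<^sub>C (1 - (1/w) *\<^sub>C k)"
  proof -
    have "(-w) *\<^sub>C ((1/w) *\<^sub>C k) = - k" using w0 by (simp add: scaleC_scaleC)
    then have "(-w) *\<^sub>C (1 - (1/w) *\<^sub>C k) = k - w *\<^sub>C 1" by (simp only: complex_vector.scale_right_diff_distrib) simp
    then show ?thesis by (simp add: k_def w_def scaleC_add_left)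
  qed
  show ?thesis
    unfolding e using R w0
    by (intro exI[of _ "(- 1/w) *\<^sub>C R"]) (simp add: mult_scaleC_left mult_scaleC_right scaleC_scaleC)
qed

section \<open>Polynomial and continuous functional calculus of a self-adjoint element\<close>

definition peval :: "complex poly \<Rightarrow> 'a::cstar_algebra \<Rightarrow> 'a"
  where "peval p h = fold_coeffs (\<lambda>a b. a *\<^sub>C 1 + h * b) p 0"

lemma peval_0 [simp]: "peval 0 h = 0" by (simp add: peval_def)

lemma peval_pCons [simp]: "peval (pCons a p) h = a *\<^sub>C 1 + h * peval p h"
  by (cases "p = 0 \<and> a = 0") (auto simp: peval_def)

lemma peval_add: "peval (p + q) h = peval p h + peval q h"
  by (induction p q rule: poly_induct2) (simp_all add: algebra_simps)

lemma peval_smult: "peval (Polynomial.smult c p) h = c *\<^sub>C peval p h"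
  by (induction p) (simp_all add: scaleC_add_right scaleC_scaleC mult_scaleC_right)

lemma peval_commute: "h * peval p h = peval p h * h"
proof (induction p)
  case (pCons a p)
  have "h * peval p h * h = h * (peval p h * h)" by (simp only: mult.assoc)
  then show ?case using pCons.IH by (simp add: distrib_left distrib_right mult_scaleC_left mult_scaleC_right)
qed simp

lemma peval_mult: "peval (p * q) h = peval p h * peval q h"
proof (induction p)
  case (pCons a p)
  then show ?case by (simp add: peval_add peval_smult distrib_right mult_scaleC_left mult.assoc)
qed simp

lemma peval_diff: "peval (p - q) h = peval p h - peval q h"
proof -
  have "p - q = p + Polynomial.smult (-1) q" by simp
  then show ?thesis by (simp only: peval_add peval_smult) simp
qed

lemma peval_monom: "peval (monom 1 k) h = h ^ k"
  by (induction k) (simp_all add: monom_Suc monom_0)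

lemma star_peval:
  assumes "star h = h" "\<forall>i. coeff p i \<in> \<real>"
  shows "star (peval p h) = peval p h"
  using assms(2)
proof (induction p)
  case (pCons a p)
  have "coeff (pCons a p) 0 \<in> \<real>" "\<forall>i. coeff (pCons a p) (Suc i) \<in> \<real>" using pCons.prems by blast+
  then have "a \<in> \<real>" "\<forall>i. coeff p i \<in> \<real>" by simp_all
  with pCons.IH show ?case
    by (simp add: star_add star_scaleC star_mult assms(1) peval_commute Reals_cnj_iff)
qed simp

text \<open>Over the complex numbers p splits into linear factors, and each factor h - z is
  invertible because z is not a real number in [-norm h, norm h].\<close>

lemma peval_invertible:
  assumes h: "star h = h" and p: "p \<noteq> 0"
    and roots: "\<And>z. poly p z = 0 \<Longrightarrow> \<not> (Im z = 0 \<and> \<bar>Re z\<bar> \<le> norm h)"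
  shows "\<exists>R. R * peval p h = 1 \<and> peval p h * R = 1"
  using p roots
proof (induction "degree p" arbitrary: p)
  case 0
  then obtain c where c: "p = [:c:]" by (metis degree_eq_zeroE)
  then show ?case using 0
    by (intro exI[of _ "(1/c) *\<^sub>C 1"]) (auto simp: mult_scaleC_left mult_scaleC_right scaleC_scaleC)
next
  case (Suc d)
  have "\<not> constant (poly p)" using Suc.hyps(2) by (simp add: constant_degree)
  from fundamental_theorem_of_algebra[OF this] obtain z where z: "poly p z = 0" by blast
  then obtain q where q: "p = [:-z, 1:] * q" by (metis poly_eq_0_iff_dvd dvdE)
  have q0: "q \<noteq> 0" using Suc.prems(1) q by auto
  have "degree p = 1 + degree q" unfolding q using q0 by (subst degree_mult_eq) auto
  then have "d = degree q" using Suc.hyps(2) by simp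
  moreover have "\<And>z. poly q z = 0 \<Longrightarrow> \<not> (Im z = 0 \<and> \<bar>Re z\<bar> \<le> norm h)"
    using Suc.prems(2) q by auto
  ultimately obtain R where R: "R * peval q h = 1" "peval q h * R = 1" using Suc.hyps(1) q0 by blast
  obtain S where S: "S * (h - z *\<^sub>C 1) = 1" "(h - z *\<^sub>C 1) * S = 1"
    using selfadjoint_resolvent[OF h Suc.prems(2)[OF z]] by blast
  have e: "peval p h = (h - z *\<^sub>C 1) * peval q h"
    unfolding q peval_mult by (simp add: mult_scaleC_right)
  have "R * S * peval p h = R * (S * (h - z *\<^sub>C 1)) * peval q h" by (simp only: e mult.assoc)
  moreover have "peval p h * (R * S) = (h - z *\<^sub>C 1) * (peval q h * R) * S" by (simp only: e mult.assoc)
  ultimately show ?case using R S by (intro exI[of _ "R * S"]) simp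
qed

text \<open>Spectral mapping: 1 - z p(h) is the value at h of q = 1 - z p, and q has no root in
  [-norm h, norm h] as soon as |z| s < 1. Real coefficients keep p(h) self-adjoint, which supplies
  the power condition of \<open>spectral_radius_bound\<close>.\<close>

theorem norm_peval_le:
  assumes h: "star h = h" and real: "\<forall>i. coeff p i \<in> \<real>"
    and bound: "\<And>x. \<bar>x\<bar> \<le> norm h \<Longrightarrow> cmod (poly p (of_real x)) \<le> s"
  shows "norm (peval p h) \<le> s"
proof (rule field_le_epsilon)
  fix e :: real assume e: "e > 0"
  have s: "s \<ge> 0" using order_trans[OF norm_ge_zero bound[of 0]] by simp
  have sa: "star (peval p h) = peval p h" by (rule star_peval[OF h real])
  show "norm (peval p h) \<le> s + e"
  proof (rule spectral_radius_bound[OF alg_seminorm_norm cstar_seminorm_power2[OF cstar_seminorm_norm sa]])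
    fix z assume z: "cmod z * (s + e) \<le> 1"
    define q where "q = 1 - Polynomial.smult z p"
    have nz: "\<not> (Im x = 0 \<and> \<bar>Re x\<bar> \<le> norm h)" if "poly q x = 0" for x
    proof
      assume "Im x = 0 \<and> \<bar>Re x\<bar> \<le> norm h"
      then have "x = of_real (Re x)" "\<bar>Re x\<bar> \<le> norm h" by (simp_all add: complex_eq_iff)
      then have "cmod (poly p x) \<le> s" using bound[of "Re x"] by metis
      moreover have "z * poly p x = 1" using that by (simp add: q_def)
      then have "cmod z * cmod (poly p x) = 1" by (metis norm_mult norm_one)
      ultimately have "1 \<le> cmod z * s" by (metis mult_left_mono norm_ge_zero)
      moreover have "cmod z > 0" using \<open>z * poly p x = 1\<close> by auto
      then have "cmod z * s < cmod z * (s + e)" using e by simp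
      ultimately show False using z by linarith
    qed
    have "q \<noteq> 0" using nz[of 0] by auto
    have pq: "peval q h = 1 - z *\<^sub>C peval p h" by (simp add: q_def peval_diff peval_smult one_pCons)
    show "\<exists>R. R * (1 - z *\<^sub>C peval p h) = 1 \<and> (1 - z *\<^sub>C peval p h) * R = 1"
      using peval_invertible[OF h \<open>q \<noteq> 0\<close> nz] by (simp add: pq)
  qed (use e s in auto)
qed

lemma Weierstrass_complex_poly:
  fixes f :: "real \<Rightarrow> real"
  assumes f: "continuous_on {-c..c} f" and e: "e > 0"
  shows "\<exists>p. (\<forall>i. coeff p i \<in> \<real>) \<and> (\<forall>x. \<bar>x\<bar> \<le> c \<longrightarrow> cmod (poly p (of_real x) - of_real (f x)) \<le> e)"
proof -
  obtain g where g: "real_polynomial_function g" "\<And>x. x \<in> {-c..c} \<Longrightarrow> \<bar>f x - g x\<bar> < e"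
    using Stone_Weierstrass_real_polynomial_function[OF _ f e] by auto
  then obtain a n where a: "g = (\<lambda>x. \<Sum>i\<le>n. a i * x ^ i)" using real_polynomial_function_iff_sum by blast
  define p where "p = (\<Sum>i\<le>n. monom (complex_of_real (a i)) i)"
  have "poly p (of_real x) = of_real (g x)" for x by (simp add: p_def a poly_sum poly_monom)
  moreover have "coeff p i \<in> \<real>" for i by (auto simp: p_def coeff_sum intro!: sum_in_Reals)
  moreover have "cmod (of_real (g x) - of_real (f x)) \<le> e" if "\<bar>x\<bar> \<le> c" for x
    using g(2)[of x] that unfolding of_real_diff[symmetric] norm_of_real by (simp add: abs_if split: if_splits)
  ultimately show ?thesis by (intro exI[of _ p]) auto
qed

text \<open>\<open>F\<close> is f(h). It is described only by its distance from polynomials in h,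
  with the error measured uniformly on [-norm h, norm h].\<close>

lemma continuous_calculus:
  assumes h: "star h = (h::'a::cstar_algebra)" and f: "continuous_on {- norm h..norm h} f"
  shows "\<exists>F. \<forall>p e. (\<forall>i. coeff p i \<in> \<real>)
    \<longrightarrow> (\<forall>x. \<bar>x\<bar> \<le> norm h \<longrightarrow> cmod (poly p (of_real x) - of_real (f x)) \<le> e) \<longrightarrow> norm (peval p h - F) \<le> e"
proof -
  have "\<forall>n. \<exists>p. (\<forall>i. coeff p i \<in> \<real>) \<and> (\<forall>x. \<bar>x\<bar> \<le> norm h \<longrightarrow> cmod (poly p (of_real x) - of_real (f x)) \<le> inverse (real (Suc n)))"
    by (intro allI Weierstrass_complex_poly[OF f]) simp
  then obtain q where q: "\<And>n i. coeff (q n) i \<in> \<real>"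
    "\<And>n x. \<bar>x\<bar> \<le> norm h \<Longrightarrow> cmod (poly (q n) (of_real x) - of_real (f x)) \<le> inverse (real (Suc n))" by metis
  have close: "norm (peval p h - peval (q n) h) \<le> e + inverse (real (Suc n))"
    if "\<forall>i. coeff p i \<in> \<real>" "\<And>x. \<bar>x\<bar> \<le> norm h \<Longrightarrow> cmod (poly p (of_real x) - of_real (f x)) \<le> e" for p n e
    unfolding peval_diff[symmetric]
  proof (rule norm_peval_le[OF h])
    show "\<forall>i. coeff (p - q n) i \<in> \<real>" using that(1) q(1) by simp
    fix x assume x: "\<bar>x\<bar> \<le> norm h"
    show "cmod (poly (p - q n) (of_real x)) \<le> e + inverse (real (Suc n))"
      using that(2)[OF x] q(2)[OF x, of n] norm_triangle_ineq4[of "poly p (of_real x) - of_real (f x)" "poly (q n) (of_real x) - of_real (f x)"]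
      by simp
  qed
  have lim: "(\<lambda>n. inverse (real (Suc n))) \<longlonglongrightarrow> 0" by (rule LIMSEQ_inverse_real_of_nat)
  have "Cauchy (\<lambda>n. peval (q n) h)"
  proof (rule metric_CauchyI)
    fix e :: real assume "e > 0"
    then have "\<forall>\<^sub>F n in sequentially. inverse (real (Suc n)) < e/2" using order_tendstoD(2)[OF lim, of "e/2"] by (simp del: of_nat_Suc)
    then obtain M where M: "\<And>n. n \<ge> M \<Longrightarrow> inverse (real (Suc n)) < e/2" by (auto simp: eventually_sequentially)
    show "\<exists>M. \<forall>m\<ge>M. \<forall>n\<ge>M. dist (peval (q m) h) (peval (q n) h) < e"
    proof (intro exI[of _ M] allI impI)
      fix m n assume "m \<ge> M" "n \<ge> M"
      then show "dist (peval (q m) h) (peval (q n) h) < e"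
        using close[of "q m" "inverse (real (Suc m))" n] q M[of m] M[of n] by (simp add: dist_norm)
    qed
  qed
  then obtain F where F: "(\<lambda>n. peval (q n) h) \<longlonglongrightarrow> F" using Cauchy_convergent_iff convergent_def by blast
  show ?thesis
  proof (intro exI[of _ F] allI impI)
    fix p e assume p: "\<forall>i. coeff p i \<in> \<real>" "\<forall>x. \<bar>x\<bar> \<le> norm h \<longrightarrow> cmod (poly p (of_real x) - of_real (f x)) \<le> e"
    have "(\<lambda>n. norm (peval p h - peval (q n) h)) \<longlonglongrightarrow> norm (peval p h - F)" by (intro tendsto_intros F)
    moreover have "(\<lambda>n. e + inverse (real (Suc n))) \<longlonglongrightarrow> e + 0" by (intro tendsto_intros lim)
    ultimately have "norm (peval p h - F) \<le> e + 0"
      by (rule LIMSEQ_le) (use close p in blast)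
    then show "norm (peval p h - F) \<le> e" by simp
  qed
qed

text \<open>Uniqueness of the C*-norm: if \<open>N h < s < \<parallel>h\<parallel>\<close> and \<open>f x\<close> is the distance vector from \<open>x\<close> to
  \<open>[-s, s]\<close>, then \<open>f(h)\<close> is divisible by all powers of \<open>h\<close>, which makes \<open>N (f(h)) = 0\<close>, although
  \<open>f(h) \<noteq> 0\<close>.\<close>

theorem cstar_norm_unique:
  fixes N :: "'a::cstar_algebra \<Rightarrow> real"
  assumes N: "cstar_seminorm N" and definite: "\<And>a. N a = 0 \<Longrightarrow> a = 0"
  shows "N a = norm a"
proof -
  have sn: "alg_seminorm N" using N by (simp add: cstar_seminorm_def)
  note sn_facts = alg_seminorm_add[OF sn] alg_seminorm_mult[OF sn] alg_seminorm_nonneg[OF sn]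
  have sa: "norm h \<le> N h" if h: "star h = h" for h
  proof (rule ccontr)
    assume "\<not> norm h \<le> N h"
    then have "N h < norm h" by simp
    then obtain s where s: "N h < s" "s < norm h" using dense by blast
    have s0: "s > 0" using s sn_facts(3)[of h] by linarith
    \<comment> \<open>f is zero on [-s, s], so it equals x^(2k) \<open>g k\<close> for each k.
      Having max(s, |x|) instead of |x| in the denominator keeps \<open>g k\<close> continuous and
      of size at most norm h / s^(2k).\<close>
    define f :: "real \<Rightarrow> real" where "f x = x - max (-s) (min s x)" for x
    define g :: "nat \<Rightarrow> real \<Rightarrow> real" where "g k x = f x / (max s \<bar>x\<bar>) ^ (2 * k)" for k x
    have cf: "continuous_on A f" for A unfolding f_def by (intro continuous_intros)
    have cg: "continuous_on A (g k)" for A k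
      unfolding g_def using s0 by (intro continuous_intros cf) (auto simp: max_def)
    have fg: "f x = x ^ (2 * k) * g k x" for x k
    proof (cases "\<bar>x\<bar> \<le> s")
      case True
      then show ?thesis by (auto simp: g_def f_def)
    next
      case False
      then have "max s \<bar>x\<bar> = \<bar>x\<bar>" "x \<noteq> 0" using s0 by auto
      then show ?thesis by (simp add: g_def power_mult)
    qed
    have fb: "\<bar>f x\<bar> \<le> \<bar>x\<bar>" for x using s0 by (auto simp: f_def)
    have gb: "\<bar>g k x\<bar> \<le> norm h / s ^ (2 * k)" if "\<bar>x\<bar> \<le> norm h" for k x
    proof -
      have "\<bar>g k x\<bar> = \<bar>f x\<bar> / (max s \<bar>x\<bar>) ^ (2 * k)" by (simp add: g_def)
      also have "\<dots> \<le> norm h / s ^ (2 * k)"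
        using that fb[of x] s0 by (intro frac_le power_mono zero_less_power) auto
      finally show ?thesis .
    qed
    obtain F where F: "\<And>p e. \<forall>i. coeff p i \<in> \<real> \<Longrightarrow>
        \<forall>x. \<bar>x\<bar> \<le> norm h \<longrightarrow> cmod (poly p (of_real x) - of_real (f x)) \<le> e \<Longrightarrow> norm (peval p h - F) \<le> e"
      using continuous_calculus[OF h cf] by meson
    \<comment> \<open>If r approximates \<open>g k\<close>, then x^(2k) r approximates f; so
      \<open>N F\<close> is, up to the error, at most \<open>N h ^ (2 * k)\<close> times the norm of
      r(h), and the latter is controlled by the supremum of \<open>g k\<close>.\<close>
    have NF: "N F \<le> N h ^ (2 * k) * (norm h / s ^ (2 * k))" for k
    proof (rule field_le_epsilon)
      fix e :: real assume e: "e > 0"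
      \<comment> \<open>c collects the factors of both errors: the power of norm h from the distance
        to \<open>F\<close>, the power of \<open>N h\<close> from the norm of r(h). Dividing by c +
        1 makes their sum at most e.\<close>
      define c where "c = norm h ^ (2 * k) + N h ^ (2 * k)"
      have c: "c \<ge> 0" using sn_facts(3) by (simp add: c_def)
      obtain r where r: "\<forall>i. coeff r i \<in> \<real>"
        "\<And>x. \<bar>x\<bar> \<le> norm h \<Longrightarrow> cmod (poly r (of_real x) - of_real (g k x)) \<le> e / (c + 1)"
        using Weierstrass_complex_poly[OF cg[of "{- norm h..norm h}" k], of "e / (c + 1)"] e c by auto
      let ?p = "monom 1 (2 * k) * r"
      have rb: "norm (peval r h) \<le> norm h / s ^ (2 * k) + e / (c + 1)"
      proof (rule norm_peval_le[OF h r(1)])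
        fix x assume x: "\<bar>x\<bar> \<le> norm h"
        have "cmod (poly r (of_real x)) \<le> cmod (of_real (g k x)) + cmod (poly r (of_real x) - of_real (g k x))"
          using norm_triangle_ineq[of "of_real (g k x)" "poly r (of_real x) - of_real (g k x)"] by simp
        then show "cmod (poly r (of_real x)) \<le> norm h / s ^ (2 * k) + e / (c + 1)"
          using r(2)[OF x] gb[OF x, of k] by simp
      qed
      have "norm (peval ?p h - F) \<le> norm h ^ (2 * k) * (e / (c + 1))"
      proof (rule F, safe)
        fix i
        show "coeff ?p i \<in> \<real>" using r(1) by (simp add: coeff_monom_mult)
      next
        fix x assume x: "\<bar>x\<bar> \<le> norm h"
        have "poly ?p (of_real x) - of_real (f x) = of_real (x ^ (2 * k)) * (poly r (of_real x) - of_real (g k x))"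
          unfolding fg[of x k] by (simp add: poly_monom algebra_simps)
        then have "cmod (poly ?p (of_real x) - of_real (f x)) = \<bar>x\<bar> ^ (2 * k) * cmod (poly r (of_real x) - of_real (g k x))"
          by (simp only: norm_mult norm_of_real power_abs)
        also have "\<dots> \<le> norm h ^ (2 * k) * (e / (c + 1))"
          using x r(2)[OF x] e c by (intro mult_mono power_mono) auto
        finally show "cmod (poly ?p (of_real x) - of_real (f x)) \<le> norm h ^ (2 * k) * (e / (c + 1))" .
      qed
      then have 1: "N (peval ?p h - F) \<le> norm h ^ (2 * k) * (e / (c + 1))"
        using cstar_seminorm_le_norm[OF N] order_trans by blast
      have Np: "N (h ^ m) \<le> N h ^ m" for m
      proof (induction m)
        case (Suc m)
        have "N (h ^ Suc m) \<le> N h * N (h ^ m)" using sn_facts(2) by simp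
        also have "\<dots> \<le> N h * N h ^ m" using Suc sn_facts(3) by (intro mult_left_mono) auto
        finally show ?case by simp
      qed (simp add: alg_seminorm_one[OF sn])
      have "N (peval ?p h) \<le> N (h ^ (2 * k)) * N (peval r h)"
        unfolding peval_mult peval_monom by (rule sn_facts(2))
      also have "\<dots> \<le> N h ^ (2 * k) * (norm h / s ^ (2 * k) + e / (c + 1))"
        using rb cstar_seminorm_le_norm[OF N, of "peval r h"] Np sn_facts(3) by (intro mult_mono) (auto intro: order_trans)
      finally have 2: "N (peval ?p h) \<le> N h ^ (2 * k) * (norm h / s ^ (2 * k)) + N h ^ (2 * k) * (e / (c + 1))"
        by (simp add: distrib_left)
      have "N F \<le> N (peval ?p h) + N (peval ?p h - F)"
        using alg_seminorm_diff[OF sn, of "peval ?p h" "peval ?p h - F"] by simp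
      also have "\<dots> \<le> N h ^ (2 * k) * (norm h / s ^ (2 * k)) + c * (e / (c + 1))"
      proof -
        have "c * q = norm h ^ (2 * k) * q + N h ^ (2 * k) * q" for q by (simp add: c_def distrib_right)
        from this[of "e / (c + 1)"] 1 2 show ?thesis by linarith
      qed
      also have "c * (e / (c + 1)) \<le> e" using e c by (simp add: field_simps)
      finally show "N F \<le> N h ^ (2 * k) * (norm h / s ^ (2 * k)) + e" by simp
    qed
    \<comment> \<open>Since N h < s, the bounds on \<open>N F\<close> decrease geometrically to
      0.\<close>
    have "(\<lambda>k. norm h * ((N h / s)\<^sup>2) ^ k) \<longlonglongrightarrow> norm h * 0"
      using s s0 sn_facts(3)[of h] by (intro tendsto_mult_left LIMSEQ_realpow_zero) (auto simp: power2_less_1_iff[symmetric] power_less_one_iff)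
    moreover have "N F \<le> norm h * ((N h / s)\<^sup>2) ^ k" for k
      using NF[of k] by (simp add: power_divide power_mult[symmetric] mult.commute)
    ultimately have "N F \<le> norm h * 0"
      by (intro LIMSEQ_le_const) auto
    then have "F = 0" using definite sn_facts(3)[of F] by (simp add: order_antisym)
    \<comment> \<open>With f(h) = 0, h is the value at h of the clamp x - f x, which is bounded by
      s; this contradicts s < norm h.\<close>
    have "norm h \<le> s"
    proof (rule field_le_epsilon)
      fix e :: real assume e: "e > 0"
      obtain r where r: "\<forall>i. coeff r i \<in> \<real>"
        "\<And>x. \<bar>x\<bar> \<le> norm h \<Longrightarrow> cmod (poly r (of_real x) - of_real (f x)) \<le> e/2"
        using Weierstrass_complex_poly[OF cf[of "{- norm h..norm h}"], of "e/2"] e by auto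
      have "norm (peval r h) \<le> e/2" using F[of r "e/2"] r \<open>F = 0\<close> by simp
      moreover have "norm (peval ([:0,1:] - r) h) \<le> s + e/2"
      proof (rule norm_peval_le[OF h])
        show "\<forall>i. coeff ([:0, 1:] - r) i \<in> \<real>"
          using r(1) by (auto simp: coeff_pCons split: nat.split)
        fix x assume x: "\<bar>x\<bar> \<le> norm h"
        have "poly ([:0, 1:] - r) (of_real x) = of_real (x - f x) - (poly r (of_real x) - of_real (f x))" by simp
        then have "cmod (poly ([:0, 1:] - r) (of_real x)) \<le> \<bar>x - f x\<bar> + cmod (poly r (of_real x) - of_real (f x))"
          by (metis norm_triangle_ineq4 norm_of_real)
        moreover have "\<bar>x - f x\<bar> \<le> s" using s0 by (auto simp: f_def)
        ultimately show "cmod (poly ([:0, 1:] - r) (of_real x)) \<le> s + e/2" using r(2)[OF x] by simp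
      qed
      ultimately show "norm h \<le> s + e"
        using norm_triangle_ineq[of "peval ([:0,1:] - r) h" "peval r h"] by (simp add: peval_diff)
    qed
    then show False using s by simp
  qed
  have "norm (star a * a) \<le> N (star a * a)" by (rule sa) (simp add: star_mult star_star)
  then have "(norm a)\<^sup>2 \<le> (N a)\<^sup>2" using N by (simp add: cstar_identity cstar_seminorm_def)
  then have "norm a \<le> N a" by (rule power2_le_imp_le) (rule sn_facts(3))
  then show ?thesis using cstar_seminorm_le_norm[OF N, of a] by simp
qed

section \<open>Operators on \<open>\<ell>\<^sup>2\<close>\<close>

text \<open>Minimise over z: for b > 0 the test point is - cnj q / b, while for b = 0 a real affine
  function that is bounded below has no linear term. It yields Cauchy-Schwarz for possibly
  degenerate forms: the inner product, states, and positive operators.\<close>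

lemma quadratic_discriminant_bound:
  fixes q :: complex and a b :: real
  assumes pos: "\<And>z. 0 \<le> a + 2 * Re (z * q) + (cmod z)\<^sup>2 * b" and b: "b \<ge> 0"
  shows "(cmod q)\<^sup>2 \<le> a * b"
proof (cases "b = 0")
  case True
  have "q = 0"
  proof (rule ccontr)
    assume q: "q \<noteq> 0"
    define t where "t = (a + 1) / (2 * (cmod q)\<^sup>2)"
    have "Re ((- of_real t * cnj q) * q) = - t * (cmod q)\<^sup>2"
      by (simp add: cmod_power2) (simp add: power2_eq_square algebra_simps)
    then have "0 \<le> a + 2 * (- t * (cmod q)\<^sup>2)" using pos[of "- of_real t * cnj q"] True by simp
    moreover have "t * (cmod q)\<^sup>2 = (a + 1) / 2" using q by (simp add: t_def)
    ultimately show False by simp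
  qed
  then show ?thesis using True by simp
next
  case False
  then have b0: "b > 0" using b by simp
  have r: "Re ((- of_real (1/b) * cnj q) * q) = - (1/b) * (cmod q)\<^sup>2"
    by (simp add: cmod_power2) (simp add: power2_eq_square field_simps)
  have "0 \<le> a + 2 * (- (1/b) * (cmod q)\<^sup>2) + (cmod q / b)\<^sup>2 * b"
    using pos[of "- of_real (1/b) * cnj q"] b0 unfolding r by (simp add: norm_mult norm_divide)
  also have "\<dots> = a - (cmod q)\<^sup>2 / b" using b0 by (simp add: power2_eq_square field_simps)
  finally show ?thesis using b0 by (simp add: field_simps)
qed

section \<open>The Hilbert spaces of square-summable families\<close>

lemma sum_fun_apply: "(\<Sum>i\<in>I. f i) x = (\<Sum>i\<in>I. f i x :: 'b::comm_monoid_add)"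
  by (induction I rule: infinite_finite_induct) simp_all

lemma ell2_summable: "x \<in> ell2 \<Longrightarrow> (\<lambda>i. (cmod (x i))\<^sup>2) summable_on A"
  unfolding ell2_def using summable_on_subset_banach by fastforce

lemma ell2_inner_abs_summable:
  assumes "x \<in> ell2" "y \<in> ell2"
  shows "(\<lambda>i. cmod (cnj (x i) * y i)) summable_on A"
proof (rule Infinite_Sum.abs_summable_on_comparison_test')
  show "(\<lambda>i. (cmod (x i))\<^sup>2 + (cmod (y i))\<^sup>2) summable_on A"
    by (intro summable_on_add ell2_summable assms)
  fix i
  have "2 * (cmod (x i) * cmod (y i)) \<le> (cmod (x i))\<^sup>2 + (cmod (y i))\<^sup>2"
    using sum_squares_bound[of "cmod (x i)" "cmod (y i)"] by (simp add: mult.assoc)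
  moreover have "0 \<le> cmod (x i) * cmod (y i)" by simp
  ultimately show "cmod (cnj (x i) * y i) \<le> (cmod (x i))\<^sup>2 + (cmod (y i))\<^sup>2"
    unfolding norm_mult complex_mod_cnj by linarith
qed

lemma ell2_inner_summable:
  "x \<in> ell2 \<Longrightarrow> y \<in> ell2 \<Longrightarrow> (\<lambda>i. cnj (x i) * y i) summable_on A"
  by (rule Infinite_Sum.abs_summable_summable[OF ell2_inner_abs_summable])

lemma ell2_zero [simp]: "0 \<in> ell2" by (simp add: ell2_def)

lemma ell2_scale: "x \<in> ell2 \<Longrightarrow> c *\<^sub>C x \<in> ell2"
  by (auto simp: ell2_def scaleC_fun_def scaleC_complex_def norm_mult power_mult_distrib intro: summable_on_cmult_right)

lemma ell2_add:
  assumes "x \<in> ell2" "y \<in> ell2" shows "x + y \<in> ell2"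
proof -
  have "(\<lambda>i. norm ((cmod (x i + y i))\<^sup>2)) summable_on UNIV"
  proof (rule Infinite_Sum.abs_summable_on_comparison_test')
    show "(\<lambda>i. 2 * (cmod (x i))\<^sup>2 + 2 * (cmod (y i))\<^sup>2) summable_on UNIV"
      by (intro summable_on_add summable_on_cmult_right ell2_summable assms)
    fix i
    have "(cmod (x i + y i))\<^sup>2 \<le> (cmod (x i) + cmod (y i))\<^sup>2"
      by (intro power_mono norm_triangle_ineq) simp
    also have "\<dots> \<le> 2 * (cmod (x i))\<^sup>2 + 2 * (cmod (y i))\<^sup>2"
      using sum_squares_bound[of "cmod (x i)" "cmod (y i)"] by (simp add: power2_sum)
    finally show "norm ((cmod (x i + y i))\<^sup>2) \<le> 2 * (cmod (x i))\<^sup>2 + 2 * (cmod (y i))\<^sup>2" by simp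
  qed
  then show ?thesis by (simp add: ell2_def)
qed

lemma ell2_diff: "x \<in> ell2 \<Longrightarrow> y \<in> ell2 \<Longrightarrow> x - y \<in> ell2"
  using ell2_add[of x "(-1) *\<^sub>C y"] ell2_scale[of y "-1"] by simp

lemma ell2_sum: "(\<And>i. i \<in> I \<Longrightarrow> x i \<in> ell2) \<Longrightarrow> (\<Sum>i\<in>I. x i) \<in> ell2"
  by (induction I rule: infinite_finite_induct) (auto intro: ell2_add)

lemma ell2_inner_add_right:
  assumes "x \<in> ell2" "y \<in> ell2" "z \<in> ell2"
  shows "ell2_inner x (y + z) = ell2_inner x y + ell2_inner x z"
  unfolding ell2_inner_def by (simp add: distrib_left infsum_add ell2_inner_summable assms)

lemma ell2_inner_scale_right: "ell2_inner x (c *\<^sub>C y) = c * ell2_inner x y"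
  unfolding ell2_inner_def scaleC_fun_def scaleC_complex_def
  by (simp add: infsum_cmult_right'[symmetric] mult.left_commute)

lemma ell2_inner_cnj: "cnj (ell2_inner x y) = ell2_inner y x"
  unfolding ell2_inner_def by (simp add: infsum_cnj[symmetric] mult.commute)

lemma ell2_inner_add_left:
  assumes "x \<in> ell2" "y \<in> ell2" "z \<in> ell2"
  shows "ell2_inner (x + y) z = ell2_inner x z + ell2_inner y z"
  using ell2_inner_add_right[OF assms(3,1,2)] by (metis ell2_inner_cnj complex_cnj_add)

lemma ell2_inner_scale_left: "ell2_inner (c *\<^sub>C x) y = cnj c * ell2_inner x y"
  using ell2_inner_scale_right[of y c x] by (metis ell2_inner_cnj complex_cnj_mult)

lemma ell2_inner_zero_right [simp]: "ell2_inner x 0 = 0" by (simp add: ell2_inner_def)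
lemma ell2_inner_zero_left [simp]: "ell2_inner 0 x = 0" by (simp add: ell2_inner_def)

lemma ell2_inner_sum_right:
  assumes "x \<in> ell2" "\<And>i. i \<in> I \<Longrightarrow> y i \<in> ell2"
  shows "ell2_inner x (\<Sum>i\<in>I. y i) = (\<Sum>i\<in>I. ell2_inner x (y i))"
  using assms(2)
  by (induction I rule: infinite_finite_induct) (auto simp: ell2_inner_add_right assms(1) ell2_sum)

lemma ell2_norm_nonneg [simp]: "0 \<le> ell2_norm x"
  by (simp add: ell2_norm_def infsum_nonneg)

lemma ell2_norm_sq: "(ell2_norm x)\<^sup>2 = (\<Sum>\<^sub>\<infinity>i. (cmod (x i))\<^sup>2)"
  by (simp add: ell2_norm_def infsum_nonneg)

lemma ell2_inner_self:
  "ell2_inner x x = complex_of_real ((ell2_norm x)\<^sup>2)"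
proof -
  have "cnj (x i) * x i = complex_of_real ((cmod (x i))\<^sup>2)" for i
    by (metis complex_norm_square mult.commute)
  then show ?thesis
    unfolding ell2_inner_def ell2_norm_sq
    using infsum_bounded_linear_strong[OF summable_on_bounded_linear_iff[OF bounded_linear_of_real bounded_linear_Re]
        bounded_linear_of_real, of "\<lambda>i. (cmod (x i))\<^sup>2" UNIV] by simp
qed

lemma ell2_norm_add_sq:
  assumes "x \<in> ell2" "y \<in> ell2"
  shows "(ell2_norm (x + y))\<^sup>2 = (ell2_norm x)\<^sup>2 + 2 * Re (ell2_inner x y) + (ell2_norm y)\<^sup>2"
proof -
  have "complex_of_real ((ell2_norm (x + y))\<^sup>2) = ell2_inner (x + y) (x + y)" by (simp add: ell2_inner_self)
  also have "\<dots> = ell2_inner x x + (ell2_inner x y + cnj (ell2_inner x y)) + ell2_inner y y"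
    by (simp add: ell2_inner_add_left ell2_inner_add_right assms ell2_add ell2_inner_cnj)
  also have "\<dots> = complex_of_real ((ell2_norm x)\<^sup>2 + 2 * Re (ell2_inner x y) + (ell2_norm y)\<^sup>2)"
    by (simp only: ell2_inner_self complex_add_cnj of_real_add)
  finally show ?thesis by (simp only: of_real_eq_iff)
qed

lemma ell2_norm_scale: "ell2_norm (c *\<^sub>C x) = cmod c * ell2_norm x"
proof (rule power2_eq_imp_eq)
  show "(ell2_norm (c *\<^sub>C x))\<^sup>2 = (cmod c * ell2_norm x)\<^sup>2"
    unfolding power_mult_distrib ell2_norm_sq
    by (simp add: scaleC_fun_def scaleC_complex_def norm_mult power_mult_distrib infsum_cmult_right')
qed simp_all

lemma ell2_cauchy_schwarz:
  assumes "x \<in> ell2" "y \<in> ell2"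
  shows "cmod (ell2_inner x y) \<le> ell2_norm x * ell2_norm y"
proof -
  have "(cmod (ell2_inner x y))\<^sup>2 \<le> (ell2_norm x)\<^sup>2 * (ell2_norm y)\<^sup>2"
  proof (rule quadratic_discriminant_bound)
    fix z
    have "(ell2_norm x)\<^sup>2 + 2 * Re (z * ell2_inner x y) + (cmod z)\<^sup>2 * (ell2_norm y)\<^sup>2 = (ell2_norm (x + z *\<^sub>C y))\<^sup>2"
      using assms by (simp add: ell2_norm_add_sq ell2_scale ell2_inner_scale_right ell2_norm_scale power_mult_distrib)
    then show "0 \<le> (ell2_norm x)\<^sup>2 + 2 * Re (z * ell2_inner x y) + (cmod z)\<^sup>2 * (ell2_norm y)\<^sup>2" by simp
  qed simp
  then have "(cmod (ell2_inner x y))\<^sup>2 \<le> (ell2_norm x * ell2_norm y)\<^sup>2" by (simp add: power_mult_distrib)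
  then show ?thesis by (rule power2_le_imp_le) simp
qed

lemma ell2_triangle:
  assumes "x \<in> ell2" "y \<in> ell2"
  shows "ell2_norm (x + y) \<le> ell2_norm x + ell2_norm y"
proof (rule power2_le_imp_le)
  have "Re (ell2_inner x y) \<le> ell2_norm x * ell2_norm y"
    using ell2_cauchy_schwarz[OF assms] complex_Re_le_cmod order_trans by blast
  then show "(ell2_norm (x + y))\<^sup>2 \<le> (ell2_norm x + ell2_norm y)\<^sup>2"
    by (simp add: ell2_norm_add_sq[OF assms] power2_sum)
qed simp

lemma ell2_norm_zero [simp]: "ell2_norm 0 = 0" by (simp add: ell2_norm_def)

lemma ell2_norm_sum:
  assumes "\<And>i. i \<in> I \<Longrightarrow> x i \<in> ell2"
  shows "ell2_norm (\<Sum>i\<in>I. x i) \<le> (\<Sum>i\<in>I. ell2_norm (x i))"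
  using assms
proof (induction I rule: infinite_finite_induct)
  case (insert a I)
  have "ell2_norm (x a + (\<Sum>i\<in>I. x i)) \<le> ell2_norm (x a) + ell2_norm (\<Sum>i\<in>I. x i)"
    using insert.prems by (intro ell2_triangle ell2_sum) auto
  moreover have "ell2_norm (\<Sum>i\<in>I. x i) \<le> (\<Sum>i\<in>I. ell2_norm (x i))" using insert by auto
  ultimately show ?case unfolding sum.insert[OF insert.hyps(1,2)] by linarith
qed auto

lemma ell2_coord:
  assumes "x \<in> ell2" shows "cmod (x i) \<le> ell2_norm x"
proof (rule power2_le_imp_le)
  have "(\<Sum>\<^sub>\<infinity>j\<in>{i}. (cmod (x j))\<^sup>2) \<le> (\<Sum>\<^sub>\<infinity>j. (cmod (x j))\<^sup>2)"
    by (rule infsum_mono2) (auto intro: ell2_summable assms)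
  then show "(cmod (x i))\<^sup>2 \<le> (ell2_norm x)\<^sup>2" by (simp add: ell2_norm_sq)
qed simp

lemma ell2_norm_eq_0: "x \<in> ell2 \<Longrightarrow> ell2_norm x = 0 \<Longrightarrow> x = 0"
  using ell2_coord[of x] by (auto simp: fun_eq_iff)

definition trunc :: "'i set \<Rightarrow> ('i \<Rightarrow> complex) \<Rightarrow> 'i \<Rightarrow> complex"
  where "trunc F x = (\<lambda>i. if i \<in> F then x i else 0)"

definition unit_vec :: "'i \<Rightarrow> 'i \<Rightarrow> complex"
  where "unit_vec k = (\<lambda>i. if i = k then 1 else 0)"

lemma trunc_summable:
  assumes "finite F"
  shows "((\<lambda>i. if i \<in> F then g i else 0) has_sum (\<Sum>i\<in>F. g i :: 'b::{topological_comm_monoid_add})) UNIV"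
  using has_sum_finite[OF assms, of g] by (rule has_sum_cong_neutral[THEN iffD1, rotated -1]) auto

lemma trunc_ell2: assumes "finite F" shows "trunc F x \<in> ell2"
proof -
  have "(\<lambda>i. (cmod (trunc F x i))\<^sup>2) = (\<lambda>i. if i \<in> F then (cmod (x i))\<^sup>2 else 0)" by (auto simp: trunc_def)
  then show ?thesis using trunc_summable[OF assms, of "\<lambda>i. (cmod (x i))\<^sup>2"]
    by (auto simp: ell2_def has_sum_imp_summable)
qed

lemma trunc_norm: assumes "finite F" shows "(ell2_norm (trunc F x))\<^sup>2 = (\<Sum>i\<in>F. (cmod (x i))\<^sup>2)"
proof -
  have "(\<lambda>i. (cmod (trunc F x i))\<^sup>2) = (\<lambda>i. if i \<in> F then (cmod (x i))\<^sup>2 else 0)" by (auto simp: trunc_def)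
  then show ?thesis using infsumI[OF trunc_summable[OF assms, of "\<lambda>i. (cmod (x i))\<^sup>2"]]
    by (simp add: ell2_norm_sq)
qed

lemma trunc_norm': "finite F \<Longrightarrow> ell2_norm (trunc F x) = sqrt (\<Sum>i\<in>F. (cmod (x i))\<^sup>2)"
  using trunc_norm[of F x] by (metis ell2_norm_nonneg real_sqrt_unique)

lemma trunc_inner: assumes "finite F" shows "ell2_inner (trunc F x) y = (\<Sum>i\<in>F. cnj (x i) * y i)"
proof -
  have "(\<lambda>i. cnj (trunc F x i) * y i) = (\<lambda>i. if i \<in> F then cnj (x i) * y i else 0)" by (auto simp: trunc_def)
  then show ?thesis using infsumI[OF trunc_summable[OF assms, of "\<lambda>i. cnj (x i) * y i"]]
    by (simp add: ell2_inner_def)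
qed

lemma unit_vec_trunc: "unit_vec k = trunc {k} (\<lambda>_. 1)" by (auto simp: unit_vec_def trunc_def)

lemma unit_vec_ell2 [simp]: "unit_vec k \<in> ell2" by (simp add: unit_vec_trunc trunc_ell2)

lemma trunc_expand: assumes "finite F" shows "trunc F x = (\<Sum>i\<in>F. x i *\<^sub>C unit_vec i)"
proof
  fix j
  have "(\<Sum>i\<in>F. x i *\<^sub>C unit_vec i) j = (\<Sum>i\<in>F. if i = j then x i else 0)"
    unfolding sum_fun_apply by (rule sum.cong) (auto simp: scaleC_fun_def scaleC_complex_def unit_vec_def)
  then show "trunc F x j = (\<Sum>i\<in>F. x i *\<^sub>C unit_vec i) j" using assms by (simp add: trunc_def)
qed

lemma trunc_norm_le: assumes "finite F" "x \<in> ell2" shows "ell2_norm (trunc F x) \<le> ell2_norm x"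
proof (rule power2_le_imp_le)
  have "(\<Sum>\<^sub>\<infinity>i\<in>F. (cmod (x i))\<^sup>2) \<le> (\<Sum>\<^sub>\<infinity>i. (cmod (x i))\<^sup>2)"
    by (rule infsum_mono2) (auto intro: ell2_summable assms)
  then show "(ell2_norm (trunc F x))\<^sup>2 \<le> (ell2_norm x)\<^sup>2" using assms by (simp add: ell2_norm_sq[of x] trunc_norm)
qed simp

lemma trunc_dense:
  assumes x: "x \<in> ell2" and e: "e > 0"
  shows "\<exists>F. finite F \<and> ell2_norm (x - trunc F x) \<le> e"
proof -
  obtain F where F: "finite F" "dist (\<Sum>i\<in>F. (cmod (x i))\<^sup>2) (\<Sum>\<^sub>\<infinity>i. (cmod (x i))\<^sup>2) \<le> e\<^sup>2"
    using infsum_finite_approximation[OF ell2_summable[OF x, of UNIV], of "e\<^sup>2"] e by auto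
  have t: "trunc F x \<in> ell2" "x - trunc F x \<in> ell2" using F x by (auto intro: trunc_ell2 ell2_diff)
  have "ell2_inner (trunc F x) (x - trunc F x) = 0"
    unfolding trunc_inner[OF F(1)] by (rule sum.neutral) (simp add: trunc_def)
  then have "(ell2_norm x)\<^sup>2 = (ell2_norm (trunc F x))\<^sup>2 + (ell2_norm (x - trunc F x))\<^sup>2"
    using ell2_norm_add_sq[OF t] by simp
  then have "(ell2_norm (x - trunc F x))\<^sup>2 \<le> e\<^sup>2"
    using F by (simp add: trunc_norm ell2_norm_sq[of x] dist_norm)
  then have "ell2_norm (x - trunc F x) \<le> e" by (rule power2_le_imp_le) (use e in simp)
  then show ?thesis using F by blast
qed

section \<open>Bounded operators and their matrix coefficients\<close>

context
  fixes T :: "('i \<Rightarrow> complex) \<Rightarrow> 'i \<Rightarrow> complex"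
  assumes T: "bounded_op T"
begin

lemma op_ell2: "x \<in> ell2 \<Longrightarrow> T x \<in> ell2" using T by (auto simp: bounded_op_def)
lemma op_add: "x \<in> ell2 \<Longrightarrow> y \<in> ell2 \<Longrightarrow> T (x + y) = T x + T y" using T by (auto simp: bounded_op_def)
lemma op_scale: "x \<in> ell2 \<Longrightarrow> T (c *\<^sub>C x) = c *\<^sub>C T x" using T by (auto simp: bounded_op_def)
lemma op_zero: "T 0 = 0" using op_scale[of 0 0] by simp
lemma op_diff: "x \<in> ell2 \<Longrightarrow> y \<in> ell2 \<Longrightarrow> T (x - y) = T x - T y"
  using op_add[of x "(-1) *\<^sub>C y"] op_scale[of y "-1"] ell2_scale[of y "-1"] by simp
lemma op_sum: "(\<And>i. i \<in> I \<Longrightarrow> x i \<in> ell2) \<Longrightarrow> T (\<Sum>i\<in>I. x i) = (\<Sum>i\<in>I. T (x i))"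
  by (induction I rule: infinite_finite_induct) (auto simp: op_zero op_add ell2_sum)

lemma op_norm_bdd: "bdd_above {ell2_norm (T x) | x. x \<in> ell2 \<and> ell2_norm x \<le> 1}"
proof -
  obtain K where K: "\<And>x. x \<in> ell2 \<Longrightarrow> ell2_norm (T x) \<le> K * ell2_norm x" using T unfolding bounded_op_def by meson
  have "ell2_norm (T x) \<le> \<bar>K\<bar>" if "x \<in> ell2" "ell2_norm x \<le> 1" for x
  proof -
    have "ell2_norm (T x) \<le> \<bar>K\<bar> * ell2_norm x"
      using K[OF that(1)] mult_right_mono[OF abs_ge_self[of K] ell2_norm_nonneg[of x]] by linarith
    also have "\<dots> \<le> \<bar>K\<bar> * 1" using that by (intro mult_left_mono) auto
    finally show ?thesis by simp
  qed
  then show ?thesis by (intro bdd_aboveI[of _ "\<bar>K\<bar>"]) auto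
qed

lemma op_norm_nonneg: "0 \<le> op_norm T"
proof -
  have "ell2_norm (T 0) \<le> op_norm T"
    unfolding op_norm_def by (rule cSup_upper[OF _ op_norm_bdd]) (auto intro!: exI[of _ 0])
  then show ?thesis by (simp add: op_zero)
qed

lemma op_norm_le: assumes x: "x \<in> ell2" shows "ell2_norm (T x) \<le> op_norm T * ell2_norm x"
proof (cases "ell2_norm x = 0")
  case True
  then show ?thesis using ell2_norm_eq_0[OF x] by (simp add: op_zero)
next
  case False
  define n where "n = ell2_norm x"
  have n: "n > 0" using False ell2_norm_nonneg[of x] by (simp add: n_def less_le)
  define y where "y = complex_of_real (1/n) *\<^sub>C x"
  have y: "y \<in> ell2" "ell2_norm y = 1"
    using x n by (auto simp: y_def ell2_scale ell2_norm_scale norm_divide n_def[symmetric])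
  have "ell2_norm (T y) \<le> op_norm T"
    unfolding op_norm_def using y by (intro cSup_upper[OF _ op_norm_bdd]) auto
  moreover have "ell2_norm (T y) = ell2_norm (T x) / n"
    using n unfolding y_def op_scale[OF x] ell2_norm_scale by (simp add: norm_divide)
  ultimately show ?thesis using n by (simp add: field_simps n_def)
qed

lemma op_norm_leI:
  assumes C: "\<And>x. x \<in> ell2 \<Longrightarrow> ell2_norm (T x) \<le> C * ell2_norm x" and "C \<ge> 0"
  shows "op_norm T \<le> C"
  unfolding op_norm_def
proof (rule cSup_least)
  show "{ell2_norm (T x) |x. x \<in> ell2 \<and> ell2_norm x \<le> 1} \<noteq> {}" by (auto intro!: exI[of _ 0])
  fix v assume "v \<in> {ell2_norm (T x) |x. x \<in> ell2 \<and> ell2_norm x \<le> 1}"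
  then obtain x where x: "v = ell2_norm (T x)" "x \<in> ell2" "ell2_norm x \<le> 1" by blast
  then show "v \<le> C" using C[OF x(2)] mult_left_mono[OF x(3) \<open>C \<ge> 0\<close>] by simp
qed

end

text \<open>A finitely supported test of boundedness by \<open>C\<close>, in terms of matrix coefficients.\<close>

definition mc :: "(('i \<Rightarrow> complex) \<Rightarrow> 'i \<Rightarrow> complex) \<Rightarrow> 'i \<Rightarrow> 'i \<Rightarrow> complex"
  where "mc T i k = T (unit_vec k) i"

definition mbound :: "('i \<Rightarrow> 'i \<Rightarrow> complex) \<Rightarrow> real \<Rightarrow> bool"
  where "mbound m C \<longleftrightarrow> (\<forall>F \<zeta> \<eta>. finite F \<longrightarrow>
    cmod (\<Sum>p\<in>F. \<Sum>q\<in>F. cnj (\<zeta> p) * m p q * \<eta> q)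
      \<le> C * (sqrt (\<Sum>p\<in>F. (cmod (\<zeta> p))\<^sup>2) * sqrt (\<Sum>p\<in>F. (cmod (\<eta> p))\<^sup>2)))"

lemma mc_inner:
  assumes T: "bounded_op T" and "finite F" "finite G"
  shows "ell2_inner (trunc F \<zeta>) (T (trunc G \<eta>)) = (\<Sum>p\<in>F. \<Sum>q\<in>G. cnj (\<zeta> p) * mc T p q * \<eta> q)"
proof -
  have "T (trunc G \<eta>) = (\<Sum>q\<in>G. \<eta> q *\<^sub>C T (unit_vec q))"
    unfolding trunc_expand[OF \<open>finite G\<close>] by (simp add: op_sum[OF T] op_scale[OF T] ell2_scale)
  then have "T (trunc G \<eta>) p = (\<Sum>q\<in>G. mc T p q * \<eta> q)" for p
    by (simp add: sum_fun_apply scaleC_fun_def scaleC_complex_def mc_def mult.commute)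
  then show ?thesis
    by (simp add: trunc_inner[OF \<open>finite F\<close>] sum_distrib_left mult.assoc)
qed

text \<open>Boundedness becomes a condition on scalar families, so operators in different
  representations can be compared through their coefficients alone.\<close>

theorem op_norm_mbound:
  assumes T: "bounded_op T" and C: "C \<ge> 0"
  shows "op_norm T \<le> C \<longleftrightarrow> mbound (mc T) C"
proof
  assume le: "op_norm T \<le> C"
  show "mbound (mc T) C"
    unfolding mbound_def
  proof (intro allI impI)
    fix F :: "'a set" and \<zeta> \<eta> assume F: "finite F"
    have t: "trunc F \<zeta> \<in> ell2" "trunc F \<eta> \<in> ell2" using F by (auto intro: trunc_ell2)
    have "cmod (ell2_inner (trunc F \<zeta>) (T (trunc F \<eta>))) \<le> ell2_norm (trunc F \<zeta>) * ell2_norm (T (trunc F \<eta>))"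
      by (intro ell2_cauchy_schwarz op_ell2[OF T] t)
    also have "\<dots> \<le> ell2_norm (trunc F \<zeta>) * (C * ell2_norm (trunc F \<eta>))"
      using op_norm_le[OF T t(2)] mult_right_mono[OF le ell2_norm_nonneg[of "trunc F \<eta>"]]
      by (intro mult_left_mono) auto
    finally show "cmod (\<Sum>p\<in>F. \<Sum>q\<in>F. cnj (\<zeta> p) * mc T p q * \<eta> q)
      \<le> C * (sqrt (\<Sum>p\<in>F. (cmod (\<zeta> p))\<^sup>2) * sqrt (\<Sum>p\<in>F. (cmod (\<eta> p))\<^sup>2))"
      unfolding mc_inner[OF T F F] trunc_norm'[OF F] by (simp add: algebra_simps)
  qed
next
  assume mb: "mbound (mc T) C"
  have fin: "cmod (ell2_inner (trunc F \<zeta>) (T (trunc G \<eta>))) \<le> C * (ell2_norm (trunc F \<zeta>) * ell2_norm (trunc G \<eta>))"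
    if F: "finite F" and G: "finite G" for F G \<zeta> \<eta>
  proof -
    let ?H = "F \<union> G"
    have H: "finite ?H" using F G by simp
    have tt: "trunc ?H (trunc F \<zeta>) = trunc F \<zeta>" "trunc ?H (trunc G \<eta>) = trunc G \<eta>" by (auto simp: trunc_def)
    show ?thesis
      using mb[unfolded mbound_def, rule_format, OF H, of "trunc F \<zeta>" "trunc G \<eta>"]
      unfolding mc_inner[OF T H H, symmetric] trunc_norm'[OF H, symmetric] tt .
  qed
  \<comment> \<open>From finitely supported vectors to all x, by truncation; the summand 1 in k
    avoids a division by zero.\<close>
  have lim: "cmod (ell2_inner (trunc F \<zeta>) (T x)) \<le> C * (ell2_norm (trunc F \<zeta>) * ell2_norm x)"
    if F: "finite F" and x: "x \<in> ell2" for F \<zeta> x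
  proof (rule field_le_epsilon)
    fix e :: real assume e: "e > 0"
    define k where "k = ell2_norm (trunc F \<zeta>) * op_norm T + 1"
    have k: "k > 0" using op_norm_nonneg[OF T] by (simp add: k_def add_nonneg_pos)
    obtain G where G: "finite G" "ell2_norm (x - trunc G x) \<le> e / k"
      using trunc_dense[OF x, of "e / k"] e k by auto
    have t: "trunc F \<zeta> \<in> ell2" "trunc G x \<in> ell2" "x - trunc G x \<in> ell2"
      using F G x by (auto intro: trunc_ell2 ell2_diff)
    have "ell2_inner (trunc F \<zeta>) (T x) = ell2_inner (trunc F \<zeta>) (T (trunc G x)) + ell2_inner (trunc F \<zeta>) (T (x - trunc G x))"
      using ell2_inner_add_right[OF t(1) op_ell2[OF T t(2)] op_ell2[OF T t(3)]] op_diff[OF T x t(2)] by simp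
    then have "cmod (ell2_inner (trunc F \<zeta>) (T x))
      \<le> cmod (ell2_inner (trunc F \<zeta>) (T (trunc G x))) + cmod (ell2_inner (trunc F \<zeta>) (T (x - trunc G x)))"
      by (metis norm_triangle_ineq)
    moreover have "cmod (ell2_inner (trunc F \<zeta>) (T (trunc G x))) \<le> C * (ell2_norm (trunc F \<zeta>) * ell2_norm x)"
      using fin[OF F G(1), of \<zeta> x] trunc_norm_le[OF G(1) x] C
      by (meson mult_left_mono ell2_norm_nonneg order_trans)
    moreover have "cmod (ell2_inner (trunc F \<zeta>) (T (x - trunc G x))) \<le> ell2_norm (trunc F \<zeta>) * (op_norm T * (e / k))"
    proof -
      have "ell2_norm (T (x - trunc G x)) \<le> op_norm T * (e / k)"
        using op_norm_le[OF T t(3)] mult_left_mono[OF G(2) op_norm_nonneg[OF T]] by linarith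
      then show ?thesis
        using ell2_cauchy_schwarz[OF t(1) op_ell2[OF T t(3)]] by (meson mult_left_mono ell2_norm_nonneg order_trans)
    qed
    moreover have "ell2_norm (trunc F \<zeta>) * (op_norm T * (e / k)) \<le> e"
    proof -
      have "ell2_norm (trunc F \<zeta>) * (op_norm T * (e / k)) = (k - 1) * e / k" by (simp add: k_def)
      also have "\<dots> \<le> e" using k e by (simp add: field_simps)
      finally show ?thesis .
    qed
    ultimately show "cmod (ell2_inner (trunc F \<zeta>) (T x)) \<le> C * (ell2_norm (trunc F \<zeta>) * ell2_norm x) + e" by linarith
  qed
  show "op_norm T \<le> C"
  proof (rule op_norm_leI[OF T _ C])
    fix x :: "'a \<Rightarrow> complex" assume x: "x \<in> ell2"
    show "ell2_norm (T x) \<le> C * ell2_norm x"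
    proof (rule power2_le_imp_le)
      show "0 \<le> C * ell2_norm x" using C by simp
      have "(\<Sum>\<^sub>\<infinity>i. (cmod (T x i))\<^sup>2) \<le> (C * ell2_norm x)\<^sup>2"
      proof (rule infsum_le_finite_sums)
        show "(\<lambda>i. (cmod (T x i))\<^sup>2) summable_on UNIV" by (intro ell2_summable op_ell2[OF T] x)
        fix F :: "'a set" assume F: "finite F"
        have tt: "trunc F (trunc F (T x)) = trunc F (T x)" by (auto simp: trunc_def)
        \<comment> \<open>Testing against the truncation of \<open>T x\<close> itself produces the
          squared norm of that truncation, and one factor cancels.\<close>
        have "ell2_inner (trunc F (T x)) (T x) = ell2_inner (trunc F (T x)) (trunc F (T x))"
          unfolding trunc_inner[OF F] by (rule sum.cong) (auto simp: trunc_def)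
        then have "cmod (ell2_inner (trunc F (T x)) (T x)) = (ell2_norm (trunc F (T x)))\<^sup>2"
          by (simp only: ell2_inner_self norm_of_real) simp
        then have "(ell2_norm (trunc F (T x)))\<^sup>2 \<le> C * (ell2_norm (trunc F (T x)) * ell2_norm x)"
          using lim[OF F x, of "T x"] by simp
        then have "ell2_norm (trunc F (T x)) \<le> C * ell2_norm x"
          using C by (cases "ell2_norm (trunc F (T x)) = 0")
            (auto simp: power2_eq_square mult.left_commute dest: mult_left_le_imp_le simp: less_le)
        then have "(ell2_norm (trunc F (T x)))\<^sup>2 \<le> (C * ell2_norm x)\<^sup>2" by (rule power_mono) simp
        then show "(\<Sum>i\<in>F. (cmod (T x i))\<^sup>2) \<le> (C * ell2_norm x)\<^sup>2" by (simp add: trunc_norm[OF F])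
      qed
      then show "(ell2_norm (T x))\<^sup>2 \<le> (C * ell2_norm x)\<^sup>2" by (simp add: ell2_norm_sq)
    qed
  qed
qed

section \<open>Tensor products of operators\<close>

lemma ell2_rows:
  assumes x: "\<xi> \<in> ell2"
  shows "(\<lambda>j. \<xi> (k, j)) \<in> ell2" "(\<lambda>k. (ell2_norm (\<lambda>j. \<xi> (k, j)))\<^sup>2) summable_on UNIV"
    "(ell2_norm \<xi>)\<^sup>2 = (\<Sum>\<^sub>\<infinity>k. (ell2_norm (\<lambda>j. \<xi> (k, j)))\<^sup>2)"
proof -
  have s: "(\<lambda>p. (cmod (\<xi> p))\<^sup>2) summable_on (Sigma UNIV (\<lambda>_. UNIV))"
    using ell2_summable[OF x] by simp
  have r: "(\<lambda>j. (cmod (\<xi> (k, j)))\<^sup>2) summable_on UNIV" for k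
  proof -
    have "(\<lambda>p. (cmod (\<xi> p))\<^sup>2) summable_on range (Pair k)" by (rule ell2_summable[OF x])
    then show ?thesis by (subst (asm) summable_on_reindex) (auto simp: o_def inj_on_def)
  qed
  show "(\<lambda>j. \<xi> (k, j)) \<in> ell2" using r by (simp add: ell2_def)
  show "(\<lambda>k. (ell2_norm (\<lambda>j. \<xi> (k, j)))\<^sup>2) summable_on UNIV"
    unfolding ell2_norm_sq by (rule summable_on_SigmaD[OF s r])
  show "(ell2_norm \<xi>)\<^sup>2 = (\<Sum>\<^sub>\<infinity>k. (ell2_norm (\<lambda>j. \<xi> (k, j)))\<^sup>2)"
    unfolding ell2_norm_sq using infsum_Sigma_banach[OF s] by simp
qed

lemma ell2_rowsI:
  assumes "\<And>k. (\<lambda>j. \<xi> (k, j)) \<in> ell2" "(\<lambda>k. (ell2_norm (\<lambda>j. \<xi> (k, j)))\<^sup>2) summable_on UNIV"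
  shows "\<xi> \<in> ell2"
proof -
  have "(\<lambda>p. (cmod (\<xi> p))\<^sup>2) summable_on (Sigma UNIV (\<lambda>_. UNIV))"
  proof (rule summable_on_SigmaI)
    show "((\<lambda>y. (cmod (\<xi> (x, y)))\<^sup>2) has_sum (ell2_norm (\<lambda>j. \<xi> (x, j)))\<^sup>2) UNIV" for x
      unfolding ell2_norm_sq by (rule has_sum_infsum) (rule ell2_summable[OF assms(1)])
  qed (use assms(2) in auto)
  then show ?thesis by (simp add: ell2_def)
qed

text \<open>The operator is 1 \<otimes> T, with vectors over the product index set seen as
  square-summable families of rows.\<close>

lemma row_op_bounded:
  fixes T :: "('j \<Rightarrow> complex) \<Rightarrow> 'j \<Rightarrow> complex"
  assumes T: "bounded_op T"
  shows "bounded_op (\<lambda>\<xi> (k :: 'k, j). T (\<lambda>l. \<xi> (k, l)) j)" (is "bounded_op ?R")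
proof -
  let ?K = "op_norm T"
  have row: "(ell2_norm (\<lambda>j. ?R \<xi> (k, j)))\<^sup>2 \<le> ?K\<^sup>2 * (ell2_norm (\<lambda>l. \<xi> (k, l)))\<^sup>2" if "\<xi> \<in> ell2" for \<xi> k
  proof -
    have "ell2_norm (T (\<lambda>l. \<xi> (k, l))) \<le> ?K * ell2_norm (\<lambda>l. \<xi> (k, l))"
      by (rule op_norm_le[OF T ell2_rows(1)[OF that]])
    from power_mono[OF this, of 2] show ?thesis by (simp add: power_mult_distrib)
  qed
  have sm: "(\<lambda>k. (ell2_norm (\<lambda>j. ?R \<xi> (k, j)))\<^sup>2) summable_on UNIV" if "\<xi> \<in> ell2" for \<xi>
    by (rule summable_on_comparison_test[OF summable_on_cmult_right[OF ell2_rows(2)[OF that], of "?K\<^sup>2"] row[OF that]]) auto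
  have ell2: "?R \<xi> \<in> ell2" if "\<xi> \<in> ell2" for \<xi>
    by (rule ell2_rowsI[OF _ sm[OF that]]) (simp add: op_ell2[OF T] ell2_rows[OF that])
  show ?thesis
    unfolding bounded_op_def
  proof (intro conjI ballI allI)
    fix \<xi> \<eta> :: "'k \<times> 'j \<Rightarrow> complex" and c assume x: "\<xi> \<in> ell2"
    show "?R \<xi> \<in> ell2" by (rule ell2[OF x])
    show "?R (c *\<^sub>C \<xi>) = c *\<^sub>C ?R \<xi>"
      using op_scale[OF T ell2_rows(1)[OF x], of c] by (auto simp: fun_eq_iff scaleC_fun_def)
    assume y: "\<eta> \<in> ell2"
    show "?R (\<xi> + \<eta>) = ?R \<xi> + ?R \<eta>"
      using op_add[OF T ell2_rows(1)[OF x] ell2_rows(1)[OF y]] by (auto simp: fun_eq_iff plus_fun_def)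
  next
    show "\<exists>K. \<forall>\<xi>\<in>ell2. ell2_norm (?R \<xi>) \<le> K * ell2_norm \<xi>"
    proof (intro exI[of _ ?K] ballI, rule power2_le_imp_le)
      fix \<xi> :: "'k \<times> 'j \<Rightarrow> complex" assume x: "\<xi> \<in> ell2"
      have "(ell2_norm (?R \<xi>))\<^sup>2 = (\<Sum>\<^sub>\<infinity>k. (ell2_norm (\<lambda>j. ?R \<xi> (k, j)))\<^sup>2)" by (rule ell2_rows(3)[OF ell2[OF x]])
      also have "\<dots> \<le> (\<Sum>\<^sub>\<infinity>k. ?K\<^sup>2 * (ell2_norm (\<lambda>l. \<xi> (k, l)))\<^sup>2)"
        by (intro infsum_mono sm x summable_on_cmult_right ell2_rows(2) row)
      also have "\<dots> = (?K * ell2_norm \<xi>)\<^sup>2" by (simp add: infsum_cmult_right' ell2_rows(3)[OF x] power_mult_distrib)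
      finally show "(ell2_norm (?R \<xi>))\<^sup>2 \<le> (?K * ell2_norm \<xi>)\<^sup>2" .
      show "0 \<le> ?K * ell2_norm \<xi>" by (simp add: op_norm_nonneg[OF T])
    qed
  qed
qed

lemma bounded_op_comp:
  assumes S: "bounded_op S" and T: "bounded_op T" shows "bounded_op (\<lambda>x. S (T x))"
proof -
  have "ell2_norm (S (T x)) \<le> (op_norm S * op_norm T) * ell2_norm x" if "x \<in> ell2" for x
    using op_norm_le[OF S op_ell2[OF T that]] mult_left_mono[OF op_norm_le[OF T that] op_norm_nonneg[OF S]]
    by (simp add: mult.assoc)
  then have "\<exists>K. \<forall>x\<in>ell2. ell2_norm (S (T x)) \<le> K * ell2_norm x" by blast
  then show ?thesis
    unfolding bounded_op_def
    using op_ell2[OF S] op_ell2[OF T] op_add[OF S] op_add[OF T] op_scale[OF S] op_scale[OF T] by metis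
qed

lemma ell2_swap:
  assumes "\<xi> \<in> ell2"
  shows "(\<lambda>(i, j). \<xi> (j, i)) \<in> ell2" "ell2_norm (\<lambda>(i, j). \<xi> (j, i)) = ell2_norm \<xi>"
proof -
  have e: "(\<lambda>p. (cmod ((\<lambda>(i, j). \<xi> (j, i)) p))\<^sup>2) = (\<lambda>p. (cmod (\<xi> (prod.swap p)))\<^sup>2)"
    by (auto simp: fun_eq_iff)
  have b: "bij_betw prod.swap (UNIV :: ('b \<times> 'a) set) (UNIV :: ('a \<times> 'b) set)"
    by (simp add: bij_swap)
  show "(\<lambda>(i, j). \<xi> (j, i)) \<in> ell2"
    using assms summable_on_reindex_bij_betw[OF b, of "\<lambda>p. (cmod (\<xi> p))\<^sup>2"]
    unfolding ell2_def mem_Collect_eq e by simp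
  show "ell2_norm (\<lambda>(i, j). \<xi> (j, i)) = ell2_norm \<xi>"
    using infsum_reindex_bij_betw[OF b, of "\<lambda>p. (cmod (\<xi> p))\<^sup>2"] unfolding ell2_norm_def e by simp
qed

text \<open>Conjugation by the flip, which turns 1 \<otimes> S into S \<otimes> 1.\<close>

lemma swap_op_bounded:
  assumes T: "bounded_op T"
  shows "bounded_op (\<lambda>\<xi> (i :: 'i, j :: 'j). T (\<lambda>(j, i). \<xi> (i, j)) (j, i))" (is "bounded_op ?R")
proof -
  have sw: "?R \<xi> = (\<lambda>(i, j). T (\<lambda>(j, i). \<xi> (i, j)) (j, i))" for \<xi> by simp
  show ?thesis
    unfolding bounded_op_def
  proof (intro conjI ballI allI)
    fix \<xi> \<eta> :: "'i \<times> 'j \<Rightarrow> complex" and c assume x: "\<xi> \<in> ell2"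
    show "?R \<xi> \<in> ell2" by (rule ell2_swap(1)[OF op_ell2[OF T ell2_swap(1)[OF x]]])
    have "(\<lambda>(j, i). (c *\<^sub>C \<xi>) (i, j)) = c *\<^sub>C (\<lambda>(j, i). \<xi> (i, j))" by (auto simp: fun_eq_iff scaleC_fun_def)
    then have "T (\<lambda>(j, i). (c *\<^sub>C \<xi>) (i, j)) = c *\<^sub>C T (\<lambda>(j, i). \<xi> (i, j))"
      by (simp only: op_scale[OF T ell2_swap(1)[OF x]])
    then show "?R (c *\<^sub>C \<xi>) = c *\<^sub>C ?R \<xi>" by (auto simp: fun_eq_iff scaleC_fun_def[of c])
    assume y: "\<eta> \<in> ell2"
    have "(\<lambda>(j, i). (\<xi> + \<eta>) (i, j)) = (\<lambda>(j, i). \<xi> (i, j)) + (\<lambda>(j, i). \<eta> (i, j))" by (auto simp: fun_eq_iff)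
    then have "T (\<lambda>(j, i). (\<xi> + \<eta>) (i, j)) = T (\<lambda>(j, i). \<xi> (i, j)) + T (\<lambda>(j, i). \<eta> (i, j))"
      by (simp only: op_add[OF T ell2_swap(1)[OF x] ell2_swap(1)[OF y]])
    then show "?R (\<xi> + \<eta>) = ?R \<xi> + ?R \<eta>" by (simp add: fun_eq_iff)
  next
    show "\<exists>K. \<forall>\<xi>\<in>ell2. ell2_norm (?R \<xi>) \<le> K * ell2_norm \<xi>"
    proof (intro exI[of _ "op_norm T"] ballI)
      fix \<xi> :: "'i \<times> 'j \<Rightarrow> complex" assume x: "\<xi> \<in> ell2"
      show "ell2_norm (?R \<xi>) \<le> op_norm T * ell2_norm \<xi>"
        using op_norm_le[OF T ell2_swap(1)[OF x]]
        by (simp add: ell2_swap(2)[OF op_ell2[OF T ell2_swap(1)[OF x]]] ell2_swap(2)[OF x])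
    qed
  qed
qed

text \<open>\<open>op_tensor\<close> is a choice, so a witness must exist: (S \<otimes> 1)(1
  \<otimes> T), where S \<otimes> 1 is the flip conjugate of 1 \<otimes> S.\<close>

lemma op_tensor:
  assumes S: "bounded_op S" and T: "bounded_op T"
  shows "bounded_op (op_tensor S T)"
    "x \<in> ell2 \<Longrightarrow> y \<in> ell2 \<Longrightarrow> op_tensor S T (ell2_tensor x y) = ell2_tensor (S x) (T y)"
proof -
  define RT where "RT = (\<lambda>\<xi> (k :: 'a, j). T (\<lambda>l. \<xi> (k, l)) j)"
  define RS where "RS = (\<lambda>\<xi> (k :: 'b, i). S (\<lambda>l. \<xi> (k, l)) i)"
  define CS where "CS = (\<lambda>\<xi> (i, j). RS (\<lambda>(j, i). \<xi> (i, j)) (j, i))"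
  have RT: "bounded_op RT" unfolding RT_def by (rule row_op_bounded[OF T])
  have RS: "bounded_op RS" unfolding RS_def by (rule row_op_bounded[OF S])
  have CS: "bounded_op CS" unfolding CS_def by (rule swap_op_bounded[OF RS])
  have b: "bounded_op (\<lambda>\<xi>. CS (RT \<xi>))" by (rule bounded_op_comp[OF CS RT])
  have e: "CS (RT (ell2_tensor x y)) = ell2_tensor (S x) (T y)" if x: "x \<in> ell2" and y: "y \<in> ell2" for x y
  proof -
    have 1: "RT (ell2_tensor x y) (k, j) = x k * T y j" for k j
    proof -
      have "(\<lambda>l. ell2_tensor x y (k, l)) = x k *\<^sub>C y" by (simp add: ell2_tensor_def scaleC_fun_def scaleC_complex_def)
      then have "RT (ell2_tensor x y) (k, j) = T (x k *\<^sub>C y) j" by (simp add: RT_def)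
      then show ?thesis unfolding op_scale[OF T y] by (simp add: scaleC_fun_def scaleC_complex_def)
    qed
    have 2: "CS (RT (ell2_tensor x y)) (i, j) = S x i * T y j" for i j
    proof -
      have "(\<lambda>k. RT (ell2_tensor x y) (k, j)) = T y j *\<^sub>C x"
        by (simp only: 1 scaleC_fun_def scaleC_complex_def mult.commute)
      moreover have "CS (RT (ell2_tensor x y)) (i, j) = S (\<lambda>k. RT (ell2_tensor x y) (k, j)) i"
        by (simp only: CS_def RS_def case_prod_conv)
      ultimately have "CS (RT (ell2_tensor x y)) (i, j) = S (T y j *\<^sub>C x) i" by metis
      then show ?thesis unfolding op_scale[OF S x] by (simp only: scaleC_fun_def scaleC_complex_def mult.commute)
    qed
    show ?thesis by (rule ext) (simp add: 2 ell2_tensor_def[of "S x" "T y"] split: prod.split)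
  qed
  have "\<exists>X. bounded_op X \<and> (\<forall>x\<in>ell2. \<forall>y\<in>ell2. X (ell2_tensor x y) = ell2_tensor (S x) (T y))"
    using b e by (intro exI[of _ "\<lambda>\<xi>. CS (RT \<xi>)"]) auto
  from someI_ex[OF this] show "bounded_op (op_tensor S T)"
    "x \<in> ell2 \<Longrightarrow> y \<in> ell2 \<Longrightarrow> op_tensor S T (ell2_tensor x y) = ell2_tensor (S x) (T y)"
    by (auto simp: op_tensor_def)
qed

text \<open>Basis vectors of the product are elementary tensors, so the choice behind
  \<open>op_tensor\<close> has no influence on the coefficients.\<close>

lemma mc_op_tensor:
  assumes "bounded_op S" "bounded_op T"
  shows "mc (op_tensor S T) (i, j) (k, l) = mc S i k * mc T j l"
proof -
  have "unit_vec (k, l) = ell2_tensor (unit_vec k) (unit_vec l)" by (auto simp: unit_vec_def ell2_tensor_def fun_eq_iff)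
  then show ?thesis by (simp add: mc_def op_tensor(2)[OF assms]) (simp add: ell2_tensor_def)
qed

lemma bounded_op_zero: "bounded_op (0 :: ('i \<Rightarrow> complex) \<Rightarrow> 'i \<Rightarrow> complex)"
  by (auto simp: bounded_op_def intro!: exI[of _ 0])

lemma bounded_op_plus:
  fixes S T :: "('i \<Rightarrow> complex) \<Rightarrow> 'i \<Rightarrow> complex"
  assumes S: "bounded_op S" and T: "bounded_op T" shows "bounded_op (S + T)"
proof -
  have "ell2_norm (S x + T x) \<le> (op_norm S + op_norm T) * ell2_norm x" if "x \<in> ell2" for x
    using ell2_triangle[OF op_ell2[OF S that] op_ell2[OF T that]] op_norm_le[OF S that] op_norm_le[OF T that]
    by (simp add: distrib_right)
  then have "\<exists>K. \<forall>x\<in>ell2. ell2_norm (S x + T x) \<le> K * ell2_norm x" by blast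
  moreover have "S x + T x \<in> ell2" if "x \<in> ell2" for x
    by (rule ell2_add[OF op_ell2[OF S that] op_ell2[OF T that]])
  ultimately show ?thesis
    unfolding bounded_op_def plus_fun_apply[of S T]
  proof (intro conjI ballI allI)
    fix x y :: "'i \<Rightarrow> complex" and c assume x: "x \<in> ell2"
    show "S (c *\<^sub>C x) + T (c *\<^sub>C x) = c *\<^sub>C (S x + T x)"
      by (simp only: op_scale[OF S x] op_scale[OF T x] scaleC_add_right)
    assume y: "y \<in> ell2"
    show "S (x + y) + T (x + y) = S x + T x + (S y + T y)"
      unfolding op_add[OF S x y] op_add[OF T x y] by (rule ext) simp
  qed auto
qed

lemma bounded_op_sum_list:
  assumes "\<And>X. X \<in> set Xs \<Longrightarrow> bounded_op X"
  shows "bounded_op (sum_list Xs)" "mc (sum_list Xs) p q = (\<Sum>X\<leftarrow>Xs. mc X p q)"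
proof -
  show "bounded_op (sum_list Xs)" using assms
    by (induction Xs) (auto simp: bounded_op_zero intro!: bounded_op_plus)
  show "mc (sum_list Xs) p q = (\<Sum>X\<leftarrow>Xs. mc X p q)" by (induction Xs) (auto simp: mc_def)
qed

text \<open>Injectivity is dropped from \<open>faithful_rep\<close> because composing with a
  homomorphism may destroy it.\<close>

definition star_rep :: "('a::cstar_algebra \<Rightarrow> ('i \<Rightarrow> complex) \<Rightarrow> 'i \<Rightarrow> complex) \<Rightarrow> bool"
  where "star_rep \<pi> \<longleftrightarrow> (\<forall>a. bounded_op (\<pi> a))
    \<and> (\<forall>x\<in>ell2. (\<forall>a b. \<pi> (a + b) x = \<pi> a x + \<pi> b x) \<and> (\<forall>c a. \<pi> (c *\<^sub>C a) x = c *\<^sub>C \<pi> a x)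
        \<and> (\<forall>a b. \<pi> (a * b) x = \<pi> a (\<pi> b x)) \<and> \<pi> 1 x = x)
    \<and> (\<forall>a. \<forall>x\<in>ell2. \<forall>y\<in>ell2. ell2_inner (\<pi> (star a) x) y = ell2_inner x (\<pi> a y))"

lemma faithful_rep_star_rep: "faithful_rep \<pi> \<Longrightarrow> star_rep \<pi>"
  by (simp add: faithful_rep_def star_rep_def)

lemma star_rep_comp: "star_rep \<pi> \<Longrightarrow> cstar_hom f \<Longrightarrow> star_rep (\<lambda>a. \<pi> (f a))"
  unfolding star_rep_def cstar_hom_def
  by (simp add: complex_vector.linear_add complex_vector.linear_scale)

context
  fixes \<pi> :: "'a::cstar_algebra \<Rightarrow> ('i \<Rightarrow> complex) \<Rightarrow> 'i \<Rightarrow> complex"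
  assumes \<pi>: "star_rep \<pi>"
begin

lemma rep_bounded: "bounded_op (\<pi> a)" using \<pi> by (auto simp: star_rep_def)
lemma rep_add: "x \<in> ell2 \<Longrightarrow> \<pi> (a + b) x = \<pi> a x + \<pi> b x" using \<pi> by (auto simp: star_rep_def)
lemma rep_scale: "x \<in> ell2 \<Longrightarrow> \<pi> (c *\<^sub>C a) x = c *\<^sub>C \<pi> a x" using \<pi> by (auto simp: star_rep_def)
lemma rep_mult: "x \<in> ell2 \<Longrightarrow> \<pi> (a * b) x = \<pi> a (\<pi> b x)" using \<pi> by (auto simp: star_rep_def)
lemma rep_one: "x \<in> ell2 \<Longrightarrow> \<pi> 1 x = x" using \<pi> by (auto simp: star_rep_def)
lemma rep_star: "x \<in> ell2 \<Longrightarrow> y \<in> ell2 \<Longrightarrow> ell2_inner (\<pi> (star a) x) y = ell2_inner x (\<pi> a y)"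
  using \<pi> by (auto simp: star_rep_def)
lemma rep_ell2: "x \<in> ell2 \<Longrightarrow> \<pi> a x \<in> ell2" by (rule op_ell2[OF rep_bounded])
lemma rep_zero: "x \<in> ell2 \<Longrightarrow> \<pi> 0 x = 0" using rep_scale[of x 0 0] by simp
lemma rep_sum: "x \<in> ell2 \<Longrightarrow> \<pi> (\<Sum>i\<in>I. a i) x = (\<Sum>i\<in>I. \<pi> (a i) x)"
proof (induction I rule: infinite_finite_induct)
  case (insert i I)
  then show ?case by (simp only: sum.insert[OF insert.hyps(1,2)] rep_add)
qed (simp_all add: rep_zero)

lemma rep_norm_sq: "x \<in> ell2 \<Longrightarrow> complex_of_real ((ell2_norm (\<pi> a x))\<^sup>2) = ell2_inner x (\<pi> (star a * a) x)"
  using rep_star[of x "\<pi> a x" "star a"] by (simp only: ell2_inner_self[symmetric] star_star rep_ell2 rep_mult)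

lemma cstar_seminorm_op_norm: "cstar_seminorm (\<lambda>a. op_norm (\<pi> a))"
proof -
  note bd = rep_bounded
  note nn = op_norm_nonneg[OF bd]
  have add: "op_norm (\<pi> (a + b)) \<le> op_norm (\<pi> a) + op_norm (\<pi> b)" for a b
  proof (rule op_norm_leI[OF bd])
    fix x :: "'i \<Rightarrow> complex" assume x: "x \<in> ell2"
    show "ell2_norm (\<pi> (a + b) x) \<le> (op_norm (\<pi> a) + op_norm (\<pi> b)) * ell2_norm x"
      using ell2_triangle[OF rep_ell2[OF x, of a] rep_ell2[OF x, of b]] op_norm_le[OF bd x, of a] op_norm_le[OF bd x, of b]
      unfolding rep_add[OF x] by (simp add: distrib_right)
  qed (simp add: nn)
  have sc: "op_norm (\<pi> (c *\<^sub>C a)) \<le> cmod c * op_norm (\<pi> a)" for c a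
  proof (rule op_norm_leI[OF bd])
    fix x :: "'i \<Rightarrow> complex" assume x: "x \<in> ell2"
    show "ell2_norm (\<pi> (c *\<^sub>C a) x) \<le> cmod c * op_norm (\<pi> a) * ell2_norm x"
      using mult_left_mono[OF op_norm_le[OF bd x, of a], of "cmod c"]
      by (simp add: rep_scale[OF x] ell2_norm_scale mult.assoc)
  qed (simp add: nn)
  have scale: "op_norm (\<pi> (c *\<^sub>C a)) = cmod c * op_norm (\<pi> a)" for c a
  proof (cases "c = 0")
    case True
    then show ?thesis using sc[of 0 a] nn[of 0] by simp
  next
    case False
    then have "op_norm (\<pi> a) \<le> cmod (1/c) * op_norm (\<pi> (c *\<^sub>C a))"
      using sc[of "1/c" "c *\<^sub>C a"] by (simp add: scaleC_scaleC)
    then show ?thesis using sc[of c a] False by (simp add: norm_divide field_simps)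
  qed
  have mult: "op_norm (\<pi> (a * b)) \<le> op_norm (\<pi> a) * op_norm (\<pi> b)" for a b
  proof (rule op_norm_leI[OF bd])
    fix x :: "'i \<Rightarrow> complex" assume x: "x \<in> ell2"
    show "ell2_norm (\<pi> (a * b) x) \<le> op_norm (\<pi> a) * op_norm (\<pi> b) * ell2_norm x"
      using op_norm_le[OF bd rep_ell2[OF x, of b], of a] mult_left_mono[OF op_norm_le[OF bd x, of b] nn[of a]]
      by (simp add: rep_mult[OF x] mult.assoc)
  qed (simp add: nn)
  have one: "op_norm (\<pi> 1) \<le> 1" by (rule op_norm_leI[OF bd]) (simp_all add: rep_one)
  have sq: "(op_norm (\<pi> a))\<^sup>2 \<le> op_norm (\<pi> (star a * a))" for a
  proof -
    have "op_norm (\<pi> a) \<le> sqrt (op_norm (\<pi> (star a * a)))"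
    proof (rule op_norm_leI[OF bd])
      fix x :: "'i \<Rightarrow> complex" assume x: "x \<in> ell2"
      have "(ell2_norm (\<pi> a x))\<^sup>2 = cmod (complex_of_real ((ell2_norm (\<pi> a x))\<^sup>2))"
        unfolding norm_of_real by simp
      also have "\<dots> \<le> ell2_norm x * ell2_norm (\<pi> (star a * a) x)"
        unfolding rep_norm_sq[OF x] by (intro ell2_cauchy_schwarz x rep_ell2)
      also have "\<dots> \<le> ell2_norm x * (op_norm (\<pi> (star a * a)) * ell2_norm x)"
        by (intro mult_left_mono op_norm_le[OF bd x]) simp
      also have "\<dots> = (sqrt (op_norm (\<pi> (star a * a))) * ell2_norm x)\<^sup>2"
        by (simp add: power_mult_distrib nn power2_eq_square)
      finally show "ell2_norm (\<pi> a x) \<le> sqrt (op_norm (\<pi> (star a * a))) * ell2_norm x"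
        by (rule power2_le_imp_le) (simp add: nn)
    qed (simp add: nn)
    then have "(op_norm (\<pi> a))\<^sup>2 \<le> (sqrt (op_norm (\<pi> (star a * a))))\<^sup>2" by (rule power_mono) (rule nn)
    then show ?thesis by (simp add: nn)
  qed
  have st: "op_norm (\<pi> a) \<le> op_norm (\<pi> (star a))" for a
    using order_trans[OF sq mult, of a] nn[of a] nn[of "star a"]
    by (cases "op_norm (\<pi> a) = 0") (auto simp: power2_eq_square)
  have "op_norm (\<pi> (star a * a)) = (op_norm (\<pi> a))\<^sup>2" for a
    using sq[of a] mult[of "star a" a] st[of a] st[of "star a"] by (simp add: star_star power2_eq_square)
  then show ?thesis unfolding cstar_seminorm_def alg_seminorm_def using add scale mult one by blast
qed

lemma rep_contractive: "op_norm (\<pi> a) \<le> norm a"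
  using cstar_seminorm_le_norm[OF cstar_seminorm_op_norm] .

lemma mc_add: "mc (\<pi> (a + b)) i k = mc (\<pi> a) i k + mc (\<pi> b) i k"
  by (simp add: mc_def rep_add)
lemma mc_scale: "mc (\<pi> (c *\<^sub>C a)) i k = c * mc (\<pi> a) i k"
  by (simp add: mc_def rep_scale scaleC_fun_def scaleC_complex_def)
lemma mc_zero: "mc (\<pi> 0) i k = 0"
  by (simp add: mc_def rep_zero)
lemma mc_sum_list: "mc (\<pi> (\<Sum>x\<leftarrow>xs. a x)) i k = (\<Sum>x\<leftarrow>xs. mc (\<pi> (a x)) i k)"
  by (induction xs) (simp_all add: mc_zero mc_add)

end

text \<open>Injectivity makes \<open>op_norm (\<pi> a)\<close> a definite C*-seminorm, so uniqueness
  of the C*-norm applies.\<close>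

lemma faithful_rep_isometric:
  assumes "faithful_rep \<pi>" shows "op_norm (\<pi> a) = norm a"
proof (rule cstar_norm_unique[OF cstar_seminorm_op_norm[OF faithful_rep_star_rep[OF assms]]])
  fix a assume "op_norm (\<pi> a) = 0"
  then have "ell2_norm (\<pi> a x) \<le> 0" if "x \<in> ell2" for x
    using op_norm_le[OF rep_bounded[OF faithful_rep_star_rep[OF assms]] that, of a] by simp
  then have "\<pi> a x = 0" if "x \<in> ell2" for x
    using ell2_norm_eq_0[OF rep_ell2[OF faithful_rep_star_rep[OF assms] that]] that
    by (simp add: order_antisym)
  then show "a = 0" using assms by (auto simp: faithful_rep_def)
qed

lemma faithful_rep_mbound:
  assumes "faithful_rep \<pi>" "C \<ge> 0" shows "mbound (mc (\<pi> a)) C \<longleftrightarrow> norm a \<le> C"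
  using op_norm_mbound[OF rep_bounded[OF faithful_rep_star_rep[OF assms(1)]] assms(2), of a]
  by (simp add: faithful_rep_isometric[OF assms(1)])

text \<open>Coefficients of the operator that a formal sum of pairs represents. Working on lists
  keeps the quotient type out of the norm estimates.\<close>

definition tcoef :: "('a::cstar_algebra \<Rightarrow> ('i \<Rightarrow> complex) \<Rightarrow> 'i \<Rightarrow> complex)
    \<Rightarrow> ('b::cstar_algebra \<Rightarrow> ('j \<Rightarrow> complex) \<Rightarrow> 'j \<Rightarrow> complex) \<Rightarrow> ('a \<times> 'b) list \<Rightarrow> 'i \<times> 'j \<Rightarrow> 'i \<times> 'j \<Rightarrow> complex"
  where "tcoef \<pi> \<rho> xs = (\<lambda>(i, j) (k, l). \<Sum>(a, b)\<leftarrow>xs. mc (\<pi> a) i k * mc (\<rho> b) j l)"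

lemma clinearI: "(\<And>x y. f (x + y) = f x + f y) \<Longrightarrow> (\<And>c x. f (c *\<^sub>C x) = c *\<^sub>C f x) \<Longrightarrow> clinear f"
  by unfold_locales auto

lemma cbilinearI:
  assumes "\<And>a b b'. f a (b + b') = f a b + f a b'" "\<And>a c b. f a (c *\<^sub>C b) = c *\<^sub>C f a b"
    "\<And>a a' b. f (a + a') b = f a b + f a' b" "\<And>a c b. f (c *\<^sub>C a) b = c *\<^sub>C f a b"
  shows "cbilinear f"
  unfolding cbilinear_def using assms by (auto intro!: clinearI)

lemma spatial_norm_mbound:
  assumes \<pi>: "star_rep \<pi>" and \<rho>: "star_rep \<rho>" and C: "C \<ge> 0"
  shows "spatial_norm \<pi> \<rho> (abs_atensor xs) \<le> C \<longleftrightarrow> mbound (tcoef \<pi> \<rho> xs) C"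
proof -
  let ?ys = "rep_atensor (abs_atensor xs)"
  let ?Xs = "map (\<lambda>(a, b). op_tensor (\<pi> a) (\<rho> b)) ?ys"
  have b: "\<And>X. X \<in> set ?Xs \<Longrightarrow> bounded_op X"
    using op_tensor(1)[OF rep_bounded[OF \<pi>] rep_bounded[OF \<rho>]] by auto
  \<comment> \<open>Each coefficient is bilinear in (a, b), hence the same for xs and for the list
    chosen by \<open>rep_atensor\<close>.\<close>
  have bil: "cbilinear (\<lambda>a b. mc (\<pi> a) i k * mc (\<rho> b) j l)" for i j k l
    by (intro cbilinearI) (simp_all add: mc_add[OF \<pi>] mc_add[OF \<rho>] mc_scale[OF \<pi>] mc_scale[OF \<rho>] algebra_simps scaleC_complex_def)
  have "mc (sum_list ?Xs) (i, j) (k, l) = tcoef \<pi> \<rho> xs (i, j) (k, l)" for i j k l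
  proof -
    have "mc (sum_list ?Xs) (i, j) (k, l) = (\<Sum>X\<leftarrow>?Xs. mc X (i, j) (k, l))" by (rule bounded_op_sum_list(2)[OF b])
    also have "\<dots> = (\<Sum>(a, b)\<leftarrow>?ys. mc (\<pi> a) i k * mc (\<rho> b) j l)"
      by (simp add: o_def case_prod_unfold mc_op_tensor[OF rep_bounded[OF \<pi>] rep_bounded[OF \<rho>]])
    also have "\<dots> = (\<Sum>(a, b)\<leftarrow>xs. mc (\<pi> a) i k * mc (\<rho> b) j l)"
      using atensor_lift_abs[OF bil, of i k j l xs] by (simp only: atensor_lift_def)
    finally show ?thesis by (simp add: tcoef_def)
  qed
  then have "mc (sum_list ?Xs) = tcoef \<pi> \<rho> xs" by (auto simp: fun_eq_iff)
  moreover have "spatial_norm \<pi> \<rho> (abs_atensor xs) = op_norm (sum_list ?Xs)" by (simp add: spatial_norm_def)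
  ultimately show ?thesis using op_norm_mbound[OF bounded_op_sum_list(1)[of ?Xs, OF b] C] by (simp only:)
qed

text \<open>All later norm estimates on minimal tensor products go through this equivalence.\<close>

lemma min_tensor_norm:
  assumes "min_tensor t"
  obtains \<pi> :: "'a::cstar_algebra \<Rightarrow> ('a \<Rightarrow> complex) \<Rightarrow> 'a \<Rightarrow> complex"
    and \<rho> :: "'b::cstar_algebra \<Rightarrow> ('b \<Rightarrow> complex) \<Rightarrow> 'b \<Rightarrow> complex"
  where "faithful_rep \<pi>" "faithful_rep \<rho>"
    "\<And>xs C. C \<ge> 0 \<Longrightarrow> norm (\<Sum>(a, b)\<leftarrow>xs. t a b) \<le> C \<longleftrightarrow> mbound (tcoef \<pi> \<rho> xs) C"
proof -
  obtain \<pi> :: "'a \<Rightarrow> ('a \<Rightarrow> complex) \<Rightarrow> 'a \<Rightarrow> complex" and \<rho> :: "'b \<Rightarrow> ('b \<Rightarrow> complex) \<Rightarrow> 'b \<Rightarrow> complex"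
    where f: "faithful_rep \<pi>" "faithful_rep \<rho>" and n: "\<And>x. norm (atensor_lift t x) = spatial_norm \<pi> \<rho> x"
    using assms unfolding min_tensor_def by blast
  have "cbilinear t" using assms by (simp add: min_tensor_def)
  then show ?thesis
    using that[OF f] n[of "abs_atensor _"]
      spatial_norm_mbound[OF f[THEN faithful_rep_star_rep]] by (simp add: atensor_lift_abs)
qed

section \<open>Functoriality of the minimal tensor product\<close>

definition row :: "'i \<Rightarrow> ('i \<times> 'j \<Rightarrow> complex) \<Rightarrow> 'j \<Rightarrow> complex"
  where "row k \<xi> = (\<lambda>j. \<xi> (k, j))"

definition emb :: "'i \<Rightarrow> ('j \<Rightarrow> complex) \<Rightarrow> 'i \<times> 'j \<Rightarrow> complex"
  where "emb i y = (\<lambda>(k, j). if k = i then y j else 0)"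

text \<open>The operator on \<open>\<ell>\<^sup>2(I \<times> J)\<close> given by a matrix over \<open>B\<close> with index set \<open>F \<subseteq> I\<close> and a
  representation of \<open>B\<close> on \<open>\<ell>\<^sup>2(J)\<close>.\<close>

definition mop :: "('b \<Rightarrow> ('j \<Rightarrow> complex) \<Rightarrow> 'j \<Rightarrow> complex) \<Rightarrow> 'i set \<Rightarrow> ('i \<Rightarrow> 'i \<Rightarrow> 'b)
    \<Rightarrow> ('i \<times> 'j \<Rightarrow> complex) \<Rightarrow> 'i \<times> 'j \<Rightarrow> complex"
  where "mop \<rho> F \<beta> \<xi> = (\<Sum>i\<in>F. emb i (\<Sum>k\<in>F. \<rho> (\<beta> i k) (row k \<xi>)))"

definition mmul :: "'i set \<Rightarrow> ('i \<Rightarrow> 'i \<Rightarrow> 'b::cstar_algebra) \<Rightarrow> ('i \<Rightarrow> 'i \<Rightarrow> 'b) \<Rightarrow> 'i \<Rightarrow> 'i \<Rightarrow> 'b"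
  where "mmul F \<beta> \<gamma> i k = (\<Sum>j\<in>F. \<beta> i j * \<gamma> j k)"

definition madj :: "('i \<Rightarrow> 'i \<Rightarrow> 'b::cstar_algebra) \<Rightarrow> 'i \<Rightarrow> 'i \<Rightarrow> 'b"
  where "madj \<beta> i k = star (\<beta> k i)"

lemma row_ell2: "\<xi> \<in> ell2 \<Longrightarrow> row k \<xi> \<in> ell2"
  unfolding row_def by (rule ell2_rows)

lemma row_add: "row k (\<xi> + \<eta>) = row k \<xi> + row k \<eta>" by (simp add: row_def fun_eq_iff)
lemma row_scale: "row k (c *\<^sub>C \<xi>) = c *\<^sub>C row k \<xi>" by (simp add: row_def fun_eq_iff scaleC_fun_def)

lemma row_norm_le: assumes "\<xi> \<in> ell2" shows "ell2_norm (row k \<xi>) \<le> ell2_norm \<xi>"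
proof (rule power2_le_imp_le)
  have "(\<Sum>\<^sub>\<infinity>i\<in>{k}. (ell2_norm (row i \<xi>))\<^sup>2) \<le> (\<Sum>\<^sub>\<infinity>i. (ell2_norm (row i \<xi>))\<^sup>2)"
    by (rule infsum_mono2) (auto simp: row_def intro: ell2_rows(2)[OF assms])
  then show "(ell2_norm (row k \<xi>))\<^sup>2 \<le> (ell2_norm \<xi>)\<^sup>2" by (simp add: row_def ell2_rows(3)[OF assms])
qed simp

lemma row_emb: "row k (emb i y) = (if k = i then y else 0)" by (auto simp: row_def emb_def)

lemma emb_add: "emb i (y + z) = emb i y + emb i z" by (auto simp: emb_def fun_eq_iff)
lemma emb_scale: "emb i (c *\<^sub>C y) = c *\<^sub>C emb i y" by (auto simp: emb_def fun_eq_iff scaleC_fun_def)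

lemma emb_ell2: assumes "y \<in> ell2" shows "emb i y \<in> ell2" "ell2_norm (emb i y) = ell2_norm y"
proof -
  have e: "(\<lambda>k. (ell2_norm (row k (emb i y)))\<^sup>2) = (\<lambda>k. if k \<in> {i} then (ell2_norm y)\<^sup>2 else 0)"
    by (auto simp: row_emb fun_eq_iff)
  note h = trunc_summable[of "{i}" "\<lambda>_. (ell2_norm y)\<^sup>2", folded e]
  show m: "emb i y \<in> ell2"
  proof (rule ell2_rowsI)
    show "(\<lambda>j. emb i y (k, j)) \<in> ell2" for k
      using assms row_emb[of k i y] by (auto simp: row_def split: if_splits simp del: zero_fun_apply)
    show "(\<lambda>k. (ell2_norm (\<lambda>j. emb i y (k, j)))\<^sup>2) summable_on UNIV"
      using h by (auto simp: row_def has_sum_imp_summable)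
  qed
  have "(ell2_norm (emb i y))\<^sup>2 = (ell2_norm y)\<^sup>2"
    using ell2_rows(3)[OF m] infsumI[OF h] by (simp add: row_def)
  then show "ell2_norm (emb i y) = ell2_norm y" by (rule power2_eq_imp_eq) simp_all
qed

lemma emb_inner: assumes "y \<in> ell2" "\<xi> \<in> ell2" shows "ell2_inner (emb i y) \<xi> = ell2_inner y (row i \<xi>)"
proof -
  have "(\<Sum>\<^sub>\<infinity>p. cnj (emb i y p) * \<xi> p) = (\<Sum>\<^sub>\<infinity>k. \<Sum>\<^sub>\<infinity>j. cnj (emb i y (k, j)) * \<xi> (k, j))"
    using infsum_Sigma_banach[of "\<lambda>p. cnj (emb i y p) * \<xi> p" UNIV "\<lambda>_. UNIV"]
      ell2_inner_summable[OF emb_ell2(1)[OF assms(1)] assms(2), of i UNIV] by simp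
  also have "(\<lambda>k. \<Sum>\<^sub>\<infinity>j. cnj (emb i y (k, j)) * \<xi> (k, j)) = (\<lambda>k. if k \<in> {i} then ell2_inner y (row i \<xi>) else 0)"
    by (auto simp: emb_def ell2_inner_def row_def fun_eq_iff)
  also have "infsum \<dots> UNIV = ell2_inner y (row i \<xi>)"
    using infsumI[OF trunc_summable[of "{i}" "\<lambda>_. ell2_inner y (row i \<xi>)"]] by simp
  finally show ?thesis by (simp add: ell2_inner_def)
qed

lemma ell2_inner_sum_left:
  assumes "y \<in> ell2" "\<And>i. i \<in> I \<Longrightarrow> x i \<in> ell2"
  shows "ell2_inner (\<Sum>i\<in>I. x i) y = (\<Sum>i\<in>I. ell2_inner (x i) y)"
  using ell2_inner_sum_right[of y I x] assms by (metis (no_types, lifting) cnj_sum ell2_inner_cnj sum.cong)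

context
  fixes \<rho> :: "'b::cstar_algebra \<Rightarrow> ('j \<Rightarrow> complex) \<Rightarrow> 'j \<Rightarrow> complex" and F :: "'i set"
  assumes \<rho>: "star_rep \<rho>" and F: "finite F"
begin

lemma mop_row_ell2: "\<xi> \<in> ell2 \<Longrightarrow> (\<Sum>k\<in>F. \<rho> (\<beta> i k) (row k \<xi>)) \<in> ell2"
  by (intro ell2_sum rep_ell2[OF \<rho>] row_ell2)

lemma row_sum: "row k (\<Sum>i\<in>I. x i) = (\<Sum>i\<in>I. row k (x i))"
  by (auto simp: row_def fun_eq_iff sum_fun_apply)

lemma row_mop:
  "row i (mop \<rho> F \<beta> \<xi>) = (if i \<in> F then \<Sum>k\<in>F. \<rho> (\<beta> i k) (row k \<xi>) else 0)"
proof -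
  have "row i (mop \<rho> F \<beta> \<xi>) = (\<Sum>i'\<in>F. if i' = i then (\<Sum>k\<in>F. \<rho> (\<beta> i k) (row k \<xi>)) else 0)"
    unfolding mop_def row_sum row_emb by (rule sum.cong) auto
  then show ?thesis using F by (simp add: sum.delta)
qed

text \<open>The crude bound by the sum over the entries suffices, since its loss disappears when
  high powers are taken in \<open>mop_compare\<close>.\<close>

lemma mop_bounded:
  "bounded_op (mop \<rho> F \<beta>)" "op_norm (mop \<rho> F \<beta>) \<le> (\<Sum>i\<in>F. \<Sum>k\<in>F. op_norm (\<rho> (\<beta> i k)))"
proof -
  let ?K = "\<Sum>i\<in>F. \<Sum>k\<in>F. op_norm (\<rho> (\<beta> i k))"
  have le: "ell2_norm (mop \<rho> F \<beta> \<xi>) \<le> ?K * ell2_norm \<xi>" if x: "\<xi> \<in> ell2" for \<xi> :: "'i \<times> 'j \<Rightarrow> complex"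
  proof -
    have "ell2_norm (mop \<rho> F \<beta> \<xi>) \<le> (\<Sum>i\<in>F. ell2_norm (emb i (\<Sum>k\<in>F. \<rho> (\<beta> i k) (row k \<xi>))))"
      unfolding mop_def by (intro ell2_norm_sum emb_ell2 mop_row_ell2 x)
    also have "\<dots> \<le> (\<Sum>i\<in>F. \<Sum>k\<in>F. op_norm (\<rho> (\<beta> i k)) * ell2_norm \<xi>)"
    proof (rule sum_mono)
      fix i
      have "ell2_norm (emb i (\<Sum>k\<in>F. \<rho> (\<beta> i k) (row k \<xi>))) = ell2_norm (\<Sum>k\<in>F. \<rho> (\<beta> i k) (row k \<xi>))"
        by (rule emb_ell2(2)[OF mop_row_ell2[OF x]])
      also have "\<dots> \<le> (\<Sum>k\<in>F. ell2_norm (\<rho> (\<beta> i k) (row k \<xi>)))"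
        by (intro ell2_norm_sum rep_ell2[OF \<rho>] row_ell2 x)
      also have "\<dots> \<le> (\<Sum>k\<in>F. op_norm (\<rho> (\<beta> i k)) * ell2_norm \<xi>)"
        by (rule sum_mono) (rule order_trans[OF op_norm_le[OF rep_bounded[OF \<rho>] row_ell2[OF x]]
            mult_left_mono[OF row_norm_le[OF x] op_norm_nonneg[OF rep_bounded[OF \<rho>]]]])
      finally show "ell2_norm (emb i (\<Sum>k\<in>F. \<rho> (\<beta> i k) (row k \<xi>))) \<le> (\<Sum>k\<in>F. op_norm (\<rho> (\<beta> i k)) * ell2_norm \<xi>)" .
    qed
    finally show ?thesis by (simp add: sum_distrib_right)
  qed
  show b: "bounded_op (mop \<rho> F \<beta>)"
    unfolding bounded_op_def
  proof (intro conjI ballI allI)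
    fix \<xi> \<eta> :: "'i \<times> 'j \<Rightarrow> complex" and c assume x: "\<xi> \<in> ell2"
    show "mop \<rho> F \<beta> \<xi> \<in> ell2" unfolding mop_def by (intro ell2_sum emb_ell2 mop_row_ell2 x)
    have "\<rho> b (row k (c *\<^sub>C \<xi>)) = c *\<^sub>C \<rho> b (row k \<xi>)" for b k
      unfolding row_scale by (rule op_scale[OF rep_bounded[OF \<rho>] row_ell2[OF x]])
    then show "mop \<rho> F \<beta> (c *\<^sub>C \<xi>) = c *\<^sub>C mop \<rho> F \<beta> \<xi>"
      unfolding mop_def by (simp only: complex_vector.scale_sum_right emb_scale[symmetric])
    assume y: "\<eta> \<in> ell2"
    have "\<rho> b (row k (\<xi> + \<eta>)) = \<rho> b (row k \<xi>) + \<rho> b (row k \<eta>)" for b k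
      unfolding row_add by (rule op_add[OF rep_bounded[OF \<rho>] row_ell2[OF x] row_ell2[OF y]])
    then show "mop \<rho> F \<beta> (\<xi> + \<eta>) = mop \<rho> F \<beta> \<xi> + mop \<rho> F \<beta> \<eta>"
      unfolding mop_def by (simp only: sum.distrib emb_add)
  qed (use le in blast)
  show "op_norm (mop \<rho> F \<beta>) \<le> ?K"
    by (rule op_norm_leI[OF b le]) (auto intro!: sum_nonneg op_norm_nonneg rep_bounded[OF \<rho>])
qed

lemma mop_mmul: assumes x: "\<xi> \<in> ell2" shows "mop \<rho> F (mmul F \<beta> \<gamma>) \<xi> = mop \<rho> F \<beta> (mop \<rho> F \<gamma> \<xi>)"
proof -
  have "(\<Sum>k\<in>F. \<rho> (mmul F \<beta> \<gamma> i k) (row k \<xi>)) = (\<Sum>j\<in>F. \<rho> (\<beta> i j) (row j (mop \<rho> F \<gamma> \<xi>)))" for i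
  proof -
    have "(\<Sum>k\<in>F. \<rho> (mmul F \<beta> \<gamma> i k) (row k \<xi>)) = (\<Sum>k\<in>F. \<Sum>j\<in>F. \<rho> (\<beta> i j) (\<rho> (\<gamma> j k) (row k \<xi>)))"
      unfolding mmul_def rep_sum[OF \<rho> row_ell2[OF x]] rep_mult[OF \<rho> row_ell2[OF x]] ..
    also have "\<dots> = (\<Sum>j\<in>F. \<Sum>k\<in>F. \<rho> (\<beta> i j) (\<rho> (\<gamma> j k) (row k \<xi>)))" by (rule sum.swap)
    also have "\<dots> = (\<Sum>j\<in>F. \<rho> (\<beta> i j) (row j (mop \<rho> F \<gamma> \<xi>)))"
      by (rule sum.cong) (simp_all only: row_mop if_True op_sum[OF rep_bounded[OF \<rho>] rep_ell2[OF \<rho> row_ell2[OF x]]])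
    finally show ?thesis .
  qed
  then show ?thesis unfolding mop_def[of \<rho> F "mmul F \<beta> \<gamma>"] mop_def[of \<rho> F \<beta>] by simp
qed

lemma mop_adj:
  assumes x: "\<xi> \<in> ell2" and z: "\<zeta> \<in> ell2"
  shows "ell2_inner (mop \<rho> F \<beta> \<xi>) \<zeta> = ell2_inner \<xi> (mop \<rho> F (madj \<beta>) \<zeta>)"
proof -
  have *: "ell2_inner (mop \<rho> F \<beta> \<xi>) \<zeta> = (\<Sum>i\<in>F. \<Sum>k\<in>F. ell2_inner (\<rho> (\<beta> i k) (row k \<xi>)) (row i \<zeta>))"
    if x: "\<xi> \<in> ell2" and z: "\<zeta> \<in> ell2" for \<xi> \<zeta> :: "'i \<times> 'j \<Rightarrow> complex" and \<beta>
  proof -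
    have "ell2_inner (mop \<rho> F \<beta> \<xi>) \<zeta> = (\<Sum>i\<in>F. ell2_inner (emb i (\<Sum>k\<in>F. \<rho> (\<beta> i k) (row k \<xi>))) \<zeta>)"
      unfolding mop_def by (rule ell2_inner_sum_left[OF z emb_ell2(1)[OF mop_row_ell2[OF x]]])
    also have "\<dots> = (\<Sum>i\<in>F. ell2_inner (\<Sum>k\<in>F. \<rho> (\<beta> i k) (row k \<xi>)) (row i \<zeta>))"
      by (simp only: emb_inner[OF mop_row_ell2[OF x] z])
    also have "\<dots> = (\<Sum>i\<in>F. \<Sum>k\<in>F. ell2_inner (\<rho> (\<beta> i k) (row k \<xi>)) (row i \<zeta>))"
      by (simp only: ell2_inner_sum_left[OF row_ell2[OF z] rep_ell2[OF \<rho> row_ell2[OF x]]])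
    finally show ?thesis .
  qed
  have "ell2_inner \<xi> (mop \<rho> F (madj \<beta>) \<zeta>) = cnj (ell2_inner (mop \<rho> F (madj \<beta>) \<zeta>) \<xi>)" by (simp add: ell2_inner_cnj)
  also have "\<dots> = (\<Sum>i\<in>F. \<Sum>k\<in>F. ell2_inner (row i \<xi>) (\<rho> (star (\<beta> k i)) (row k \<zeta>)))"
    unfolding *[OF z x] by (simp add: cnj_sum ell2_inner_cnj madj_def)
  also have "\<dots> = (\<Sum>i\<in>F. \<Sum>k\<in>F. ell2_inner (\<rho> (\<beta> k i) (row i \<xi>)) (row k \<zeta>))"
    by (simp only: rep_star[OF \<rho> row_ell2[OF x] row_ell2[OF z], symmetric] star_star)
  also have "\<dots> = (\<Sum>i\<in>F. \<Sum>k\<in>F. ell2_inner (\<rho> (\<beta> i k) (row k \<xi>)) (row i \<zeta>))" by (rule sum.swap)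
  finally show ?thesis unfolding *[OF x z] by simp
qed

text \<open>Matrices over the algebra are not given a C*-algebra structure of their own, so the
  C*-identity is proved by hand; this is its nontrivial half.\<close>

lemma mop_norm_sq_le: "(op_norm (mop \<rho> F \<beta>))\<^sup>2 \<le> op_norm (mop \<rho> F (mmul F (madj \<beta>) \<beta>))"
proof -
  let ?P = "mmul F (madj \<beta>) \<beta>"
  note bd = mop_bounded(1) note nn = op_norm_nonneg[OF bd]
  have "op_norm (mop \<rho> F \<beta>) \<le> sqrt (op_norm (mop \<rho> F ?P))"
  proof (rule op_norm_leI[OF bd])
    fix x :: "'i \<times> 'j \<Rightarrow> complex" assume x: "x \<in> ell2"
    have "(ell2_norm (mop \<rho> F \<beta> x))\<^sup>2 = cmod (complex_of_real ((ell2_norm (mop \<rho> F \<beta> x))\<^sup>2))"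
      unfolding norm_of_real by simp
    also have "\<dots> = cmod (ell2_inner x (mop \<rho> F ?P x))"
      unfolding ell2_inner_self[symmetric] mop_mmul[OF x] mop_adj[OF x op_ell2[OF bd x]] ..
    also have "\<dots> \<le> ell2_norm x * ell2_norm (mop \<rho> F ?P x)" by (rule ell2_cauchy_schwarz[OF x op_ell2[OF bd x]])
    also have "\<dots> \<le> ell2_norm x * (op_norm (mop \<rho> F ?P) * ell2_norm x)"
      by (intro mult_left_mono op_norm_le[OF bd x]) simp
    also have "\<dots> = (sqrt (op_norm (mop \<rho> F ?P)) * ell2_norm x)\<^sup>2"
      by (simp add: power_mult_distrib nn power2_eq_square)
    finally show "ell2_norm (mop \<rho> F \<beta> x) \<le> sqrt (op_norm (mop \<rho> F ?P)) * ell2_norm x"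
      by (rule power2_le_imp_le) (simp add: nn)
  qed (simp add: nn)
  then have "(op_norm (mop \<rho> F \<beta>))\<^sup>2 \<le> (sqrt (op_norm (mop \<rho> F ?P)))\<^sup>2" by (rule power_mono) (rule nn)
  then show ?thesis by (simp add: nn)
qed

lemma mop_norm_mult: "op_norm (mop \<rho> F (mmul F \<beta> \<gamma>)) \<le> op_norm (mop \<rho> F \<beta>) * op_norm (mop \<rho> F \<gamma>)"
proof -
  note bd = mop_bounded(1) note nn = op_norm_nonneg[OF bd]
  show ?thesis
  proof (rule op_norm_leI[OF bd])
    fix x :: "'i \<times> 'j \<Rightarrow> complex" assume x: "x \<in> ell2"
    show "ell2_norm (mop \<rho> F (mmul F \<beta> \<gamma>) x) \<le> op_norm (mop \<rho> F \<beta>) * op_norm (mop \<rho> F \<gamma>) * ell2_norm x"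
      using op_norm_le[OF bd op_ell2[OF bd x], of \<beta> \<gamma>] mult_left_mono[OF op_norm_le[OF bd x, of \<gamma>] nn[of \<beta>]]
      by (simp add: mop_mmul[OF x] mult.assoc)
  qed (simp add: nn)
qed

lemma mop_norm_adj: "op_norm (mop \<rho> F (madj \<beta>)) \<le> op_norm (mop \<rho> F \<beta>)"
proof -
  have "madj (madj \<beta>) = \<beta>" by (simp add: madj_def fun_eq_iff star_star)
  then show ?thesis
    using order_trans[OF mop_norm_sq_le mop_norm_mult, of "madj \<beta>"] op_norm_nonneg[OF mop_bounded(1), of \<beta>]
      op_norm_nonneg[OF mop_bounded(1), of "madj \<beta>"]
    by (cases "op_norm (mop \<rho> F (madj \<beta>)) = 0") (auto simp: power2_eq_square)
qed

lemma mc_mop: "mc (mop \<rho> F \<beta>) (i, j) (k, l) = (if i \<in> F \<and> k \<in> F then mc (\<rho> (\<beta> i k)) j l else 0)"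
proof -
  have r: "row k' (unit_vec (k, l)) = (if k' = k then unit_vec l else 0)" for k' :: 'i and l :: 'j
    by (auto simp: row_def unit_vec_def fun_eq_iff)
  have "mc (mop \<rho> F \<beta>) (i, j) (k, l) = row i (mop \<rho> F \<beta> (unit_vec (k, l))) j" by (simp add: mc_def row_def)
  also have "\<dots> = (if i \<in> F then (\<Sum>k'\<in>F. \<rho> (\<beta> i k') (if k' = k then unit_vec l else 0)) j else 0)"
    unfolding row_mop r by simp
  also have "(\<Sum>k'\<in>F. \<rho> (\<beta> i k') (if k' = k then unit_vec l else 0)) = (\<Sum>k'\<in>F. if k' = k then \<rho> (\<beta> i k) (unit_vec l) else 0)"
    by (rule sum.cong) (auto simp: op_zero[OF rep_bounded[OF \<rho>]])
  also have "\<dots> = (if k \<in> F then \<rho> (\<beta> i k) (unit_vec l) else 0)" using F by (simp add: sum.delta)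
  finally show ?thesis by (simp add: mc_def)
qed

lemma mop_entry:
  assumes "i \<in> F" "k \<in> F" shows "op_norm (\<rho> (\<beta> i k)) \<le> op_norm (mop \<rho> F \<beta>)"
proof (rule op_norm_leI[OF rep_bounded[OF \<rho>]])
  fix x :: "'j \<Rightarrow> complex" assume x: "x \<in> ell2"
  have ex: "emb k x \<in> ell2" by (rule emb_ell2[OF x])
  have "(\<Sum>k'\<in>F. \<rho> (\<beta> i k') (row k' (emb k x))) = (\<Sum>k'\<in>F. if k' = k then \<rho> (\<beta> i k) x else 0)"
    by (rule sum.cong) (auto simp: op_zero[OF rep_bounded[OF \<rho>]] row_emb)
  then have "row i (mop \<rho> F \<beta> (emb k x)) = \<rho> (\<beta> i k) x"
    using assms F by (simp add: row_mop sum.delta)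
  then have "ell2_norm (\<rho> (\<beta> i k) x) \<le> ell2_norm (mop \<rho> F \<beta> (emb k x))"
    using row_norm_le[OF op_ell2[OF mop_bounded(1) ex], of i \<beta>] by simp
  also have "\<dots> \<le> op_norm (mop \<rho> F \<beta>) * ell2_norm x"
    using op_norm_le[OF mop_bounded(1) ex, of \<beta>] by (simp add: emb_ell2(2)[OF x])
  finally show "ell2_norm (\<rho> (\<beta> i k) x) \<le> op_norm (mop \<rho> F \<beta>) * ell2_norm x" .
qed (rule op_norm_nonneg[OF mop_bounded(1)])

end

text \<open>Taking roots of order 2^n removes the constant K.\<close>

lemma le_of_power_le:
  fixes x y K :: real
  assumes le: "\<And>n. x ^ (2 ^ n) \<le> K * y ^ (2 ^ n)" and y: "0 \<le> y"
  shows "x \<le> y"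
proof (rule ccontr)
  assume "\<not> x \<le> y"
  then have xy: "y < x" by simp
  show False
  proof (cases "y = 0")
    case True
    then show False using le[of 0] xy by simp
  next
    case False
    then have y0: "y > 0" using y by simp
    have "1 < x / y" using xy y0 by simp
    then obtain m where "K < (x / y) ^ m" using real_arch_pow by blast
    also have "(x / y) ^ m \<le> (x / y) ^ (2 ^ m)"
      using \<open>1 < x / y\<close> by (intro power_increasing) (auto intro: less_imp_le)
    also have "\<dots> \<le> K" using le[of m] y0 by (simp add: power_divide field_simps)
    finally show False by simp
  qed
qed

text \<open>Entrywise comparison loses a factor (card F)^2. It is applied to the powers P^(2^n) of
  the self-adjoint P = \<open>mmul F (madj \<beta>) \<beta>\<close>: for \<rho>' the norm of the
  power dominates the power of the norm, for \<rho> submultiplicativity gives the opposite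
  inequality, and the factor vanishes under roots.\<close>

lemma mop_compare:
  fixes \<rho> :: "'b::cstar_algebra \<Rightarrow> ('j \<Rightarrow> complex) \<Rightarrow> 'j \<Rightarrow> complex"
    and \<rho>' :: "'b \<Rightarrow> ('l \<Rightarrow> complex) \<Rightarrow> 'l \<Rightarrow> complex" and F :: "'i set"
  assumes \<rho>: "faithful_rep \<rho>" and \<rho>': "star_rep \<rho>'" and F: "finite F"
  shows "op_norm (mop \<rho>' F \<beta>) \<le> op_norm (mop \<rho> F \<beta>)"
proof -
  note s\<rho> = faithful_rep_star_rep[OF \<rho>]
  define N where "N \<beta> = op_norm (mop \<rho> F \<beta>)" for \<beta>
  define N' where "N' \<beta> = op_norm (mop \<rho>' F \<beta>)" for \<beta>
  have nn: "0 \<le> N \<gamma>" "0 \<le> N' \<gamma>" for \<gamma>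
    using op_norm_nonneg[OF mop_bounded(1)[OF s\<rho> F]] op_norm_nonneg[OF mop_bounded(1)[OF \<rho>' F]] by (simp_all add: N_def N'_def)
  define P where "P = mmul F (madj \<beta>) \<beta>"
  define Q where "Q n = ((\<lambda>R. mmul F R R) ^^ n) P" for n
  have QS: "Q (Suc n) = mmul F (Q n) (Q n)" for n by (simp add: Q_def)
  have adj: "madj (Q n) = Q n" for n
  proof (induction n)
    case 0
    show ?case by (simp add: Q_def P_def madj_def mmul_def fun_eq_iff star_sum star_mult star_star)
  next
    case (Suc n)
    have "madj (Q (Suc n)) = mmul F (madj (Q n)) (madj (Q n))"
      by (simp add: QS madj_def mmul_def fun_eq_iff star_sum star_mult)
    then show ?case by (simp add: Suc QS)
  qed
  have up: "N' P ^ (2 ^ n) \<le> N' (Q n)" for n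
  proof (induction n)
    case (Suc n)
    have "N' P ^ (2 ^ Suc n) = (N' P ^ (2 ^ n))\<^sup>2" by (simp add: power_mult[symmetric] mult.commute)
    also have "\<dots> \<le> (N' (Q n))\<^sup>2" using Suc nn by (intro power_mono) auto
    also have "\<dots> \<le> N' (mmul F (madj (Q n)) (Q n))" unfolding N'_def by (rule mop_norm_sq_le[OF \<rho>' F])
    finally show ?case by (simp add: adj QS)
  qed (simp add: Q_def)
  have dn: "N (Q n) \<le> N P ^ (2 ^ n)" for n
  proof (induction n)
    case (Suc n)
    have "N (Q (Suc n)) \<le> N (Q n) * N (Q n)" unfolding QS N_def by (rule mop_norm_mult[OF s\<rho> F])
    also have "\<dots> \<le> N P ^ (2 ^ n) * N P ^ (2 ^ n)" using Suc nn by (intro mult_mono) auto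
    also have "\<dots> = N P ^ (2 ^ Suc n)" by (simp add: power_add[symmetric] mult_2)
    finally show ?case .
  qed (simp add: Q_def)
  have cmp: "N' \<gamma> \<le> real (card F * card F) * N \<gamma>" for \<gamma>
  proof -
    have "N' \<gamma> \<le> (\<Sum>i\<in>F. \<Sum>k\<in>F. op_norm (\<rho>' (\<gamma> i k)))" unfolding N'_def by (rule mop_bounded(2)[OF \<rho>' F])
    also have "\<dots> \<le> (\<Sum>i\<in>F. \<Sum>k\<in>F. N \<gamma>)"
    proof (intro sum_mono)
      fix i k assume ik: "i \<in> F" "k \<in> F"
      have "op_norm (\<rho>' (\<gamma> i k)) \<le> op_norm (\<rho> (\<gamma> i k))"
        using rep_contractive[OF \<rho>'] by (simp add: faithful_rep_isometric[OF \<rho>])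
      also have "\<dots> \<le> N \<gamma>" unfolding N_def by (rule mop_entry[OF s\<rho> F ik])
      finally show "op_norm (\<rho>' (\<gamma> i k)) \<le> N \<gamma>" .
    qed
    finally show ?thesis by simp
  qed
  have "N' P \<le> N P"
  proof (rule le_of_power_le[OF _ nn(1)])
    fix n
    have "N' P ^ (2 ^ n) \<le> real (card F * card F) * N (Q n)" using order_trans[OF up cmp] .
    also have "\<dots> \<le> real (card F * card F) * N P ^ (2 ^ n)" by (intro mult_left_mono dn) simp
    finally show "N' P ^ (2 ^ n) \<le> real (card F * card F) * N P ^ (2 ^ n)" .
  qed
  have "(N' \<beta>)\<^sup>2 \<le> N' P" unfolding N'_def P_def by (rule mop_norm_sq_le[OF \<rho>' F])
  also note \<open>N' P \<le> N P\<close>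
  also have "N P \<le> N (madj \<beta>) * N \<beta>" unfolding N_def P_def by (rule mop_norm_mult[OF s\<rho> F])
  also have "\<dots> \<le> N \<beta> * N \<beta>" using mop_norm_adj[OF s\<rho> F] nn by (intro mult_right_mono) (auto simp: N_def)
  finally have "(N' \<beta>)\<^sup>2 \<le> (N \<beta>)\<^sup>2" by (simp add: power2_eq_square)
  then show ?thesis using nn unfolding N_def N'_def by (auto intro: power2_le_imp_le)
qed

lemma mbound_restrict:
  assumes m: "mbound m C" and C: "C \<ge> 0"
  shows "mbound (\<lambda>p q. if p \<in> S \<and> q \<in> S then m p q else 0) C"
  unfolding mbound_def
proof (intro allI impI)
  fix G :: "'a set" and \<zeta> \<eta> :: "'a \<Rightarrow> complex" assume G: "finite G"
  let ?z = "\<lambda>p. if p \<in> S then \<zeta> p else 0" and ?e = "\<lambda>p. if p \<in> S then \<eta> p else 0"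
  have "(\<Sum>p\<in>G. \<Sum>q\<in>G. cnj (\<zeta> p) * (if p \<in> S \<and> q \<in> S then m p q else 0) * \<eta> q)
      = (\<Sum>p\<in>G. \<Sum>q\<in>G. cnj (?z p) * m p q * ?e q)"
    by (intro sum.cong) auto
  then have "cmod (\<Sum>p\<in>G. \<Sum>q\<in>G. cnj (\<zeta> p) * (if p \<in> S \<and> q \<in> S then m p q else 0) * \<eta> q)
      \<le> C * (sqrt (\<Sum>p\<in>G. (cmod (?z p))\<^sup>2) * sqrt (\<Sum>p\<in>G. (cmod (?e p))\<^sup>2))"
    using m[unfolded mbound_def, rule_format, OF G, of ?z ?e] by simp
  also have "\<dots> \<le> C * (sqrt (\<Sum>p\<in>G. (cmod (\<zeta> p))\<^sup>2) * sqrt (\<Sum>p\<in>G. (cmod (\<eta> p))\<^sup>2))"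
    by (intro mult_left_mono mult_mono real_sqrt_le_mono sum_mono C) (auto intro!: sum_nonneg)
  finally show "cmod (\<Sum>p\<in>G. \<Sum>q\<in>G. cnj (\<zeta> p) * (if p \<in> S \<and> q \<in> S then m p q else 0) * \<eta> q)
      \<le> C * (sqrt (\<Sum>p\<in>G. (cmod (\<zeta> p))\<^sup>2) * sqrt (\<Sum>p\<in>G. (cmod (\<eta> p))\<^sup>2))" .
qed

text \<open>Both legs of a tensor can be moved to other representations, one at a time, after compressing
  the other leg to a finite matrix block.\<close>

lemma tcoef_right:
  fixes \<pi> :: "'a::cstar_algebra \<Rightarrow> ('i \<Rightarrow> complex) \<Rightarrow> 'i \<Rightarrow> complex"
    and \<rho> :: "'b::cstar_algebra \<Rightarrow> ('j \<Rightarrow> complex) \<Rightarrow> 'j \<Rightarrow> complex"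
    and \<rho>' :: "'b \<Rightarrow> ('l \<Rightarrow> complex) \<Rightarrow> 'l \<Rightarrow> complex"
  assumes \<pi>: "star_rep \<pi>" and \<rho>: "faithful_rep \<rho>" and \<rho>': "star_rep \<rho>'" and C: "C \<ge> 0"
    and m: "mbound (tcoef \<pi> \<rho> xs) C"
  shows "mbound (tcoef \<pi> \<rho>' xs) C"
  unfolding mbound_def
proof (intro allI impI)
  fix G :: "('i \<times> 'l) set" and \<zeta> \<eta> :: "'i \<times> 'l \<Rightarrow> complex" assume G: "finite G"
  note s\<rho> = faithful_rep_star_rep[OF \<rho>]
  let ?F = "fst ` G"
  have F: "finite ?F" using G by simp
  \<comment> \<open>Slices of the tensor by the coefficients (i, k) of \<pi>. They form a matrix
    over the second algebra whose operator, in any representation of that algebra, has the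
    coefficients of the tensor on rows and columns in \<open>?F\<close>; a finite \<open>?F\<close>
    is enough for a test with finite support.\<close>
  define \<beta> where "\<beta> i k = (\<Sum>(a, b)\<leftarrow>xs. mc (\<pi> a) i k *\<^sub>C b)" for i k
  have mc\<beta>: "mc (\<rho> (\<beta> i k)) j l = tcoef \<pi> \<rho> xs (i, j) (k, l)" if "star_rep \<rho>" for \<rho> :: "_ \<Rightarrow> ('z \<Rightarrow> complex) \<Rightarrow> 'z \<Rightarrow> complex" and i k j l
    unfolding \<beta>_def mc_sum_list[OF that] by (simp add: case_prod_unfold mc_scale[OF that] tcoef_def)
  have e: "mc (mop \<rho> ?F \<beta>) = (\<lambda>p q. if p \<in> ?F \<times> UNIV \<and> q \<in> ?F \<times> UNIV then tcoef \<pi> \<rho> xs p q else 0)"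
    by (auto simp: fun_eq_iff mc_mop[OF s\<rho> F] mc\<beta>[OF s\<rho>])
  have "mbound (mc (mop \<rho> ?F \<beta>)) C"
    unfolding e by (rule mbound_restrict[OF m C])
  then have "op_norm (mop \<rho> ?F \<beta>) \<le> C" by (simp add: op_norm_mbound[OF mop_bounded(1)[OF s\<rho> F] C])
  then have "op_norm (mop \<rho>' ?F \<beta>) \<le> C" using mop_compare[OF \<rho> \<rho>' F, of \<beta>] by simp
  then have m': "mbound (mc (mop \<rho>' ?F \<beta>)) C" by (simp add: op_norm_mbound[OF mop_bounded(1)[OF \<rho>' F] C])
  have "(\<Sum>p\<in>G. \<Sum>q\<in>G. cnj (\<zeta> p) * tcoef \<pi> \<rho>' xs p q * \<eta> q) = (\<Sum>p\<in>G. \<Sum>q\<in>G. cnj (\<zeta> p) * mc (mop \<rho>' ?F \<beta>) p q * \<eta> q)"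
  proof (intro sum.cong refl)
    fix p q assume "p \<in> G" "q \<in> G"
    then have "fst p \<in> ?F" "fst q \<in> ?F" by simp_all
    then have "mc (mop \<rho>' ?F \<beta>) (fst p, snd p) (fst q, snd q) = tcoef \<pi> \<rho>' xs (fst p, snd p) (fst q, snd q)"
      by (simp only: mc_mop[OF \<rho>' F] mc\<beta>[OF \<rho>'] if_True simp_thms)
    then show "cnj (\<zeta> p) * tcoef \<pi> \<rho>' xs p q * \<eta> q = cnj (\<zeta> p) * mc (mop \<rho>' ?F \<beta>) p q * \<eta> q" by simp
  qed
  then show "cmod (\<Sum>p\<in>G. \<Sum>q\<in>G. cnj (\<zeta> p) * tcoef \<pi> \<rho>' xs p q * \<eta> q)
      \<le> C * (sqrt (\<Sum>p\<in>G. (cmod (\<zeta> p))\<^sup>2) * sqrt (\<Sum>p\<in>G. (cmod (\<eta> p))\<^sup>2))"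
    using m'[unfolded mbound_def, rule_format, OF G, of \<zeta> \<eta>] by simp
qed

lemma tcoef_swap:
  fixes \<pi> :: "'a::cstar_algebra \<Rightarrow> ('i \<Rightarrow> complex) \<Rightarrow> 'i \<Rightarrow> complex"
    and \<rho> :: "'b::cstar_algebra \<Rightarrow> ('j \<Rightarrow> complex) \<Rightarrow> 'j \<Rightarrow> complex"
  assumes m: "mbound (tcoef \<pi> \<rho> xs) C"
  shows "mbound (tcoef \<rho> \<pi> (map prod.swap xs)) C"
  unfolding mbound_def
proof (intro allI impI)
  fix G :: "('j \<times> 'i) set" and \<zeta> \<eta> :: "'j \<times> 'i \<Rightarrow> complex" assume G: "finite G"
  have sw: "tcoef \<rho> \<pi> (map prod.swap xs) p q = tcoef \<pi> \<rho> xs (prod.swap p) (prod.swap q)" for p q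
    by (cases p; cases q) (simp add: tcoef_def case_prod_unfold o_def mult.commute)
  have r: "(\<Sum>p\<in>prod.swap ` G. f p) = (\<Sum>p\<in>G. f (prod.swap p))" for f :: "_ \<Rightarrow> 'z::comm_monoid_add"
    by (simp add: sum.reindex)
  show "cmod (\<Sum>p\<in>G. \<Sum>q\<in>G. cnj (\<zeta> p) * tcoef \<rho> \<pi> (map prod.swap xs) p q * \<eta> q)
      \<le> C * (sqrt (\<Sum>p\<in>G. (cmod (\<zeta> p))\<^sup>2) * sqrt (\<Sum>p\<in>G. (cmod (\<eta> p))\<^sup>2))"
    using m[unfolded mbound_def, rule_format, of "prod.swap ` G" "\<zeta> \<circ> prod.swap" "\<eta> \<circ> prod.swap"] G
    by (simp add: r sw)
qed

theorem tcoef_compare: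
  assumes "faithful_rep \<pi>" "faithful_rep \<rho>" "star_rep \<pi>'" "star_rep \<rho>'" "C \<ge> 0" "mbound (tcoef \<pi> \<rho> xs) C"
  shows "mbound (tcoef \<pi>' \<rho>' xs) C"
proof -
  have "mbound (tcoef \<pi> \<rho>' xs) C"
    by (rule tcoef_right[OF faithful_rep_star_rep]) (use assms in auto)
  then have "mbound (tcoef \<rho>' \<pi> (map prod.swap xs)) C" by (rule tcoef_swap)
  then have "mbound (tcoef \<rho>' \<pi>' (map prod.swap xs)) C"
    by (rule tcoef_right[rotated -1]) (use assms in auto)
  from tcoef_swap[OF this] show ?thesis by (simp add: o_def)
qed

section \<open>Boundedness of slices\<close>

definition l2s :: "'i set \<Rightarrow> ('i \<Rightarrow> complex) \<Rightarrow> real"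
  where "l2s F z = sqrt (\<Sum>p\<in>F. (cmod (z p))\<^sup>2)"

lemma sum_swap4:
  "(\<Sum>j\<in>G. \<Sum>l\<in>G. \<Sum>i\<in>F. \<Sum>k\<in>F. f i j k l) = (\<Sum>i\<in>F. \<Sum>j\<in>G. \<Sum>k\<in>F. \<Sum>l\<in>G. f i j k l)"
proof -
  have "(\<Sum>l\<in>G. \<Sum>i\<in>F. \<Sum>k\<in>F. f i j k l) = (\<Sum>i\<in>F. \<Sum>k\<in>F. \<Sum>l\<in>G. f i j k l)" for j
    by (subst sum.swap, intro sum.cong refl, rule sum.swap)
  then show ?thesis by (simp only: sum.swap[of _ F G])
qed

text \<open>Test vectors fixed in the first leg leave an element d of the second algebra, whose norm
  is bounded by testing the tensor with product vectors. Applying \<phi> to d gives the coefficient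
  of the sliced element.\<close>

lemma tcoef_slice:
  fixes \<phi> :: "'b::cstar_algebra \<Rightarrow> complex" and xs :: "('a::cstar_algebra \<times> 'b) list"
    and \<pi> :: "'a \<Rightarrow> ('i \<Rightarrow> complex) \<Rightarrow> 'i \<Rightarrow> complex" and \<rho> :: "'b \<Rightarrow> ('j \<Rightarrow> complex) \<Rightarrow> 'j \<Rightarrow> complex"
  assumes \<pi>: "faithful_rep \<pi>" and \<rho>: "faithful_rep \<rho>" and C: "C \<ge> 0" and m: "mbound (tcoef \<pi> \<rho> xs) C"
    and \<phi>: "clinear \<phi>" "\<And>b. cmod (\<phi> b) \<le> c * norm b" and c: "c \<ge> 0"
  shows "norm (\<Sum>(a, b)\<leftarrow>xs. \<phi> b *\<^sub>C a) \<le> c * C"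
proof -
  note s = faithful_rep_star_rep[OF \<pi>] faithful_rep_star_rep[OF \<rho>]
  have "mbound (mc (\<pi> (\<Sum>(a, b)\<leftarrow>xs. \<phi> b *\<^sub>C a))) (c * C)"
    unfolding mbound_def l2s_def[symmetric]
  proof (intro allI impI)
    fix F :: "'i set" and \<zeta> \<eta> :: "'i \<Rightarrow> complex" assume F: "finite F"
    define s1 where "s1 a = (\<Sum>p\<in>F. \<Sum>q\<in>F. cnj (\<zeta> p) * mc (\<pi> a) p q * \<eta> q)" for a
    define d where "d = (\<Sum>(a, b)\<leftarrow>xs. s1 a *\<^sub>C b)"
    have "norm d \<le> C * (l2s F \<zeta> * l2s F \<eta>)"
    proof -
      have "mbound (mc (\<rho> d)) (C * (l2s F \<zeta> * l2s F \<eta>))"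
        unfolding mbound_def l2s_def[symmetric]
      proof (intro allI impI)
        fix G :: "'j set" and \<zeta>' \<eta>' :: "'j \<Rightarrow> complex" assume G: "finite G"
        let ?z = "\<lambda>(i, j). \<zeta> i * \<zeta>' j" and ?e = "\<lambda>(i, j). \<eta> i * \<eta>' j"
        have nrm: "l2s (F \<times> G) (\<lambda>(i, j). x i * y j) = l2s F x * l2s G y" for x y
          by (simp add: l2s_def case_prod_unfold norm_mult power_mult_distrib real_sqrt_mult[symmetric]
              sum_product sum.cartesian_product)
        have "(\<Sum>p\<in>G. \<Sum>q\<in>G. cnj (\<zeta>' p) * mc (\<rho> d) p q * \<eta>' q)
          = (\<Sum>j\<in>G. \<Sum>l\<in>G. cnj (\<zeta>' j) * (\<Sum>(a, b)\<leftarrow>xs. s1 a * mc (\<rho> b) j l) * \<eta>' l)"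
          unfolding d_def by (simp add: mc_sum_list[OF s(2)] case_prod_unfold mc_scale[OF s(2)])
        also have "\<dots> = (\<Sum>j\<in>G. \<Sum>l\<in>G. \<Sum>i\<in>F. \<Sum>k\<in>F. cnj (?z (i, j)) * tcoef \<pi> \<rho> xs (i, j) (k, l) * ?e (k, l))"
        proof (intro sum.cong refl)
          fix j l
          have "(\<Sum>i\<in>F. \<Sum>k\<in>F. cnj (?z (i, j)) * tcoef \<pi> \<rho> xs (i, j) (k, l) * ?e (k, l))
            = cnj (\<zeta>' j) * (\<Sum>i\<in>F. \<Sum>k\<in>F. cnj (\<zeta> i) * tcoef \<pi> \<rho> xs (i, j) (k, l) * \<eta> k) * \<eta>' l"
            by (simp add: sum_distrib_left sum_distrib_right mult_ac)
          also have "(\<Sum>i\<in>F. \<Sum>k\<in>F. cnj (\<zeta> i) * tcoef \<pi> \<rho> xs (i, j) (k, l) * \<eta> k) = (\<Sum>(a, b)\<leftarrow>xs. s1 a * mc (\<rho> b) j l)"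
            unfolding tcoef_def
            by (induction xs) (auto simp: s1_def sum.distrib distrib_left distrib_right sum_distrib_left sum_distrib_right mult_ac)
          finally show "cnj (\<zeta>' j) * (\<Sum>(a, b)\<leftarrow>xs. s1 a * mc (\<rho> b) j l) * \<eta>' l
            = (\<Sum>i\<in>F. \<Sum>k\<in>F. cnj (?z (i, j)) * tcoef \<pi> \<rho> xs (i, j) (k, l) * ?e (k, l))" by simp
        qed
        also have "\<dots> = (\<Sum>i\<in>F. \<Sum>j\<in>G. \<Sum>k\<in>F. \<Sum>l\<in>G. cnj (?z (i, j)) * tcoef \<pi> \<rho> xs (i, j) (k, l) * ?e (k, l))"
          by (rule sum_swap4)
        also have "\<dots> = (\<Sum>p\<in>F \<times> G. \<Sum>q\<in>F \<times> G. cnj (?z p) * tcoef \<pi> \<rho> xs p q * ?e q)"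
        proof -
          have "(\<Sum>p\<in>F \<times> G. g p) = (\<Sum>i\<in>F. \<Sum>j\<in>G. g (i, j))" for g :: "'i \<times> 'j \<Rightarrow> complex"
            by (simp add: sum.cartesian_product)
          then show ?thesis by simp
        qed
        finally show "cmod (\<Sum>p\<in>G. \<Sum>q\<in>G. cnj (\<zeta>' p) * mc (\<rho> d) p q * \<eta>' q)
          \<le> C * (l2s F \<zeta> * l2s F \<eta>) * (l2s G \<zeta>' * l2s G \<eta>')"
          using m[unfolded mbound_def l2s_def[symmetric], rule_format, of "F \<times> G" ?z ?e] F G unfolding nrm by (simp add: mult_ac)
      qed
      then show ?thesis by (subst (asm) faithful_rep_mbound[OF \<rho>]) (use C in \<open>auto intro!: mult_nonneg_nonneg sum_nonneg simp: l2s_def\<close>)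
    qed
    moreover have "(\<Sum>p\<in>F. \<Sum>q\<in>F. cnj (\<zeta> p) * mc (\<pi> (\<Sum>(a, b)\<leftarrow>xs. \<phi> b *\<^sub>C a)) p q * \<eta> q) = \<phi> d"
      unfolding d_def
      by (induction xs) (auto simp: s1_def mc_zero[OF s(1)] mc_add[OF s(1)] mc_scale[OF s(1)] distrib_left distrib_right
          sum.distrib sum_distrib_left sum_distrib_right complex_vector.linear_0[OF \<phi>(1)] complex_vector.linear_add[OF \<phi>(1)]
          complex_vector.linear_scale[OF \<phi>(1)] scaleC_complex_def mult_ac)
    ultimately show "cmod (\<Sum>p\<in>F. \<Sum>q\<in>F. cnj (\<zeta> p) * mc (\<pi> (\<Sum>(a, b)\<leftarrow>xs. \<phi> b *\<^sub>C a)) p q * \<eta> q)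
      \<le> c * C * (l2s F \<zeta> * l2s F \<eta>)"
      using order_trans[OF \<phi>(2)[of d] mult_left_mono[OF _ c]] by (simp add: mult.assoc)
  qed
  then show ?thesis by (subst (asm) faithful_rep_mbound[OF \<pi>]) (use C c in auto)
qed

section \<open>Homomorphisms and extension from elementary tensors\<close>

lemma cstar_hom_clinear: "cstar_hom f \<Longrightarrow> clinear f" by (simp add: cstar_hom_def)
lemma cstar_hom_mult: "cstar_hom f \<Longrightarrow> f (x * y) = f x * f y" by (simp add: cstar_hom_def)
lemma cstar_hom_star: "cstar_hom f \<Longrightarrow> f (star x) = star (f x)" by (simp add: cstar_hom_def)
lemma cstar_hom_one: "cstar_hom f \<Longrightarrow> f 1 = 1" by (simp add: cstar_hom_def)

lemma cstar_hom_contractive: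
  assumes f: "cstar_hom f" shows "norm (f a) \<le> norm a"
proof -
  have "cstar_seminorm (\<lambda>a. norm (f a))"
    unfolding cstar_seminorm_def alg_seminorm_def
    using complex_vector.linear_add[OF cstar_hom_clinear[OF f]] complex_vector.linear_scale[OF cstar_hom_clinear[OF f]]
      cstar_hom_mult[OF f] cstar_hom_star[OF f] cstar_hom_one[OF f]
    by (simp add: norm_triangle_ineq norm_scaleC norm_mult_ineq cstar_identity)
  then show ?thesis by (rule cstar_seminorm_le_norm)
qed

lemma bounded_linear_of_clinear:
  fixes f :: "'a::cstar_algebra \<Rightarrow> 'b::cstar_algebra"
  assumes f: "clinear f" and b: "\<And>a. norm (f a) \<le> K * norm a"
  shows "bounded_linear f"
proof (rule bounded_linear_intro[where K=K])
  show "f (x + y) = f x + f y" for x y by (rule complex_vector.linear_add[OF f])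
  show "f (r *\<^sub>R x) = r *\<^sub>R f x" for r x
    unfolding scaleR_scaleC by (rule complex_vector.linear_scale[OF f])
  show "norm (f x) \<le> norm x * K" for x using b[of x] by (simp add: mult.commute)
qed

lemma cstar_hom_bounded_linear: "cstar_hom f \<Longrightarrow> bounded_linear f"
  by (rule bounded_linear_of_clinear[where K=1]) (auto simp: cstar_hom_clinear cstar_hom_contractive)

lemma bounded_linear_scaleC: "bounded_linear (\<lambda>x. c *\<^sub>C (x :: 'a::cstar_algebra))"
  by (rule bounded_linear_of_clinear[where K="cmod c"])
    (auto intro!: clinearI simp: scaleC_add_right scaleC_scaleC mult.commute norm_scaleC)

lemma bounded_linear_star: "bounded_linear (star :: 'a::cstar_algebra \<Rightarrow> 'a)"
  by (rule bounded_linear_intro[where K=1]) (simp_all add: star_add scaleR_scaleC star_scaleC)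

lemma min_tensor_cbilinear: "min_tensor t \<Longrightarrow> cbilinear t" by (simp add: min_tensor_def)
lemma min_tensor_mult: "min_tensor t \<Longrightarrow> t a b * t a' b' = t (a * a') (b * b')" by (simp add: min_tensor_def)
lemma min_tensor_star: "min_tensor t \<Longrightarrow> star (t a b) = t (star a) (star b)" by (simp add: min_tensor_def)
lemma min_tensor_one: "min_tensor t \<Longrightarrow> t 1 1 = 1" by (simp add: min_tensor_def)
lemma min_tensor_dense: "min_tensor t \<Longrightarrow> closure (cspan {t a b | a b. True}) = UNIV" by (simp add: min_tensor_def)

lemma cbilinear_add_left: "cbilinear f \<Longrightarrow> f (a + a') b = f a b + f a' b"
  unfolding cbilinear_def using complex_vector.linear_add[of "\<lambda>a. f a b"] by auto
lemma cbilinear_add_right: "cbilinear f \<Longrightarrow> f a (b + b') = f a b + f a b'"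
  unfolding cbilinear_def using complex_vector.linear_add[of "f a"] by auto
lemma cbilinear_scaleC_right: "cbilinear f \<Longrightarrow> f a (c *\<^sub>C b) = c *\<^sub>C f a b"
  unfolding cbilinear_def using complex_vector.linear_scale[of "f a"] by auto
lemma cbilinear_zero_left: "cbilinear f \<Longrightarrow> f 0 b = 0"
  using cbilinear_scaleC_left[of f 0 0 b] by simp
lemma cbilinear_zero_right: "cbilinear f \<Longrightarrow> f a 0 = 0"
  using cbilinear_scaleC_right[of f a 0 0] by simp
lemma cbilinear_sum_left: "cbilinear f \<Longrightarrow> f (\<Sum>i\<in>I. a i) b = (\<Sum>i\<in>I. f (a i) b)"
  by (induction I rule: infinite_finite_induct) (auto simp: cbilinear_zero_left cbilinear_add_left)
lemma cbilinear_sum_right: "cbilinear f \<Longrightarrow> f a (\<Sum>i\<in>I. b i) = (\<Sum>i\<in>I. f a (b i))"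
  by (induction I rule: infinite_finite_induct) (auto simp: cbilinear_zero_right cbilinear_add_right)
lemma span_bilinear_list:
  assumes t: "cbilinear t" and z: "z \<in> cspan {t a b | a b. True}"
  shows "\<exists>xs. z = (\<Sum>(a, b)\<leftarrow>xs. t a b)"
  using z
proof (induction rule: complex_vector.span_induct_alt)
  case base
  show ?case by (intro exI[of _ "[]"]) simp
next
  case (step c x y)
  then obtain xs a b where "y = (\<Sum>(a, b)\<leftarrow>xs. t a b)" "x = t a b" by blast
  then show ?case by (intro exI[of _ "(c *\<^sub>C a, b) # xs"]) (simp add: cbilinear_scaleC_left[OF t])
qed

text \<open>Density of the elementary tensors; the identities between slices, coproducts and
  coactions below are checked in this way.\<close>

lemma tensor_ext:
  fixes t :: "'a::cstar_algebra \<Rightarrow> 'b::cstar_algebra \<Rightarrow> 'c::cstar_algebra" and F G :: "'c \<Rightarrow> 'd::cstar_algebra"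
  assumes t: "min_tensor t" and F: "bounded_linear F" and G: "bounded_linear G"
    and eq: "\<And>a b. F (t a b) = G (t a b)"
  shows "F z = G z"
proof -
  interpret F: bounded_linear F by fact
  interpret G: bounded_linear G by fact
  have "F z = G z" if z: "z \<in> cspan {t a b | a b. True}" for z
  proof -
    obtain xs where "z = (\<Sum>(a, b)\<leftarrow>xs. t a b)"
      using span_bilinear_list[OF min_tensor_cbilinear[OF t] z] by blast
    then show ?thesis by (induction xs arbitrary: z) (auto simp: F.zero G.zero F.add G.add eq)
  qed
  moreover have "closed {z. F z = G z}"
    by (intro closed_Collect_eq linear_continuous_on F G)
  ultimately have "closure (cspan {t a b | a b. True}) \<subseteq> {z. F z = G z}"
    by (intro closure_minimal) auto
  then show ?thesis unfolding min_tensor_dense[OF t] by blast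
qed

text \<open>The bound on formal sums makes the map well defined and Lipschitz on the dense span, so
  it extends by uniform continuity; linearity and the bound pass to the closure.\<close>

lemma tensor_extend:
  fixes t :: "'a::cstar_algebra \<Rightarrow> 'b::cstar_algebra \<Rightarrow> 'c::cstar_algebra" and \<beta> :: "'a \<Rightarrow> 'b \<Rightarrow> 'd::cstar_algebra"
  assumes t: "min_tensor t" and \<beta>: "cbilinear \<beta>" and K: "K \<ge> 0"
    and bound: "\<And>xs. norm (\<Sum>(a, b)\<leftarrow>xs. \<beta> a b) \<le> K * norm (\<Sum>(a, b)\<leftarrow>xs. t a b)"
  shows "\<exists>F. bounded_linear F \<and> clinear F \<and> (\<forall>z. norm (F z) \<le> K * norm z) \<and> (\<forall>a b. F (t a b) = \<beta> a b)"
proof -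
  let ?D = "cspan {t a b | a b. True}"
  note tb = min_tensor_cbilinear[OF t]
  define rep where "rep z = (SOME xs. z = (\<Sum>(a, b)\<leftarrow>xs. t a b))" for z
  define f where "f z = (\<Sum>(a, b)\<leftarrow>rep z. \<beta> a b)" for z
  have neg: "(\<Sum>(a, b)\<leftarrow>map (\<lambda>(a, b). (c *\<^sub>C a, b)) xs. g a b) = c *\<^sub>C (\<Sum>(a, b)\<leftarrow>xs. g a b)"
    if "cbilinear g" for g :: "'a \<Rightarrow> 'b \<Rightarrow> 'x::complex_vector" and c xs by (rule sum_list_scaleC_left[OF that])
  \<comment> \<open>The bound is applied to the formal difference: both lists appended, the second
    one with sign -1.\<close>
  have wd: "(\<Sum>(a, b)\<leftarrow>xs. \<beta> a b) = (\<Sum>(a, b)\<leftarrow>ys. \<beta> a b)"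
    if "(\<Sum>(a, b)\<leftarrow>xs. t a b) = (\<Sum>(a, b)\<leftarrow>ys. t a b)" for xs ys
    using bound[of "xs @ map (\<lambda>(a, b). ((-1) *\<^sub>C a, b)) ys"] that
    by (simp only: sum_list_append map_append neg[OF tb] neg[OF \<beta>]) simp
  have f: "f (\<Sum>(a, b)\<leftarrow>xs. t a b) = (\<Sum>(a, b)\<leftarrow>xs. \<beta> a b)" for xs
  proof -
    have "(\<Sum>(a, b)\<leftarrow>xs. t a b) = (\<Sum>(a, b)\<leftarrow>rep (\<Sum>(a, b)\<leftarrow>xs. t a b). t a b)"
      unfolding rep_def by (rule someI) simp
    then show ?thesis unfolding f_def by (intro wd) simp
  qed
  have D: "\<exists>xs. z = (\<Sum>(a, b)\<leftarrow>xs. t a b)" if "z \<in> ?D" for z by (rule span_bilinear_list[OF tb that])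
  have fadd: "f (x + y) = f x + f y" if xy: "x \<in> ?D" "y \<in> ?D" for x y
  proof -
    obtain xs ys where "x = (\<Sum>(a, b)\<leftarrow>xs. t a b)" "y = (\<Sum>(a, b)\<leftarrow>ys. t a b)" using D xy by metis
    then show ?thesis using f[of "xs @ ys"] by (simp add: f)
  qed
  have fscale: "f (c *\<^sub>C x) = c *\<^sub>C f x" if x: "x \<in> ?D" for c x
  proof -
    obtain xs where "x = (\<Sum>(a, b)\<leftarrow>xs. t a b)" using D x by metis
    then show ?thesis using f[of "map (\<lambda>(a, b). (c *\<^sub>C a, b)) xs"] by (simp only: neg[OF tb] neg[OF \<beta>] f)
  qed
  have fb: "norm (f x) \<le> K * norm x" if x: "x \<in> ?D" for x
    using D[OF x] bound by (auto simp: f)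
  have sub: "csubspace ?D" by (rule complex_vector.subspace_span)
  have fdiff: "f x - f y = f (x - y)" if "x \<in> ?D" "y \<in> ?D" for x y
    using fadd[of "x - y" y] that complex_vector.subspace_diff[OF sub that] by simp
  have "uniformly_continuous_on ?D f"
    unfolding uniformly_continuous_on_def
  proof (intro allI impI)
    fix e :: real assume e: "e > 0"
    show "\<exists>d>0. \<forall>x\<in>?D. \<forall>x'\<in>?D. dist x' x < d \<longrightarrow> dist (f x') (f x) < e"
    proof (intro exI[of _ "e / (K + 1)"] conjI ballI impI)
      show "0 < e / (K + 1)" using e K by simp
      fix x x' assume x: "x \<in> ?D" "x' \<in> ?D" "dist x' x < e / (K + 1)"
      have "dist (f x') (f x) \<le> K * dist x' x"
        unfolding dist_norm fdiff[OF x(2,1)] by (rule fb[OF complex_vector.subspace_diff[OF sub x(2,1)]])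
      also have "\<dots> \<le> (K + 1) * dist x' x" by (simp add: distrib_right)
      also have "\<dots> < e" using x(3) K by (simp add: field_simps)
      finally show "dist (f x') (f x) < e" .
    qed
  qed
  then obtain g where g: "uniformly_continuous_on (closure ?D) g" "\<And>x. x \<in> ?D \<Longrightarrow> f x = g x"
    by (rule uniformly_continuous_on_extension_on_closure) blast
  have cg: "continuous_on UNIV g"
    using uniformly_continuous_imp_continuous[OF g(1)] unfolding min_tensor_dense[OF t] .
  have cg': "continuous_on UNIV (\<lambda>x. g (h x))" if "continuous_on UNIV h" for h :: "'c \<Rightarrow> 'c"
    by (rule continuous_on_compose2[OF cg that]) simp
  have ind: "P x" if "closed {x. P x}" "\<And>x. x \<in> ?D \<Longrightarrow> P x" for P x
  proof -
    have "closure ?D \<subseteq> {x. P x}" by (intro closure_minimal that(1)) (use that(2) in blast)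
    then show ?thesis unfolding min_tensor_dense[OF t] by blast
  qed
  have gadd: "g (x + y) = g x + g y" for x y
  proof -
    have *: "g (x + y) = g x + g y" if y: "y \<in> ?D" for x y
    proof (rule ind[of "\<lambda>x. g (x + y) = g x + g y"])
      have "continuous_on UNIV (\<lambda>x. g (x + y))" by (rule cg') (intro continuous_intros)
      then show "closed {x. g (x + y) = g x + g y}"
        by (rule closed_Collect_eq[OF _ continuous_on_add[OF cg continuous_on_const]])
      show "g (x + y) = g x + g y" if "x \<in> ?D" for x
        using fadd[OF that y] g(2)[OF that] g(2)[OF y] g(2)[OF complex_vector.subspace_add[OF sub that y]] by simp
    qed
    show ?thesis
    proof (rule ind[of "\<lambda>y. g (x + y) = g x + g y"])
      have "continuous_on UNIV (\<lambda>y. g (x + y))" by (rule cg') (intro continuous_intros)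
      then show "closed {y. g (x + y) = g x + g y}"
        by (rule closed_Collect_eq[OF _ continuous_on_add[OF continuous_on_const cg]])
    qed (rule *)
  qed
  have gscale: "g (c *\<^sub>C x) = c *\<^sub>C g x" for c x
  proof (rule ind[of "\<lambda>x. g (c *\<^sub>C x) = c *\<^sub>C g x"])
    have "continuous_on UNIV (\<lambda>x. c *\<^sub>C g x)"
      using continuous_on_compose2[OF linear_continuous_on[OF bounded_linear_scaleC, of UNIV c] cg] by simp
    moreover have "continuous_on UNIV (\<lambda>x. g (c *\<^sub>C x))"
      by (rule cg'[OF linear_continuous_on[OF bounded_linear_scaleC]])
    ultimately show "closed {x. g (c *\<^sub>C x) = c *\<^sub>C g x}" by (intro closed_Collect_eq)
    show "g (c *\<^sub>C x) = c *\<^sub>C g x" if "x \<in> ?D" for x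
      using fscale[OF that] g(2)[OF that] g(2)[OF complex_vector.subspace_scale[OF sub that]] by simp
  qed
  have gb: "norm (g x) \<le> K * norm x" for x
  proof (rule ind[of "\<lambda>x. norm (g x) \<le> K * norm x"])
    show "closed {x. norm (g x) \<le> K * norm x}"
      by (rule closed_Collect_le[OF continuous_on_norm[OF cg] continuous_on_mult_left[OF continuous_on_norm_id]])
    show "norm (g x) \<le> K * norm x" if "x \<in> ?D" for x using fb[OF that] g(2)[OF that] by simp
  qed
  have lin: "clinear g" by (rule clinearI) (simp_all add: gadd gscale)
  have "g (t a b) = \<beta> a b" for a b
  proof -
    have "t a b \<in> ?D" by (rule complex_vector.span_base) blast
    then show ?thesis using g(2)[of "t a b"] f[of "[(a, b)]"] by simp
  qed
  then show ?thesis using lin gb bounded_linear_of_clinear[OF lin gb] by blast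
qed

lemma min_tensor_map_unique:
  assumes t: "min_tensor t" and "bounded_linear F" "\<And>a b. F (t a b) = t' (f a) (g b)"
  shows "min_tensor_map t t' f g = F"
  unfolding min_tensor_map_def
proof (rule the_equality)
  show "bounded_linear F \<and> (\<forall>a b. F (t a b) = t' (f a) (g b))" using assms by blast
  fix G assume "bounded_linear G \<and> (\<forall>a b. G (t a b) = t' (f a) (g b))"
  then show "G = F" using tensor_ext[OF t _ assms(2), of G] assms(3) by (auto intro!: ext)
qed

text \<open>Pulling faithful representations of the targets back along f and g gives representations
  of the sources, so \<open>tcoef_compare\<close> bounds the norm of the image by the original
  norm.\<close>

lemma min_tensor_map:
  fixes t :: "'a::cstar_algebra \<Rightarrow> 'b::cstar_algebra \<Rightarrow> 'ab::cstar_algebra"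
    and t' :: "'c::cstar_algebra \<Rightarrow> 'd::cstar_algebra \<Rightarrow> 'cd::cstar_algebra"
  assumes t: "min_tensor t" and t': "min_tensor t'" and f: "cstar_hom f" and g: "cstar_hom g"
  shows "cstar_hom (min_tensor_map t t' f g)" "min_tensor_map t t' f g (t a b) = t' (f a) (g b)"
proof -
  note lf = cstar_hom_clinear[OF f] and lg = cstar_hom_clinear[OF g]
  note tb = min_tensor_cbilinear[OF t'] 
  have \<beta>: "cbilinear (\<lambda>a b. t' (f a) (g b))"
    by (intro cbilinearI) (simp_all add: complex_vector.linear_add[OF lf] complex_vector.linear_add[OF lg]
        complex_vector.linear_scale[OF lf] complex_vector.linear_scale[OF lg] cbilinear_add_left[OF tb] cbilinear_add_right[OF tb]
        cbilinear_scaleC_left[OF tb] cbilinear_scaleC_right[OF tb])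
  obtain \<pi> :: "'a \<Rightarrow> ('a \<Rightarrow> complex) \<Rightarrow> 'a \<Rightarrow> complex" and \<rho> :: "'b \<Rightarrow> ('b \<Rightarrow> complex) \<Rightarrow> 'b \<Rightarrow> complex"
    where r: "faithful_rep \<pi>" "faithful_rep \<rho>"
    and n: "\<And>xs C. C \<ge> 0 \<Longrightarrow> norm (\<Sum>(a, b)\<leftarrow>xs. t a b) \<le> C \<longleftrightarrow> mbound (tcoef \<pi> \<rho> xs) C"
    using min_tensor_norm[OF t] by blast
  obtain \<pi>' :: "'c \<Rightarrow> ('c \<Rightarrow> complex) \<Rightarrow> 'c \<Rightarrow> complex" and \<rho>' :: "'d \<Rightarrow> ('d \<Rightarrow> complex) \<Rightarrow> 'd \<Rightarrow> complex"
    where r': "faithful_rep \<pi>'" "faithful_rep \<rho>'"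
    and n': "\<And>xs C. C \<ge> 0 \<Longrightarrow> norm (\<Sum>(a, b)\<leftarrow>xs. t' a b) \<le> C \<longleftrightarrow> mbound (tcoef \<pi>' \<rho>' xs) C"
    using min_tensor_norm[OF t'] by blast
  have "norm (\<Sum>(a, b)\<leftarrow>xs. t' (f a) (g b)) \<le> 1 * norm (\<Sum>(a, b)\<leftarrow>xs. t a b)" for xs
  proof -
    let ?C = "norm (\<Sum>(a, b)\<leftarrow>xs. t a b)"
    have "mbound (tcoef \<pi> \<rho> xs) ?C" using n[of ?C xs] by simp
    then have "mbound (tcoef (\<lambda>a. \<pi>' (f a)) (\<lambda>b. \<rho>' (g b)) xs) ?C"
      by (rule tcoef_compare[OF r star_rep_comp[OF faithful_rep_star_rep[OF r'(1)] f]
            star_rep_comp[OF faithful_rep_star_rep[OF r'(2)] g] norm_ge_zero])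
    also have "tcoef (\<lambda>a. \<pi>' (f a)) (\<lambda>b. \<rho>' (g b)) xs = tcoef \<pi>' \<rho>' (map (\<lambda>(a, b). (f a, g b)) xs)"
      by (simp add: tcoef_def case_prod_unfold o_def)
    finally have "norm (\<Sum>(a, b)\<leftarrow>map (\<lambda>(a, b). (f a, g b)) xs. t' a b) \<le> ?C" by (subst n') simp_all
    then show ?thesis by (simp add: case_prod_unfold o_def)
  qed
  from tensor_extend[OF t \<beta> _ this] obtain F where F: "bounded_linear F" "clinear F" "\<And>a b. F (t a b) = t' (f a) (g b)"
    by auto
  have e: "min_tensor_map t t' f g = F" by (rule min_tensor_map_unique[OF t F(1)]) (rule F(3))
  show "min_tensor_map t t' f g (t a b) = t' (f a) (g b)" by (simp add: e F)
  have "F (x * y) = F x * F y" for x y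
  proof -
    have 1: "F (t a b * y) = F (t a b) * F y" for a b y
      by (rule tensor_ext[OF t, where z = y and F = "\<lambda>y. F (t a b * y)" and G = "\<lambda>y. F (t a b) * F y",
            OF bounded_linear_compose[OF F(1) bounded_linear_mult_right] bounded_linear_compose[OF bounded_linear_mult_right F(1)]])
        (simp add: min_tensor_mult[OF t] min_tensor_mult[OF t'] F(3) cstar_hom_mult[OF f] cstar_hom_mult[OF g])
    show ?thesis
      by (rule tensor_ext[OF t, where z = x and F = "\<lambda>x. F (x * y)" and G = "\<lambda>x. F x * F y",
            OF bounded_linear_compose[OF F(1) bounded_linear_mult_left] bounded_linear_compose[OF bounded_linear_mult_left F(1)]])
        (rule 1)
  qed
  moreover have "F (star x) = star (F x)" for x
    by (rule tensor_ext[OF t, where z = x and F = "\<lambda>x. F (star x)" and G = "\<lambda>x. star (F x)",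
          OF bounded_linear_compose[OF F(1) bounded_linear_star] bounded_linear_compose[OF bounded_linear_star F(1)]])
      (simp add: min_tensor_star[OF t] min_tensor_star[OF t'] F(3) cstar_hom_star[OF f] cstar_hom_star[OF g])
  moreover have "F 1 = 1"
    using F(3)[of 1 1] by (simp add: min_tensor_one[OF t] min_tensor_one[OF t'] cstar_hom_one[OF f] cstar_hom_one[OF g])
  ultimately show "cstar_hom (min_tensor_map t t' f g)" unfolding e cstar_hom_def using F(2) by blast
qed

section \<open>States and slice maps\<close>

text \<open>Contractivity together with \<phi>(1) = 1 stands in for positivity, which
  \<open>cstate_pos\<close> recovers. In this form being a state is a closed condition on the
  values, as the compactness argument for the Haar state requires.\<close>

definition cstate :: "('a::cstar_algebra \<Rightarrow> complex) \<Rightarrow> bool"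
  where "cstate \<phi> \<longleftrightarrow> clinear \<phi> \<and> (\<forall>a. cmod (\<phi> a) \<le> norm a) \<and> \<phi> 1 = 1"

text \<open>The slice maps: \<open>rslice\<close> is id \<otimes> \<phi>, and \<open>lslice\<close>
  is \<phi> \<otimes> id.\<close>

definition rslice :: "('a::cstar_algebra \<Rightarrow> 'b::cstar_algebra \<Rightarrow> 'c::cstar_algebra) \<Rightarrow> ('b \<Rightarrow> complex) \<Rightarrow> 'c \<Rightarrow> 'a"
  where "rslice t \<phi> = (THE F. bounded_linear F \<and> (\<forall>a b. F (t a b) = \<phi> b *\<^sub>C a))"

definition lslice :: "('a::cstar_algebra \<Rightarrow> 'b::cstar_algebra \<Rightarrow> 'c::cstar_algebra) \<Rightarrow> ('a \<Rightarrow> complex) \<Rightarrow> 'c \<Rightarrow> 'b"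
  where "lslice t \<phi> = (THE F. bounded_linear F \<and> (\<forall>a b. F (t a b) = \<phi> a *\<^sub>C b))"

lemma cstateD:
  assumes "cstate \<phi>"
  shows "clinear \<phi>" "cmod (\<phi> a) \<le> norm a" "\<phi> 1 = 1" "bounded_linear \<phi>"
    "\<phi> (a + b) = \<phi> a + \<phi> b" "\<phi> (c *\<^sub>C a) = c * \<phi> a" "\<phi> (a - b) = \<phi> a - \<phi> b"
  using assms complex_vector.linear_add[of \<phi>] complex_vector.linear_scale[of \<phi>] complex_vector.linear_diff[of \<phi>]
    bounded_linear_of_clinear[of \<phi> 1]
  by (auto simp: cstate_def scaleC_complex_def)

lemma rslice:
  assumes t: "min_tensor (t :: 'a::cstar_algebra \<Rightarrow> 'b::cstar_algebra \<Rightarrow> 'c::cstar_algebra)" and \<phi>: "cstate \<phi>"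
  shows "bounded_linear (rslice t \<phi>)" "clinear (rslice t \<phi>)" "norm (rslice t \<phi> z) \<le> norm z"
    "rslice t \<phi> (t a b) = \<phi> b *\<^sub>C a"
proof -
  obtain \<pi> :: "'a \<Rightarrow> ('a \<Rightarrow> complex) \<Rightarrow> 'a \<Rightarrow> complex" and \<rho> :: "'b \<Rightarrow> ('b \<Rightarrow> complex) \<Rightarrow> 'b \<Rightarrow> complex"
    where r: "faithful_rep \<pi>" "faithful_rep \<rho>"
    and n: "\<And>xs C. C \<ge> 0 \<Longrightarrow> norm (\<Sum>(a, b)\<leftarrow>xs. t a b) \<le> C \<longleftrightarrow> mbound (tcoef \<pi> \<rho> xs) C"
    using min_tensor_norm[OF t] by blast
  have "cbilinear (\<lambda>a b. \<phi> b *\<^sub>C a)"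
    by (intro cbilinearI) (simp_all add: cstateD[OF \<phi>] scaleC_add_left scaleC_add_right scaleC_scaleC mult.commute)
  moreover have "norm (\<Sum>(a, b)\<leftarrow>xs. \<phi> b *\<^sub>C a) \<le> 1 * norm (\<Sum>(a, b)\<leftarrow>xs. t a b)" for xs
    by (rule tcoef_slice[OF r]) (use n[of "norm (\<Sum>(a, b)\<leftarrow>xs. t a b)" xs] cstateD[OF \<phi>] in auto)
  ultimately obtain F where F: "bounded_linear F" "clinear F" "\<And>z. norm (F z) \<le> norm z" "\<And>a b. F (t a b) = \<phi> b *\<^sub>C a"
    using tensor_extend[OF t, of "\<lambda>a b. \<phi> b *\<^sub>C a" 1] by auto
  have "rslice t \<phi> = F" unfolding rslice_def
  proof (rule the_equality)
    show "G = F" if "bounded_linear G \<and> (\<forall>a b. G (t a b) = \<phi> b *\<^sub>C a)" for G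
      using tensor_ext[OF t _ F(1), of G] that F(4) by (auto intro!: ext)
  qed (use F in blast)
  then show "bounded_linear (rslice t \<phi>)" "clinear (rslice t \<phi>)" "norm (rslice t \<phi> z) \<le> norm z"
    "rslice t \<phi> (t a b) = \<phi> b *\<^sub>C a" using F by simp_all
qed

lemma lslice:
  assumes t: "min_tensor (t :: 'a::cstar_algebra \<Rightarrow> 'b::cstar_algebra \<Rightarrow> 'c::cstar_algebra)" and \<phi>: "cstate \<phi>"
  shows "bounded_linear (lslice t \<phi>)" "clinear (lslice t \<phi>)" "norm (lslice t \<phi> z) \<le> norm z"
    "lslice t \<phi> (t a b) = \<phi> a *\<^sub>C b"
proof -
  obtain \<pi> :: "'a \<Rightarrow> ('a \<Rightarrow> complex) \<Rightarrow> 'a \<Rightarrow> complex" and \<rho> :: "'b \<Rightarrow> ('b \<Rightarrow> complex) \<Rightarrow> 'b \<Rightarrow> complex"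
    where r: "faithful_rep \<pi>" "faithful_rep \<rho>"
    and n: "\<And>xs C. C \<ge> 0 \<Longrightarrow> norm (\<Sum>(a, b)\<leftarrow>xs. t a b) \<le> C \<longleftrightarrow> mbound (tcoef \<pi> \<rho> xs) C"
    using min_tensor_norm[OF t] by blast
  have "cbilinear (\<lambda>a b. \<phi> a *\<^sub>C b)"
    by (intro cbilinearI) (simp_all add: cstateD[OF \<phi>] scaleC_add_left scaleC_add_right scaleC_scaleC mult.commute)
  moreover have "norm (\<Sum>(a, b)\<leftarrow>xs. \<phi> a *\<^sub>C b) \<le> 1 * norm (\<Sum>(a, b)\<leftarrow>xs. t a b)" for xs
  proof -
    have "mbound (tcoef \<rho> \<pi> (map prod.swap xs)) (norm (\<Sum>(a, b)\<leftarrow>xs. t a b))"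
      by (rule tcoef_swap) (use n[of "norm (\<Sum>(a, b)\<leftarrow>xs. t a b)" xs] in simp)
    from tcoef_slice[OF r(2,1) _ this cstateD(1)[OF \<phi>], of 1] cstateD(2)[OF \<phi>] show ?thesis
      by (simp add: case_prod_unfold o_def)
  qed
  ultimately obtain F where F: "bounded_linear F" "clinear F" "\<And>z. norm (F z) \<le> norm z" "\<And>a b. F (t a b) = \<phi> a *\<^sub>C b"
    using tensor_extend[OF t, of "\<lambda>a b. \<phi> a *\<^sub>C b" 1] by auto
  have "lslice t \<phi> = F" unfolding lslice_def
  proof (rule the_equality)
    show "G = F" if "bounded_linear G \<and> (\<forall>a b. G (t a b) = \<phi> a *\<^sub>C b)" for G
      using tensor_ext[OF t _ F(1), of G] that F(4) by (auto intro!: ext)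
  qed (use F in blast)
  then show "bounded_linear (lslice t \<phi>)" "clinear (lslice t \<phi>)" "norm (lslice t \<phi> z) \<le> norm z"
    "lslice t \<phi> (t a b) = \<phi> a *\<^sub>C b" using F by simp_all
qed

text \<open>Positivity of \<open>z\<^sup>* z\<close> enters only through \<open>\<parallel>c - z\<^sup>* z\<parallel> \<le> c\<close> for \<open>c = \<parallel>z\<parallel>\<^sup>2\<close>, which is read off a
  faithful representation.\<close>

lemma norm_diff_square_le:
  fixes z :: "'a::cstar_algebra"
  assumes \<pi>: "faithful_rep (\<pi> :: 'a \<Rightarrow> ('i \<Rightarrow> complex) \<Rightarrow> 'i \<Rightarrow> complex)" and c: "c = (norm z)\<^sup>2"
  shows "norm (complex_of_real c *\<^sub>C 1 - star z * z) \<le> c"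
proof -
  note s = faithful_rep_star_rep[OF \<pi>]
  define w where "w = complex_of_real c *\<^sub>C 1 - star z * z"
  have c0: "c \<ge> 0" by (simp add: c)
  have rw: "\<pi> w x = complex_of_real c *\<^sub>C x - \<pi> (star z * z) x" if x: "x \<in> ell2" for x
    using rep_add[OF s x, of "complex_of_real c *\<^sub>C 1" "(-1) *\<^sub>C (star z * z)"] rep_scale[OF s x, of "complex_of_real c" 1]
      rep_scale[OF s x, of "-1" "star z * z"] rep_one[OF s x] by (simp add: w_def)
  have sw: "star w = w" by (simp add: w_def star_diff star_scaleC star_mult star_star)
  have pos: "0 \<le> Re (ell2_inner x (\<pi> w x))" "Re (ell2_inner x (\<pi> w x)) \<le> c * (ell2_norm x)\<^sup>2"
    and real: "Im (ell2_inner x (\<pi> w x)) = 0" if x: "x \<in> ell2" for x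
  proof -
    have "\<pi> w x = complex_of_real c *\<^sub>C x + (-1) *\<^sub>C \<pi> (star z * z) x" using rw[OF x] by simp
    then have "ell2_inner x (\<pi> w x) = complex_of_real c * ell2_inner x x - ell2_inner x (\<pi> (star z * z) x)"
      using ell2_inner_add_right[OF x ell2_scale[OF x, of "complex_of_real c"] ell2_scale[OF rep_ell2[OF s x], of "-1" "star z * z"]]
      by (simp only: ell2_inner_scale_right) simp
    also have "\<dots> = complex_of_real (c * (ell2_norm x)\<^sup>2 - (ell2_norm (\<pi> z x))\<^sup>2)"
      by (simp add: ell2_inner_self rep_norm_sq[OF s x, symmetric])
    finally have e: "ell2_inner x (\<pi> w x) = complex_of_real (c * (ell2_norm x)\<^sup>2 - (ell2_norm (\<pi> z x))\<^sup>2)" .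
    have "ell2_norm (\<pi> z x) \<le> norm z * ell2_norm x"
      using op_norm_le[OF rep_bounded[OF s] x, of z] by (simp add: faithful_rep_isometric[OF \<pi>])
    then have "(ell2_norm (\<pi> z x))\<^sup>2 \<le> c * (ell2_norm x)\<^sup>2"
      using power_mono[of _ _ 2] by (fastforce simp: c power_mult_distrib)
    then show "0 \<le> Re (ell2_inner x (\<pi> w x))" "Re (ell2_inner x (\<pi> w x)) \<le> c * (ell2_norm x)\<^sup>2" "Im (ell2_inner x (\<pi> w x)) = 0"
      by (simp_all add: e)
  qed
  have "op_norm (\<pi> w) \<le> c"
  proof (rule op_norm_leI[OF rep_bounded[OF s] _ c0])
    fix y :: "'i \<Rightarrow> complex" assume y: "y \<in> ell2"
    define x where "x = \<pi> w y"
    have x: "x \<in> ell2" by (simp add: x_def rep_ell2[OF s y])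
    define q where "q = ell2_inner x (\<pi> w y)"
    \<comment> \<open>Cauchy-Schwarz for the form sending (x, y) to the inner product of x with
      \<pi>(w) y, positive by \<open>pos\<close>. As x = \<pi>(w) y, the left side is the fourth
      power of the norm of x.\<close>
    have "(cmod q)\<^sup>2 \<le> Re (ell2_inner x (\<pi> w x)) * Re (ell2_inner y (\<pi> w y))"
    proof (rule quadratic_discriminant_bound)
      fix u
      have uy: "u *\<^sub>C y \<in> ell2" "x + u *\<^sub>C y \<in> ell2" using x y by (auto intro: ell2_scale ell2_add)
      have "ell2_inner (x + u *\<^sub>C y) (\<pi> w (x + u *\<^sub>C y)) = ell2_inner x (\<pi> w x) + u * q + cnj u * ell2_inner y (\<pi> w x)
          + cnj u * u * ell2_inner y (\<pi> w y)"
        using x y uy unfolding op_add[OF rep_bounded[OF s] x uy(1)] op_scale[OF rep_bounded[OF s] y]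
        by (simp add: ell2_inner_add_left ell2_inner_add_right ell2_inner_scale_left ell2_inner_scale_right
            rep_ell2[OF s] ell2_scale ell2_add q_def algebra_simps)
      moreover have "ell2_inner y (\<pi> w x) = cnj q"
        using rep_star[OF s y x, of w] by (simp add: q_def sw ell2_inner_cnj)
      moreover have "cnj u * u * ell2_inner y (\<pi> w y) = complex_of_real ((cmod u)\<^sup>2) * ell2_inner y (\<pi> w y)"
        by (metis complex_norm_square mult.commute)
      ultimately have "Re (ell2_inner (x + u *\<^sub>C y) (\<pi> w (x + u *\<^sub>C y)))
          = Re (ell2_inner x (\<pi> w x)) + 2 * Re (u * q) + (cmod u)\<^sup>2 * Re (ell2_inner y (\<pi> w y))"
        by simp
      then show "0 \<le> Re (ell2_inner x (\<pi> w x)) + 2 * Re (u * q) + (cmod u)\<^sup>2 * Re (ell2_inner y (\<pi> w y))"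
        using pos(1)[OF uy(2)] by simp
    qed (rule pos(1)[OF y])
    also have "\<dots> \<le> (c * (ell2_norm x)\<^sup>2) * (c * (ell2_norm y)\<^sup>2)"
      using pos[OF x] pos[OF y] c0 by (intro mult_mono) auto
    finally have "(cmod q)\<^sup>2 \<le> (c * ell2_norm x * ell2_norm y)\<^sup>2" by (simp add: power2_eq_square mult_ac)
    then have "cmod q \<le> c * ell2_norm x * ell2_norm y" by (rule power2_le_imp_le) (simp add: c0)
    moreover have "cmod q = ell2_norm x * ell2_norm x"
      unfolding q_def x_def[symmetric] ell2_inner_self norm_of_real by (simp add: power2_eq_square)
    ultimately have "ell2_norm x * ell2_norm x \<le> ell2_norm x * (c * ell2_norm y)" by (simp add: mult_ac)
    then show "ell2_norm (\<pi> w y) \<le> c * ell2_norm y"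
      using c0 unfolding x_def[symmetric] by (cases "ell2_norm x = 0") (auto simp: less_le)
  qed
  then show ?thesis by (simp add: faithful_rep_isometric[OF \<pi>] w_def)
qed

lemma cstate_pos:
  fixes z :: "'a::cstar_algebra"
  assumes \<pi>: "faithful_rep (\<pi> :: 'a \<Rightarrow> ('i \<Rightarrow> complex) \<Rightarrow> 'i \<Rightarrow> complex)" and \<phi>: "cstate \<phi>"
  shows "Im (\<phi> (star z * z)) = 0" "0 \<le> Re (\<phi> (star z * z))"
proof -
  define c where "c = (norm z)\<^sup>2"
  define p where "p = \<phi> (star z * z)"
  have "\<phi> (complex_of_real c *\<^sub>C 1 - star z * z) = of_real c - p" by (simp add: cstateD[OF \<phi>] p_def)
  then have 1: "cmod (of_real c - p) \<le> c"
    using order_trans[OF cstateD(2)[OF \<phi>] norm_diff_square_le[OF \<pi> c_def]] by metis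
  \<comment> \<open>The disc of radius c around c lies in the right half-plane.\<close>
  then have "\<bar>Re (of_real c - p)\<bar> \<le> c" using abs_Re_le_cmod order_trans by blast
  then show "0 \<le> Re (\<phi> (star z * z))" by (simp add: p_def[symmetric])
  \<comment> \<open>The self-adjoint element \<open>z\<^sup>* z\<close> has real expectation: shift by \<open>i s\<close> and compare norms.\<close>
  have sq: "(Re p)\<^sup>2 + (Im p + s)\<^sup>2 \<le> c\<^sup>2 + s\<^sup>2" for s :: real
  proof -
    let ?m = "\<i> * complex_of_real s" and ?h = "star z * z"
    have sh: "star ?h = ?h" by (simp add: star_mult star_star)
    have "(cmod (\<phi> (?h + ?m *\<^sub>C 1)))\<^sup>2 \<le> (norm (?h + ?m *\<^sub>C 1))\<^sup>2" by (intro power_mono cstateD(2)[OF \<phi>]) simp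
    also have "\<dots> \<le> (norm ?h)\<^sup>2 + s\<^sup>2" by (rule norm_selfadjoint_shift[OF sh])
    also have "norm ?h = c" by (simp add: c_def cstar_identity)
    also have "\<phi> (?h + ?m *\<^sub>C 1) = p + ?m" by (simp add: cstateD[OF \<phi>] p_def)
    finally show ?thesis by (simp add: cmod_power2)
  qed
  have "Im p = 0"
  proof (rule ccontr)
    assume "Im p \<noteq> 0"
    moreover define s where "s = (c\<^sup>2 + 1) / (2 * Im p)"
    ultimately have "2 * Im p * s = c\<^sup>2 + 1" by simp
    moreover have "(Im p)\<^sup>2 + 2 * Im p * s \<le> c\<^sup>2" using sq[of s] zero_le_power2[of "Re p"] unfolding power2_sum by linarith
    ultimately show False using zero_le_power2[of "Im p"] by linarith
  qed
  then show "Im (\<phi> (star z * z)) = 0" by (simp add: p_def)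
qed

text \<open>Polarisation: positivity makes the sum of the mixed terms real for every c, and the
  values c = 1 and c = i decide.\<close>

lemma cstate_hermitian:
  fixes x :: "'a::cstar_algebra"
  assumes \<pi>: "faithful_rep (\<pi> :: 'a \<Rightarrow> ('i \<Rightarrow> complex) \<Rightarrow> 'i \<Rightarrow> complex)" and \<phi>: "cstate \<phi>"
  shows "\<phi> (star y * x) = cnj (\<phi> (star x * y))"
proof -
  note D = cstateD[OF \<phi>]
  have im: "Im (c * \<phi> (star x * y) + cnj c * \<phi> (star y * x)) = 0" for c
  proof -
    have "\<phi> (star (x + c *\<^sub>C y) * (x + c *\<^sub>C y)) = \<phi> (star x * x) + c * \<phi> (star x * y) + cnj c * \<phi> (star y * x)
      + cnj c * c * \<phi> (star y * y)"
      by (simp add: star_add star_scaleC distrib_left distrib_right mult_scaleC_left mult_scaleC_right D scaleC_scaleC algebra_simps)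
    then show ?thesis
      using cstate_pos(1)[OF \<pi> \<phi>, of "x + c *\<^sub>C y"] cstate_pos(1)[OF \<pi> \<phi>, of x] cstate_pos(1)[OF \<pi> \<phi>, of y] by simp
  qed
  show ?thesis using im[of 1] im[of \<i>] by (simp add: complex_eq_iff)
qed

lemma cstate_cauchy_schwarz:
  fixes x :: "'a::cstar_algebra"
  assumes \<pi>: "faithful_rep (\<pi> :: 'a \<Rightarrow> ('i \<Rightarrow> complex) \<Rightarrow> 'i \<Rightarrow> complex)" and \<phi>: "cstate \<phi>"
  shows "(cmod (\<phi> (star x * y)))\<^sup>2 \<le> Re (\<phi> (star x * x)) * Re (\<phi> (star y * y))"
proof (rule quadratic_discriminant_bound)
  fix c
  note D = cstateD[OF \<phi>]
  have "\<phi> (star (x + c *\<^sub>C y) * (x + c *\<^sub>C y)) = \<phi> (star x * x) + c * \<phi> (star x * y) + cnj c * \<phi> (star y * x)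
      + cnj c * c * \<phi> (star y * y)"
    by (simp add: star_add star_scaleC distrib_left distrib_right mult_scaleC_left mult_scaleC_right D scaleC_scaleC algebra_simps)
  moreover have "cnj c * c * \<phi> (star y * y) = complex_of_real ((cmod c)\<^sup>2) * \<phi> (star y * y)"
    by (metis complex_norm_square mult.commute)
  ultimately have "Re (\<phi> (star (x + c *\<^sub>C y) * (x + c *\<^sub>C y)))
    = Re (\<phi> (star x * x)) + 2 * Re (c * \<phi> (star x * y)) + (cmod c)\<^sup>2 * Re (\<phi> (star y * y))"
    using cstate_hermitian[OF \<pi> \<phi>, of y x] by simp
  then show "0 \<le> Re (\<phi> (star x * x)) + 2 * Re (c * \<phi> (star x * y)) + (cmod c)\<^sup>2 * Re (\<phi> (star y * y))"
    using cstate_pos(2)[OF \<pi> \<phi>, of "x + c *\<^sub>C y"] by simp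
qed (rule cstate_pos(2)[OF \<pi> \<phi>])

text \<open>Normalised vector functionals of a faithful representation are states. If all of them
  vanish at a, polarisation makes every matrix coefficient of \<pi>(a) zero.\<close>

lemma cstates_separate:
  fixes a :: "'a::cstar_algebra"
  assumes \<pi>: "faithful_rep (\<pi> :: 'a \<Rightarrow> ('i \<Rightarrow> complex) \<Rightarrow> 'i \<Rightarrow> complex)"
    and z: "\<And>\<phi>. cstate \<phi> \<Longrightarrow> \<phi> a = 0"
  shows "a = 0"
proof -
  note s = faithful_rep_star_rep[OF \<pi>]
  have q: "ell2_inner x (\<pi> a x) = 0" if x: "x \<in> ell2" for x
  proof (cases "ell2_norm x = 0")
    case True
    then show ?thesis using ell2_norm_eq_0[OF x] by simp
  next
    case False
    define n where "n = ell2_norm x"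
    have n: "n > 0" using False ell2_norm_nonneg[of x] by (simp add: n_def less_le)
    define \<phi> where "\<phi> b = complex_of_real (1 / n\<^sup>2) * ell2_inner x (\<pi> b x)" for b
    have "cstate \<phi>"
      unfolding cstate_def
    proof (intro conjI allI)
      show "clinear \<phi>"
        by (rule clinearI) (simp_all add: \<phi>_def rep_add[OF s x] rep_scale[OF s x] ell2_inner_add_right[OF x rep_ell2[OF s x] rep_ell2[OF s x]]
            ell2_inner_scale_right scaleC_complex_def distrib_left mult.left_commute)
      show "\<phi> 1 = 1" using n by (simp add: \<phi>_def rep_one[OF s x] ell2_inner_self n_def[symmetric])
      fix b
      have "cmod (ell2_inner x (\<pi> b x)) \<le> n * (norm b * n)"
        using ell2_cauchy_schwarz[OF x rep_ell2[OF s x], of b] op_norm_le[OF rep_bounded[OF s] x, of b]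
          mult_left_mono[of _ _ n] n unfolding n_def[symmetric] faithful_rep_isometric[OF \<pi>] by (meson order_trans less_imp_le)
      then show "cmod (\<phi> b) \<le> norm b"
        using n by (simp add: \<phi>_def norm_mult norm_divide norm_power power2_eq_square divide_simps mult_ac)
    qed
    then have "\<phi> a = 0" by (rule z)
    then show ?thesis using n by (simp add: \<phi>_def)
  qed
  have "\<pi> a y = 0" if y: "y \<in> ell2" for y
  proof -
    have "ell2_inner x (\<pi> a y) = 0" if x: "x \<in> ell2" for x
    proof -
      have e: "c * ell2_inner x (\<pi> a y) + cnj c * ell2_inner y (\<pi> a x) = 0" for c
      proof -
        have cy: "c *\<^sub>C y \<in> ell2" by (rule ell2_scale[OF y])
        have "ell2_inner (x + c *\<^sub>C y) (\<pi> a (x + c *\<^sub>C y)) = ell2_inner x (\<pi> a x) + c * ell2_inner x (\<pi> a y)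
          + cnj c * ell2_inner y (\<pi> a x) + cnj c * c * ell2_inner y (\<pi> a y)"
          using x y cy unfolding op_add[OF rep_bounded[OF s] x cy] op_scale[OF rep_bounded[OF s] y]
          by (simp add: ell2_inner_add_left ell2_inner_add_right ell2_inner_scale_left ell2_inner_scale_right
              rep_ell2[OF s] ell2_scale ell2_add algebra_simps)
        then show ?thesis using q[OF x] q[OF y] q[OF ell2_add[OF x cy]] by simp
      qed
      have "2 * ell2_inner x (\<pi> a y) = 0" using e[of 1] e[of \<i>] by (simp add: complex_eq_iff)
      then show ?thesis by simp
    qed
    from this[OF rep_ell2[OF s y, of a]] have "ell2_norm (\<pi> a y) = 0" by (simp add: ell2_inner_self)
    then show ?thesis by (rule ell2_norm_eq_0[OF rep_ell2[OF s y]])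
  qed
  then show ?thesis using \<pi> by (auto simp: faithful_rep_def)
qed

lemma cstar_hom_id: "cstar_hom id"
  by (auto simp: cstar_hom_def intro!: clinearI)

lemma min_tensor_faithful:
  assumes "min_tensor (t :: 'a::cstar_algebra \<Rightarrow> 'b::cstar_algebra \<Rightarrow> 'c::cstar_algebra)"
  shows "\<exists>\<pi> :: 'a \<Rightarrow> ('a \<Rightarrow> complex) \<Rightarrow> 'a \<Rightarrow> complex. faithful_rep \<pi>"
    "\<exists>\<rho> :: 'b \<Rightarrow> ('b \<Rightarrow> complex) \<Rightarrow> 'b \<Rightarrow> complex. faithful_rep \<rho>"
  using min_tensor_norm[OF assms] by metis+

context
  fixes t :: "'a::cstar_algebra \<Rightarrow> 'b::cstar_algebra \<Rightarrow> 'c::cstar_algebra"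
  assumes t: "min_tensor t"
begin

lemma rslice_mult_left: assumes "cstate \<phi>" shows "rslice t \<phi> (t a 1 * z) = a * rslice t \<phi> z"
  by (rule tensor_ext[OF t, where z = z and F = "\<lambda>z. rslice t \<phi> (t a 1 * z)" and G = "\<lambda>z. a * rslice t \<phi> z",
        OF bounded_linear_compose[OF rslice(1)[OF t assms] bounded_linear_mult_right]
          bounded_linear_compose[OF bounded_linear_mult_right rslice(1)[OF t assms]]])
    (simp add: min_tensor_mult[OF t] rslice(4)[OF t assms] mult_scaleC_right)

lemma rslice_mult_right: assumes "cstate \<phi>" shows "rslice t \<phi> (z * t a 1) = rslice t \<phi> z * a"
  by (rule tensor_ext[OF t, where z = z and F = "\<lambda>z. rslice t \<phi> (z * t a 1)" and G = "\<lambda>z. rslice t \<phi> z * a",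
        OF bounded_linear_compose[OF rslice(1)[OF t assms] bounded_linear_mult_left]
          bounded_linear_compose[OF bounded_linear_mult_left rslice(1)[OF t assms]]])
    (simp add: min_tensor_mult[OF t] rslice(4)[OF t assms] mult_scaleC_left)

lemma rslice_star: assumes "cstate \<phi>" shows "rslice t \<phi> (star z) = star (rslice t \<phi> z)"
proof (rule tensor_ext[OF t, where z = z and F = "\<lambda>z. rslice t \<phi> (star z)" and G = "\<lambda>z. star (rslice t \<phi> z)",
        OF bounded_linear_compose[OF rslice(1)[OF t assms] bounded_linear_star]
          bounded_linear_compose[OF bounded_linear_star rslice(1)[OF t assms]]])
  fix a b
  obtain \<rho> :: "'b \<Rightarrow> ('b \<Rightarrow> complex) \<Rightarrow> 'b \<Rightarrow> complex" where "faithful_rep \<rho>" using min_tensor_faithful(2)[OF t] by blast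
  from cstate_hermitian[OF this assms, of b 1] have "\<phi> (star b) = cnj (\<phi> b)" by simp
  then show "rslice t \<phi> (star (t a b)) = star (rslice t \<phi> (t a b))"
    by (simp add: min_tensor_star[OF t] rslice(4)[OF t assms] star_scaleC)
qed

lemma rslice_one: "cstate \<phi> \<Longrightarrow> rslice t \<phi> 1 = 1"
  using rslice(4)[OF t, of \<phi> 1 1] by (simp add: min_tensor_one[OF t] cstateD)

lemma cstate_rslice: assumes \<phi>: "cstate \<phi>" and \<psi>: "cstate \<psi>" shows "cstate (\<lambda>z. \<phi> (rslice t \<psi> z))"
  unfolding cstate_def
proof (intro conjI allI clinearI)
  show "\<phi> (rslice t \<psi> (x + y)) = \<phi> (rslice t \<psi> x) + \<phi> (rslice t \<psi> y)" for x y
    by (simp add: complex_vector.linear_add[OF rslice(2)[OF t \<psi>]] cstateD[OF \<phi>])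
  show "\<phi> (rslice t \<psi> (c *\<^sub>C x)) = c *\<^sub>C \<phi> (rslice t \<psi> x)" for c x
    by (simp add: complex_vector.linear_scale[OF rslice(2)[OF t \<psi>]] cstateD[OF \<phi>] scaleC_complex_def)
  show "cmod (\<phi> (rslice t \<psi> a)) \<le> norm a" for a
    by (rule order_trans[OF cstateD(2)[OF \<phi>] rslice(3)[OF t \<psi>]])
  show "\<phi> (rslice t \<psi> 1) = 1" by (simp add: rslice_one[OF \<psi>] cstateD[OF \<phi>])
qed

lemma slice_slice: assumes \<phi>: "cstate \<phi>" and \<psi>: "cstate \<psi>" shows "\<phi> (rslice t \<psi> z) = \<psi> (lslice t \<phi> z)"
  by (rule tensor_ext[OF t, where z = z and F = "\<lambda>z. \<phi> (rslice t \<psi> z)" and G = "\<lambda>z. \<psi> (lslice t \<phi> z)",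
        OF bounded_linear_compose[OF cstateD(4)[OF \<phi>] rslice(1)[OF t \<psi>]]
          bounded_linear_compose[OF cstateD(4)[OF \<psi>] lslice(1)[OF t \<phi>]]])
    (simp add: rslice(4)[OF t \<psi>] lslice(4)[OF t \<phi>] cstateD[OF \<phi>] cstateD[OF \<psi>] mult.commute)

lemma rslice_combination:
  assumes \<phi>: "\<And>k. k \<in> K \<Longrightarrow> cstate (\<phi> k)" and \<psi>: "cstate (\<lambda>b. \<Sum>k\<in>K. c k * \<phi> k b)"
  shows "rslice t (\<lambda>b. \<Sum>k\<in>K. c k * \<phi> k b) z = (\<Sum>k\<in>K. c k *\<^sub>C rslice t (\<phi> k) z)"
proof (rule tensor_ext[OF t rslice(1)[OF t \<psi>], where z = z and G = "\<lambda>z. \<Sum>k\<in>K. c k *\<^sub>C rslice t (\<phi> k) z"])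
  show "bounded_linear (\<lambda>z. \<Sum>k\<in>K. c k *\<^sub>C rslice t (\<phi> k) z)"
    by (rule bounded_linear_sum) (rule bounded_linear_compose[OF bounded_linear_scaleC rslice(1)[OF t \<phi>]])
  fix a b
  show "rslice t (\<lambda>b. \<Sum>k\<in>K. c k * \<phi> k b) (t a b) = (\<Sum>k\<in>K. c k *\<^sub>C rslice t (\<phi> k) (t a b))"
    by (simp add: rslice(4)[OF t \<psi>] rslice(4)[OF t \<phi>] scaleC_scaleC complex_vector.scale_sum_left)
qed

end

section \<open>Coactions\<close>

text \<open>The functional \<phi> acts on A by (id \<otimes> \<phi>)\<delta>. For \<delta> =
  \<Delta>, following the action of \<psi> by \<phi> is the convolution product of \<phi> and
  \<psi>, and convolution is always written in this way.\<close>

definition act :: "('a::cstar_algebra \<Rightarrow> 'b::cstar_algebra \<Rightarrow> 'c::cstar_algebra) \<Rightarrow> ('a \<Rightarrow> 'c) \<Rightarrow> ('b \<Rightarrow> complex) \<Rightarrow> 'a \<Rightarrow> 'a"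
  where "act s \<delta> \<phi> a = rslice s \<phi> (\<delta> a)"

context
  fixes t :: "'h::cstar_algebra \<Rightarrow> 'h \<Rightarrow> 'hh::cstar_algebra" and \<Delta> :: "'h \<Rightarrow> 'hh"
    and s :: "'a::cstar_algebra \<Rightarrow> 'h \<Rightarrow> 'ah::cstar_algebra" and s' :: "'ah \<Rightarrow> 'h \<Rightarrow> 'ahh::cstar_algebra"
    and s'' :: "'a \<Rightarrow> 'hh \<Rightarrow> 'ahh" and \<delta> :: "'a \<Rightarrow> 'ah"
  assumes coact: "coaction t \<Delta> s s' s'' \<delta>" and hom\<Delta>: "cstar_hom \<Delta>"
begin

lemma coact_tensors: "min_tensor s" "min_tensor s'" "min_tensor t" "min_tensor s''"
  using coact by (simp_all add: coaction_def min_tensor3_def)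

lemma coact_assoc: "s' (s a b) c = s'' a (t b c)"
  using coact by (simp add: coaction_def min_tensor3_def)

lemma coact_hom: "cstar_hom \<delta>"
  using coact by (simp add: coaction_def)

lemma coact_map_right: "cstar_hom (min_tensor_map s s'' id \<Delta>)" "min_tensor_map s s'' id \<Delta> (s a b) = s'' a (\<Delta> b)"
  using min_tensor_map[OF coact_tensors(1,4) cstar_hom_id hom\<Delta>] by simp_all

lemma coact_map_left: "cstar_hom (min_tensor_map s s' \<delta> id)" "min_tensor_map s s' \<delta> id (s a b) = s' (\<delta> a) b"
  using min_tensor_map[OF coact_tensors(1,2) coact_hom cstar_hom_id] by simp_all

lemma coact_coassoc: "min_tensor_map s s' \<delta> id (\<delta> a) = min_tensor_map s s'' id \<Delta> (\<delta> a)"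
  using coact by (simp add: coaction_def fun_eq_iff)

text \<open>Slicing the last leg in either bracketing of the threefold tensor product.\<close>

lemma slice_outer:
  assumes \<psi>: "cstate \<psi>" shows "rslice s' \<psi> (s'' a w) = s a (rslice t \<psi> w)"
proof (rule tensor_ext[OF coact_tensors(3), where z = w and F = "\<lambda>w. rslice s' \<psi> (s'' a w)" and G = "\<lambda>w. s a (rslice t \<psi> w)"])
  have bl: "bounded_linear (u a)" if u: "min_tensor u" for u :: "'x::cstar_algebra \<Rightarrow> 'y::cstar_algebra \<Rightarrow> 'z::cstar_algebra" and a
  proof -
    note b = min_tensor_cbilinear[OF u]
    obtain \<pi> :: "'x \<Rightarrow> ('x \<Rightarrow> complex) \<Rightarrow> 'x \<Rightarrow> complex" and \<rho> :: "'y \<Rightarrow> ('y \<Rightarrow> complex) \<Rightarrow> 'y \<Rightarrow> complex"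
      where "faithful_rep \<pi>" using min_tensor_norm[OF u] by metis
    have h: "cstar_hom (u 1)"
      unfolding cstar_hom_def
      by (auto intro!: clinearI simp: cbilinear_add_right[OF b] cbilinear_scaleC_right[OF b] min_tensor_mult[OF u] min_tensor_star[OF u] min_tensor_one[OF u])
    have "bounded_linear (\<lambda>y. u a 1 * u 1 y)"
      by (rule bounded_linear_compose[OF bounded_linear_mult_right cstar_hom_bounded_linear[OF h]])
    then show ?thesis by (simp add: min_tensor_mult[OF u])
  qed
  show "bounded_linear (\<lambda>w. rslice s' \<psi> (s'' a w))"
    by (rule bounded_linear_compose[OF rslice(1)[OF coact_tensors(2) \<psi>] bl[OF coact_tensors(4)]])
  show "bounded_linear (\<lambda>w. s a (rslice t \<psi> w))"
    by (rule bounded_linear_compose[OF bl[OF coact_tensors(1)] rslice(1)[OF coact_tensors(3) \<psi>]])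
  show "rslice s' \<psi> (s'' a (t b c)) = s a (rslice t \<psi> (t b c))" for b c
    by (simp add: coact_assoc[symmetric] rslice(4)[OF coact_tensors(2) \<psi>] rslice(4)[OF coact_tensors(3) \<psi>]
        cbilinear_scaleC_right[OF min_tensor_cbilinear[OF coact_tensors(1)]])
qed

lemma cstate_conv: assumes "cstate \<phi>" "cstate \<psi>" shows "cstate (\<lambda>b. \<phi> (act t \<Delta> \<psi> b))"
proof -
  note st = cstate_rslice[OF coact_tensors(3) assms]
  show ?thesis
    unfolding cstate_def
  proof (intro conjI allI clinearI)
    show "\<phi> (act t \<Delta> \<psi> (x + y)) = \<phi> (act t \<Delta> \<psi> x) + \<phi> (act t \<Delta> \<psi> y)" for x y
      using cstateD(5)[OF st] by (simp add: act_def complex_vector.linear_add[OF cstar_hom_clinear[OF hom\<Delta>]])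
    show "\<phi> (act t \<Delta> \<psi> (c *\<^sub>C x)) = c *\<^sub>C \<phi> (act t \<Delta> \<psi> x)" for c x
      using cstateD(6)[OF st] by (simp add: act_def complex_vector.linear_scale[OF cstar_hom_clinear[OF hom\<Delta>]] scaleC_complex_def)
    show "cmod (\<phi> (act t \<Delta> \<psi> a)) \<le> norm a" for a
      using order_trans[OF cstateD(2)[OF st] cstar_hom_contractive[OF hom\<Delta>]] by (simp add: act_def)
    show "\<phi> (act t \<Delta> \<psi> 1) = 1" using cstateD(3)[OF st] by (simp add: act_def cstar_hom_one[OF hom\<Delta>])
  qed
qed

lemma slice_map_left:
  assumes \<psi>: "cstate \<psi>" shows "rslice s' \<psi> (min_tensor_map s s' \<delta> id z) = \<delta> (rslice s \<psi> z)"
  by (rule tensor_ext[OF coact_tensors(1), where z = z and F = "\<lambda>z. rslice s' \<psi> (min_tensor_map s s' \<delta> id z)"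
        and G = "\<lambda>z. \<delta> (rslice s \<psi> z)",
        OF bounded_linear_compose[OF rslice(1)[OF coact_tensors(2) \<psi>] cstar_hom_bounded_linear[OF coact_map_left(1)]]
          bounded_linear_compose[OF cstar_hom_bounded_linear[OF coact_hom] rslice(1)[OF coact_tensors(1) \<psi>]]])
    (simp add: coact_map_left(2) rslice(4)[OF coact_tensors(2) \<psi>] rslice(4)[OF coact_tensors(1) \<psi>]
      complex_vector.linear_scale[OF cstar_hom_clinear[OF coact_hom]])

lemma slice_map_right:
  assumes \<phi>: "cstate \<phi>" and \<psi>: "cstate \<psi>"
  shows "rslice s \<phi> (rslice s' \<psi> (min_tensor_map s s'' id \<Delta> z)) = rslice s (\<lambda>b. \<phi> (act t \<Delta> \<psi> b)) z"
  by (rule tensor_ext[OF coact_tensors(1), where z = z and F = "\<lambda>z. rslice s \<phi> (rslice s' \<psi> (min_tensor_map s s'' id \<Delta> z))",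
        OF bounded_linear_compose[OF rslice(1)[OF coact_tensors(1) \<phi>] bounded_linear_compose[OF
            rslice(1)[OF coact_tensors(2) \<psi>] cstar_hom_bounded_linear[OF coact_map_right(1)]]]
          rslice(1)[OF coact_tensors(1) cstate_conv[OF \<phi> \<psi>]]])
    (simp add: coact_map_right(2) slice_outer[OF \<psi>] rslice(4)[OF coact_tensors(1) \<phi>]
      rslice(4)[OF coact_tensors(1) cstate_conv[OF \<phi> \<psi>]] act_def[of t \<Delta>, symmetric])

text \<open>Coassociativity of \<delta>, sliced in both H-legs.\<close>

lemma act_act:
  assumes \<phi>: "cstate \<phi>" and \<psi>: "cstate \<psi>"
  shows "act s \<delta> \<phi> (act s \<delta> \<psi> a) = act s \<delta> (\<lambda>b. \<phi> (act t \<Delta> \<psi> b)) a"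
  by (simp only: act_def[of s \<delta>] slice_map_left[OF \<psi>, symmetric] coact_coassoc slice_map_right[OF \<phi> \<psi>])

lemma act_contractive: "cstate \<phi> \<Longrightarrow> norm (act s \<delta> \<phi> a) \<le> norm a"
  unfolding act_def using order_trans[OF rslice(3)[OF coact_tensors(1)] cstar_hom_contractive[OF coact_hom]] .

lemma act_clinear: assumes "cstate \<phi>" shows "clinear (act s \<delta> \<phi>)"
  by (rule clinearI) (simp_all add: act_def complex_vector.linear_add[OF cstar_hom_clinear[OF coact_hom]]
      complex_vector.linear_scale[OF cstar_hom_clinear[OF coact_hom]]
      complex_vector.linear_add[OF rslice(2)[OF coact_tensors(1) assms]]
      complex_vector.linear_scale[OF rslice(2)[OF coact_tensors(1) assms]])

end

section \<open>The Haar state\<close>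

lemma cqg_coaction:
  assumes "compact_quantum_group t t' t'' \<Delta>" shows "coaction t \<Delta> t t' t'' \<Delta>" "cstar_hom \<Delta>"
  using assms by (auto simp: compact_quantum_group_def coaction_def)

lemma cstate_average:
  assumes K: "finite K" "K \<noteq> {}" and \<phi>: "\<And>k. k \<in> K \<Longrightarrow> cstate (\<phi> k)"
  shows "cstate (\<lambda>b. \<Sum>k\<in>K. (1 / of_nat (card K)) * \<phi> k b)"
  unfolding cstate_def
proof (intro conjI allI clinearI)
  have c: "of_nat (card K) \<noteq> (0::complex)" using K by simp
  show "(\<Sum>k\<in>K. (1 / of_nat (card K)) * \<phi> k (x + y)) = (\<Sum>k\<in>K. (1 / of_nat (card K)) * \<phi> k x) + (\<Sum>k\<in>K. (1 / of_nat (card K)) * \<phi> k y)" for x y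
    unfolding sum.distrib[symmetric] by (rule sum.cong) (simp_all add: cstateD[OF \<phi>] distrib_left add_divide_distrib)
  show "(\<Sum>k\<in>K. (1 / of_nat (card K)) * \<phi> k (c *\<^sub>C x)) = c *\<^sub>C (\<Sum>k\<in>K. (1 / of_nat (card K)) * \<phi> k x)" for c x
    unfolding scaleC_complex_def sum_distrib_left by (rule sum.cong) (simp_all add: cstateD[OF \<phi>])
  show "(\<Sum>k\<in>K. (1 / of_nat (card K)) * \<phi> k 1) = 1" using c by (simp add: cstateD[OF \<phi>])
  fix a
  have "cmod (\<Sum>k\<in>K. (1 / of_nat (card K)) * \<phi> k a) \<le> (\<Sum>k\<in>K. (1 / real (card K)) * norm a)"
    by (rule sum_norm_le) (simp add: norm_mult norm_divide cstateD(2)[OF \<phi>] divide_right_mono)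
  also have "\<dots> = norm a" using K by simp
  finally show "cmod (\<Sum>k\<in>K. (1 / of_nat (card K)) * \<phi> k a) \<le> norm a" .
qed

context
  fixes t :: "'h::cstar_algebra \<Rightarrow> 'h \<Rightarrow> 'hh::cstar_algebra" and t' :: "'hh \<Rightarrow> 'h \<Rightarrow> 'hhh::cstar_algebra"
    and t'' :: "'h \<Rightarrow> 'hh \<Rightarrow> 'hhh" and \<Delta> :: "'h \<Rightarrow> 'hh"
  assumes cqg: "compact_quantum_group t t' t'' \<Delta>"
begin

lemmas coaction_self = cqg_coaction[OF cqg]
lemmas self_tensors = coact_tensors[OF coaction_self]

text \<open>The argument of Maes and Van Daele: for a state \<open>\<omega>\<close> with \<open>h * \<omega> = \<omega> * h = h\<close> and
  \<open>b = (id \<otimes> h)\<Delta>(a)\<close>, the element \<open>\<Delta>(b) - b \<otimes> 1\<close> vanishes in the GNS space of \<open>h \<otimes> \<omega>\<close>, hence in that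
  of \<open>h \<otimes> \<rho>\<close> for \<open>\<rho> \<le> c \<omega>\<close>. Here the equalities hold up to \<open>\<eta>\<close>, as they do for \<open>h\<close> a Cesaro mean
  of convolution powers of \<open>\<omega>\<close>.\<close>

lemma almost_invariant_defect:
  assumes \<Omega>: "finite \<Omega>" "\<And>\<rho>. \<rho> \<in> \<Omega> \<Longrightarrow> cstate \<rho>" and \<rho>: "\<rho> \<in> \<Omega>" and h: "cstate h"
    and \<omega>: "\<omega> = (\<lambda>b. \<Sum>\<rho>\<in>\<Omega>. (1 / of_nat (card \<Omega>)) * \<rho> b)"
    and b: "norm (act t \<Delta> \<omega> b - b) \<le> \<eta> * M" and bM: "norm b \<le> M"
    and hb: "\<And>x. cmod (h (act t \<Delta> \<omega> x) - h x) \<le> \<eta> * norm x" and \<eta>: "\<eta> \<ge> 0"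
  shows "cmod (h (rslice t \<rho> (t c 1 * (\<Delta> b - t b 1)))) \<le> norm (t c 1) * sqrt (real (card \<Omega>) * (3 * \<eta> * M\<^sup>2))"
proof -
  have \<omega>s: "cstate \<omega>" unfolding \<omega> using \<Omega> \<rho> by (intro cstate_average) auto
  define Z where "Z = \<Delta> b - t b 1"
  define T where "T = act t \<Delta> \<omega>"
  obtain \<pi> :: "'hh \<Rightarrow> ('hh \<Rightarrow> complex) \<Rightarrow> 'hh \<Rightarrow> complex" where \<pi>: "faithful_rep \<pi>"
    using min_tensor_faithful(2)[OF self_tensors(4)] by blast
  have M: "M \<ge> 0" using bM norm_ge_zero order_trans by blast
  have pos: "0 \<le> Re (h (rslice t \<sigma> (star Z * Z)))" if "\<sigma> \<in> \<Omega>" for \<sigma>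
    using cstate_pos(2)[OF \<pi> cstate_rslice[OF self_tensors(1) h \<Omega>(2)[OF that]]] .
  have ZZ: "star Z * Z = \<Delta> (star b * b) - \<Delta> (star b) * t b 1 - t (star b) 1 * \<Delta> b + t (star b * b) 1"
    by (simp add: Z_def star_diff min_tensor_star[OF self_tensors(1)] cstar_hom_star[OF coaction_self(2), symmetric] cstar_hom_mult[OF coaction_self(2)]
        min_tensor_mult[OF self_tensors(1), symmetric] algebra_simps) (simp add: min_tensor_mult[OF self_tensors(1)])
  note rlin = rslice(2)[OF self_tensors(1) \<omega>s]
  have "rslice t \<omega> (star Z * Z) = T (star b * b) - star (T b) * b - star b * T b + star b * b"
    unfolding ZZ T_def act_def
    by (simp add: complex_vector.linear_add[OF rlin] complex_vector.linear_diff[OF rlin]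
        rslice_mult_left[OF self_tensors(1) \<omega>s] rslice_mult_right[OF self_tensors(1) \<omega>s] rslice(4)[OF self_tensors(1) \<omega>s] cstateD(3)[OF \<omega>s]
        cstar_hom_star[OF coaction_self(2)] rslice_star[OF self_tensors(1) \<omega>s])
  \<comment> \<open>Written with the difference T b - b and the invariance defect of h, so that each
    of the three terms contributes at most \<eta> M^2.\<close>
  also have "\<dots> = (T (star b * b) - star b * b) - star (T b - b) * b - star b * (T b - b)"
    by (simp add: star_diff algebra_simps)
  finally have e: "h (rslice t \<omega> (star Z * Z)) = (h (T (star b * b)) - h (star b * b)) - h (star (T b - b) * b) - h (star b * (T b - b))"
    by (simp add: cstateD[OF h])
  have "cmod (h (T (star b * b)) - h (star b * b)) \<le> \<eta> * M\<^sup>2"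
  proof -
    have "norm (star b * b) \<le> M\<^sup>2" using power_mono[OF bM, of 2] by (simp add: cstar_identity)
    then show ?thesis using hb[of "star b * b"] mult_left_mono[OF _ \<eta>] order_trans unfolding T_def by blast
  qed
  moreover have "cmod (h (star (T b - b) * b)) \<le> \<eta> * M\<^sup>2"
  proof -
    have "cmod (h (star (T b - b) * b)) \<le> norm (star (T b - b)) * norm b"
      by (rule order_trans[OF cstateD(2)[OF h] norm_mult_ineq])
    also have "\<dots> \<le> (\<eta> * M) * M" using b bM \<eta> M unfolding T_def by (intro mult_mono) (auto)
    finally show ?thesis by (simp add: power2_eq_square)
  qed
  moreover have "cmod (h (star b * (T b - b))) \<le> \<eta> * M\<^sup>2"
  proof -
    have "cmod (h (star b * (T b - b))) \<le> norm (star b) * norm (T b - b)"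
      by (rule order_trans[OF cstateD(2)[OF h] norm_mult_ineq])
    also have "\<dots> \<le> M * (\<eta> * M)" using b bM \<eta> M unfolding T_def by (intro mult_mono) (auto)
    finally show ?thesis by (simp add: power2_eq_square mult_ac)
  qed
  ultimately have bound\<omega>: "cmod (h (rslice t \<omega> (star Z * Z))) \<le> 3 * \<eta> * M\<^sup>2"
    unfolding e
    using norm_triangle_ineq4[of "(h (T (star b * b)) - h (star b * b)) - h (star (T b - b) * b)" "h (star b * (T b - b))"]
      norm_triangle_ineq4[of "h (T (star b * b)) - h (star b * b)" "h (star (T b - b) * b)"] by linarith
  \<comment> \<open>\<omega> is the average over \<Omega>, and every \<sigma> takes a nonnegative
    value on \<open>star Z * Z\<close>; so \<rho> is dominated there by card \<Omega> times
    \<omega>.\<close>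
  have "rslice t \<omega> (star Z * Z) = (\<Sum>\<sigma>\<in>\<Omega>. (1 / of_nat (card \<Omega>)) *\<^sub>C rslice t \<sigma> (star Z * Z))"
    unfolding \<omega> by (rule rslice_combination[OF self_tensors(1) \<Omega>(2)]) (use \<omega>s in \<open>simp_all add: \<omega>\<close>)
  then have "h (rslice t \<omega> (star Z * Z)) = (\<Sum>\<sigma>\<in>\<Omega>. h (rslice t \<sigma> (star Z * Z))) / of_nat (card \<Omega>)"
    by (simp add: complex_vector.linear_sum[OF cstateD(1)[OF h]] cstateD(6)[OF h] sum_divide_distrib)
  then have "of_nat (card \<Omega>) * h (rslice t \<omega> (star Z * Z)) = (\<Sum>\<sigma>\<in>\<Omega>. h (rslice t \<sigma> (star Z * Z)))"
    using \<Omega>(1) \<rho> by auto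
  then have "real (card \<Omega>) * Re (h (rslice t \<omega> (star Z * Z))) = (\<Sum>\<sigma>\<in>\<Omega>. Re (h (rslice t \<sigma> (star Z * Z))))"
    by (drule_tac arg_cong[where f = Re]) simp
  also have "\<dots> \<ge> Re (h (rslice t \<rho> (star Z * Z)))"
    by (rule member_le_sum[OF \<rho>]) (use pos \<Omega> in auto)
  finally have "Re (h (rslice t \<rho> (star Z * Z))) \<le> real (card \<Omega>) * Re (h (rslice t \<omega> (star Z * Z)))" .
  also have "\<dots> \<le> real (card \<Omega>) * (3 * \<eta> * M\<^sup>2)"
    using bound\<omega> complex_Re_le_cmod order_trans by (intro mult_left_mono) (blast, simp)
  finally have r: "Re (h (rslice t \<rho> (star Z * Z))) \<le> real (card \<Omega>) * (3 * \<eta> * M\<^sup>2)" .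
  have hs: "cstate (\<lambda>z. h (rslice t \<rho> z))" by (rule cstate_rslice[OF self_tensors(1) h \<Omega>(2)[OF \<rho>]])
  \<comment> \<open>Cauchy-Schwarz against c \<otimes> 1 passes from \<open>star Z * Z\<close> to Z
    itself.\<close>
  define x where "x = star (t c 1)"
  have "(cmod (h (rslice t \<rho> (star x * Z))))\<^sup>2 \<le> Re (h (rslice t \<rho> (star x * x))) * Re (h (rslice t \<rho> (star Z * Z)))"
    by (rule cstate_cauchy_schwarz[OF \<pi> hs])
  also have "\<dots> \<le> (norm (t c 1))\<^sup>2 * (real (card \<Omega>) * (3 * \<eta> * M\<^sup>2))"
  proof (rule mult_mono[OF _ r])
    have "Re (h (rslice t \<rho> (star x * x))) \<le> norm (star x * x)"
      by (rule order_trans[OF complex_Re_le_cmod cstateD(2)[OF hs]])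
    then show "Re (h (rslice t \<rho> (star x * x))) \<le> (norm (t c 1))\<^sup>2" by (simp add: cstar_identity x_def)
  qed (use pos[OF \<rho>] in auto)
  finally have "(cmod (h (rslice t \<rho> (star x * Z))))\<^sup>2 \<le> (norm (t c 1) * sqrt (real (card \<Omega>) * (3 * \<eta> * M\<^sup>2)))\<^sup>2"
    using \<eta> by (simp add: power_mult_distrib)
  then have "cmod (h (rslice t \<rho> (star x * Z))) \<le> norm (t c 1) * sqrt (real (card \<Omega>) * (3 * \<eta> * M\<^sup>2))"
    by (rule power2_le_imp_le) (use \<eta> in auto)
  then show ?thesis by (simp add: x_def star_star Z_def)
qed

text \<open>h is the mean of the first n convolution powers of \<omega>. Both invariance defects
  telescope and leave two boundary terms, hence 2/n.\<close>

lemma cesaro_state: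
  assumes \<omega>: "cstate \<omega>" and n: "n > 0"
  shows "\<exists>h. cstate h \<and> (\<forall>x. cmod (h (act t \<Delta> \<omega> x) - h x) \<le> 2 / real n * norm x)
    \<and> (\<forall>a. norm (act t \<Delta> \<omega> (act t \<Delta> h a) - act t \<Delta> h a) \<le> 2 / real n * norm a)"
proof -
  define T where "T = act t \<Delta> \<omega>"
  \<comment> \<open>\<open>\<phi> k\<close> is the convolution power of order k + 1.\<close>
  define \<phi> where "\<phi> k = (\<lambda>b. \<omega> ((T ^^ k) b))" for k
  have \<phi>S: "\<phi> (Suc k) = (\<lambda>b. \<phi> k (act t \<Delta> \<omega> b))" for k
    by (simp add: \<phi>_def T_def funpow_Suc_right del: funpow.simps)
  have \<phi>: "cstate (\<phi> k)" for k
  proof (induction k)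
    case (Suc k)
    then show ?case unfolding \<phi>S by (rule cstate_conv[OF coaction_self _ \<omega>])
  qed (simp add: \<phi>_def \<omega>)
  have act\<phi>: "act t \<Delta> (\<phi> k) a = (T ^^ Suc k) a" for k a
  proof (induction k arbitrary: a)
    case (Suc k)
    have "act t \<Delta> (\<phi> (Suc k)) a = act t \<Delta> (\<phi> k) (act t \<Delta> \<omega> a)"
      unfolding \<phi>S by (rule act_act[OF coaction_self \<phi> \<omega>, symmetric])
    also have "\<dots> = (T ^^ Suc k) (T a)" unfolding Suc T_def ..
    finally show ?case by (simp add: funpow_swap1)
  qed (simp add: \<phi>_def T_def)
  have Tb: "norm ((T ^^ k) a) \<le> norm a" for k a
    by (induction k) (auto simp: T_def intro: order_trans[OF act_contractive[OF coaction_self \<omega>]])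
  define h where "h = (\<lambda>b. \<Sum>k<n. (1 / of_nat (card {..<n})) * \<phi> k b)"
  have h: "cstate h" unfolding h_def by (rule cstate_average) (use n \<phi> in auto)
  have acth: "act t \<Delta> h a = (\<Sum>k<n. (1 / of_nat n) *\<^sub>C (T ^^ Suc k) a)" for a
  proof -
    have "act t \<Delta> h a = (\<Sum>k<n. (1 / of_nat (card {..<n})) *\<^sub>C rslice t (\<phi> k) (\<Delta> a))"
      unfolding act_def h_def by (rule rslice_combination[OF self_tensors(1) \<phi>]) (use h in \<open>simp add: h_def\<close>)
    then show ?thesis by (simp add: act_def[symmetric] act\<phi> del: funpow.simps)
  qed
  have "cmod (h (T x) - h x) \<le> 2 / real n * norm x" for x
  proof -
    have "h (T x) - h x = (\<Sum>k<n. (1 / of_nat n) * (\<phi> (Suc k) x - \<phi> k x))"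
      by (simp add: h_def \<phi>S T_def sum_subtractf[symmetric] right_diff_distrib diff_divide_distrib)
    also have "\<dots> = (1 / of_nat n) * (\<phi> n x - \<phi> 0 x)"
      unfolding sum_distrib_left[symmetric] by (simp only: sum_lessThan_telescope[of "\<lambda>k. \<phi> k x"])
    also have "cmod \<dots> \<le> 1 / real n * (norm x + norm x)"
      unfolding norm_mult using order_trans[OF norm_triangle_ineq4 add_mono[OF cstateD(2)[OF \<phi>] cstateD(2)[OF \<phi>]], of n x 0 x]
      by (intro mult_mono) (auto simp: norm_divide)
    finally show ?thesis by simp
  qed
  moreover have "norm (T (act t \<Delta> h a) - act t \<Delta> h a) \<le> 2 / real n * norm a" for a
  proof -
    have lin: "clinear T" unfolding T_def by (rule act_clinear[OF coaction_self \<omega>])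
    have "T (act t \<Delta> h a) - act t \<Delta> h a = (\<Sum>k<n. (1 / of_nat n) *\<^sub>C ((T ^^ Suc (Suc k)) a - (T ^^ Suc k) a))"
      unfolding acth by (simp add: complex_vector.linear_sum[OF lin] complex_vector.linear_scale[OF lin]
          sum_subtractf[symmetric] complex_vector.scale_right_diff_distrib)
    also have "\<dots> = (1 / of_nat n) *\<^sub>C ((T ^^ Suc n) a - (T ^^ Suc 0) a)"
      unfolding complex_vector.scale_sum_right[symmetric] by (simp only: sum_lessThan_telescope[of "\<lambda>k. (T ^^ Suc k) a"])
    also have "norm \<dots> \<le> 1 / real n * (norm a + norm a)"
      unfolding norm_scaleC using order_trans[OF norm_triangle_ineq4 add_mono[OF Tb Tb], of "Suc n" a "Suc 0" a]
      by (intro mult_mono) (auto simp: norm_divide)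
    finally show ?thesis by simp
  qed
  ultimately show ?thesis using h unfolding T_def by blast
qed

text \<open>Finitely many states are handled through their average, finitely many elements through
  density of the span of (c \<otimes> 1)\<Delta>(a): on such products the defect has the form
  estimated in \<open>almost_invariant_defect\<close>.\<close>

lemma haar_approx:
  assumes \<Omega>: "finite \<Omega>" "\<Omega> \<noteq> {}" "\<And>\<rho>. \<rho> \<in> \<Omega> \<Longrightarrow> cstate \<rho>" and X: "finite X" and e: "e > 0"
  shows "\<exists>h. cstate h \<and> (\<forall>\<rho>\<in>\<Omega>. \<forall>d\<in>X. cmod (h (lslice t \<rho> (\<Delta> d)) - h d) \<le> e)"
proof -
  define \<omega> where "\<omega> = (\<lambda>b. \<Sum>\<rho>\<in>\<Omega>. (1 / of_nat (card \<Omega>)) * \<rho> b)"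
  have \<omega>: "cstate \<omega>" unfolding \<omega>_def by (rule cstate_average[OF \<Omega>])
  note tb = min_tensor_cbilinear[OF self_tensors(1)]
  have bil: "cbilinear (\<lambda>g x. t g 1 * \<Delta> x)"
    by (intro cbilinearI) (simp_all add: complex_vector.linear_add[OF cstar_hom_clinear[OF coaction_self(2)]]
        complex_vector.linear_scale[OF cstar_hom_clinear[OF coaction_self(2)]] cbilinear_add_left[OF tb] cbilinear_scaleC_left[OF tb]
        distrib_left distrib_right mult_scaleC_left mult_scaleC_right)
  \<comment> \<open>The functional \<open>\<Theta>\<close> below has norm at most 2, so e/4 costs
    e/2; the other half is left for the choice of n.\<close>
  have "\<exists>xs. norm (t 1 d - (\<Sum>(c, a)\<leftarrow>xs. t c 1 * \<Delta> a)) \<le> e / 4" for d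
  proof -
    have "t 1 d \<in> closure (cspan {t g 1 * \<Delta> x | g x. True})" using cqg by (simp add: compact_quantum_group_def)
    then obtain w where "w \<in> cspan {t g 1 * \<Delta> x | g x. True}" "dist w (t 1 d) < e / 4"
      using e unfolding closure_approachable by (metis divide_pos_pos zero_less_numeral)
    moreover obtain xs where "w = (\<Sum>(c, a)\<leftarrow>xs. t c 1 * \<Delta> a)" using span_bilinear_list[OF bil calculation(1)] by blast
    ultimately show ?thesis by (metis dist_norm norm_minus_commute less_imp_le)
  qed
  then obtain xs where xs: "\<And>d. norm (t 1 d - (\<Sum>(c, a)\<leftarrow>xs d. t c 1 * \<Delta> a)) \<le> e / 4" by metis
  define S where "S d = (\<Sum>(c, a)\<leftarrow>xs d. norm (t c 1) * norm a)" for d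
  have S0: "S d \<ge> 0" for d unfolding S_def by (rule sum_list_nonneg) auto
  define S' where "S' = (\<Sum>d\<in>X. S d)"
  \<comment> \<open>n has to be fixed before h exists. This works because the total coefficient size
    \<open>S'\<close> depends on X and e only.\<close>
  have "(\<lambda>n. S' * sqrt (real (card \<Omega>) * (3 * (2 / real n)))) \<longlonglongrightarrow> S' * sqrt (real (card \<Omega>) * (3 * 0))"
    by (intro tendsto_intros lim_const_over_n)
  then have "\<forall>\<^sub>F n in sequentially. S' * sqrt (real (card \<Omega>) * (3 * (2 / real n))) < e / 2"
    by (rule order_tendstoD(2)) (use e in simp)
  then have "\<forall>\<^sub>F n in sequentially. n > 0 \<and> S' * sqrt (real (card \<Omega>) * (3 * (2 / real n))) < e / 2"
    using eventually_gt_at_top[of 0] by (rule eventually_conj[rotated])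
  then obtain n :: nat where n: "n > 0" "S' * sqrt (real (card \<Omega>) * (3 * (2 / real n))) < e / 2"
    using eventually_happens'[OF sequentially_bot] by blast
  define \<eta> where "\<eta> = 2 / real n"
  have \<eta>: "\<eta> \<ge> 0" by (simp add: \<eta>_def)
  obtain h where h: "cstate h" "\<And>x. cmod (h (act t \<Delta> \<omega> x) - h x) \<le> \<eta> * norm x"
    "\<And>a. norm (act t \<Delta> \<omega> (act t \<Delta> h a) - act t \<Delta> h a) \<le> \<eta> * norm a"
    using cesaro_state[OF \<omega> n(1)] unfolding \<eta>_def by blast
  have "cmod (h (lslice t \<rho> (\<Delta> d)) - h d) \<le> e" if \<rho>: "\<rho> \<in> \<Omega>" and d: "d \<in> X" for \<rho> d
  proof -
    note \<rho>s = \<Omega>(3)[OF \<rho>]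
    have \<rho>h: "cstate (\<lambda>b. \<rho> (act t \<Delta> h b))" by (rule cstate_conv[OF coaction_self \<rho>s h(1)])
    \<comment> \<open>\<open>\<Theta>\<close> is h tensored with the difference between the
      convolution of \<rho> with h and h itself. On 1 \<otimes> d it is the defect to be bounded; on
      (c \<otimes> 1)\<Delta>(a) the inner slice by h replaces a by the almost invariant b.\<close>
    define \<Theta> where "\<Theta> w = h (rslice t (\<lambda>b. \<rho> (act t \<Delta> h b)) w) - h (rslice t h w)" for w
    note st1 = cstate_rslice[OF self_tensors(1) h(1) \<rho>h] and st2 = cstate_rslice[OF self_tensors(1) h(1) h(1)]
    have \<Theta>add: "\<Theta> (v + w) = \<Theta> v + \<Theta> w" for v w
      by (simp add: \<Theta>_def cstateD(5)[OF st1] cstateD(5)[OF st2])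
    have \<Theta>b: "cmod (\<Theta> w) \<le> 2 * norm w" for w
      unfolding \<Theta>_def using norm_triangle_ineq4[of "h (rslice t (\<lambda>b. \<rho> (act t \<Delta> h b)) w)" "h (rslice t h w)"]
        cstateD(2)[OF st1, of w] cstateD(2)[OF st2, of w] by linarith
    have \<Theta>el: "cmod (\<Theta> (t c 1 * \<Delta> a)) \<le> norm (t c 1) * norm a * sqrt (real (card \<Omega>) * (3 * \<eta>))" for c a
    proof -
      define b where "b = act t \<Delta> h a"
      have "rslice t (\<lambda>b. \<rho> (act t \<Delta> h b)) (t c 1 * \<Delta> a) = c * act t \<Delta> (\<lambda>b. \<rho> (act t \<Delta> h b)) a"
        by (simp only: rslice_mult_left[OF self_tensors(1) \<rho>h] act_def[of t \<Delta> "\<lambda>b. \<rho> (act t \<Delta> h b)"])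
      also have "\<dots> = c * act t \<Delta> \<rho> b" by (simp add: act_act[OF coaction_self \<rho>s h(1), symmetric] b_def)
      also have "\<dots> = rslice t \<rho> (t c 1 * \<Delta> b)" by (simp add: rslice_mult_left[OF self_tensors(1) \<rho>s] act_def)
      finally have 1: "rslice t (\<lambda>b. \<rho> (act t \<Delta> h b)) (t c 1 * \<Delta> a) = rslice t \<rho> (t c 1 * \<Delta> b)" .
      have "rslice t h (t c 1 * \<Delta> a) = c * b" by (simp add: rslice_mult_left[OF self_tensors(1) h(1)] act_def b_def)
      also have "\<dots> = rslice t \<rho> (t c 1 * t b 1)"
        by (simp add: min_tensor_mult[OF self_tensors(1)] rslice(4)[OF self_tensors(1) \<rho>s] cstateD(3)[OF \<rho>s])
      finally have "\<Theta> (t c 1 * \<Delta> a) = h (rslice t \<rho> (t c 1 * (\<Delta> b - t b 1)))"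
        unfolding \<Theta>_def 1
        by (simp add: right_diff_distrib cstateD(7)[OF h(1)] complex_vector.linear_diff[OF rslice(2)[OF self_tensors(1) \<rho>s]])
      also have "cmod \<dots> \<le> norm (t c 1) * sqrt (real (card \<Omega>) * (3 * \<eta> * (norm a)\<^sup>2))"
        by (rule almost_invariant_defect[OF \<Omega>(1,3) \<rho> h(1) \<omega>_def _ _ h(2) \<eta>])
          (auto simp: b_def intro: h(3) act_contractive[OF coaction_self h(1)])
      also have "\<dots> = norm (t c 1) * norm a * sqrt (real (card \<Omega>) * (3 * \<eta>))"
        by (simp add: real_sqrt_mult mult_ac)
      finally show ?thesis .
    qed
    have "cmod (\<Theta> (\<Sum>(c, a)\<leftarrow>ys. t c 1 * \<Delta> a)) \<le> (\<Sum>(c, a)\<leftarrow>ys. norm (t c 1) * norm a) * sqrt (real (card \<Omega>) * (3 * \<eta>))" for ys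
    proof (induction ys)
      case Nil
      show ?case using \<Theta>b[of 0] by simp
    next
      case (Cons y ys)
      obtain c a where y: "y = (c, a)" by (cases y)
      show ?case
        using norm_triangle_ineq[of "\<Theta> (t c 1 * \<Delta> a)" "\<Theta> (\<Sum>(c, a)\<leftarrow>ys. t c 1 * \<Delta> a)"] \<Theta>el[of c a] Cons
        by (simp add: y \<Theta>add distrib_right)
    qed
    then have "cmod (\<Theta> (\<Sum>(c, a)\<leftarrow>xs d. t c 1 * \<Delta> a)) \<le> S d * sqrt (real (card \<Omega>) * (3 * \<eta>))" by (simp add: S_def)
    also have "\<dots> \<le> S' * sqrt (real (card \<Omega>) * (3 * \<eta>))"
      unfolding S'_def using S0 d X \<eta> by (intro mult_right_mono member_le_sum) auto
    also have "\<dots> < e / 2" using n(2) by (simp add: \<eta>_def)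
    finally have "cmod (\<Theta> (\<Sum>(c, a)\<leftarrow>xs d. t c 1 * \<Delta> a)) < e / 2" .
    moreover have "cmod (\<Theta> (t 1 d - (\<Sum>(c, a)\<leftarrow>xs d. t c 1 * \<Delta> a))) \<le> 2 * (e / 4)"
      using \<Theta>b[of "t 1 d - (\<Sum>(c, a)\<leftarrow>xs d. t c 1 * \<Delta> a)"] xs[of d] by linarith
    moreover have "\<Theta> (t 1 d) = \<Theta> (t 1 d - (\<Sum>(c, a)\<leftarrow>xs d. t c 1 * \<Delta> a)) + \<Theta> (\<Sum>(c, a)\<leftarrow>xs d. t c 1 * \<Delta> a)"
      by (simp add: \<Theta>add[symmetric])
    then have "cmod (\<Theta> (t 1 d)) \<le> cmod (\<Theta> (t 1 d - (\<Sum>(c, a)\<leftarrow>xs d. t c 1 * \<Delta> a))) + cmod (\<Theta> (\<Sum>(c, a)\<leftarrow>xs d. t c 1 * \<Delta> a))"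
      by (metis norm_triangle_ineq)
    ultimately have "cmod (\<Theta> (t 1 d)) \<le> e" by linarith
    moreover have "\<Theta> (t 1 d) = h (lslice t \<rho> (\<Delta> d)) - h d"
      by (simp add: \<Theta>_def rslice(4)[OF self_tensors(1) \<rho>h] rslice(4)[OF self_tensors(1) h(1)] cstateD(3,6)[OF h(1)]
          slice_slice[OF self_tensors(1) \<rho>s h(1), symmetric] act_def[of t \<Delta>, symmetric])
    ultimately show ?thesis by simp
  qed
  then show ?thesis using h(1) by blast
qed

text \<open>States lie in a product of discs, compact by Tychonoff, and linearity, normalisation and
  each approximate invariance are closed conditions; \<open>haar_approx\<close> gives the finite
  intersection property. The point obtained satisfies \<rho>((id \<otimes> h)\<Delta>(d)) =
  \<rho>(h(d) 1) for all states \<rho>, and states separate.\<close>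

theorem haar_state: "\<exists>h. cstate h \<and> (\<forall>d. act t \<Delta> h d = h d *\<^sub>C 1)"
proof -
  let ?K = "PiE UNIV (\<lambda>a :: 'h. cball (0::complex) (norm a))"
  have K: "compact ?K"
    using compactin_PiE[of "\<lambda>_. euclidean" UNIV "\<lambda>a :: 'h. cball (0::complex) (norm a)"]
    by (simp add: euclidean_product_topology)
  have co: "continuous_on UNIV (\<lambda>h :: 'h \<Rightarrow> complex. h a)" for a by simp
  define lin where "lin = range (\<lambda>(a, b). {h :: 'h \<Rightarrow> complex. h (a + b) = h a + h b}) \<union> range (\<lambda>(c, a). {h. h (c *\<^sub>C a) = c * h a})
    \<union> {{h. h 1 = 1}}"
  define avg where "avg = (\<lambda>(\<rho>, d, e). {h :: 'h \<Rightarrow> complex. cmod (h (lslice t \<rho> (\<Delta> d)) - h d) \<le> e}) ` ({\<rho>. cstate \<rho>} \<times> UNIV \<times> {0<..})"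
  have "?K \<inter> \<Inter>(lin \<union> avg) \<noteq> {}"
  proof (rule compact_imp_fip[OF K])
    fix T assume "T \<in> lin \<union> avg"
    then show "closed T"
      unfolding lin_def avg_def
      by (auto intro!: closed_Collect_eq closed_Collect_le continuous_intros co)
  next
    fix F assume F: "finite F" "F \<subseteq> lin \<union> avg"
    then have "finite (F \<inter> avg)" "F \<inter> avg \<subseteq> avg" by auto
    then obtain J where J: "J \<subseteq> {\<rho>. cstate \<rho>} \<times> UNIV \<times> {0<..}" "finite J"
      "F \<inter> avg = (\<lambda>(\<rho>, d, e). {h :: 'h \<Rightarrow> complex. cmod (h (lslice t \<rho> (\<Delta> d)) - h d) \<le> e}) ` J"
      unfolding avg_def by (meson finite_subset_image)
    have "\<exists>h. cstate h \<and> (\<forall>(\<rho>, d, e)\<in>J. cmod (h (lslice t \<rho> (\<Delta> d)) - h d) \<le> e)"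
    proof (cases "J = {}")
      case True
      obtain \<rho> where "cstate (\<rho> :: 'h \<Rightarrow> complex)"
      proof -
        obtain \<pi> :: "'h \<Rightarrow> ('h \<Rightarrow> complex) \<Rightarrow> 'h \<Rightarrow> complex" where "faithful_rep \<pi>"
          using min_tensor_faithful(1)[OF self_tensors(1)] by blast
        from cstates_separate[OF this, of 1] that show ?thesis by auto
      qed
      then show ?thesis using True by blast
    next
      case False
      define e where "e = Min ((\<lambda>(\<rho>, d, e). e) ` J)"
      have e: "e > 0" unfolding e_def using J False by (subst Min_gr_iff) auto
      have eJ: "e \<le> e'" if "(\<rho>, d, e') \<in> J" for \<rho> d e'
        unfolding e_def using that J by (intro Min_le) force+
      obtain h where "cstate h" "\<forall>\<rho>\<in>fst ` J. \<forall>d\<in>(fst \<circ> snd) ` J. cmod (h (lslice t \<rho> (\<Delta> d)) - h d) \<le> e"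
      proof -
        have "cstate \<rho>" if "\<rho> \<in> fst ` J" for \<rho> using that J(1) by auto
        from haar_approx[OF _ _ this _ e, of "fst ` J" "(fst \<circ> snd) ` J"] that show ?thesis using J(2) False by blast
      qed
      then show ?thesis using eJ by (intro exI[of _ h]) force
    qed
    then obtain h where h: "cstate h" "\<And>\<rho> d e. (\<rho>, d, e) \<in> J \<Longrightarrow> cmod (h (lslice t \<rho> (\<Delta> d)) - h d) \<le> e" by blast
    have "h \<in> ?K" using cstateD(2)[OF h(1)] by auto
    moreover have "h \<in> T" if "T \<in> F" for T
    proof (cases "T \<in> avg")
      case True
      then have "T \<in> (\<lambda>(\<rho>, d, e). {h :: 'h \<Rightarrow> complex. cmod (h (lslice t \<rho> (\<Delta> d)) - h d) \<le> e}) ` J" using that J(3) by blast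
      then show ?thesis using h(2) by auto
    next
      case False
      then have "T \<in> lin" using that F by blast
      then show ?thesis unfolding lin_def using cstateD[OF h(1)] by auto
    qed
    ultimately show "?K \<inter> \<Inter>F \<noteq> {}" by blast
  qed
  then obtain h where hK: "h \<in> ?K" and hF: "\<And>T. T \<in> lin \<union> avg \<Longrightarrow> h \<in> T" by blast
  have l1: "h (a + b) = h a + h b" for a b
    using hF[of "{h. h (a + b) = h a + h b}"] unfolding lin_def by force
  have l2: "h (c *\<^sub>C a) = c * h a" for c a
    using hF[of "{h. h (c *\<^sub>C a) = c * h a}"] unfolding lin_def by force
  have l3: "h 1 = 1" using hF[of "{h. h 1 = 1}"] unfolding lin_def by blast
  have h: "cstate h"
    unfolding cstate_def using hK l3 by (auto intro!: clinearI simp: l1 l2 scaleC_complex_def PiE_iff)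
  have i: "h (lslice t \<rho> (\<Delta> d)) = h d" if "cstate \<rho>" for \<rho> d
  proof -
    have "cmod (h (lslice t \<rho> (\<Delta> d)) - h d) \<le> 0 + e" if "e > 0" for e
      using hF[of "{h. cmod (h (lslice t \<rho> (\<Delta> d)) - h d) \<le> e}"] \<open>cstate \<rho>\<close> that unfolding avg_def by force
    then have "cmod (h (lslice t \<rho> (\<Delta> d)) - h d) \<le> 0" by (rule field_le_epsilon)
    then show ?thesis by simp
  qed
  obtain \<pi> :: "'h \<Rightarrow> ('h \<Rightarrow> complex) \<Rightarrow> 'h \<Rightarrow> complex" where \<pi>: "faithful_rep \<pi>"
    using min_tensor_faithful(1)[OF self_tensors(1)] by blast
  have "act t \<Delta> h d - h d *\<^sub>C 1 = 0" for d
  proof (rule cstates_separate[OF \<pi>])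
    fix \<rho> :: "'h \<Rightarrow> complex" assume \<rho>: "cstate \<rho>"
    show "\<rho> (act t \<Delta> h d - h d *\<^sub>C 1) = 0"
      using i[OF \<rho>, of d] by (simp add: act_def slice_slice[OF self_tensors(1) \<rho> h] cstateD[OF \<rho>])
  qed
  then have "act t \<Delta> h d = h d *\<^sub>C 1" for d by (simp only: right_minus_eq)
  then show ?thesis using h by blast
qed

end

section \<open>Equivariant rows\<close>

lemma min_tensor_left_hom:
  assumes u: "min_tensor u" shows "cstar_hom (\<lambda>x. u x 1)"
proof -
  note b = min_tensor_cbilinear[OF u]
  show ?thesis
    unfolding cstar_hom_def
    by (auto intro!: clinearI simp: cbilinear_add_left[OF b] cbilinear_scaleC_left[OF b] min_tensor_mult[OF u] min_tensor_star[OF u] min_tensor_one[OF u])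
qed

lemma min_tensor_right_hom:
  assumes u: "min_tensor u" shows "cstar_hom (u 1)"
proof -
  note b = min_tensor_cbilinear[OF u]
  show ?thesis
    unfolding cstar_hom_def
    by (auto intro!: clinearI simp: cbilinear_add_right[OF b] cbilinear_scaleC_right[OF b] min_tensor_mult[OF u] min_tensor_star[OF u] min_tensor_one[OF u])
qed

lemma cstar_hom_sum: "cstar_hom f \<Longrightarrow> f (\<Sum>i\<in>I. x i) = (\<Sum>i\<in>I. f (x i))"
  by (rule complex_vector.linear_sum[OF cstar_hom_clinear])

lemma sum_rotate: "(\<Sum>i\<in>I. \<Sum>j\<in>J. \<Sum>k\<in>K. f i j k) = (\<Sum>j\<in>J. \<Sum>k\<in>K. \<Sum>i\<in>I. f i j k)"
  by (simp only: sum.swap[of _ J I] sum.swap[of _ K I])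

lemma kronecker_sum_left:
  fixes x :: "nat \<Rightarrow> 'a::semiring_1"
  assumes "j < n"
  shows "(\<Sum>k<n. (if j = k then 1 else 0) * x k) = x j" "(\<Sum>k<n. (if k = j then 1 else 0) * x k) = x j"
    "(\<Sum>k<n. x k * (if j = k then 1 else 0)) = x j" "(\<Sum>k<n. x k * (if k = j then 1 else 0)) = x j"
  using assms by (simp_all add: if_distrib[where f = "\<lambda>c. c * _"] if_distrib[where f = "\<lambda>c. _ * c"] sum.delta cong: if_cong)

text \<open>A comodule in an arbitrary basis gives a matrix U that need not be unitary, so its
  inverse W is carried along; W plays the role of the antipode applied to U. The functional h is the
  Haar state.\<close>

locale rep_of_coaction =
  fixes t :: "'h::cstar_algebra \<Rightarrow> 'h \<Rightarrow> 'hh::cstar_algebra" and \<Delta> :: "'h \<Rightarrow> 'hh"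
    and s :: "'a::cstar_algebra \<Rightarrow> 'h \<Rightarrow> 'ah::cstar_algebra" and s' :: "'ah \<Rightarrow> 'h \<Rightarrow> 'ahh::cstar_algebra"
    and s'' :: "'a \<Rightarrow> 'hh \<Rightarrow> 'ahh" and \<delta> :: "'a \<Rightarrow> 'ah" and h :: "'h \<Rightarrow> complex"
    and n :: nat and U W :: "nat \<Rightarrow> nat \<Rightarrow> 'h"
  assumes coact: "coaction t \<Delta> s s' s'' \<delta>" and hom\<Delta>: "cstar_hom \<Delta>"
    and h: "cstate h" and haar: "\<And>d. act t \<Delta> h d = h d *\<^sub>C 1"
    and corep: "\<And>i j. i < n \<Longrightarrow> j < n \<Longrightarrow> \<Delta> (U i j) = (\<Sum>k<n. t (U i k) (U k j))"
    and UW: "\<And>i j. i < n \<Longrightarrow> j < n \<Longrightarrow> (\<Sum>k<n. U i k * W k j) = (if i = j then 1 else 0)"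
    and WU: "\<And>i j. i < n \<Longrightarrow> j < n \<Longrightarrow> (\<Sum>k<n. W i k * U k j) = (if i = j then 1 else 0)"
begin

lemmas tensors = coact_tensors[OF coact hom\<Delta>]
lemmas assoc = coact_assoc[OF coact hom\<Delta>]
lemmas \<delta>_hom = coact_hom[OF coact hom\<Delta>]
lemmas tb = min_tensor_cbilinear[OF tensors(3)]
lemmas sb = min_tensor_cbilinear[OF tensors(1)]
lemmas sb' = min_tensor_cbilinear[OF tensors(2)]
lemmas sb'' = min_tensor_cbilinear[OF tensors(4)]

abbreviation "cmul \<equiv> min_tensor_map s s'' id \<Delta>"
abbreviation "hav \<equiv> rslice s h"

lemma cmul_hom: "cstar_hom cmul" by (rule coact_map_right(1)[OF coact hom\<Delta>])
lemma cmul_tensor: "cmul (s a b) = s'' a (\<Delta> b)" by (rule coact_map_right(2)[OF coact hom\<Delta>])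

text \<open>Invariance of h makes \<open>hav\<close> an average over the coaction id \<otimes>
  \<Delta>: it projects A \<otimes> H onto the fixed points A \<otimes> 1.\<close>

lemma slice_haar: "rslice s' h (cmul z) = s (hav z) 1"
  by (rule tensor_ext[OF tensors(1), where z = z and F = "\<lambda>z. rslice s' h (cmul z)" and G = "\<lambda>z. s (hav z) 1",
        OF bounded_linear_compose[OF rslice(1)[OF tensors(2) h] cstar_hom_bounded_linear[OF cmul_hom]]
          bounded_linear_compose[OF cstar_hom_bounded_linear[OF min_tensor_left_hom[OF tensors(1)]] rslice(1)[OF tensors(1) h]]])
    (simp add: cmul_tensor slice_outer[OF coact hom\<Delta> h] act_def[of t \<Delta>, symmetric] haar cbilinear_scaleC_right[OF sb]
      rslice(4)[OF tensors(1) h] cbilinear_scaleC_left[OF sb])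

lemma hav_left: "hav (s a 1) = a"
  by (simp add: rslice(4)[OF tensors(1) h] cstateD(3)[OF h])

lemma fixed_point_tensor: "cmul z = s' z 1 \<Longrightarrow> z = s (hav z) 1"
  using slice_haar[of z] by (simp add: rslice(4)[OF tensors(2) h] cstateD(3)[OF h])

lemma cmul_left: "cmul (s a 1) = s' (s a 1) 1"
  by (simp add: cmul_tensor cstar_hom_one[OF hom\<Delta>] assoc min_tensor_one[OF tensors(3)])

text \<open>Over H \<otimes> H the matrix \<Delta>(W) is a left inverse of \<Delta>(U) and the
  flipped expression is a right inverse, so they agree.\<close>

lemma comult_inverse: assumes "i < n" "j < n" shows "\<Delta> (W i j) = (\<Sum>k<n. t (W k j) (W i k))"
proof -
  define X where "X i j = (\<Sum>k<n. t (W k j) (W i k))" for i j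
  have 1: "(\<Sum>m<n. \<Delta> (U i m) * X m j) = (if i = j then 1 else 0)" if ij: "i < n" "j < n" for i j
  proof -
    have "(\<Sum>m<n. \<Delta> (U i m) * X m j) = (\<Sum>m<n. \<Sum>k<n. \<Sum>l<n. t (U i k * W l j) (U k m * W m l))"
      using ij by (simp add: corep X_def sum_product min_tensor_mult[OF tensors(3)])
    also have "\<dots> = (\<Sum>k<n. \<Sum>l<n. \<Sum>m<n. t (U i k * W l j) (U k m * W m l))"
      by (rule sum_rotate)
    also have "\<dots> = (\<Sum>k<n. \<Sum>l<n. t (U i k * W l j) (if k = l then 1 else 0))"
      by (simp add: cbilinear_sum_right[OF tb, symmetric] UW)
    also have "\<dots> = (\<Sum>k<n. t (U i k * W k j) 1)"
      by (simp add: if_distrib[where f = "t _"] cbilinear_zero_right[OF tb] sum.delta cong: if_cong)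
    also have "\<dots> = (if i = j then 1 else 0)"
      using ij by (simp add: cbilinear_sum_left[OF tb, symmetric] UW cbilinear_zero_left[OF tb] min_tensor_one[OF tensors(3)])
    finally show ?thesis .
  qed
  have "X i j = (\<Sum>m<n. (\<Sum>l<n. \<Delta> (W i l) * \<Delta> (U l m)) * X m j)"
    using assms by (simp add: cstar_hom_mult[OF hom\<Delta>, symmetric] cstar_hom_sum[OF hom\<Delta>, symmetric] WU
        if_distrib[where f = \<Delta>] cstar_hom_one[OF hom\<Delta>] complex_vector.linear_0[OF cstar_hom_clinear[OF hom\<Delta>]]
        kronecker_sum_left cong: if_cong)
  also have "\<dots> = (\<Sum>l<n. \<Delta> (W i l) * (\<Sum>m<n. \<Delta> (U l m) * X m j))"
    by (simp add: sum_distrib_left sum_distrib_right mult.assoc) (rule sum.swap)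
  also have "\<dots> = \<Delta> (W i j)" using assms by (simp add: 1 kronecker_sum_left)
  finally show ?thesis by (simp add: X_def)
qed

text \<open>\<open>b = (a \<otimes> 1)(1 \<otimes> U)\<close> for the row \<open>a\<close> obtained by applying \<open>id \<otimes> h\<close> to \<open>b (1 \<otimes> U)\<^sup>-\<^sup>1\<close>.\<close>

lemma equivariant_row:
  assumes b: "\<And>j. j < n \<Longrightarrow> cmul (b j) = (\<Sum>k<n. s' (b k) (U k j))" and j: "j < n"
  shows "b j = (\<Sum>l<n. s (hav (\<Sum>k<n. b k * s 1 (W k l))) (U l j))"
proof -
  define c where "c l = (\<Sum>k<n. b k * s 1 (W k l))" for l
  \<comment> \<open>The row c = b (1 \<otimes> W) is fixed: the coproduct of W is flipped, so its
    second leg cancels the U that equivariance of b produces.\<close>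
  have "cmul (c l) = s' (c l) 1" if l: "l < n" for l
  proof -
    have e: "s' (b i) (U i k) * s'' 1 (t (W m l) (W k m)) = s' (b i * s 1 (W m l)) (U i k * W k m)" for i k m
      by (simp add: assoc[symmetric] min_tensor_mult[OF tensors(2)])
    have "cmul (c l) = (\<Sum>k<n. (\<Sum>i<n. s' (b i) (U i k)) * s'' 1 (\<Sum>m<n. t (W m l) (W k m)))"
      using l by (simp add: c_def cstar_hom_sum[OF cmul_hom] cstar_hom_mult[OF cmul_hom] b cmul_tensor comult_inverse)
    also have "\<dots> = (\<Sum>k<n. \<Sum>i<n. \<Sum>m<n. s' (b i * s 1 (W m l)) (U i k * W k m))"
      by (simp add: cbilinear_sum_right[OF sb''] sum_product e)
    also have "\<dots> = (\<Sum>i<n. \<Sum>m<n. \<Sum>k<n. s' (b i * s 1 (W m l)) (U i k * W k m))"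
      by (rule sum_rotate)
    also have "\<dots> = (\<Sum>i<n. \<Sum>m<n. s' (b i * s 1 (W m l)) (if i = m then 1 else 0))"
      by (simp add: cbilinear_sum_right[OF sb', symmetric] UW)
    also have "\<dots> = (\<Sum>i<n. s' (b i * s 1 (W i l)) 1)"
      by (simp add: if_distrib[where f = "s' _"] cbilinear_zero_right[OF sb'] sum.delta cong: if_cong)
    finally show ?thesis by (simp add: c_def cbilinear_sum_left[OF sb'])
  qed
  then have c: "c l = s (hav (c l)) 1" if "l < n" for l using that fixed_point_tensor by blast
  have "(\<Sum>l<n. s (hav (c l)) (U l j)) = (\<Sum>l<n. c l * s 1 (U l j))"
  proof (rule sum.cong[OF refl])
    fix l assume "l \<in> {..<n}"
    then have "c l * s 1 (U l j) = s (hav (c l)) 1 * s 1 (U l j)" using c[of l] by simp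
    then show "s (hav (c l)) (U l j) = c l * s 1 (U l j)" by (simp add: min_tensor_mult[OF tensors(1)])
  qed
  also have "\<dots> = (\<Sum>l<n. \<Sum>k<n. b k * s 1 (W k l * U l j))"
    by (simp add: c_def sum_distrib_right mult.assoc min_tensor_mult[OF tensors(1)])
  also have "\<dots> = (\<Sum>k<n. b k * s 1 (\<Sum>l<n. W k l * U l j))"
    by (subst sum.swap) (simp add: cbilinear_sum_right[OF sb] sum_distrib_left)
  also have "\<dots> = (\<Sum>k<n. b k * (if k = j then 1 else 0))"
    by (rule sum.cong) (use j in \<open>auto simp: WU min_tensor_one[OF tensors(1)] cbilinear_zero_right[OF sb]\<close>)
  also have "\<dots> = b j" using j by (simp add: kronecker_sum_left)
  finally show ?thesis by (simp add: c_def)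
qed

lemma row_equivariant:
  assumes "j < n"
  shows "cmul (\<Sum>l<n. s (a l) (U l j)) = (\<Sum>k<n. s' (\<Sum>l<n. s (a l) (U l k)) (U k j))"
proof -
  have "cmul (\<Sum>l<n. s (a l) (U l j)) = (\<Sum>l<n. \<Sum>k<n. s' (s (a l) (U l k)) (U k j))"
    using assms by (simp add: cstar_hom_sum[OF cmul_hom] cmul_tensor corep cbilinear_sum_right[OF sb''] assoc)
  also have "\<dots> = (\<Sum>k<n. \<Sum>l<n. s' (s (a l) (U l k)) (U k j))" by (rule sum.swap)
  finally show ?thesis by (simp add: cbilinear_sum_left[OF sb'])
qed

text \<open>Uniqueness of the row a in a product (a \<otimes> 1)(1 \<otimes> U): cancelling U and
  averaging recovers it.\<close>

lemma row_coefficients: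
  assumes j: "j < n"
  shows "hav (\<Sum>k<n. (\<Sum>l<n. s (a l) (U l k)) * s 1 (W k j)) = a j"
proof -
  have "(\<Sum>k<n. (\<Sum>l<n. s (a l) (U l k)) * s 1 (W k j)) = (\<Sum>k<n. \<Sum>l<n. s (a l) (U l k * W k j))"
    by (simp add: sum_distrib_right min_tensor_mult[OF tensors(1)])
  also have "\<dots> = (\<Sum>l<n. s (a l) (\<Sum>k<n. U l k * W k j))"
    by (subst sum.swap) (simp add: cbilinear_sum_right[OF sb])
  also have "\<dots> = (\<Sum>l<n. if l = j then s (a l) 1 else 0)"
    by (rule sum.cong) (use j in \<open>auto simp: UW cbilinear_zero_right[OF sb]\<close>)
  also have "\<dots> = s (a j) 1" using j by (simp add: sum.delta)
  finally show ?thesis by (simp add: hav_left)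
qed

text \<open>Rows \<open>w\<close> with \<open>(w \<otimes> 1)(1 \<otimes> U) \<in> \<delta>(A)\<^sup>n\<close>: the fibre at \<open>1\<close> of the associated module.\<close>

definition good_row :: "(nat \<Rightarrow> 'a) \<Rightarrow> bool"
  where "good_row w \<longleftrightarrow> (\<forall>k<n. (\<Sum>l<n. s (w l) (U l k)) \<in> range \<delta>)"

text \<open>The last leg of (\<delta> \<otimes> id)(\<delta>(y)(1 \<otimes> W)) is sliced by h in
  two ways: directly, which gives a value of \<delta>, and after coassociativity, which gives the
  averaged row multiplied by U.\<close>

lemma good_row_average:
  assumes l: "l < n"
  shows "good_row (\<lambda>j. hav (\<delta> y * s 1 (W l j)))"
  unfolding good_row_def
proof (intro allI impI)
  fix k assume k: "k < n"
  define \<zeta> where "\<zeta> j = \<delta> y * s 1 (W l j)" for j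
  let ?E1 = "min_tensor_map s s' \<delta> id"
  have hE1: "cstar_hom ?E1" and E1t: "?E1 (s a b) = s' (\<delta> a) b" for a b
    using coact_map_left[OF coact hom\<Delta>] by auto
  \<comment> \<open>W in the last leg is expressed through \<Delta>(W), where invariance of h
    applies, at the price of a factor U in the middle leg.\<close>
  have W: "t 1 (W l k) = (\<Sum>j<n. \<Delta> (W l j) * t (U j k) 1)"
  proof -
    have "(\<Sum>j<n. \<Delta> (W l j) * t (U j k) 1) = (\<Sum>j<n. \<Sum>i<n. t (W i j * U j k) (W l i))"
      using l by (simp add: comult_inverse sum_distrib_right min_tensor_mult[OF tensors(3)])
    also have "\<dots> = (\<Sum>i<n. t (\<Sum>j<n. W i j * U j k) (W l i))"
      by (subst sum.swap) (simp add: cbilinear_sum_left[OF tb])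
    also have "\<dots> = (\<Sum>i<n. if i = k then t 1 (W l i) else 0)"
      by (rule sum.cong) (use k in \<open>auto simp: WU cbilinear_zero_left[OF tb]\<close>)
    also have "\<dots> = t 1 (W l k)" using k by (simp add: sum.delta)
    finally show ?thesis by simp
  qed
  have "?E1 (\<zeta> k) = cmul (\<delta> y) * s'' 1 (t 1 (W l k))"
    by (simp add: \<zeta>_def cstar_hom_mult[OF hE1] E1t coact_coassoc[OF coact hom\<Delta>] cstar_hom_one[OF \<delta>_hom] assoc[symmetric] min_tensor_one[OF tensors(1)])
  also have "\<dots> = (\<Sum>j<n. cmul (\<zeta> j) * s' (s 1 (U j k)) 1)"
  proof -
    have "s'' 1 (\<Delta> (W l j) * t (U j k) 1) = cmul (s 1 (W l j)) * s' (s 1 (U j k)) 1" for j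
      by (simp add: cmul_tensor assoc min_tensor_mult[OF tensors(4)])
    then show ?thesis
      unfolding W by (simp add: cbilinear_sum_right[OF sb''] sum_distrib_left \<zeta>_def cstar_hom_mult[OF cmul_hom] mult.assoc)
  qed
  finally have "rslice s' h (?E1 (\<zeta> k)) = (\<Sum>j<n. s (hav (\<zeta> j)) 1 * s 1 (U j k))"
    by (simp add: complex_vector.linear_sum[OF rslice(2)[OF tensors(2) h]] rslice_mult_right[OF tensors(2) h] slice_haar)
  then have "(\<Sum>j<n. s (hav (\<zeta> j)) (U j k)) = \<delta> (hav (\<zeta> k))"
    by (simp add: slice_map_left[OF coact hom\<Delta> h] min_tensor_mult[OF tensors(1)])
  then show "(\<Sum>j<n. s (hav (\<delta> y * s 1 (W l j))) (U j k)) \<in> range \<delta>" unfolding \<zeta>_def by (metis rangeI)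
qed

text \<open>Row i of a left inverse, as a Neumann series started at the unit row i: v (m + 1) is - v
  m times \<epsilon>. With entries at most 1/(2n), a sum of n products shrinks by one half at each
  stage.\<close>

lemma matrix_neumann:
  fixes Y :: "nat \<Rightarrow> nat \<Rightarrow> 'a"
  assumes Y: "\<And>k j. k < n \<Longrightarrow> j < n \<Longrightarrow> norm (Y k j - (if k = j then 1 else 0)) \<le> 1 / (2 * real n)" and i: "i < n"
  shows "\<exists>L. \<forall>j<n. (\<Sum>k<n. L k * Y k j) = (if i = j then 1 else 0)"
proof -
  define \<epsilon> where "\<epsilon> k j = Y k j - (if k = j then 1 else 0)" for k j
  define v where "v = rec_nat (\<lambda>j. if i = j then 1 else 0 :: 'a) (\<lambda>_ w j. - (\<Sum>k<n. w k * \<epsilon> k j))"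
  have v0: "v 0 j = (if i = j then 1 else 0)" and vS: "v (Suc m) j = - (\<Sum>k<n. v m k * \<epsilon> k j)" for m j
    by (simp_all add: v_def)
  have vb: "\<forall>j<n. norm (v m j) \<le> (1/2) ^ m" for m
  proof (induction m)
    case (Suc m)
    show ?case
    proof (intro allI impI)
      fix j assume j: "j < n"
      have "norm (v (Suc m) j) \<le> (\<Sum>k<n. norm (v m k * \<epsilon> k j))" unfolding vS norm_minus_cancel by (rule norm_sum)
      also have "\<dots> \<le> (\<Sum>k<n. (1/2) ^ m * (1 / (2 * real n)))"
        using Suc Y j by (intro sum_mono order_trans[OF norm_mult_ineq] mult_mono) (auto simp: \<epsilon>_def)
      also have "\<dots> = (1/2) ^ Suc m" using i by simp
      finally show "norm (v (Suc m) j) \<le> (1/2) ^ Suc m" .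
    qed
  qed (auto simp: v0)
  have sm: "summable (\<lambda>m. v m j)" if "j < n" for j
    by (rule summable_comparison_test[OF _ summable_geometric[of "1/2 :: real"]]) (use vb that in auto)
  define L where "L k = (\<Sum>m. v m k)" for k
  have "(\<Sum>k<n. L k * Y k j) = (if i = j then 1 else 0)" if j: "j < n" for j
  proof -
    have "(\<Sum>k<n. L k * \<epsilon> k j) = (\<Sum>m. \<Sum>k<n. v m k * \<epsilon> k j)"
      unfolding L_def by (subst suminf_sum) (auto intro!: sum.cong summable_mult2 sm simp: suminf_mult2[OF sm])
    also have "\<dots> = - (\<Sum>m. v (Suc m) j)"
      using summable_Suc_iff[THEN iffD2, OF sm[OF j]] by (subst suminf_minus[symmetric]) (auto simp: vS)
    also have "\<dots> = v 0 j - L j" using suminf_split_head[OF sm[OF j]] by (simp add: L_def)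
    finally have "(\<Sum>k<n. L k * \<epsilon> k j) = v 0 j - L j" .
    moreover have "(\<Sum>k<n. L k * Y k j) = (\<Sum>k<n. L k * \<epsilon> k j) + (\<Sum>k<n. L k * (if k = j then 1 else 0))"
      unfolding sum.distrib[symmetric] distrib_left[symmetric] by (simp add: \<epsilon>_def)
    ultimately show ?thesis using j by (simp add: kronecker_sum_left v0)
  qed
  then show ?thesis by blast
qed

text \<open>Freeness approximates 1 \<otimes> U by sums of (x \<otimes> 1)\<delta>(y). Multiplying
  by 1 \<otimes> W and averaging turns each summand into x times a good row, and the whole into a
  matrix near the identity whose rows are combinations of good rows. Inverting that matrix makes the
  approximation exact.\<close>

lemma good_rows_generate:
  assumes free: "free_coaction s \<delta>" and i: "i < n"
  shows "\<exists>xs. (\<forall>(x, w)\<in>set xs. good_row w) \<and> (\<forall>j<n. (\<Sum>(x, w)\<leftarrow>xs. x * w j) = (if i = j then 1 else 0))"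
proof -
  define gen where "gen v \<longleftrightarrow> (\<exists>xs. (\<forall>(x, w)\<in>set xs. good_row w) \<and> (\<forall>j<n. (\<Sum>(x, w)\<leftarrow>xs. x * w j) = v j))" for v
  have gen_add: "gen (\<lambda>j. v j + v' j)" if vv: "gen v" "gen v'" for v v'
  proof -
    obtain xs xs' where "\<forall>(x, w)\<in>set xs. good_row w" "\<forall>j<n. (\<Sum>(x, w)\<leftarrow>xs. x * w j) = v j"
      "\<forall>(x, w)\<in>set xs'. good_row w" "\<forall>j<n. (\<Sum>(x, w)\<leftarrow>xs'. x * w j) = v' j"
      using vv unfolding gen_def by blast
    then show ?thesis unfolding gen_def by (intro exI[of _ "xs @ xs'"]) auto
  qed
  have gen_mult: "gen (\<lambda>j. a * v j)" if v: "gen v" for a v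
  proof -
    obtain xs where xs: "\<forall>(x, w)\<in>set xs. good_row w" "\<forall>j<n. (\<Sum>(x, w)\<leftarrow>xs. x * w j) = v j"
      using v unfolding gen_def by blast
    have "(\<Sum>(x, w)\<leftarrow>map (\<lambda>(x, w). (a * x, w)) xs. x * w j) = a * (\<Sum>(x, w)\<leftarrow>xs. x * w j)" for j
      by (induction xs) (auto simp: distrib_left mult.assoc)
    then show ?thesis unfolding gen_def using xs by (intro exI[of _ "map (\<lambda>(x, w). (a * x, w)) xs"]) auto
  qed
  have gen_zero: "gen (\<lambda>j. 0)" unfolding gen_def by (intro exI[of _ "[]"]) auto
  have gen_sum: "gen (\<lambda>j. \<Sum>k\<in>K. v k j)" if "\<And>k. k \<in> K \<Longrightarrow> gen (v k)" for K :: "nat set" and v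
    using that by (induction K rule: infinite_finite_induct) (auto simp: gen_zero intro: gen_add)
  \<comment> \<open>The total size of W, plus 1 to stay positive. With tolerance e = 1/(2 n C) the
    matrix \<open>Y\<close> comes within the distance 1/(2 n) of the identity that
    \<open>matrix_neumann\<close> allows.\<close>
  define C where "C = (\<Sum>l<n. \<Sum>j<n. norm (s 1 (W l j))) + 1"
  have C: "C > 0" unfolding C_def by (intro add_nonneg_pos sum_nonneg) auto
  define e where "e = 1 / (2 * real n * C)"
  have n0: "n > 0" using i by simp
  have e: "e > 0" using C n0 by (simp add: e_def)
  have bil: "cbilinear (\<lambda>x y. s x 1 * \<delta> y)"
    by (intro cbilinearI) (simp_all add: complex_vector.linear_add[OF cstar_hom_clinear[OF \<delta>_hom]]
        complex_vector.linear_scale[OF cstar_hom_clinear[OF \<delta>_hom]] cbilinear_add_left[OF sb] cbilinear_scaleC_left[OF sb]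
        distrib_left distrib_right mult_scaleC_left mult_scaleC_right)
  have "\<exists>xs. norm ((\<Sum>(x, y)\<leftarrow>xs. s x 1 * \<delta> y) - z) \<le> e" for z
  proof -
    have "z \<in> closure (cspan {s x 1 * \<delta> y | x y. True})" using free by (simp add: free_coaction_def)
    then obtain w where "w \<in> cspan {s x 1 * \<delta> y | x y. True}" "dist w z < e"
      using e unfolding closure_approachable by blast
    moreover obtain xs where "w = (\<Sum>(x, y)\<leftarrow>xs. s x 1 * \<delta> y)" using span_bilinear_list[OF bil calculation(1)] by blast
    ultimately show ?thesis by (metis dist_norm less_imp_le)
  qed
  then obtain xs where xs: "\<And>z. norm ((\<Sum>(x, y)\<leftarrow>xs z. s x 1 * \<delta> y) - z) \<le> e" by metis
  define z where "z k l = (\<Sum>(x, y)\<leftarrow>xs (s 1 (U k l)). s x 1 * \<delta> y)" for k l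
  define Y where "Y k j = (\<Sum>l<n. hav (z k l * s 1 (W l j)))" for k j
  have linE: "clinear hav" by (rule rslice(2)[OF tensors(1) h])
  have "norm (Y k j - (if k = j then 1 else 0)) \<le> 1 / (2 * real n)" if kj: "k < n" "j < n" for k j
  proof -
    have "(\<Sum>l<n. hav (s 1 (U k l) * s 1 (W l j))) = (if k = j then 1 else 0)"
      using kj by (simp add: min_tensor_mult[OF tensors(1)] complex_vector.linear_sum[OF linE, symmetric] cbilinear_sum_right[OF sb, symmetric] UW
          hav_left cbilinear_zero_right[OF sb] complex_vector.linear_0[OF linE])
    then have "Y k j - (if k = j then 1 else 0) = (\<Sum>l<n. hav ((z k l - s 1 (U k l)) * s 1 (W l j)))"
      by (simp add: Y_def left_diff_distrib complex_vector.linear_diff[OF linE] sum_subtractf)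
    also have "norm \<dots> \<le> (\<Sum>l<n. e * norm (s 1 (W l j)))"
    proof (rule sum_norm_le)
      fix l
      have "norm (hav ((z k l - s 1 (U k l)) * s 1 (W l j))) \<le> norm (z k l - s 1 (U k l)) * norm (s 1 (W l j))"
        by (rule order_trans[OF rslice(3)[OF tensors(1) h] norm_mult_ineq])
      also have "\<dots> \<le> e * norm (s 1 (W l j))" using xs by (intro mult_right_mono) (auto simp: z_def)
      finally show "norm (hav ((z k l - s 1 (U k l)) * s 1 (W l j))) \<le> e * norm (s 1 (W l j))" .
    qed
    also have "\<dots> \<le> e * C"
    proof -
      have "(\<Sum>l<n. norm (s 1 (W l j))) \<le> (\<Sum>l<n. \<Sum>j<n. norm (s 1 (W l j)))"
        using kj by (intro sum_mono member_le_sum) auto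
      then show ?thesis using e by (simp add: sum_distrib_left[symmetric] C_def)
    qed
    also have "\<dots> = 1 / (2 * real n)" using C by (simp add: e_def)
    finally show ?thesis .
  qed
  then obtain L where L: "\<And>j. j < n \<Longrightarrow> (\<Sum>k<n. L k * Y k j) = (if i = j then 1 else 0)"
    using matrix_neumann[of Y i] i by blast
  have "gen (\<lambda>j. hav (z k l * s 1 (W l j)))" if l: "l < n" for k l
  proof -
    define ys where "ys = xs (s 1 (U k l))"
    have "gen (\<lambda>j. hav ((\<Sum>(x, y)\<leftarrow>ys. s x 1 * \<delta> y) * s 1 (W l j)))"
    proof (induction ys)
      case Nil
      show ?case by (simp add: gen_zero complex_vector.linear_0[OF linE])
    next
      case (Cons p ys)
      obtain x y where p: "p = (x, y)" by (cases p)
      have "gen (\<lambda>j. hav (\<delta> y * s 1 (W l j)))"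
        unfolding gen_def using good_row_average[OF l, of y] by (intro exI[of _ "[(1, \<lambda>j. hav (\<delta> y * s 1 (W l j)))]"]) auto
      from gen_add[OF gen_mult[OF this, of x] Cons] show ?case
        by (simp add: p distrib_right complex_vector.linear_add[OF linE] mult.assoc rslice_mult_left[OF tensors(1) h])
    qed
    then show ?thesis by (simp add: z_def ys_def)
  qed
  then have "gen (\<lambda>j. \<Sum>l\<in>{..<n}. hav (z k l * s 1 (W l j)))" for k
    by (rule gen_sum[of "{..<n}" "\<lambda>l j. hav (z k l * s 1 (W l j))"]) simp
  then have "gen (\<lambda>j. L k * Y k j)" for k unfolding Y_def by (rule gen_mult)
  then have "gen (\<lambda>j. \<Sum>k<n. L k * Y k j)" by (rule gen_sum[of "{..<n}" "\<lambda>k j. L k * Y k j"])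
  then show ?thesis using L unfolding gen_def by auto
qed

text \<open>If \<Delta>(p) = r \<otimes> 1, slicing by h gives r = h(p) 1. Both the values at 1 of
  fixed functions and the good rows multiplied by W take this form after applying \<theta>; for the
  rows this is the cancellation of U against the flipped coproduct of W.\<close>

lemma equivariant_hom_fibre:
  assumes \<theta>: "cstar_hom \<theta>" and eq: "\<And>y. min_tensor_map s t \<theta> id (\<delta> y) = \<Delta> (\<theta> y)"
  shows "\<And>y a. \<delta> y = s a 1 \<Longrightarrow> \<exists>c. \<theta> a = c *\<^sub>C 1"
    and "\<And>w m. good_row w \<Longrightarrow> m < n \<Longrightarrow> \<exists>c. (\<Sum>l<n. \<theta> (w l) * W l m) = c *\<^sub>C 1"
proof -
  let ?T = "min_tensor_map s t \<theta> id"
  have hT: "cstar_hom ?T" and Tt: "?T (s a b) = t (\<theta> a) b" for a b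
    using min_tensor_map[OF tensors(1,3) \<theta> cstar_hom_id] by auto
  have scalar: "r = h p *\<^sub>C 1" if "\<Delta> p = t r 1" for p r
    using haar[of p] that by (simp add: act_def rslice(4)[OF tensors(3) h] cstateD(3)[OF h])
  show "\<exists>c. \<theta> a = c *\<^sub>C 1" if "\<delta> y = s a 1" for y a
    using eq[of y] scalar[of "\<theta> y" "\<theta> a"] that by (auto simp: Tt)
  show "\<exists>c. (\<Sum>l<n. \<theta> (w l) * W l m) = c *\<^sub>C 1" if w: "good_row w" and m: "m < n" for w m
  proof -
    have "\<exists>y. k < n \<longrightarrow> (\<Sum>l<n. s (w l) (U l k)) = \<delta> y" for k
      using w unfolding good_row_def by blast
    then obtain y where y: "\<And>k. k < n \<Longrightarrow> (\<Sum>l<n. s (w l) (U l k)) = \<delta> (y k)" by metis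
    have \<Delta>y: "\<Delta> (\<theta> (y k)) = (\<Sum>l<n. t (\<theta> (w l)) (U l k))" if "k < n" for k
      using eq[of "y k"] y[OF that, symmetric] by (simp add: cstar_hom_sum[OF hT] Tt)
    have "\<Delta> (\<Sum>k<n. \<theta> (y k) * W k m) = (\<Sum>k<n. (\<Sum>l<n. t (\<theta> (w l)) (U l k)) * (\<Sum>j<n. t (W j m) (W k j)))"
      using m by (simp add: cstar_hom_sum[OF hom\<Delta>] cstar_hom_mult[OF hom\<Delta>] \<Delta>y comult_inverse)
    also have "\<dots> = (\<Sum>k<n. \<Sum>l<n. \<Sum>j<n. t (\<theta> (w l) * W j m) (U l k * W k j))"
      by (simp add: sum_product min_tensor_mult[OF tensors(3)])
    also have "\<dots> = (\<Sum>l<n. \<Sum>j<n. \<Sum>k<n. t (\<theta> (w l) * W j m) (U l k * W k j))"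
      by (rule sum_rotate)
    also have "\<dots> = (\<Sum>l<n. \<Sum>j<n. t (\<theta> (w l) * W j m) (if l = j then 1 else 0))"
      by (simp add: cbilinear_sum_right[OF tb, symmetric] UW)
    also have "\<dots> = (\<Sum>l<n. t (\<theta> (w l) * W l m) 1)"
      by (simp add: if_distrib[where f = "t _"] cbilinear_zero_right[OF tb] sum.delta cong: if_cong)
    finally have "\<Delta> (\<Sum>k<n. \<theta> (y k) * W k m) = t (\<Sum>l<n. \<theta> (w l) * W l m) 1" by (simp add: cbilinear_sum_left[OF tb])
    then show ?thesis using scalar by blast
  qed
qed

end

text \<open>A character \<open>\<phi>\<close> of \<open>A\<close> yields the equivariant homomorphism \<open>(\<phi> \<otimes> id) \<circ> \<delta> : A \<rightarrow> H\<close>.\<close>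

lemma character_equivariant_hom:
  fixes t :: "'h::cstar_algebra \<Rightarrow> 'h \<Rightarrow> 'hh::cstar_algebra" and \<Delta> :: "'h \<Rightarrow> 'hh"
    and s :: "'a::cstar_algebra \<Rightarrow> 'h \<Rightarrow> 'ah::cstar_algebra" and s' :: "'ah \<Rightarrow> 'h \<Rightarrow> 'ahh::cstar_algebra"
    and s'' :: "'a \<Rightarrow> 'hh \<Rightarrow> 'ahh" and \<delta> :: "'a \<Rightarrow> 'ah"
  assumes coact: "coaction t \<Delta> s s' s'' \<delta>" and hom\<Delta>: "cstar_hom \<Delta>" and \<phi>: "cstar_hom (\<phi> :: 'a \<Rightarrow> complex)"
  shows "\<exists>\<theta>. cstar_hom \<theta> \<and> (\<forall>y. min_tensor_map s t \<theta> id (\<delta> y) = \<Delta> (\<theta> y))"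
proof -
  note tensors = coact_tensors[OF coact hom\<Delta>] and assoc = coact_assoc[OF coact hom\<Delta>] and \<delta>_hom = coact_hom[OF coact hom\<Delta>]
  have st: "cstate \<phi>"
    using cstar_hom_clinear[OF \<phi>] cstar_hom_contractive[OF \<phi>] cstar_hom_one[OF \<phi>] by (simp add: cstate_def)
  have \<phi>m: "\<phi> (a * b) = \<phi> a * \<phi> b" and \<phi>s: "\<phi> (star a) = cnj (\<phi> a)" for a b
    using cstar_hom_mult[OF \<phi>] cstar_hom_star[OF \<phi>] by (auto simp: star_complex_def)
  \<comment> \<open>Multiplicativity of \<phi> makes its slice map a homomorphism and not merely a
    contraction.\<close>
  have hom: "cstar_hom (lslice s \<phi>)"
    unfolding cstar_hom_def
  proof (intro conjI allI)
    note L = lslice[OF tensors(1) st]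
    show "clinear (lslice s \<phi>)" by (rule L(2))
    show "lslice s \<phi> 1 = 1" using L(4)[of 1 1] by (simp add: min_tensor_one[OF tensors(1)] cstateD(3)[OF st])
    show "lslice s \<phi> (star x) = star (lslice s \<phi> x)" for x
      by (rule tensor_ext[OF tensors(1), where z = x and F = "\<lambda>x. lslice s \<phi> (star x)" and G = "\<lambda>x. star (lslice s \<phi> x)",
            OF bounded_linear_compose[OF L(1) bounded_linear_star] bounded_linear_compose[OF bounded_linear_star L(1)]])
        (simp add: min_tensor_star[OF tensors(1)] L(4) star_scaleC \<phi>s)
    fix x y
    have 1: "lslice s \<phi> (s a b * y) = lslice s \<phi> (s a b) * lslice s \<phi> y" for a b
      by (rule tensor_ext[OF tensors(1), where z = y and F = "\<lambda>y. lslice s \<phi> (s a b * y)" and G = "\<lambda>y. lslice s \<phi> (s a b) * lslice s \<phi> y",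
            OF bounded_linear_compose[OF L(1) bounded_linear_mult_right] bounded_linear_compose[OF bounded_linear_mult_right L(1)]])
        (simp add: min_tensor_mult[OF tensors(1)] L(4) \<phi>m mult_scaleC_left mult_scaleC_right scaleC_scaleC)
    show "lslice s \<phi> (x * y) = lslice s \<phi> x * lslice s \<phi> y"
      by (rule tensor_ext[OF tensors(1), where z = x and F = "\<lambda>x. lslice s \<phi> (x * y)" and G = "\<lambda>x. lslice s \<phi> x * lslice s \<phi> y",
            OF bounded_linear_compose[OF L(1) bounded_linear_mult_left] bounded_linear_compose[OF bounded_linear_mult_left L(1)]])
        (rule 1)
  qed
  define \<theta> where "\<theta> = (\<lambda>y. lslice s \<phi> (\<delta> y))"
  have h\<theta>: "cstar_hom \<theta>"
    unfolding cstar_hom_def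
    by (auto intro!: clinearI simp: \<theta>_def cstar_hom_mult[OF \<delta>_hom] cstar_hom_star[OF \<delta>_hom] cstar_hom_one[OF \<delta>_hom]
        cstar_hom_mult[OF hom] cstar_hom_star[OF hom] cstar_hom_one[OF hom]
        complex_vector.linear_add[OF cstar_hom_clinear[OF \<delta>_hom]] complex_vector.linear_add[OF cstar_hom_clinear[OF hom]]
        complex_vector.linear_scale[OF cstar_hom_clinear[OF \<delta>_hom]] complex_vector.linear_scale[OF cstar_hom_clinear[OF hom]])
  note T = min_tensor_map[OF tensors(1,3) h\<theta> cstar_hom_id]
  note E1 = coact_map_left[OF coact hom\<Delta>] and D = coact_map_right[OF coact hom\<Delta>]
  note L'' = lslice[OF tensors(4) st] and L = lslice[OF tensors(1) st]
  have outer: "lslice s'' \<phi> (s' z b) = t (lslice s \<phi> z) b" for z b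
  proof -
    have bl: "bounded_linear (\<lambda>x. u x b)" if u: "min_tensor u" for u :: "'x::cstar_algebra \<Rightarrow> 'y::cstar_algebra \<Rightarrow> 'z::cstar_algebra" and b
    proof -
      have "bounded_linear (\<lambda>x. u x 1 * u 1 b)"
        by (rule bounded_linear_compose[OF bounded_linear_mult_left cstar_hom_bounded_linear[OF min_tensor_left_hom[OF u]]])
      then show ?thesis by (simp add: min_tensor_mult[OF u])
    qed
    show ?thesis
      by (rule tensor_ext[OF tensors(1), where z = z and F = "\<lambda>z. lslice s'' \<phi> (s' z b)" and G = "\<lambda>z. t (lslice s \<phi> z) b",
            OF bounded_linear_compose[OF L''(1) bl[OF tensors(2)]] bounded_linear_compose[OF bl[OF tensors(3)] L(1)]])
        (simp add: assoc L''(4) L(4) cbilinear_scaleC_left[OF min_tensor_cbilinear[OF tensors(3)]])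
  qed
  have "min_tensor_map s t \<theta> id z = lslice s'' \<phi> (min_tensor_map s s' \<delta> id z)" for z
    by (rule tensor_ext[OF tensors(1) cstar_hom_bounded_linear[OF T(1)], where z = z and G = "\<lambda>z. lslice s'' \<phi> (min_tensor_map s s' \<delta> id z)",
          OF bounded_linear_compose[OF L''(1) cstar_hom_bounded_linear[OF E1(1)]]])
      (simp only: T(2) E1(2) outer id_apply, simp only: \<theta>_def)
  moreover have "lslice s'' \<phi> (min_tensor_map s s'' id \<Delta> z) = \<Delta> (lslice s \<phi> z)" for z
    by (rule tensor_ext[OF tensors(1), where z = z and F = "\<lambda>z. lslice s'' \<phi> (min_tensor_map s s'' id \<Delta> z)" and G = "\<lambda>z. \<Delta> (lslice s \<phi> z)",
          OF bounded_linear_compose[OF L''(1) cstar_hom_bounded_linear[OF D(1)]]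
            bounded_linear_compose[OF cstar_hom_bounded_linear[OF hom\<Delta>] L(1)]])
      (simp add: D(2) L''(4) L(4) complex_vector.linear_scale[OF cstar_hom_clinear[OF hom\<Delta>]])
  ultimately have "min_tensor_map s t \<theta> id (\<delta> y) = \<Delta> (\<theta> y)" for y
    by (simp add: coact_coassoc[OF coact hom\<Delta>] \<theta>_def)
  then show ?thesis using h\<theta> by blast
qed

section \<open>Paths of invertible matrices\<close>

definition pad :: "nat \<Rightarrow> (nat \<Rightarrow> nat \<Rightarrow> 'h::cstar_algebra) \<Rightarrow> nat \<Rightarrow> nat \<Rightarrow> 'h"
  where "pad N A i j = (if i < N \<and> j < N then A i j else mat_id i j)"

lemma block_pad: "block_matrix N (pad N A)" by (simp add: block_matrix_def pad_def)

lemma pad_GL: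
  assumes "\<And>i j. i < N \<Longrightarrow> j < N \<Longrightarrow> (\<Sum>k<N. A i k * B k j) = (if i = j then 1 else 0)"
    and "\<And>i j. i < N \<Longrightarrow> j < N \<Longrightarrow> (\<Sum>k<N. B i k * A k j) = (if i = j then 1 else 0)"
  shows "pad N A \<in> GL N"
  unfolding GL_def using assms
  by (auto simp: block_pad mat_id_def pad_def intro!: exI[of _ "pad N B"])

lemma block_mono: "block_matrix n A \<Longrightarrow> n \<le> m \<Longrightarrow> block_matrix m A"
  by (auto simp: block_matrix_def)

text \<open>Both matrices are the identity outside the n-block, so enlarging the size only adds
  trivial entries.\<close>

lemma block_prod:
  assumes A: "block_matrix n A" and B: "block_matrix n B" and nm: "n \<le> m" and ij: "i < m" "j < m"
  shows "(\<Sum>k<m. A i k * B k j) = (if i < n \<and> j < n then \<Sum>k<n. A i k * B k j else mat_id i j)"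
proof (cases "i < n")
  case True
  have "(\<Sum>k<m. A i k * B k j) = (\<Sum>k<n. A i k * B k j)"
  proof (rule sum.mono_neutral_right)
    show "\<forall>k\<in>{..<m} - {..<n}. A i k * B k j = 0"
      using A True unfolding block_matrix_def mat_id_def by auto
  qed (use nm in auto)
  moreover have "(\<Sum>k<n. A i k * B k j) = mat_id i j" if "\<not> j < n"
  proof -
    have "(\<Sum>k<n. A i k * B k j) = (\<Sum>k<n. 0)"
      using B that by (intro sum.cong) (auto simp: block_matrix_def mat_id_def)
    then show ?thesis using True that by (simp add: mat_id_def)
  qed
  ultimately show ?thesis using True by auto
next
  case False
  then have "A i k = mat_id i k" for k using A by (simp add: block_matrix_def)
  then have "(\<Sum>k<m. A i k * B k j) = B i j" using ij by (simp add: mat_id_def kronecker_sum_left)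
  then show ?thesis using False B by (simp add: block_matrix_def)
qed

lemma GL_mono: assumes "A \<in> GL n" "n \<le> m" shows "A \<in> GL m"
proof -
  obtain B where B: "block_matrix n A" "block_matrix n B"
    "\<And>i j. i < n \<Longrightarrow> j < n \<Longrightarrow> (\<Sum>k<n. A i k * B k j) = mat_id i j"
    "\<And>i j. i < n \<Longrightarrow> j < n \<Longrightarrow> (\<Sum>k<n. B i k * A k j) = mat_id i j"
    using assms(1) unfolding GL_def by blast
  have "(\<Sum>k<m. A i k * B k j) = mat_id i j" "(\<Sum>k<m. B i k * A k j) = mat_id i j" if "i < m" "j < m" for i j
    using block_prod[OF B(1,2) assms(2) that] block_prod[OF B(2,1) assms(2) that] B(3,4) by (auto split: if_splits)
  then show ?thesis unfolding GL_def using block_mono[OF B(1) assms(2)] block_mono[OF B(2) assms(2)] by auto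
qed

text \<open>The size k in which U is invertible may exceed n. Outside the n-block U is the identity,
  which forces the same of its inverse, so the inverse already lives in size n.\<close>

lemma GL_block_inverse:
  assumes U: "U \<in> GL k" and b: "block_matrix n U"
  shows "\<exists>W. block_matrix n W \<and> (\<forall>i<n. \<forall>j<n. (\<Sum>k<n. U i k * W k j) = (if i = j then 1 else 0)
    \<and> (\<Sum>k<n. W i k * U k j) = (if i = j then 1 else 0))"
proof -
  define m where "m = max n k"
  have "U \<in> GL m" using GL_mono[OF U, of m] by (simp add: m_def)
  then obtain B where B: "block_matrix m U" "block_matrix m B"
    "\<And>i j. i < m \<Longrightarrow> j < m \<Longrightarrow> (\<Sum>k<m. U i k * B k j) = mat_id i j"
    "\<And>i j. i < m \<Longrightarrow> j < m \<Longrightarrow> (\<Sum>k<m. B i k * U k j) = mat_id i j"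
    unfolding GL_def by blast
  have nm: "n \<le> m" by (simp add: m_def)
  have Bl: "B i j = mat_id i j" if "\<not> i < n" "j < m" for i j
  proof (cases "i < m")
    case True
    have "(\<Sum>k<m. U i k * B k j) = B i j"
      using b that True by (simp add: block_matrix_def mat_id_def kronecker_sum_left)
    then show ?thesis using B(3)[OF True that(2)] by simp
  next
    case False
    then show ?thesis using B(2) by (simp add: block_matrix_def)
  qed
  have Br: "B i j = mat_id i j" if "\<not> j < n" "i < m" for i j
  proof (cases "j < m")
    case True
    have "(\<Sum>k<m. B i k * U k j) = B i j"
      using b that True by (simp add: block_matrix_def mat_id_def kronecker_sum_left)
    then show ?thesis using B(4)[OF that(2) True] by simp
  next
    case False
    then show ?thesis using B(2) by (simp add: block_matrix_def)
  qed
  have bB: "block_matrix n B"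
    unfolding block_matrix_def
  proof (intro allI impI)
    fix i j assume ij: "\<not> (i < n \<and> j < n)"
    show "B i j = mat_id i j"
    proof (cases "i < m \<and> j < m")
      case True
      then show ?thesis using ij Bl[of i j] Br[of j i] by auto
    next
      case False
      then show ?thesis using B(2) by (simp add: block_matrix_def)
    qed
  qed
  have "(\<Sum>k<n. U i k * B k j) = (if i = j then 1 else 0)" "(\<Sum>k<n. B i k * U k j) = (if i = j then 1 else 0)"
    if "i < n" "j < n" for i j
    using block_prod[OF b bB nm, of i j] block_prod[OF bB b nm, of i j] B(3,4)[of i j] that nm by (simp_all add: mat_id_def)
  then show ?thesis using bB by blast
qed

lemma GL_path_refl: "U \<in> GL n \<Longrightarrow> GL_path U U"
  unfolding GL_path_def by (intro exI[of _ n] exI[of _ "\<lambda>_. U"]) auto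

lemma GL_pathE:
  fixes U W :: "nat \<Rightarrow> nat \<Rightarrow> 'h::cstar_algebra"
  assumes "GL_path U W"
  obtains n and \<gamma> :: "real \<Rightarrow> nat \<Rightarrow> nat \<Rightarrow> 'h" where "\<And>i j. continuous_on {0..1} (\<lambda>s. \<gamma> s i j)" "\<gamma> ` {0..1} \<subseteq> GL n" "\<gamma> 0 = U" "\<gamma> 1 = W"
proof -
  from assms obtain n and \<gamma> :: "real \<Rightarrow> nat \<Rightarrow> nat \<Rightarrow> 'h" where
    g: "(\<forall>i j. continuous_on {0..1} (\<lambda>s. \<gamma> s i j)) \<and> \<gamma> ` {0..1} \<subseteq> GL n \<and> \<gamma> 0 = U \<and> \<gamma> 1 = W"
    unfolding GL_path_def by (elim exE)
  show ?thesis by (rule that[of \<gamma> n]) (simp_all add: g)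
qed

lemma GL_path_sym:
  fixes U W :: "nat \<Rightarrow> nat \<Rightarrow> 'a::cstar_algebra"
  assumes "GL_path U W" shows "GL_path W U"
proof -
  obtain n and \<gamma> :: "real \<Rightarrow> nat \<Rightarrow> nat \<Rightarrow> 'a" where g: "\<And>i j. continuous_on {0..1} (\<lambda>s. \<gamma> s i j)" "\<gamma> ` {0..1} \<subseteq> GL n" "\<gamma> 0 = U" "\<gamma> 1 = W"
    using GL_pathE[OF assms] by blast
  have "continuous_on {0..1} (\<lambda>s. \<gamma> (1 - s) i j)" for i j
    by (rule continuous_on_compose2[OF g(1)]) (auto intro!: continuous_intros)
  then show ?thesis unfolding GL_path_def
    using g by (intro exI[of _ n] exI[of _ "\<lambda>s. \<gamma> (1 - s)"]) auto
qed

lemma GL_path_trans: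
  fixes U V W :: "nat \<Rightarrow> nat \<Rightarrow> 'a::cstar_algebra"
  assumes "GL_path U V" "GL_path V W" shows "GL_path U W"
proof -
  obtain n1 and g1 :: "real \<Rightarrow> nat \<Rightarrow> nat \<Rightarrow> 'a" where g1: "\<And>i j. continuous_on {0..1} (\<lambda>s. g1 s i j)" "g1 ` {0..1} \<subseteq> GL n1" "g1 0 = U" "g1 1 = V"
    using GL_pathE[OF assms(1)] by blast
  obtain n2 and g2 :: "real \<Rightarrow> nat \<Rightarrow> nat \<Rightarrow> 'a" where g2: "\<And>i j. continuous_on {0..1} (\<lambda>s. g2 s i j)" "g2 ` {0..1} \<subseteq> GL n2" "g2 0 = V" "g2 1 = W"
    using GL_pathE[OF assms(2)] by blast
  define g where "g = (\<lambda>s. if s \<le> 1/2 then g1 (2 * s) else g2 (2 * s - 1))"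
  have "continuous_on {0..1} (\<lambda>s. g s i j)" for i j
  proof -
    have "path ((\<lambda>s. g1 s i j) +++ (\<lambda>s. g2 s i j))"
      by (rule path_join_imp) (use g1 g2 in \<open>auto simp: path_def pathstart_def pathfinish_def\<close>)
    also have "(\<lambda>s. g1 s i j) +++ (\<lambda>s. g2 s i j) = (\<lambda>s. g s i j)" by (auto simp: joinpaths_def g_def)
    finally show ?thesis by (simp add: path_def)
  qed
  moreover have "g s \<in> GL (max n1 n2)" if s: "s \<in> {0..1}" for s
  proof (cases "s \<le> 1/2")
    case True
    then have "g1 (2 * s) \<in> GL n1" using s g1(2) by (intro subsetD[OF g1(2)] imageI) auto
    then show ?thesis using True by (auto simp: g_def intro: GL_mono)
  next
    case False
    then have "g2 (2 * s - 1) \<in> GL n2" using s by (intro subsetD[OF g2(2)] imageI) auto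
    then show ?thesis using False by (auto simp: g_def intro: GL_mono)
  qed
  moreover have "g 0 = U" "g 1 = W" using g1(3) g2(4) by (simp_all add: g_def)
  ultimately show ?thesis unfolding GL_path_def
    by (intro exI[of _ "max n1 n2"] exI[of _ g]) blast
qed

lemma K1_class_eqI: "GL_path U V \<Longrightarrow> K1_class U = K1_class V"
  unfolding K1_class_def using GL_path_trans GL_path_sym by blast

text \<open>A class in \<open>K1\<close> contains a representative W of its own; equality of the
  classes then gives a path that starts at U, and paths stay in \<open>GL\<close>.\<close>

lemma K1_class_GL: assumes "K1_class U \<in> K1" shows "\<exists>n. U \<in> GL n"
proof -
  obtain W n where W: "K1_class U = K1_class W" "W \<in> GL n" using assms unfolding K1_def by blast
  then have "W \<in> K1_class W" by (auto simp: K1_class_def GL_path_refl)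
  then have "GL_path U W" using W(1) by (auto simp: K1_class_def)
  then show ?thesis by (rule GL_pathE) force
qed

lemma GL_pathI:
  fixes \<gamma> :: "real \<Rightarrow> nat \<Rightarrow> nat \<Rightarrow> 'h::cstar_algebra"
  assumes c: "\<And>i j. i < N \<Longrightarrow> j < N \<Longrightarrow> continuous_on {0..1} (\<lambda>x. \<gamma> x i j)"
    and inv: "\<And>x. x \<in> {0..1} \<Longrightarrow> \<exists>B. \<forall>i<N. \<forall>j<N. (\<Sum>k<N. \<gamma> x i k * B k j) = (if i = j then 1 else 0)
        \<and> (\<Sum>k<N. B i k * \<gamma> x k j) = (if i = j then 1 else 0)"
  shows "GL_path (pad N (\<gamma> 0)) (pad N (\<gamma> 1))"
  unfolding GL_path_def
proof (intro exI[of _ N] exI[of _ "\<lambda>x. pad N (\<gamma> x)"] conjI allI refl image_subsetI)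
  show "continuous_on {0..1} (\<lambda>x. pad N (\<gamma> x) i j)" for i j
  proof (cases "i < N \<and> j < N")
    case False
    then have "pad N (\<gamma> x) i j = mat_id i j" for x by (auto simp: pad_def)
    then show ?thesis by simp
  qed (simp add: pad_def c)
  fix x :: real assume "x \<in> {0..1}"
  from inv[OF this] obtain B where "\<forall>i<N. \<forall>j<N. (\<Sum>k<N. \<gamma> x i k * B k j) = (if i = j then 1 else 0)
        \<and> (\<Sum>k<N. B i k * \<gamma> x k j) = (if i = j then 1 else 0)" by blast
  then show "pad N (\<gamma> x) \<in> GL N" by (intro pad_GL[where B = B]) auto
qed

section \<open>Tensors over a basis\<close>

lemma atensor_abs_plus: "abs_atensor xs + abs_atensor ys = abs_atensor (xs @ ys)"
  by (rule plus_atensor.abs_eq)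

lemma atensor_abs_sum: "abs_atensor xs = (\<Sum>(a, b)\<leftarrow>xs. atens a b)"
proof (induction xs)
  case Nil
  show ?case by (simp add: zero_atensor_def)
next
  case (Cons p xs)
  obtain a b where p: "p = (a, b)" by (cases p)
  have "abs_atensor (p # xs) = abs_atensor [p] + abs_atensor xs" by (simp add: atensor_abs_plus)
  then show ?case using Cons by (simp add: p atens.abs_eq)
qed

lemma atensor_exists_list: "\<exists>xs. z = (\<Sum>(a, b)\<leftarrow>xs. atens a b)"
  by (metis Quotient3_abs_rep[OF Quotient3_atensor] atensor_abs_sum)

lemma atens_cbilinear: "cbilinear atens"
proof (rule cbilinearI)
  fix a a' :: 'a and b b' :: 'b and c
  show "atens a (b + b') = atens a b + atens a b'" by transfer (simp add: atensor_rel_def cbilinear_add_right)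
  show "atens a (c *\<^sub>C b) = c *\<^sub>C atens a b" by transfer (simp add: atensor_rel_def cbilinear_scaleC_left cbilinear_scaleC_right)
  show "atens (a + a') b = atens a b + atens a' b" by transfer (simp add: atensor_rel_def cbilinear_add_left)
  show "atens (c *\<^sub>C a) b = c *\<^sub>C atens a b" by transfer (simp add: atensor_rel_def)
qed

lemma atensor_lift_clinear: assumes f: "cbilinear f" shows "clinear (atensor_lift f)"
proof (rule clinearI)
  have r: "\<exists>xs. z = abs_atensor xs" for z :: "('a, 'b) atensor" by (metis Quotient3_abs_rep[OF Quotient3_atensor])
  fix x y :: "('a, 'b) atensor" and c
  obtain xs ys where x: "x = abs_atensor xs" and y: "y = abs_atensor ys" using r by metis
  show "atensor_lift f (x + y) = atensor_lift f x + atensor_lift f y"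
    unfolding x y atensor_abs_plus atensor_lift_abs[OF f] by simp
  show "atensor_lift f (c *\<^sub>C x) = c *\<^sub>C atensor_lift f x"
    unfolding x scaleC_atensor.abs_eq atensor_lift_abs[OF f] by (rule sum_list_scaleC_left[OF f])
qed

lemma atensor_ext:
  assumes F: "clinear F" and G: "clinear G" and eq: "\<And>a b. F (atens a b) = G (atens a b)"
  shows "F z = G z"
proof -
  obtain xs where "z = (\<Sum>(a, b)\<leftarrow>xs. atens a b)" using atensor_exists_list by blast
  then show ?thesis
    by (induction xs arbitrary: z)
      (auto simp: complex_vector.linear_0[OF F] complex_vector.linear_0[OF G] complex_vector.linear_add[OF F] complex_vector.linear_add[OF G] eq)
qed

lemma atensor_map_bilinear:
  assumes "clinear f" "clinear g" shows "cbilinear (\<lambda>a b. atens (f a) (g b))"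
  using assms by (intro cbilinearI) (simp_all add: complex_vector.linear_add complex_vector.linear_scale
      cbilinear_add_left[OF atens_cbilinear] cbilinear_add_right[OF atens_cbilinear]
      cbilinear_scaleC_left[OF atens_cbilinear] cbilinear_scaleC_right[OF atens_cbilinear])

lemma clinear_id: "clinear id" by (auto intro: clinearI)

lemma atensor_map:
  assumes "clinear f" shows "clinear (atensor_map f id)" "atensor_map f id (atens a b) = atens (f a) b"
  unfolding atensor_map_def
  using atensor_lift_clinear[OF atensor_map_bilinear[OF assms clinear_id]]
    atensor_lift_atens[OF atensor_map_bilinear[OF assms clinear_id]] by auto

definition dual_basis :: "nat \<Rightarrow> (nat \<Rightarrow> 'v::complex_vector) \<Rightarrow> nat \<Rightarrow> 'v \<Rightarrow> complex"
  where "dual_basis n e k = (SOME \<phi>. clinear \<phi> \<and> (\<forall>l<n. \<phi> (e l) = (if l = k then 1 else 0)))"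

text \<open>Slicing by the dual basis identifies tensors over V with rows of length n.\<close>

definition coord :: "nat \<Rightarrow> (nat \<Rightarrow> 'v::complex_vector) \<Rightarrow> nat \<Rightarrow> ('b::complex_vector, 'v) atensor \<Rightarrow> 'b"
  where "coord n e k = atensor_lift (\<lambda>b v. dual_basis n e k v *\<^sub>C b)"

context
  fixes n :: nat and e :: "nat \<Rightarrow> 'v::complex_vector"
  assumes inj: "inj_on e {..<n}" and indep: "cindependent (e ` {..<n})" and span: "cspan (e ` {..<n}) = UNIV"
begin

lemma dual_basis: "clinear (dual_basis n e k)" "l < n \<Longrightarrow> dual_basis n e k (e l) = (if l = k then 1 else 0)"
proof -
  define f where "f v = (if the_inv_into {..<n} e v = k then 1 else 0 :: complex)" for v
  obtain \<phi> :: "'v \<Rightarrow> complex" where "clinear \<phi>" "\<forall>v\<in>e ` {..<n}. \<phi> v = f v"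
    using complex_vector.linear_independent_extend[OF indep, of f] by blast
  then have "\<exists>\<phi> :: 'v \<Rightarrow> complex. clinear \<phi> \<and> (\<forall>l<n. \<phi> (e l) = (if l = k then 1 else 0))"
    using the_inv_into_f_f[OF inj] by (intro exI[of _ \<phi>]) (auto simp: f_def)
  from someI_ex[OF this] show "clinear (dual_basis n e k)" "l < n \<Longrightarrow> dual_basis n e k (e l) = (if l = k then 1 else 0)"
    by (simp_all add: dual_basis_def)
qed

lemma dual_basis_expand: "v = (\<Sum>k<n. dual_basis n e k v *\<^sub>C e k)"
proof -
  let ?g = "\<lambda>v. \<Sum>k<n. dual_basis n e k v *\<^sub>C e k"
  have g: "clinear ?g"
    by (rule clinearI) (simp_all only: complex_vector.linear_add[OF dual_basis(1)] complex_vector.linear_scale[OF dual_basis(1)]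
        scaleC_add_left sum.distrib scaleC_complex_def scaleC_scaleC[symmetric] complex_vector.scale_sum_right)
  have "id v = ?g v"
  proof (rule complex_vector.linear_eq_on[OF clinear_id g])
    show "v \<in> cspan (e ` {..<n})" by (simp add: span)
    fix b assume "b \<in> e ` {..<n}"
    then obtain l where l: "l < n" "b = e l" by auto
    have "?g b = (\<Sum>k<n. if k = l then e k else 0)"
      unfolding l(2) by (rule sum.cong) (auto simp: dual_basis(2)[OF l(1)])
    then show "id b = ?g b" using l by (simp add: sum.delta)
  qed
  then show ?thesis by simp
qed

lemma coord_bilinear: "cbilinear (\<lambda>b v. dual_basis n e k v *\<^sub>C (b :: 'b::complex_vector))"
  by (intro cbilinearI) (simp_all add: complex_vector.linear_add[OF dual_basis(1)] complex_vector.linear_scale[OF dual_basis(1)]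
      scaleC_add_left scaleC_add_right scaleC_scaleC scaleC_complex_def mult.commute)

lemma coord_clinear: "clinear (coord n e k)"
  unfolding coord_def by (rule atensor_lift_clinear[OF coord_bilinear])

lemma coord_atens: "coord n e k (atens b v) = dual_basis n e k v *\<^sub>C b"
  unfolding coord_def by (rule atensor_lift_atens[OF coord_bilinear])

lemma coord_sum: "k < n \<Longrightarrow> coord n e k (\<Sum>l<n. atens (b l) (e l)) = b k"
proof -
  assume k: "k < n"
  have "coord n e k (\<Sum>l<n. atens (b l) (e l)) = (\<Sum>l<n. if l = k then b l else 0)"
    unfolding complex_vector.linear_sum[OF coord_clinear] coord_atens
    by (rule sum.cong) (auto simp: dual_basis(2))
  then show ?thesis using k by (simp add: sum.delta)
qed

lemma coord_expand:
  fixes z :: "('b::complex_vector, 'v) atensor"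
  shows "z = (\<Sum>k<n. atens (coord n e k z) (e k))"
proof -
  let ?G = "\<lambda>z :: ('b, 'v) atensor. \<Sum>k<n. atens (coord n e k z) (e k)"
  have G: "clinear ?G"
    by (rule clinearI) (simp_all add: complex_vector.linear_add[OF coord_clinear] complex_vector.linear_scale[OF coord_clinear]
        cbilinear_add_left[OF atens_cbilinear] cbilinear_scaleC_left[OF atens_cbilinear] sum.distrib complex_vector.scale_sum_right)
  have "id z = ?G z"
  proof (rule atensor_ext[where F = id and G = ?G, OF clinear_id G])
    fix a :: 'b and v :: 'v
    have "?G (atens a v) = (\<Sum>k<n. atens a (dual_basis n e k v *\<^sub>C e k))"
      by (simp add: coord_atens cbilinear_scaleC_left[OF atens_cbilinear] cbilinear_scaleC_right[OF atens_cbilinear])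
    also have "\<dots> = atens a v" by (simp add: cbilinear_sum_right[OF atens_cbilinear, symmetric] dual_basis_expand[symmetric])
    finally show "id (atens a v) = ?G (atens a v)" by simp
  qed
  then show ?thesis by simp
qed

lemma coord_eqI: "(\<And>k. k < n \<Longrightarrow> coord n e k z = coord n e k w) \<Longrightarrow> z = w"
  by (subst coord_expand[of z], subst coord_expand[of w]) simp

lemma coord_map: assumes f: "clinear f" shows "coord n e k (atensor_map f id z) = f (coord n e k z)"
proof (rule atensor_ext[where F = "\<lambda>z. coord n e k (atensor_map f id z)" and G = "\<lambda>z. f (coord n e k z)" and z = z])
  show "clinear (\<lambda>z. coord n e k (atensor_map f id z))"
    by (rule clinearI) (simp_all add: complex_vector.linear_add[OF atensor_map(1)[OF f]] complex_vector.linear_scale[OF atensor_map(1)[OF f]]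
        complex_vector.linear_add[OF coord_clinear] complex_vector.linear_scale[OF coord_clinear])
  show "clinear (\<lambda>z. f (coord n e k z))"
    by (rule clinearI) (simp_all add: complex_vector.linear_add[OF f] complex_vector.linear_scale[OF f]
        complex_vector.linear_add[OF coord_clinear] complex_vector.linear_scale[OF coord_clinear])
qed (simp add: atensor_map(2)[OF f] coord_atens complex_vector.linear_scale[OF f])

lemma coord_atensor_of:
  assumes X: "csubspace X" and z: "z \<in> atensor_of X Y" shows "coord n e k z \<in> X"
  using z unfolding atensor_of_def
proof (induction rule: complex_vector.span_induct_alt)
  case base
  show ?case by (simp add: complex_vector.linear_0[OF coord_clinear] complex_vector.subspace_0[OF X])
next
  case (step c x y)
  then show ?case
    by (auto simp: complex_vector.linear_add[OF coord_clinear] complex_vector.linear_scale[OF coord_clinear] coord_atens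
        intro!: complex_vector.subspace_add[OF X] complex_vector.subspace_scale[OF X])
qed

lemma atensor_ofI: "(\<And>k. k < n \<Longrightarrow> coord n e k z \<in> X) \<Longrightarrow> z \<in> atensor_of X UNIV"
  unfolding atensor_of_def
  by (subst coord_expand[of z], rule complex_vector.span_sum, rule complex_vector.span_base) blast

text \<open>Translates the right side of the cotensor condition into rows: applying the comodule map
  becomes multiplication by U.\<close>

lemma coord_coaction:
  fixes cV :: "'v \<Rightarrow> ('h::complex_vector, 'v) atensor" and T :: "'b::complex_vector \<Rightarrow> 'h \<Rightarrow> 'c::complex_vector"
  assumes cV: "clinear cV" and U: "\<And>i. i < n \<Longrightarrow> cV (e i) = (\<Sum>j<n. atens (U i j) (e j))"
    and T: "cbilinear T" and j: "j < n"
  shows "coord n e j (atensor_lift (\<lambda>b v. atensor_map (T b) id (cV v)) z) = (\<Sum>k<n. T (coord n e k z) (U k j))"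
proof -
  have Tl: "clinear (T b)" for b using T by (simp add: cbilinear_def)
  have bil: "cbilinear (\<lambda>b v. atensor_map (T b) id (cV v))"
  proof (rule cbilinearI)
    fix b b' :: 'b and v v' :: 'v and c
    show "atensor_map (T b) id (cV (v + v')) = atensor_map (T b) id (cV v) + atensor_map (T b) id (cV v')"
      by (simp add: complex_vector.linear_add[OF cV] complex_vector.linear_add[OF atensor_map(1)[OF Tl]])
    show "atensor_map (T b) id (cV (c *\<^sub>C v)) = c *\<^sub>C atensor_map (T b) id (cV v)"
      by (simp add: complex_vector.linear_scale[OF cV] complex_vector.linear_scale[OF atensor_map(1)[OF Tl]])
    show "atensor_map (T (b + b')) id (cV v) = atensor_map (T b) id (cV v) + atensor_map (T b') id (cV v)"
      by (rule coord_eqI) (simp add: complex_vector.linear_add[OF coord_clinear] coord_map[OF Tl] cbilinear_add_left[OF T])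
    show "atensor_map (T (c *\<^sub>C b)) id (cV v) = c *\<^sub>C atensor_map (T b) id (cV v)"
      by (rule coord_eqI) (simp add: complex_vector.linear_scale[OF coord_clinear] coord_map[OF Tl] cbilinear_scaleC_left[OF T])
  qed
  have "atensor_lift (\<lambda>b v. atensor_map (T b) id (cV v)) z = (\<Sum>k<n. atensor_map (T (coord n e k z)) id (cV (e k)))"
    by (subst (1) coord_expand[of z])
      (simp add: complex_vector.linear_sum[OF atensor_lift_clinear[OF bil]] atensor_lift_atens[OF bil])
  moreover have "coord n e j (cV (e k)) = U k j" if "k < n" for k using that j by (simp only: U coord_sum)
  ultimately show ?thesis by (simp only: complex_vector.linear_sum[OF coord_clinear] coord_map[OF Tl]) simp
qed

end

text \<open>On the complex line through T and the identity the determinant is a polynomial that is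
  nonzero at 0 and 1, and the complement of its finitely many roots in the plane is
  path-connected.\<close>

lemma complex_matrix_path:
  fixes T T' :: "nat \<Rightarrow> nat \<Rightarrow> complex"
  assumes TT': "\<forall>i<N. \<forall>j<N. (\<Sum>k<N. T i k * T' k j) = (if i = j then 1 else 0)"
  shows "\<exists>\<gamma> :: real \<Rightarrow> nat \<Rightarrow> nat \<Rightarrow> complex. (\<forall>i j. continuous_on {0..1} (\<lambda>x. \<gamma> x i j))
    \<and> (\<forall>i<N. \<forall>j<N. \<gamma> 0 i j = T i j \<and> \<gamma> 1 i j = (if i = j then 1 else 0))
    \<and> (\<forall>x\<in>{0..1}. \<exists>B. \<forall>i<N. \<forall>j<N. (\<Sum>k<N. \<gamma> x i k * B k j) = (if i = j then 1 else 0)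
        \<and> (\<Sum>k<N. B i k * \<gamma> x k j) = (if i = j then 1 else 0))"
proof -
  define I where "I i j = (if i = j then 1 else 0 :: complex)" for i j :: nat
  define q where "q i j = [:T i j, I i j - T i j:]" for i j
  \<comment> \<open>The Leibniz formula with the entries read as polynomials in the parameter of the
    line.\<close>
  define P where "P = (\<Sum>p\<in>{p. p permutes {0..<N}}. signof p * (\<Prod>i = 0..<N. q i (p i)))"
  define M where "M z = Matrix.mat N N (\<lambda>(i, j). poly (q i j) z)" for z
  have Mc: "M z \<in> carrier_mat N N" for z by (simp add: M_def)
  have prods: "(A * B) $$ (i, j) = (\<Sum>k<N. A $$ (i, k) * B $$ (k, j))"
    if "A \<in> carrier_mat N N" "B \<in> carrier_mat N N" "i < N" "j < N" for A B :: "complex mat" and i j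
    using that by (simp add: scalar_prod_def atLeast0LessThan)
  have sg: "poly (signof p) z = signof p" for p :: "nat \<Rightarrow> nat" and z :: complex
    by (simp add: sign_def)
  have det: "Determinant.det (M z) = poly P z" for z
  proof -
    have "Determinant.det (M z) = (\<Sum>p\<in>{p. p permutes {0..<N}}. signof p * (\<Prod>i = 0..<N. M z $$ (i, p i)))"
      by (rule det_def'[OF Mc])
    also have "\<dots> = (\<Sum>p\<in>{p. p permutes {0..<N}}. signof p * (\<Prod>i = 0..<N. poly (q i (p i)) z))"
    proof (intro sum.cong refl, goal_cases)
      case (1 p)
      then have "(\<Prod>i = 0..<N. M z $$ (i, p i)) = (\<Prod>i = 0..<N. poly (q i (p i)) z)"
        by (intro prod.cong refl) (auto simp: M_def dest: permutes_in_image)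
      then show ?case by simp
    qed
    finally show ?thesis by (simp add: P_def poly_sum poly_prod sg)
  qed
  have "M 0 * Matrix.mat N N (\<lambda>(i, j). T' i j) = 1\<^sub>m N"
  proof (rule eq_matI)
    fix i j assume "i < dim_row (1\<^sub>m N :: complex mat)" "j < dim_col (1\<^sub>m N :: complex mat)"
    then show "(M 0 * Matrix.mat N N (\<lambda>(i, j). T' i j)) $$ (i, j) = 1\<^sub>m N $$ (i, j)"
      by (subst prods) (auto simp: Mc M_def q_def TT')
  qed (auto simp: M_def)
  then have "Determinant.det (M 0) * Determinant.det (Matrix.mat N N (\<lambda>(i, j). T' i j)) = 1"
    using det_mult[OF Mc, of "Matrix.mat N N (\<lambda>(i, j). T' i j)" 0] by simp
  then have P0: "poly P 0 \<noteq> 0" by (auto simp: det)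
  have "M 1 = 1\<^sub>m N" by (rule eq_matI) (auto simp: M_def q_def I_def)
  then have P1: "poly P 1 \<noteq> 0" using det[of 1] by simp
  have "P \<noteq> 0" using P0 by auto
  then have "countable {z. poly P z = 0}" by (intro countable_finite poly_roots_finite)
  then have "path_connected (- {z. poly P z = 0})" by (intro path_connected_complement_countable) auto
  then obtain g where g: "path g" "path_image g \<subseteq> - {z. poly P z = 0}" "pathstart g = 0" "pathfinish g = 1"
    unfolding path_connected_def using P0 P1 by blast
  define \<gamma> where "\<gamma> x i j = poly (q i j) (g x)" for x i j
  show ?thesis
  proof (intro exI[of _ \<gamma>] conjI allI impI ballI)
    show "continuous_on {0..1} (\<lambda>x. \<gamma> x i j)" for i j
      using g(1) unfolding \<gamma>_def path_def by (intro continuous_intros)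
    show "\<gamma> 0 i j = T i j" "\<gamma> 1 i j = (if i = j then 1 else 0)" for i j
      using g(3,4) by (simp_all add: \<gamma>_def q_def pathstart_def pathfinish_def I_def)
  next
    fix x :: real assume x: "x \<in> {0..1}"
    then have "g x \<in> path_image g" by (simp add: path_image_def)
    then have nz: "Determinant.det (M (g x)) \<noteq> 0" using g(2) by (auto simp: det)
    define B where "B = (1 / Determinant.det (M (g x))) \<cdot>\<^sub>m adj_mat (M (g x))"
    have Bc: "B \<in> carrier_mat N N" using adj_mat(1)[OF Mc] by (simp add: B_def)
    have "(1 / c) \<cdot>\<^sub>m (c \<cdot>\<^sub>m 1\<^sub>m N) = (1\<^sub>m N :: complex mat)" if "c \<noteq> 0" for c
      using that by (intro eq_matI) auto
    then have B: "M (g x) * B = 1\<^sub>m N" "B * M (g x) = 1\<^sub>m N"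
      using adj_mat[OF Mc, of "g x"] Mc nz
      by (simp_all add: B_def mult_smult_distrib[OF Mc adj_mat(1)[OF Mc]] mult_smult_assoc_mat[OF adj_mat(1)[OF Mc] Mc])
    have Me: "M (g x) $$ (i, j) = \<gamma> x i j" if "i < N" "j < N" for i j using that by (simp add: M_def \<gamma>_def)
    show "\<exists>B. \<forall>i<N. \<forall>j<N. (\<Sum>k<N. \<gamma> x i k * B k j) = (if i = j then 1 else 0)
        \<and> (\<Sum>k<N. B i k * \<gamma> x k j) = (if i = j then 1 else 0)"
    proof (intro exI[of _ "\<lambda>i j. B $$ (i, j)"] allI impI conjI)
      fix i j assume ij: "i < N" "j < N"
      show "(\<Sum>k<N. \<gamma> x i k * B $$ (k, j)) = (if i = j then 1 else 0)"
        using prods[OF Mc Bc ij, of "g x"] ij by (simp add: B Me)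
      show "(\<Sum>k<N. B $$ (i, k) * \<gamma> x k j) = (if i = j then 1 else 0)"
        using prods[OF Bc Mc ij, of "g x"] ij by (simp add: B Me)
    qed
  qed
qed

lemma scalar_matrix_path:
  fixes T T' :: "nat \<Rightarrow> nat \<Rightarrow> complex"
  assumes TT': "\<And>i j. i < N \<Longrightarrow> j < N \<Longrightarrow> (\<Sum>k<N. T i k * T' k j) = (if i = j then 1 else 0)"
  shows "GL_path (pad N (\<lambda>i j. T i j *\<^sub>C 1)) (mat_id :: nat \<Rightarrow> nat \<Rightarrow> 'h::cstar_algebra)"
proof -
  obtain \<gamma> :: "real \<Rightarrow> nat \<Rightarrow> nat \<Rightarrow> complex" where c: "\<forall>i j. continuous_on {0..1} (\<lambda>x. \<gamma> x i j)"
    and ends: "\<forall>i<N. \<forall>j<N. \<gamma> 0 i j = T i j \<and> \<gamma> 1 i j = (if i = j then 1 else 0)"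
    and inv: "\<forall>x\<in>{0..1}. \<exists>B. \<forall>i<N. \<forall>j<N. (\<Sum>k<N. \<gamma> x i k * B k j) = (if i = j then 1 else 0)
        \<and> (\<Sum>k<N. B i k * \<gamma> x k j) = (if i = j then 1 else 0)"
  proof -
    have "\<forall>i<N. \<forall>j<N. (\<Sum>k<N. T i k * T' k j) = (if i = j then 1 else 0)" using TT' by blast
    from complex_matrix_path[OF this] that show ?thesis by (elim exE conjE)
  qed
  have bl: "bounded_linear (\<lambda>z. z *\<^sub>C (1 :: 'h))"
    by (rule bounded_linear_of_clinear[where K = 1])
      (auto intro!: clinearI simp: scaleC_add_left scaleC_scaleC[symmetric] scaleC_complex_def norm_scaleC simp del: complex_vector.scale_scale)
  have m: "(z *\<^sub>C 1) * (w *\<^sub>C 1) = (z * w) *\<^sub>C (1 :: 'h)" for z w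
    by (simp add: mult_scaleC_left mult_scaleC_right scaleC_scaleC)
  have "GL_path (pad N (\<lambda>i j. \<gamma> 0 i j *\<^sub>C (1 :: 'h))) (pad N (\<lambda>i j. \<gamma> 1 i j *\<^sub>C 1))"
  proof (rule GL_pathI[where \<gamma> = "\<lambda>x i j. \<gamma> x i j *\<^sub>C (1 :: 'h)"])
    show "continuous_on {0..1} (\<lambda>x. \<gamma> x i j *\<^sub>C (1 :: 'h))" for i j
      by (rule continuous_on_compose2[OF linear_continuous_on[OF bl, of UNIV] c[rule_format]]) simp
    fix x :: real assume "x \<in> {0..1}"
    with inv obtain B where B: "\<forall>i<N. \<forall>j<N. (\<Sum>k<N. \<gamma> x i k * B k j) = (if i = j then 1 else 0)
        \<and> (\<Sum>k<N. B i k * \<gamma> x k j) = (if i = j then 1 else 0)" by blast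
    show "\<exists>B. \<forall>i<N. \<forall>j<N. (\<Sum>k<N. \<gamma> x i k *\<^sub>C (1 :: 'h) * B k j) = (if i = j then 1 else 0)
        \<and> (\<Sum>k<N. B i k * \<gamma> x k j *\<^sub>C (1 :: 'h)) = (if i = j then 1 else 0)"
      using B by (intro exI[of _ "\<lambda>i j. B i j *\<^sub>C 1"]) (simp add: m complex_vector.scale_sum_left[symmetric])
  qed
  moreover have "pad N (\<lambda>i j. \<gamma> 0 i j *\<^sub>C (1 :: 'h)) = pad N (\<lambda>i j. T i j *\<^sub>C 1)"
    "pad N (\<lambda>i j. \<gamma> 1 i j *\<^sub>C (1 :: 'h)) = mat_id"
    using ends by (auto simp: pad_def mat_id_def fun_eq_iff)
  ultimately show ?thesis by simp
qed

section \<open>From a path of invertible matrices to triviality in \<open>K1\<close>\<close>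

lemma mat_assoc:
  fixes A :: "'k \<Rightarrow> 'r::semiring_0"
  shows "(\<Sum>k\<in>K. A k * (\<Sum>l\<in>L. B k l * C l)) = (\<Sum>l\<in>L. (\<Sum>k\<in>K. A k * B k l) * C l)"
  by (simp add: sum_distrib_left sum_distrib_right mult.assoc) (rule sum.swap)

text \<open>A path of invertible matrices from a scalar matrix to \<open>S U\<close> with \<open>S\<close> scalar trivialises \<open>U\<close> in
  \<open>K\<^sub>1\<close>. That the matrices are square is forced by the trace of the scalar one.\<close>

theorem clutching_trivial:
  fixes U W :: "nat \<Rightarrow> nat \<Rightarrow> 'h::cstar_algebra" and g gi :: "real \<Rightarrow> nat \<Rightarrow> nat \<Rightarrow> 'h" and N K :: nat
    and h :: "'h \<Rightarrow> complex"
  assumes h: "cstate h" and bU: "block_matrix n U" and bW: "block_matrix n W" and nK: "n \<le> K"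
    and UW: "\<And>i j. i < n \<Longrightarrow> j < n \<Longrightarrow> (\<Sum>k<n. U i k * W k j) = (if i = j then 1 else 0)"
    and WU: "\<And>i j. i < n \<Longrightarrow> j < n \<Longrightarrow> (\<Sum>k<n. W i k * U k j) = (if i = j then 1 else 0)"
    and cont: "\<And>i j. continuous_on {0..1} (\<lambda>x. g x i j)"
    and ggi: "\<And>x i j. x \<in> {0..1} \<Longrightarrow> i < N \<Longrightarrow> j < N \<Longrightarrow> (\<Sum>l<K. g x i l * gi x l j) = (if i = j then 1 else 0)"
    and gig: "\<And>x i j. x \<in> {0..1} \<Longrightarrow> i < K \<Longrightarrow> j < K \<Longrightarrow> (\<Sum>l<N. gi x i l * g x l j) = (if i = j then 1 else 0)"
    and g0: "\<And>i l. i < N \<Longrightarrow> l < K \<Longrightarrow> \<exists>c. g 0 i l = c *\<^sub>C 1"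
    and g1: "\<And>i m. i < N \<Longrightarrow> m < n \<Longrightarrow> \<exists>c. (\<Sum>l<n. g 1 i l * W l m) = c *\<^sub>C 1"
    and g1': "\<And>i l. i < N \<Longrightarrow> n \<le> l \<Longrightarrow> l < K \<Longrightarrow> \<exists>c. g 1 i l = c *\<^sub>C 1"
  shows "K1_class U = K1_class mat_id"
proof -
  note lin = complex_vector.linear_sum[OF cstateD(1)[OF h]] and D = cstateD[OF h]
  have \<delta>_hom: "h (if i = j then 1 else 0) = (if i = j then 1 else 0)" for i j :: nat
    by (simp add: D(3) complex_vector.linear_0[OF D(1)])
  have hs: "h ((c *\<^sub>C 1) * x) = c * h x" "h (x * (c *\<^sub>C 1)) = c * h x" for c x
    by (simp_all add: mult_scaleC_left mult_scaleC_right D(6))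
  obtain c where c: "\<And>i l. i < N \<Longrightarrow> l < K \<Longrightarrow> g 0 i l = c i l *\<^sub>C 1" using g0 by metis
  \<comment> \<open>\<open>g 0\<close> is scalar, so applying h entrywise to its inverse gives a
    scalar inverse; comparing the traces of the two products gives N = K.\<close>
  define d where "d l i = h (gi 0 l i)" for l i
  have cd: "(\<Sum>l<K. c i l * d l j) = (if i = j then 1 else 0)" if "i < N" "j < N" for i j
  proof -
    have "h (\<Sum>l<K. g 0 i l * gi 0 l j) = (\<Sum>l<K. c i l * d l j)" using that by (simp add: lin c hs d_def)
    then show ?thesis using ggi[of 0 i j] that by (simp add: \<delta>_hom)
  qed
  have dc: "(\<Sum>i<N. d l i * c i j) = (if l = j then 1 else 0)" if "l < K" "j < K" for l j
  proof -
    have "h (\<Sum>i<N. gi 0 l i * g 0 i j) = (\<Sum>i<N. d l i * c i j)" using that by (simp add: lin c hs d_def mult.commute)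
    then show ?thesis using gig[of 0 l j] that by (simp add: \<delta>_hom)
  qed
  have "complex_of_nat N = (\<Sum>i<N. \<Sum>l<K. c i l * d l i)" by (simp add: cd)
  also have "\<dots> = (\<Sum>l<K. \<Sum>i<N. d l i * c i l)" by (subst sum.swap) (simp add: mult.commute)
  also have "\<dots> = complex_of_nat K" by (simp add: dc)
  finally have NK: "N = K" by simp
  have nN: "n \<le> N" using nK NK by simp
  have WUN: "(\<Sum>k<N. W i k * U k j) = (if i = j then 1 else 0)" if "i < N" "j < N" for i j
    using block_prod[OF bW bU nN that] WU by (auto simp: mat_id_def split: if_splits)
  have UWN: "(\<Sum>k<N. U i k * W k j) = (if i = j then 1 else 0)" if "i < N" "j < N" for i j
    using block_prod[OF bU bW nN that] UW by (auto simp: mat_id_def split: if_splits)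
  have "\<exists>s. (\<Sum>l<N. g 1 i l * W l m) = s *\<^sub>C 1" if i: "i < N" and m: "m < N" for i m
  proof (cases "m < n")
    case True
    have "(\<Sum>l<N. g 1 i l * W l m) = (\<Sum>l<n. g 1 i l * W l m)"
      using nN bW True by (intro sum.mono_neutral_right) (auto simp: block_matrix_def mat_id_def)
    then show ?thesis using g1[OF i True] by simp
  next
    case False
    then have "(\<Sum>l<N. g 1 i l * W l m) = g 1 i m"
      using bW m by (simp add: block_matrix_def mat_id_def kronecker_sum_left)
    then show ?thesis using g1'[OF i] False m NK by simp
  qed
  then obtain S where S: "\<And>i m. i < N \<Longrightarrow> m < N \<Longrightarrow> (\<Sum>l<N. g 1 i l * W l m) = S i m *\<^sub>C 1" by metis
  have g1SU: "g 1 i j = (\<Sum>m<N. S i m *\<^sub>C U m j)" if ij: "i < N" "j < N" for i j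
  proof -
    have "g 1 i j = (\<Sum>l<N. g 1 i l * (\<Sum>m<N. W l m * U m j))"
      using ij by (simp add: WUN kronecker_sum_left)
    also have "\<dots> = (\<Sum>m<N. (\<Sum>l<N. g 1 i l * W l m) * U m j)" by (rule mat_assoc)
    also have "\<dots> = (\<Sum>m<N. S i m *\<^sub>C U m j)" using ij by (simp add: S mult_scaleC_left)
    finally show ?thesis .
  qed
  \<comment> \<open>Since \<open>g 1\<close> = S U, the matrix X = U \<open>gi 1\<close> is the
    inverse of S over H. As S is scalar, T = h(X) is a scalar inverse of it.\<close>
  define X where "X i j = (\<Sum>k<N. U i k * gi 1 k j)" for i j
  define T where "T i j = h (X i j)" for i j
  have SX: "(\<Sum>k<N. S i k *\<^sub>C X k j) = (if i = j then 1 else 0)" if ij: "i < N" "j < N" for i j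
  proof -
    have "(\<Sum>k<N. S i k *\<^sub>C X k j) = (\<Sum>k<N. (S i k *\<^sub>C 1) * (\<Sum>l<N. U k l * gi 1 l j))"
      by (simp add: X_def mult_scaleC_left)
    also have "\<dots> = (\<Sum>l<N. (\<Sum>k<N. (S i k *\<^sub>C 1) * U k l) * gi 1 l j)" by (rule mat_assoc)
    also have "\<dots> = (\<Sum>l<N. g 1 i l * gi 1 l j)" using ij by (simp add: g1SU mult_scaleC_left)
    finally show ?thesis using ggi[of 1 i j] ij NK by simp
  qed
  have XS: "(\<Sum>k<N. X i k * S k j *\<^sub>C 1) = (if i = j then 1 else 0)" if ij: "i < N" "j < N" for i j
  proof -
    have gS: "(\<Sum>k<N. gi 1 l k * S k j *\<^sub>C 1) = W l j" if l: "l < N" for l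
    proof -
      have "(\<Sum>k<N. gi 1 l k * S k j *\<^sub>C 1) = (\<Sum>k<N. gi 1 l k * (\<Sum>m<N. g 1 k m * W m j))" using ij by (simp add: S)
      also have "\<dots> = (\<Sum>m<N. (\<Sum>k<N. gi 1 l k * g 1 k m) * W m j)" by (rule mat_assoc)
      also have "\<dots> = (\<Sum>m<N. (if l = m then 1 else 0) * W m j)" using l gig[of 1 l] NK by simp
      finally show ?thesis using l by (simp add: kronecker_sum_left)
    qed
    have "(\<Sum>k<N. X i k * S k j *\<^sub>C 1) = (\<Sum>l<N. U i l * (\<Sum>k<N. gi 1 l k * S k j *\<^sub>C 1))"
      unfolding X_def by (rule mat_assoc[symmetric])
    also have "\<dots> = (\<Sum>l<N. U i l * W l j)" by (simp add: gS)
    finally show ?thesis using UWN ij by simp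
  qed
  have ST: "(\<Sum>k<N. S i k * T k j) = (if i = j then 1 else 0)" if "i < N" "j < N" for i j
    using arg_cong[OF SX[OF that], of h] by (simp add: lin D(6) \<delta>_hom T_def)
  have TS: "(\<Sum>k<N. T i k * S k j) = (if i = j then 1 else 0)" if "i < N" "j < N" for i j
    using arg_cong[OF XS[OF that], of h] by (simp add: lin hs \<delta>_hom T_def mult.commute)
  \<comment> \<open>T g runs from the scalar matrix T c to T S U = U.\<close>
  define p where "p x i j = (\<Sum>k<N. T i k *\<^sub>C g x k j)" for x i j
  have "GL_path (pad N (p 0)) (pad N (p 1))"
  proof (rule GL_pathI)
    show "continuous_on {0..1} (\<lambda>x. p x i j)" for i j
      unfolding p_def
      by (intro continuous_on_sum) (rule continuous_on_compose2[OF linear_continuous_on[OF bounded_linear_scaleC, of UNIV] cont], simp)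
    fix x :: real assume x: "x \<in> {0..1}"
    \<comment> \<open>B is \<open>gi x\<close> times S, the inverse of T times
      \<open>g x\<close>.\<close>
    define B where "B i j = (\<Sum>k<N. S k j *\<^sub>C gi x i k)" for i j
    have "(\<Sum>k<N. p x i k * B k j) = (if i = j then 1 else 0)" if ij: "i < N" "j < N" for i j
    proof -
      have gB: "(\<Sum>k<N. g x l k * B k j) = S l j *\<^sub>C 1" if l: "l < N" for l
      proof -
        have "(\<Sum>k<N. g x l k * B k j) = (\<Sum>k<N. g x l k * (\<Sum>m<N. gi x k m * S m j *\<^sub>C 1))"
          by (simp add: B_def mult_scaleC_right)
        also have "\<dots> = (\<Sum>m<N. (\<Sum>k<N. g x l k * gi x k m) * S m j *\<^sub>C 1)" by (rule mat_assoc)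
        also have "\<dots> = (\<Sum>m<N. (if l = m then 1 else 0) * S m j *\<^sub>C 1)" using ggi[OF x] l NK by simp
        finally show ?thesis using l by (simp add: kronecker_sum_left)
      qed
      have "(\<Sum>k<N. p x i k * B k j) = (\<Sum>k<N. (\<Sum>l<N. T i l *\<^sub>C 1 * g x l k) * B k j)"
        by (simp add: p_def mult_scaleC_left)
      also have "\<dots> = (\<Sum>l<N. T i l *\<^sub>C 1 * (\<Sum>k<N. g x l k * B k j))" by (rule mat_assoc[symmetric])
      also have "\<dots> = (\<Sum>l<N. T i l * S l j) *\<^sub>C 1"
        by (simp add: gB mult_scaleC_left scaleC_scaleC complex_vector.scale_sum_left)
      finally show ?thesis using TS ij by simp
    qed
    moreover have "(\<Sum>k<N. B i k * p x k j) = (if i = j then 1 else 0)" if ij: "i < N" "j < N" for i j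
    proof -
      have Bp: "(\<Sum>k<N. S l k *\<^sub>C p x k j) = g x l j" if l: "l < N" for l
      proof -
        have "(\<Sum>k<N. S l k *\<^sub>C p x k j) = (\<Sum>k<N. S l k *\<^sub>C 1 * (\<Sum>m<N. T k m *\<^sub>C 1 * g x m j))"
          by (simp add: p_def mult_scaleC_left)
        also have "\<dots> = (\<Sum>m<N. (\<Sum>k<N. S l k *\<^sub>C 1 * T k m *\<^sub>C 1) * g x m j)" by (rule mat_assoc)
        also have "\<dots> = (\<Sum>m<N. ((\<Sum>k<N. S l k * T k m) *\<^sub>C 1) * g x m j)"
          by (simp add: mult_scaleC_left scaleC_scaleC complex_vector.scale_sum_left)
        also have "\<dots> = (\<Sum>m<N. (if l = m then 1 else 0) * g x m j)"
          using l ST by (intro sum.cong) (auto)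
        finally show ?thesis using l by (simp add: kronecker_sum_left)
      qed
      have "(\<Sum>k<N. B i k * p x k j) = (\<Sum>k<N. (\<Sum>l<N. gi x i l * S l k *\<^sub>C 1) * p x k j)"
        by (simp add: B_def mult_scaleC_right)
      also have "\<dots> = (\<Sum>l<N. gi x i l * (\<Sum>k<N. S l k *\<^sub>C 1 * p x k j))" by (rule mat_assoc[symmetric])
      also have "\<dots> = (\<Sum>l<N. gi x i l * g x l j)" by (simp add: mult_scaleC_left Bp)
      finally show ?thesis using gig[OF x] ij NK by simp
    qed
    ultimately show "\<exists>B. \<forall>i<N. \<forall>j<N. (\<Sum>k<N. p x i k * B k j) = (if i = j then 1 else 0)
        \<and> (\<Sum>k<N. B i k * p x k j) = (if i = j then 1 else 0)" by blast
  qed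
  moreover have "pad N (p 1) = U"
  proof (intro ext)
    fix i j
    show "pad N (p 1) i j = U i j"
    proof (cases "i < N \<and> j < N")
      case True
      have "p 1 i j = (\<Sum>k<N. T i k *\<^sub>C 1 * (\<Sum>m<N. S k m *\<^sub>C 1 * U m j))"
        using True by (simp add: p_def g1SU mult_scaleC_left)
      also have "\<dots> = (\<Sum>m<N. (\<Sum>k<N. T i k *\<^sub>C 1 * S k m *\<^sub>C 1) * U m j)" by (rule mat_assoc)
      also have "\<dots> = (\<Sum>m<N. ((\<Sum>k<N. T i k * S k m) *\<^sub>C 1) * U m j)"
        by (simp add: mult_scaleC_left scaleC_scaleC complex_vector.scale_sum_left)
      also have "\<dots> = (\<Sum>m<N. (if i = m then 1 else 0) * U m j)"
        using True TS by (intro sum.cong) auto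
      finally show ?thesis using True by (simp add: pad_def kronecker_sum_left)
    next
      case False
      then show ?thesis using block_mono[OF bU nN] by (auto simp: pad_def block_matrix_def)
    qed
  qed
  moreover have "GL_path (pad N (p 0)) mat_id"
  proof -
    define T0 where "T0 i j = (\<Sum>k<N. T i k * c k j)" for i j
    define T0' where "T0' i j = (\<Sum>k<N. d i k * S k j)" for i j
    have p0: "pad N (p 0) = pad N (\<lambda>i j. T0 i j *\<^sub>C 1)"
      using c NK by (auto simp: pad_def fun_eq_iff p_def T0_def scaleC_scaleC complex_vector.scale_sum_left)
    have "(\<Sum>k<N. T0 i k * T0' k j) = (if i = j then 1 else 0)" if ij: "i < N" "j < N" for i j
    proof -
      have cT: "(\<Sum>k<N. c l k * T0' k j) = S l j" if l: "l < N" for l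
      proof -
        have "(\<Sum>k<N. c l k * T0' k j) = (\<Sum>m<N. (\<Sum>k<N. c l k * d k m) * S m j)"
          unfolding T0'_def by (rule mat_assoc)
        also have "\<dots> = (\<Sum>m<N. (if l = m then 1 else 0) * S m j)" using l cd NK by simp
        finally show ?thesis using l by (simp add: kronecker_sum_left)
      qed
      have "(\<Sum>k<N. T0 i k * T0' k j) = (\<Sum>l<N. T i l * (\<Sum>k<N. c l k * T0' k j))"
        unfolding T0_def by (rule mat_assoc[symmetric])
      then show ?thesis using TS[OF ij] by (simp add: cT)
    qed
    then show ?thesis unfolding p0 by (rule scalar_matrix_path)
  qed
  ultimately have "GL_path U mat_id" using GL_path_trans GL_path_sym by metis
  then show ?thesis by (rule K1_class_eqI)
qed

section \<open>Functions on the unit interval\<close>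

lemma C01_const: "(\<lambda>_. c) \<in> C01" by (simp add: C01_def)

lemma C01_add: "f \<in> C01 \<Longrightarrow> g \<in> C01 \<Longrightarrow> (\<lambda>x. f x + g x :: 'a::cstar_algebra) \<in> C01"
  and C01_mult: "f \<in> C01 \<Longrightarrow> g \<in> C01 \<Longrightarrow> (\<lambda>x. f x * g x :: 'a::cstar_algebra) \<in> C01"
  and C01_diff: "f \<in> C01 \<Longrightarrow> g \<in> C01 \<Longrightarrow> (\<lambda>x. f x - g x :: 'a::cstar_algebra) \<in> C01"
  unfolding C01_def by (auto intro!: continuous_on_add continuous_on_mult continuous_on_diff)

lemma C01_sum: "(\<And>i. i \<in> I \<Longrightarrow> f i \<in> C01) \<Longrightarrow> (\<lambda>x. \<Sum>i\<in>I. f i x :: 'a::cstar_algebra) \<in> C01"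
  by (induction I rule: infinite_finite_induct) (auto simp: C01_const C01_add)

lemma C01_linear: "bounded_linear F \<Longrightarrow> f \<in> C01 \<Longrightarrow> (\<lambda>x. F (f x)) \<in> C01"
  unfolding C01_def by (auto intro: bounded_linear.continuous_on)

lemma C01_cts: "f \<in> C01 \<Longrightarrow> continuous_on {0..1} f" by (simp add: C01_def)

text \<open>Elements of \<open>C01\<close> are constant outside [0,1], hence the clamped identity
  function.\<close>

definition ramp :: "real \<Rightarrow> 'a::cstar_algebra"
  where "ramp x = of_real (max 0 (min 1 x))"

lemma ramp_C01: "ramp \<in> C01"
proof -
  have "continuous_on {0..1} (\<lambda>x :: real. of_real (max 0 (min 1 x)) :: 'a::cstar_algebra)"
    by (intro continuous_on_of_real continuous_on_max continuous_on_min continuous_on_const continuous_on_id)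
  then show ?thesis by (auto simp: C01_def ramp_def[abs_def])
qed

lemma ramp_eq: "x \<in> {0..1} \<Longrightarrow> ramp x = of_real x" by (simp add: ramp_def)

lemma of_real_scaleC: "of_real r = complex_of_real r *\<^sub>C (1 :: 'a::cstar_algebra)"
  by (subst of_real_def) (rule scaleR_scaleC)

lemma of_real_commute: "of_real r * x = x * (of_real r :: 'a::cstar_algebra)"
  by (simp add: of_real_def)
section \<open>The associated module over the join\<close>

text \<open>\<open>OH\<close> is kept as any set containing the entries of U;
  \<open>jmod_iff\<close> derives the Peter-Weyl condition from that.\<close>

locale comodule_of_coaction = rep_of_coaction t \<Delta> s s' s'' \<delta> h n U W
  for t :: "'h::cstar_algebra \<Rightarrow> 'h \<Rightarrow> 'hh::cstar_algebra" and \<Delta> :: "'h \<Rightarrow> 'hh"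
    and s :: "'a::cstar_algebra \<Rightarrow> 'h \<Rightarrow> 'ah::cstar_algebra" and s' :: "'ah \<Rightarrow> 'h \<Rightarrow> 'ahh::cstar_algebra"
    and s'' :: "'a \<Rightarrow> 'hh \<Rightarrow> 'ahh" and \<delta> :: "'a \<Rightarrow> 'ah" and h :: "'h \<Rightarrow> complex"
    and n :: nat and U W :: "nat \<Rightarrow> nat \<Rightarrow> 'h" +
  fixes cV :: "'v::complex_vector \<Rightarrow> ('h, 'v) atensor" and e :: "nat \<Rightarrow> 'v" and OH :: "'h set"
  assumes cV: "clinear cV" and cVe: "\<And>i. i < n \<Longrightarrow> cV (e i) = (\<Sum>j<n. atens (U i j) (e j))"
    and UO: "\<And>i j. i < n \<Longrightarrow> j < n \<Longrightarrow> U i j \<in> OH"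
    and inj: "inj_on e {..<n}" and indep: "cindependent (e ` {..<n})" and span: "cspan (e ` {..<n}) = UNIV"
begin

abbreviation "jalg \<equiv> join s \<delta>"
abbreviation "jten \<equiv> join_tensor s'"
abbreviation "jcoact \<equiv> join_coaction \<Delta> s s''"
abbreviation "jfix \<equiv> fixed_points jalg jten jcoact"
abbreviation "jmod \<equiv> cotensor (peter_weyl OH jalg jten jcoact) jten jcoact cV"
abbreviation "crd \<equiv> coord n e"

lemmas basis = inj indep span

lemma jalg_iff: "f \<in> jalg \<longleftrightarrow> f \<in> C01 \<and> f 0 \<in> range (s 1) \<and> f 1 \<in> range \<delta>"
proof -
  have "{s (c *\<^sub>C 1) k | c k. True} = range (s 1)"
  proof (intro Set.set_eqI iffI)
    fix z assume "z \<in> {s (c *\<^sub>C 1) k | c k. True}"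
    then obtain c k where "z = s (c *\<^sub>C 1) k" by blast
    then have "z = s 1 (c *\<^sub>C k)" by (simp add: cbilinear_scaleC_left[OF sb] cbilinear_scaleC_right[OF sb])
    then show "z \<in> range (s 1)" by blast
  next
    fix z assume "z \<in> range (s 1)"
    then obtain k where "z = s (1 *\<^sub>C 1) k" by auto
    then show "z \<in> {s (c *\<^sub>C 1) k | c k. True}" by blast
  qed
  then show ?thesis by (simp add: join_def)
qed

lemma range_hom_closed:
  fixes f :: "'x::cstar_algebra \<Rightarrow> 'y::cstar_algebra"
  assumes f: "cstar_hom f"
  shows "0 \<in> range f" "x \<in> range f \<Longrightarrow> y \<in> range f \<Longrightarrow> x + y \<in> range f" "x \<in> range f \<Longrightarrow> y \<in> range f \<Longrightarrow> x * y \<in> range f"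
    "x \<in> range f \<Longrightarrow> c *\<^sub>C x \<in> range f" "1 \<in> range f" "(\<And>i. i \<in> I \<Longrightarrow> g i \<in> range f) \<Longrightarrow> (\<Sum>i\<in>I. g i) \<in> range f"
proof -
  note l = cstar_hom_clinear[OF f]
  show z: "0 \<in> range f" using complex_vector.linear_0[OF l] by (metis rangeI)
  show "1 \<in> range f" using cstar_hom_one[OF f] by (metis rangeI)
  show a: "x \<in> range f \<Longrightarrow> y \<in> range f \<Longrightarrow> x + y \<in> range f" for x y by (auto simp: complex_vector.linear_add[OF l, symmetric])
  show "x \<in> range f \<Longrightarrow> y \<in> range f \<Longrightarrow> x * y \<in> range f" by (auto simp: cstar_hom_mult[OF f, symmetric])
  show "x \<in> range f \<Longrightarrow> c *\<^sub>C x \<in> range f" by (auto simp: complex_vector.linear_scale[OF l, symmetric])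
  show "(\<And>i. i \<in> I \<Longrightarrow> g i \<in> range f) \<Longrightarrow> (\<Sum>i\<in>I. g i) \<in> range f"
    by (induction I rule: infinite_finite_induct) (simp_all add: z a)
qed

lemmas s1_range = range_hom_closed[OF min_tensor_right_hom[OF tensors(1)]]
lemmas \<delta>_range = range_hom_closed[OF \<delta>_hom]

lemma jalg_add: "f \<in> jalg \<Longrightarrow> g \<in> jalg \<Longrightarrow> f + g \<in> jalg"
  unfolding jalg_iff plus_fun_def by (auto intro!: C01_add s1_range(2) \<delta>_range(2))

lemma jalg_mult: "f \<in> jalg \<Longrightarrow> g \<in> jalg \<Longrightarrow> f * g \<in> jalg"
  unfolding jalg_iff times_fun_def by (auto intro!: C01_mult s1_range(3) \<delta>_range(3))

lemma jalg_subspace: "csubspace jalg"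
proof (rule complex_vector.subspaceI)
  show "0 \<in> jalg" unfolding jalg_iff zero_fun_def by (auto simp: C01_const s1_range(1) \<delta>_range(1))
  show "c *\<^sub>C f \<in> jalg" if "f \<in> jalg" for c f
    using that unfolding jalg_iff scaleC_fun_def
    by (auto intro!: C01_linear[OF bounded_linear_scaleC] s1_range(4) \<delta>_range(4))
qed (rule jalg_add)

lemma jcoact_apply: "jcoact f x = cmul (f x)" by (simp add: join_coaction_def)
lemma jten_apply: "jten f k x = s' (f x) k" by (simp add: join_tensor_def)

lemma jcoact_clinear: "clinear jcoact"
  by (rule clinearI) (auto simp: fun_eq_iff jcoact_apply scaleC_fun_def complex_vector.linear_add[OF cstar_hom_clinear[OF cmul_hom]]
      complex_vector.linear_scale[OF cstar_hom_clinear[OF cmul_hom]])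

lemma jten_cbilinear: "cbilinear jten"
  by (rule cbilinearI) (auto simp: fun_eq_iff jten_apply scaleC_fun_def cbilinear_add_left[OF sb'] cbilinear_add_right[OF sb']
      cbilinear_scaleC_left[OF sb'] cbilinear_scaleC_right[OF sb'])

text \<open>Equivariance writes the coaction of each coordinate as a sum with entries of U in the
  H-leg. These lie in \<open>OH\<close>, so the Peter-Weyl condition follows and only membership of
  the coordinates in the join remains.\<close>

lemma jmod_iff: "z \<in> jmod \<longleftrightarrow> (\<forall>k<n. crd k z \<in> jalg) \<and> (\<forall>k<n. jcoact (crd k z) = (\<Sum>j<n. jten (crd j z) (U j k)))"
proof -
  let ?P = "peter_weyl OH jalg jten jcoact"
  have P: "csubspace ?P"
  proof (rule complex_vector.subspaceI)
    let ?S = "cspan {jten b' h | b' h. b' \<in> jalg \<and> h \<in> OH}"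
    show "0 \<in> ?P"
      by (simp add: peter_weyl_def complex_vector.linear_0[OF jcoact_clinear] complex_vector.span_zero complex_vector.subspace_0[OF jalg_subspace])
    show "x + y \<in> ?P" if "x \<in> ?P" "y \<in> ?P" for x y
      using that complex_vector.span_add[of "jcoact x" _ "jcoact y"]
      by (simp add: peter_weyl_def complex_vector.linear_add[OF jcoact_clinear] jalg_add)
    show "c *\<^sub>C x \<in> ?P" if "x \<in> ?P" for c x
      using that complex_vector.span_scale[of "jcoact x" _ c]
      by (simp add: peter_weyl_def complex_vector.linear_scale[OF jcoact_clinear] complex_vector.subspace_scale[OF jalg_subspace])
  qed
  have eq: "atensor_map jcoact id z = atensor_lift (\<lambda>b v. atensor_map (jten b) id (cV v)) z
    \<longleftrightarrow> (\<forall>k<n. jcoact (crd k z) = (\<Sum>j<n. jten (crd j z) (U j k)))" (is "?l = ?r \<longleftrightarrow> _")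
  proof
    assume "?l = ?r"
    then have "crd k ?l = crd k ?r" for k by simp
    then show "\<forall>k<n. jcoact (crd k z) = (\<Sum>j<n. jten (crd j z) (U j k))"
      using coord_coaction[OF basis cV cVe jten_cbilinear] by (simp add: coord_map[OF basis jcoact_clinear])
  next
    assume "\<forall>k<n. jcoact (crd k z) = (\<Sum>j<n. jten (crd j z) (U j k))"
    then show "?l = ?r"
      by (intro coord_eqI[OF basis])
        (simp add: coord_coaction[OF basis cV cVe jten_cbilinear] coord_map[OF basis jcoact_clinear])
  qed
  show ?thesis
  proof (intro iffI conjI)
    assume z: "z \<in> jmod"
    then have "crd k z \<in> ?P" for k by (auto simp: cotensor_def intro!: coord_atensor_of[OF basis P])
    then show "\<forall>k<n. crd k z \<in> jalg" by (simp add: peter_weyl_def)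
    show "\<forall>k<n. jcoact (crd k z) = (\<Sum>j<n. jten (crd j z) (U j k))" using z eq by (simp add: cotensor_def)
  next
    assume r: "(\<forall>k<n. crd k z \<in> jalg) \<and> (\<forall>k<n. jcoact (crd k z) = (\<Sum>j<n. jten (crd j z) (U j k)))"
    have "crd k z \<in> ?P" if k: "k < n" for k
    proof -
      have "jcoact (crd k z) \<in> cspan {jten b' h | b' h. b' \<in> jalg \<and> h \<in> OH}"
        using r k UO by (simp, intro complex_vector.span_sum complex_vector.span_base) blast
      then show ?thesis using r k by (simp add: peter_weyl_def)
    qed
    from atensor_ofI[OF basis this] show "z \<in> jmod" using r eq by (simp add: cotensor_def)
  qed
qed

lemma jmod_coord: assumes "z \<in> jmod" "k < n"
  shows "crd k z \<in> jalg" "cmul (crd k z x) = (\<Sum>j<n. s' (crd j z x) (U j k))"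
proof -
  show "crd k z \<in> jalg" using assms by (simp add: jmod_iff)
  have "jcoact (crd k z) x = (\<Sum>j<n. jten (crd j z) (U j k)) x" using assms by (simp add: jmod_iff)
  then show "cmul (crd k z x) = (\<Sum>j<n. s' (crd j z x) (U j k))" by (simp add: jcoact_apply jten_apply sum_fun_apply)
qed

lemma jmodI:
  assumes "\<And>k. k < n \<Longrightarrow> crd k z \<in> jalg" "\<And>k x. k < n \<Longrightarrow> cmul (crd k z x) = (\<Sum>j<n. s' (crd j z x) (U j k))"
  shows "z \<in> jmod"
  unfolding jmod_iff using assms by (auto simp: fun_eq_iff jcoact_apply jten_apply sum_fun_apply)

lemma crd_action:
  fixes r :: "real \<Rightarrow> 'ah"
  shows "crd k (left_action r z) = r * crd k z"
proof -
  have "clinear (\<lambda>b :: real \<Rightarrow> 'ah. r * b)"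
    by (rule clinearI) (auto simp: fun_eq_iff distrib_left scaleC_fun_def mult_scaleC_right)
  then show ?thesis unfolding left_action_def by (rule coord_map[OF basis])
qed

lemma crd_add: "crd k (z + w) = crd k z + crd k w"
  by (rule complex_vector.linear_add[OF coord_clinear[OF basis]])

lemma crd_zero: "crd k 0 = 0"
  by (rule complex_vector.linear_0[OF coord_clinear[OF basis]])

lemma jfix_iff: "r \<in> jfix \<longleftrightarrow> r \<in> jalg \<and> (\<forall>x. cmul (r x) = s' (r x) 1)"
  by (auto simp: fixed_points_def fun_eq_iff jcoact_apply jten_apply)

text \<open>Fixed functions take values in A \<otimes> 1 and are handled as A-valued functions
  through \<open>hav\<close>. With \<open>jfix_C01\<close>, \<open>jfix_0\<close>,
  \<open>jfix_1\<close> and \<open>jfixI\<close> this identifies the fixed-point algebra with the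
  functions a that are scalar at 0 and satisfy a(1) \<otimes> 1 in \<delta>(A).\<close>

lemma jfix_tensor: "r \<in> jfix \<Longrightarrow> r x = s (hav (r x)) 1"
  using fixed_point_tensor by (simp add: jfix_iff)

lemma jfix_C01: "r \<in> jfix \<Longrightarrow> (\<lambda>x. hav (r x)) \<in> C01"
  by (rule C01_linear[OF rslice(1)[OF tensors(1) h]]) (simp add: jfix_iff jalg_iff)

lemma hav_scalar: "hav (s 1 k) = h k *\<^sub>C 1" by (rule rslice(4)[OF tensors(1) h])

lemma jfix_0: "r \<in> jfix \<Longrightarrow> \<exists>c. hav (r 0) = c *\<^sub>C 1"
  by (auto simp: jfix_iff jalg_iff hav_scalar)

lemma jfix_1: "r \<in> jfix \<Longrightarrow> s (hav (r 1)) 1 \<in> range \<delta>"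
  using jfix_tensor[of r 1] by (simp add: jfix_iff jalg_iff)

lemma jfixI:
  assumes a: "a \<in> C01" and a0: "\<exists>c. a 0 = c *\<^sub>C 1" and a1: "s (a 1) 1 \<in> range \<delta>"
  shows "(\<lambda>x. s (a x) 1) \<in> jfix"
  unfolding jfix_iff jalg_iff
proof (intro conjI allI)
  show "(\<lambda>x. s (a x) 1) \<in> C01" by (rule C01_linear[OF cstar_hom_bounded_linear[OF min_tensor_left_hom[OF tensors(1)]] a])
  obtain c where "a 0 = c *\<^sub>C 1" using a0 by blast
  then have "s (a 0) 1 = s 1 (c *\<^sub>C 1)" by (simp add: cbilinear_scaleC_left[OF sb] cbilinear_scaleC_right[OF sb])
  then show "s (a 0) 1 \<in> range (s 1)" by simp
qed (use a1 cmul_left in auto)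

lemma jfix_add: "r \<in> jfix \<Longrightarrow> r' \<in> jfix \<Longrightarrow> r + r' \<in> jfix"
  by (simp add: jfix_iff jalg_add complex_vector.linear_add[OF cstar_hom_clinear[OF cmul_hom]] cbilinear_add_left[OF sb'])

lemma jfix_mult: "r \<in> jfix \<Longrightarrow> r' \<in> jfix \<Longrightarrow> r * r' \<in> jfix"
  by (simp add: jfix_iff jalg_mult cstar_hom_mult[OF cmul_hom] min_tensor_mult[OF tensors(2)])

lemma jfix_zero: "0 \<in> jfix"
  using jfixI[of "\<lambda>_. 0", OF C01_const exI[of _ 0]] by (simp add: cbilinear_zero_left[OF sb] \<delta>_range(1) zero_fun_def)

lemma jfix_one: "1 \<in> jfix"
  using jfixI[of "\<lambda>_. 1", OF C01_const exI[of _ 1]] by (simp add: min_tensor_one[OF tensors(1)] \<delta>_range(5) one_fun_def)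

text \<open>\<open>jrow (z, y)\<close> lists the coefficients of \<open>z\<close> relative to \<open>U\<close>, followed by those of \<open>y\<close>; it embeds
  the module into functions with values in \<open>A\<^sup>n\<^sup>+\<^sup>m\<close>.\<close>

definition jrow :: "(real \<Rightarrow> 'ah, 'v) atensor \<times> (nat \<Rightarrow> real \<Rightarrow> 'ah) \<Rightarrow> nat \<Rightarrow> real \<Rightarrow> 'a"
  where "jrow p l x = (if l < n then hav (\<Sum>k<n. crd k (fst p) x * s 1 (W k l)) else hav (snd p (l - n) x))"

definition jact :: "(real \<Rightarrow> 'ah) \<Rightarrow> (real \<Rightarrow> 'ah, 'v) atensor \<times> (nat \<Rightarrow> real \<Rightarrow> 'ah)
    \<Rightarrow> (real \<Rightarrow> 'ah, 'v) atensor \<times> (nat \<Rightarrow> real \<Rightarrow> 'ah)"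
  where "jact r p = (left_action r (fst p), \<lambda>i. r * snd p i)"

lemmas hav_lin = rslice(2)[OF tensors(1) h]

lemma jrow_add: "jrow (p + q) l x = jrow p l x + jrow q l x"
  by (simp add: jrow_def crd_add complex_vector.linear_add[OF hav_lin, symmetric] distrib_right sum.distrib)

lemma jrow_zero: "jrow 0 l x = 0"
  by (simp add: jrow_def crd_zero complex_vector.linear_0[OF hav_lin])

lemma jrow_act: assumes "r \<in> jfix" shows "jrow (jact r p) l x = hav (r x) * jrow p l x"
proof -
  have "r x * w = s (hav (r x)) 1 * w" for w using jfix_tensor[OF assms, of x] by simp
  then have "hav (r x * w) = hav (r x) * hav w" for w by (metis rslice_mult_left[OF tensors(1) h])
  moreover have "(\<Sum>k<n. r x * crd k (fst p) x * s 1 (W k l)) = r x * (\<Sum>k<n. crd k (fst p) x * s 1 (W k l))"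
    by (simp add: sum_distrib_left mult.assoc)
  ultimately show ?thesis by (simp add: jrow_def jact_def crd_action)
qed

lemma jmod_add: "z \<in> jmod \<Longrightarrow> w \<in> jmod \<Longrightarrow> z + w \<in> jmod"
  by (rule jmodI) (auto simp: crd_add jmod_coord intro!: jalg_add
      simp: complex_vector.linear_add[OF cstar_hom_clinear[OF cmul_hom]] cbilinear_add_left[OF sb'] sum.distrib)

lemma jmod_zero: "0 \<in> jmod"
  by (rule jmodI) (auto simp: crd_zero complex_vector.subspace_0[OF jalg_subspace]
      complex_vector.linear_0[OF cstar_hom_clinear[OF cmul_hom]] cbilinear_zero_left[OF sb'])

lemma jmod_act: assumes r: "r \<in> jfix" and z: "z \<in> jmod" shows "left_action r z \<in> jmod"
proof (rule jmodI)
  fix k assume k: "k < n"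
  show "crd k (left_action r z) \<in> jalg"
    unfolding crd_action using r jmod_coord(1)[OF z k] by (intro jalg_mult) (auto simp: jfix_iff)
  fix x
  have "cmul (crd k (left_action r z) x) = s' (r x) 1 * (\<Sum>j<n. s' (crd j z x) (U j k))"
    using r by (simp add: crd_action cstar_hom_mult[OF cmul_hom] jmod_coord(2)[OF z k] jfix_iff)
  also have "\<dots> = (\<Sum>j<n. s' (crd j (left_action r z) x) (U j k))"
    by (simp add: sum_distrib_left min_tensor_mult[OF tensors(2)] crd_action)
  finally show "cmul (crd k (left_action r z) x) = (\<Sum>j<n. s' (crd j (left_action r z) x) (U j k))" .
qed

lemma pair_add:
  "p \<in> jmod \<times> free_module jfix m \<Longrightarrow> q \<in> jmod \<times> free_module jfix m \<Longrightarrow> p + q \<in> jmod \<times> free_module jfix m"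
  by (auto simp: free_module_def jmod_add jfix_add)

lemma pair_zero: "0 \<in> jmod \<times> free_module jfix m"
  by (auto simp: free_module_def jmod_zero jfix_zero zero_prod_def)

lemma pair_act: "r \<in> jfix \<Longrightarrow> p \<in> jmod \<times> free_module jfix m \<Longrightarrow> jact r p \<in> jmod \<times> free_module jfix m"
  by (auto simp: free_module_def jmod_act jfix_mult jact_def)

text \<open>\<open>equivariant_row\<close> recovers the module component from its coefficients,
  \<open>jfix_tensor\<close> the free component.\<close>

lemma jrow_inj:
  assumes p: "p \<in> jmod \<times> free_module jfix m" and z: "\<And>l x. l < n + m \<Longrightarrow> jrow p l x = 0"
  shows "p = 0"
proof -
  have "crd k (fst p) = 0" if k: "k < n" for k
  proof
    fix x
    have "crd k (fst p) x = (\<Sum>l<n. s (hav (\<Sum>k<n. crd k (fst p) x * s 1 (W k l))) (U l k))"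
      by (rule equivariant_row[OF _ k]) (use p in \<open>auto intro: jmod_coord(2)\<close>)
    also have "\<dots> = (\<Sum>l<n. s (jrow p l x) (U l k))" by (simp add: jrow_def)
    finally show "crd k (fst p) x = 0 x" using z by (simp add: cbilinear_zero_left[OF sb])
  qed
  then have "fst p = 0" by (intro coord_eqI[OF basis]) (simp add: crd_zero)
  moreover have "snd p i = 0" for i
  proof (cases "i < m")
    case True
    then have r: "snd p i \<in> jfix" using p by (auto simp: free_module_def)
    show ?thesis
    proof
      fix x
      have "hav (snd p i x) = 0" using z[of "n + i" x] True by (simp add: jrow_def)
      then show "snd p i x = 0 x" using jfix_tensor[OF r, of x] by (simp add: cbilinear_zero_left[OF sb])
    qed
  qed (use p in \<open>auto simp: free_module_def\<close>)
  ultimately show ?thesis by (simp add: prod_eq_iff fun_eq_iff)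
qed

lemma jrow_C01: assumes p: "p \<in> jmod \<times> free_module jfix m" and l: "l < n + m" shows "jrow p l \<in> C01"
proof (cases "l < n")
  case True
  have "(\<lambda>x. hav (\<Sum>k<n. crd k (fst p) x * s 1 (W k l))) \<in> C01"
    by (rule C01_linear[OF rslice(1)[OF tensors(1) h]], rule C01_sum, rule C01_mult)
      (use p jmod_coord(1) in \<open>auto simp: C01_const jalg_iff\<close>)
  then show ?thesis using True by (simp add: jrow_def[abs_def])
next
  case False
  then have "snd p (l - n) \<in> jfix" using p l by (auto simp: free_module_def)
  from jfix_C01[OF this] show ?thesis using False by (simp add: jrow_def[abs_def])
qed

lemma jrow_0: assumes p: "p \<in> jmod \<times> free_module jfix m" and l: "l < n + m" shows "\<exists>c. jrow p l 0 = c *\<^sub>C 1"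
proof (cases "l < n")
  case True
  have "(\<Sum>k<n. crd k (fst p) 0 * s 1 (W k l)) \<in> range (s 1)"
    by (intro s1_range(6) s1_range(3)) (use p jmod_coord(1) in \<open>auto simp: jalg_iff\<close>)
  then show ?thesis using True by (auto simp: jrow_def hav_scalar)
next
  case False
  then have "snd p (l - n) \<in> jfix" using p l by (auto simp: free_module_def)
  from jfix_0[OF this] show ?thesis using False by (simp add: jrow_def)
qed

lemma jrow_1:
  assumes p: "p \<in> jmod \<times> free_module jfix m"
  shows "good_row (\<lambda>l. jrow p l 1)" "n \<le> l \<Longrightarrow> l < n + m \<Longrightarrow> s (jrow p l 1) 1 \<in> range \<delta>"
proof -
  have "(\<Sum>l<n. s (jrow p l 1) (U l k)) = crd k (fst p) 1" if k: "k < n" for k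
  proof -
    have "crd k (fst p) 1 = (\<Sum>l<n. s (hav (\<Sum>k<n. crd k (fst p) 1 * s 1 (W k l))) (U l k))"
      by (rule equivariant_row[OF _ k]) (use p in \<open>auto intro: jmod_coord(2)\<close>)
    then show ?thesis by (simp add: jrow_def)
  qed
  moreover have "crd k (fst p) 1 \<in> range \<delta>" if "k < n" for k
    using p jmod_coord(1)[OF _ that] by (auto simp: jalg_iff)
  ultimately show "good_row (\<lambda>l. jrow p l 1)" by (simp add: good_row_def)
  show "s (jrow p l 1) 1 \<in> range \<delta>" if "n \<le> l" "l < n + m"
  proof -
    have "snd p (l - n) \<in> jfix" using p that by (auto simp: free_module_def)
    from jfix_1[OF this] show ?thesis using that by (simp add: jrow_def)
  qed
qed

text \<open>Converse to \<open>jrow_C01\<close>, \<open>jrow_0\<close> and \<open>jrow_1\<close>: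
  continuity and the two boundary conditions describe the rows completely.\<close>

lemma jrow_exists:
  assumes C: "\<And>l. l < n + m \<Longrightarrow> a l \<in> C01" and a0: "\<And>l. l < n + m \<Longrightarrow> \<exists>c. a l 0 = c *\<^sub>C 1"
    and a1: "good_row (\<lambda>l. a l 1)" "\<And>l. n \<le> l \<Longrightarrow> l < n + m \<Longrightarrow> s (a l 1) 1 \<in> range \<delta>"
  shows "\<exists>p \<in> jmod \<times> free_module jfix m. \<forall>l<n + m. \<forall>x. jrow p l x = a l x"
proof -
  define b where "b k = (\<lambda>x. \<Sum>l<n. s (a l x) (U l k))" for k
  define z where "z = (\<Sum>k<n. atens (b k) (e k))"
  define y where "y i = (if i < m then (\<lambda>x. s (a (n + i) x) 1) else 0)" for i
  have crd: "crd k z = b k" if "k < n" for k unfolding z_def by (rule coord_sum[OF basis that])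
  have "z \<in> jmod"
  proof (rule jmodI)
    fix k assume k: "k < n"
    have "b k \<in> C01"
    proof -
      have "(\<lambda>x. \<Sum>l<n. s (a l x) 1 * s 1 (U l k)) \<in> C01"
        by (rule C01_sum, rule C01_mult, rule C01_linear[OF cstar_hom_bounded_linear[OF min_tensor_left_hom[OF tensors(1)]]])
          (auto simp: C01_const intro: C)
      then show ?thesis by (simp add: b_def min_tensor_mult[OF tensors(1)])
    qed
    moreover have "b k 0 \<in> range (s 1)"
      unfolding b_def
    proof (rule s1_range(6))
      fix l assume "l \<in> {..<n}"
      then obtain c where "a l 0 = c *\<^sub>C 1" using a0[of l] by auto
      then have "s (a l 0) (U l k) = s 1 (c *\<^sub>C U l k)" by (simp add: cbilinear_scaleC_left[OF sb] cbilinear_scaleC_right[OF sb])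
      then show "s (a l 0) (U l k) \<in> range (s 1)" by simp
    qed
    moreover have "b k 1 \<in> range \<delta>" using a1(1) k by (simp add: good_row_def b_def)
    ultimately show "crd k z \<in> jalg" by (simp add: crd[OF k] jalg_iff)
    fix x
    show "cmul (crd k z x) = (\<Sum>j<n. s' (crd j z x) (U j k))"
      using row_equivariant[OF k, of "\<lambda>l. a l x"] by (simp add: crd k b_def)
  qed
  moreover have "y \<in> free_module jfix m"
    unfolding free_module_def y_def using C a0 a1(2) by (auto intro!: jfixI)
  moreover have "jrow (z, y) l x = a l x" if l: "l < n + m" for l x
  proof (cases "l < n")
    case True
    then show ?thesis using row_coefficients[OF True, of "\<lambda>l. a l x"] by (simp add: jrow_def crd b_def)
  next
    case False
    then have "l - n < m" using l by linarith
    then show ?thesis using False by (simp add: jrow_def y_def hav_left)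
  qed
  ultimately show ?thesis by blast
qed
end

section \<open>The matrix of a basis of the stabilised module and its inverse\<close>

context comodule_of_coaction
begin

text \<open>\<open>G\<close> consists of the rows of the preimages of the standard basis.
  Membership, generation and independence record what is used of the isomorphism, now in terms of
  A-valued functions.\<close>

lemma stably_free_rows:
  assumes "stably_free jfix left_action jmod"
  obtains N m and G :: "nat \<Rightarrow> nat \<Rightarrow> real \<Rightarrow> 'a" where
    "\<forall>i<N. \<exists>p \<in> jmod \<times> free_module jfix m. G i = jrow p"
    "\<forall>p \<in> jmod \<times> free_module jfix m.
      \<exists>r. (\<forall>i<N. r i \<in> jfix) \<and> (\<forall>l x. jrow p l x = (\<Sum>i<N. hav (r i x) * G i l x))"
    "\<forall>r. (\<forall>i<N. r i \<in> jfix) \<and> (\<forall>l<n + m. \<forall>x. (\<Sum>i<N. hav (r i x) * G i l x) = 0) \<longrightarrow> (\<forall>i<N. r i = 0)"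
proof -
  obtain m N f where bij: "bij_betw f (jmod \<times> free_module jfix m) (free_module jfix N)"
    and add: "\<forall>p \<in> jmod \<times> free_module jfix m. \<forall>q \<in> jmod \<times> free_module jfix m. f (p + q) = f p + f q"
    and act: "\<forall>r\<in>jfix. \<forall>x\<in>jmod. \<forall>y \<in> free_module jfix m. f (left_action r x, \<lambda>i. r * y i) = (\<lambda>i. r * f (x, y) i)"
    using assms unfolding stably_free_def by blast
  let ?M = "jmod \<times> free_module jfix m"
  have fact: "f (jact r p) i = r * f p i" if "r \<in> jfix" "p \<in> ?M" for r p i
    using act that by (auto simp: jact_def)
  have f0: "f 0 = 0" using add pair_zero[of m] by (metis add_cancel_left_left)
  define E :: "nat \<Rightarrow> nat \<Rightarrow> real \<Rightarrow> 'ah" where "E i j = (if j = i then 1 else 0)" for i j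
  define v where "v i = inv_into ?M f (E i)" for i
  have E: "E i \<in> free_module jfix N" if "i < N" for i
    using that by (auto simp: free_module_def E_def jfix_zero jfix_one)
  have v: "v i \<in> ?M" "f (v i) = E i" if "i < N" for i
  proof -
    have "E i \<in> f ` ?M" using E[OF that] bij by (simp add: bij_betw_def)
    then show "v i \<in> ?M" "f (v i) = E i" unfolding v_def by (rule inv_into_into, rule f_inv_into_f)
  qed
  \<comment> \<open>f is additive and linear only on the pairs in \<open>?M\<close>, so membership
    is carried through the induction.\<close>
  have comb: "(\<Sum>i\<in>I. jact (r i) (v i)) \<in> ?M \<and> f (\<Sum>i\<in>I. jact (r i) (v i)) j = (\<Sum>i\<in>I. r i * E i j)
      \<and> jrow (\<Sum>i\<in>I. jact (r i) (v i)) l x = (\<Sum>i\<in>I. hav (r i x) * jrow (v i) l x)"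
    if "finite I" "\<And>i. i \<in> I \<Longrightarrow> i < N" "\<And>i. i < N \<Longrightarrow> r i \<in> jfix" for I r j l x
    using that(1,2)
  proof (induction I rule: finite_induct)
    case empty
    then show ?case using pair_zero by (simp add: f0 jrow_zero)
  next
    case (insert i I)
    have i: "i < N" using insert by simp
    have a: "jact (r i) (v i) \<in> ?M" by (rule pair_act[OF that(3)[OF i] v(1)[OF i]])
    have IH: "(\<Sum>i\<in>I. jact (r i) (v i)) \<in> ?M" "f (\<Sum>i\<in>I. jact (r i) (v i)) j = (\<Sum>i\<in>I. r i * E i j)"
      "jrow (\<Sum>i\<in>I. jact (r i) (v i)) l x = (\<Sum>i\<in>I. hav (r i x) * jrow (v i) l x)"
      using insert.IH insert.prems by (blast intro: insertI2)+
    have "f (jact (r i) (v i) + (\<Sum>i\<in>I. jact (r i) (v i))) j = r i * E i j + (\<Sum>i\<in>I. r i * E i j)"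
      using add[rule_format, OF a IH(1)] IH(2) fact[OF that(3)[OF i] v(1)[OF i]] by (simp add: v(2)[OF i])
    moreover have "jrow (jact (r i) (v i) + (\<Sum>i\<in>I. jact (r i) (v i))) l x
        = hav (r i x) * jrow (v i) l x + (\<Sum>i\<in>I. hav (r i x) * jrow (v i) l x)"
      by (simp only: jrow_add jrow_act[OF that(3)[OF i]] IH(3))
    ultimately show ?case
      using pair_add[OF a IH(1)] by (simp only: sum.insert[OF insert(1,2)])
  qed
  have combN: "(\<Sum>i<N. jact (r i) (v i)) \<in> ?M \<and> f (\<Sum>i<N. jact (r i) (v i)) j = (\<Sum>i<N. r i * E i j)
      \<and> jrow (\<Sum>i<N. jact (r i) (v i)) l x = (\<Sum>i<N. hav (r i x) * jrow (v i) l x)"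
    if "\<And>i. i < N \<Longrightarrow> r i \<in> jfix" for r j l x
    by (rule comb) (simp_all add: that)
  have fcomb: "f (\<Sum>i<N. jact (r i) (v i)) j = (if j < N then r j else 0)" if "\<And>i. i < N \<Longrightarrow> r i \<in> jfix" for r j
    using conjunct1[OF conjunct2[OF combN[of r j, OF that]]]
    by (simp add: E_def if_distrib[where f = "\<lambda>c. _ * c"] cong: if_cong)
  have Mcomb: "(\<Sum>i<N. jact (r i) (v i)) \<in> ?M" if "\<And>i. i < N \<Longrightarrow> r i \<in> jfix" for r
    by (rule conjunct1[OF combN[of r, OF that]])
  have jcomb: "jrow (\<Sum>i<N. jact (r i) (v i)) l x = (\<Sum>i<N. hav (r i x) * jrow (v i) l x)"
    if "\<And>i. i < N \<Longrightarrow> r i \<in> jfix" for r l x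
    by (rule conjunct2[OF conjunct2[OF combN[of r, OF that]]])
  show ?thesis
  proof (rule that[of N m "\<lambda>i. jrow (v i)"])
    show "\<forall>i<N. \<exists>p\<in>?M. jrow (v i) = jrow p" using v(1) by blast
    show "\<forall>p\<in>?M. \<exists>r. (\<forall>i<N. r i \<in> jfix) \<and> (\<forall>l x. jrow p l x = (\<Sum>i<N. hav (r i x) * jrow (v i) l x))"
    proof (intro ballI exI conjI)
      fix p assume p: "p \<in> ?M"
      have fp: "f p \<in> free_module jfix N" using bij p by (auto simp: bij_betw_def)
      then have r: "\<And>i. i < N \<Longrightarrow> f p i \<in> jfix" by (simp add: free_module_def)
      then show "\<forall>i<N. f p i \<in> jfix" by simp
      have "f (\<Sum>i<N. jact (f p i) (v i)) = f p"
        using fp by (auto simp: fun_eq_iff[of "f _"] fcomb[OF r] free_module_def)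
      then have "(\<Sum>i<N. jact (f p i) (v i)) = p"
        using inj_onD[OF bij_betw_imp_inj_on[OF bij] _ Mcomb[OF r] p] by simp
      then show "\<forall>l x. jrow p l x = (\<Sum>i<N. hav (f p i x) * jrow (v i) l x)"
        using jcomb[of "f p", OF r] by simp
    qed
    show "\<forall>r. (\<forall>i<N. r i \<in> jfix) \<and> (\<forall>l<n + m. \<forall>x. (\<Sum>i<N. hav (r i x) * jrow (v i) l x) = 0) \<longrightarrow> (\<forall>i<N. r i = 0)"
    proof (intro allI impI, elim conjE)
      fix r i assume r: "\<forall>i<N. r i \<in> jfix" and z: "\<forall>l<n + m. \<forall>x. (\<Sum>i<N. hav (r i x) * jrow (v i) l x) = 0"
        and i: "i < N"
      have "(\<Sum>i<N. jact (r i) (v i)) = 0"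
        by (rule jrow_inj) (use Mcomb[of r] jcomb[of r] r z in auto)
      then show "r i = 0" using fcomb[of r i, OF r[rule_format]] f0 i by simp
    qed
  qed
qed

lemma ramp_0: "ramp 0 = (0 :: 'x::cstar_algebra)" and ramp_1: "ramp 1 = (1 :: 'x)"
  and ramp_commute: "ramp x * y = y * (ramp x :: 'x)"
  by (simp_all add: ramp_def of_real_commute)

text \<open>One-sided inverses over A need not be two-sided, so both products require an argument.
  The left inverse is \<gamma> = \<alpha> + \<beta>, where \<alpha> expands (1 - x) times a unit row
  over the fixed-point algebra and \<beta> expands x times a unit row over C([0,1],A).\<close>

lemma stably_free_inverse:
  assumes free: "free_coaction s \<delta>" and sf: "stably_free jfix left_action jmod"
  obtains N m and G \<gamma> :: "nat \<Rightarrow> nat \<Rightarrow> real \<Rightarrow> 'a" where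
    "\<forall>i<N. \<exists>p \<in> jmod \<times> free_module jfix m. G i = jrow p"
    "\<forall>i<n + m. \<forall>j<n + m. \<forall>x\<in>{0..1}. (\<Sum>k<N. \<gamma> i k x * G k j x) = (if i = j then 1 else 0)"
    "\<forall>i<N. \<forall>j<N. \<forall>x\<in>{0..1}. (\<Sum>k<n + m. G i k x * \<gamma> k j x) = (if i = j then 1 else 0)"
proof -
  obtain N m and G :: "nat \<Rightarrow> nat \<Rightarrow> real \<Rightarrow> 'a" where G: "\<forall>i<N. \<exists>p \<in> jmod \<times> free_module jfix m. G i = jrow p"
    and expand: "\<forall>p \<in> jmod \<times> free_module jfix m.
      \<exists>r. (\<forall>i<N. r i \<in> jfix) \<and> (\<forall>l x. jrow p l x = (\<Sum>i<N. hav (r i x) * G i l x))"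
    and indep: "\<forall>r. (\<forall>i<N. r i \<in> jfix) \<and> (\<forall>l<n + m. \<forall>x. (\<Sum>i<N. hav (r i x) * G i l x) = 0) \<longrightarrow> (\<forall>i<N. r i = 0)"
    using stably_free_rows[OF sf] by blast
  define K where "K = n + m"
  have GC: "G i l \<in> C01" if "i < N" "l < K" for i l using G[rule_format, OF that(1)] jrow_C01 that(2) by (auto simp: K_def)
  have row: "\<exists>r. (\<forall>i<N. r i \<in> jfix) \<and> (\<forall>l<K. \<forall>x. a l x = (\<Sum>i<N. hav (r i x) * G i l x))"
    if "\<And>l. l < K \<Longrightarrow> a l \<in> C01" "\<And>l. l < K \<Longrightarrow> \<exists>c. a l 0 = c *\<^sub>C 1"
      "good_row (\<lambda>l. a l 1)" "\<And>l. n \<le> l \<Longrightarrow> l < K \<Longrightarrow> s (a l 1) 1 \<in> range \<delta>" for a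
  proof -
    note E = jrow_exists[of m a, folded K_def, OF that]
    obtain p where "p \<in> jmod \<times> free_module jfix m" "\<forall>l<n + m. \<forall>x. jrow p l x = a l x"
      using E unfolding K_def by blast
    with expand[rule_format, of p] show ?thesis by (auto simp: K_def)
  qed
  have good0: "good_row (\<lambda>l. 0)" by (simp add: good_row_def cbilinear_zero_left[OF sb] \<delta>_range(1))

  \<comment> \<open>\<open>(1 - x) e\<^sub>k\<close> lies in the module, being scalar at \<open>0\<close> and zero at \<open>1\<close>; \<open>x e\<^sub>k\<close> is only a combination of
    module elements with coefficients in \<open>A\<close>.\<close>
  have "\<exists>r. (\<forall>i<N. r i \<in> jfix) \<and> (\<forall>l<K. \<forall>x. (if k = l then 1 - ramp x else 0) = (\<Sum>i<N. hav (r i x) * G i l x))"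
    (is "\<exists>r. ?P k r") for k
  proof (rule row)
    show "(\<lambda>x. if k = l then 1 - ramp x else 0 :: 'a) \<in> C01" for l
      by (cases "k = l") (simp_all add: C01_const C01_diff ramp_C01)
    show "\<exists>c. (if k = l then 1 - ramp 0 else 0 :: 'a) = c *\<^sub>C 1" for l
      by (cases "k = l") (auto simp: ramp_0 intro: exI[of _ 1] exI[of _ 0])
  qed (simp_all add: ramp_1 good0 cbilinear_zero_left[OF sb] \<delta>_range(1) cong: if_cong)
  then have "\<forall>k. \<exists>r. ?P k r" by blast
  from choice[OF this] obtain \<alpha> where "\<forall>k. ?P k (\<alpha> k)" by (elim exE)
  then have \<alpha>: "\<And>k i. i < N \<Longrightarrow> \<alpha> k i \<in> jfix"
    and \<alpha>G: "\<And>k l x. l < K \<Longrightarrow> (\<Sum>i<N. hav (\<alpha> k i x) * G i l x) = (if k = l then 1 - ramp x else 0)"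
    by simp_all

  \<comment> \<open>\<open>gens\<close> puts no boundary conditions on the coefficients, which
    brings x times a unit row within reach.\<close>
  define gens where "gens v \<longleftrightarrow> (\<exists>b. (\<forall>i<N. b i \<in> C01) \<and> (\<forall>l<K. \<forall>x. v l x = (\<Sum>i<N. b i x * G i l x)))"
    for v :: "nat \<Rightarrow> real \<Rightarrow> 'a"
  have gens_row: "gens a" if "\<And>l. l < K \<Longrightarrow> a l \<in> C01" "\<And>l. l < K \<Longrightarrow> \<exists>c. a l 0 = c *\<^sub>C 1"
      "good_row (\<lambda>l. a l 1)" "\<And>l. n \<le> l \<Longrightarrow> l < K \<Longrightarrow> s (a l 1) 1 \<in> range \<delta>" for a
  proof -
    note R = row[of a, OF that]
    obtain r where "\<forall>i<N. r i \<in> jfix" "\<forall>l<K. \<forall>x. a l x = (\<Sum>i<N. hav (r i x) * G i l x)"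
      using R by blast
    then show ?thesis unfolding gens_def using jfix_C01 by (intro exI[of _ "\<lambda>i x. hav (r i x)"]) auto
  qed
  have gens_add: "gens (\<lambda>l x. v l x + w l x)" if vw: "gens v" "gens w" for v w
  proof -
    obtain b c where "\<forall>i<N. b i \<in> C01" "\<forall>l<K. \<forall>x. v l x = (\<Sum>i<N. b i x * G i l x)"
      "\<forall>i<N. c i \<in> C01" "\<forall>l<K. \<forall>x. w l x = (\<Sum>i<N. c i x * G i l x)"
      using vw unfolding gens_def by blast
    then show ?thesis
      unfolding gens_def by (intro exI[of _ "\<lambda>i x. b i x + c i x"]) (simp add: C01_add distrib_right sum.distrib)
  qed
  have gens_mult: "gens (\<lambda>l x. y * v l x)" if v: "gens v" for v y
  proof -
    obtain b where "\<forall>i<N. b i \<in> C01" "\<forall>l<K. \<forall>x. v l x = (\<Sum>i<N. b i x * G i l x)"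
      using v unfolding gens_def by blast
    then show ?thesis
      unfolding gens_def by (intro exI[of _ "\<lambda>i x. y * b i x"]) (simp add: C01_mult C01_const sum_distrib_left mult.assoc)
  qed
  have gens_zero: "gens (\<lambda>l x. 0)" unfolding gens_def by (intro exI[of _ "\<lambda>i x. 0"]) (simp add: C01_const)
  have "gens (\<lambda>l x. if k = l then ramp x else 0)" if k: "k < K" for k
  proof (cases "k < n")
    case False
    show ?thesis
    proof (rule gens_row)
      show "(\<lambda>x. if k = l then ramp x else 0 :: 'a) \<in> C01" for l
        by (cases "k = l") (simp_all add: C01_const ramp_C01)
      show "\<exists>c. (if k = l then ramp 0 else 0 :: 'a) = c *\<^sub>C 1" for l by (auto simp: ramp_0 intro: exI[of _ 0])
      show "good_row (\<lambda>l. if k = l then ramp 1 else 0)"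
        using False good0 by (simp add: good_row_def ramp_1 cbilinear_zero_left[OF sb])
      show "s (if k = l then ramp 1 else 0) 1 \<in> range \<delta>" for l
        by (simp add: ramp_1 cbilinear_zero_left[OF sb] \<delta>_range(1,5) min_tensor_one[OF tensors(1)])
    qed
  next
    case True
    obtain xs where xs: "\<forall>(y, w)\<in>set xs. good_row w" "\<forall>j<n. (\<Sum>(y, w)\<leftarrow>xs. y * w j) = (if k = j then 1 else 0)"
      using good_rows_generate[OF free True] by blast
    have "gens (\<lambda>l x. ramp x * (if l < n then \<Sum>(y, w)\<leftarrow>xs. y * w l else 0))" using xs(1)
    proof (induction xs)
      case Nil
      show ?case using gens_zero by (simp cong: if_cong)
    next
      case (Cons yw xs)
      obtain y w where yw: "yw = (y, w)" by (cases yw)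
      \<comment> \<open>The factor x makes the constant good row w vanish at 0 and leaves it good at
        1, so the product is a row of the module.\<close>
      have "gens (\<lambda>l x. ramp x * (if l < n then w l else 0))"
      proof (rule gens_row)
        show "(\<lambda>x. ramp x * (if l < n then w l else 0)) \<in> C01" for l by (intro C01_mult C01_const ramp_C01)
        show "\<exists>c. ramp 0 * (if l < n then w l else 0) = c *\<^sub>C 1" for l by (auto simp: ramp_0 intro: exI[of _ 0])
        show "good_row (\<lambda>l. ramp 1 * (if l < n then w l else 0))"
          using Cons.prems by (simp add: good_row_def ramp_1 yw)
      qed (simp add: cbilinear_zero_left[OF sb] \<delta>_range(1))
      from gens_add[OF gens_mult[OF this, of y] Cons.IH] Cons.prems
      have "gens (\<lambda>l x. y * (ramp x * (if l < n then w l else 0)) + ramp x * (if l < n then \<Sum>(y, w)\<leftarrow>xs. y * w l else 0))"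
        by simp
      moreover have "y * (ramp x * z) = ramp x * (y * z)" for x z by (metis mult.assoc ramp_commute)
      ultimately show ?case by (simp add: yw distrib_left[symmetric] if_distrib cong: if_cong)
    qed
    moreover have "ramp x * (if l < n then \<Sum>(y, w)\<leftarrow>xs. y * w l else 0) = (if k = l then ramp x else 0)" for l x
      using xs(2) True by auto
    ultimately show ?thesis by simp
  qed
  then have "\<forall>k. \<exists>b. k < K \<longrightarrow> (\<forall>i<N. b i \<in> C01) \<and> (\<forall>l<K. \<forall>x. (if k = l then ramp x else 0) = (\<Sum>i<N. b i x * G i l x))"
    (is "\<forall>k. \<exists>b. ?P k b")
    unfolding gens_def by blast
  from choice[OF this] obtain \<beta> where "\<forall>k. ?P k (\<beta> k)" by (elim exE)
  then have \<beta>: "\<And>k i. k < K \<Longrightarrow> i < N \<Longrightarrow> \<beta> k i \<in> C01"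
    and \<beta>G: "\<And>k l x. k < K \<Longrightarrow> l < K \<Longrightarrow> (\<Sum>i<N. \<beta> k i x * G i l x) = (if k = l then ramp x else 0)"
    by simp_all
  define \<gamma> where "\<gamma> k i x = hav (\<alpha> k i x) + \<beta> k i x" for k i x
  have \<gamma>G: "(\<Sum>k<N. \<gamma> i k x * G k j x) = (if i = j then 1 else 0)" if "i < K" "j < K" for i j x
    using that by (simp add: \<gamma>_def distrib_right sum.distrib \<alpha>G \<beta>G)
  have \<gamma>C: "\<gamma> k i \<in> C01" if "k < K" "i < N" for k i
    using C01_add[OF jfix_C01[OF \<alpha>[OF that(2)]] \<beta>[OF that]] by (simp add: \<gamma>_def[abs_def])

  \<comment> \<open>The factor \<open>1 - x\<close> in front brings the coefficients into the fixed-point algebra, where independence of the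
    basis applies to the relation \<open>((1 - x) - G \<alpha>) G = 0\<close>.\<close>
  have G\<alpha>: "(1 - ramp x) * ((if i = j then 1 - ramp x else 0) - (\<Sum>l<K. G i l x * hav (\<alpha> l j x))) = 0"
    if ij: "i < N" "j < N" for i j x
  proof -
    define q where "q j x = (1 - ramp x) * ((if i = j then 1 - ramp x else 0) - (\<Sum>l<K. G i l x * hav (\<alpha> l j x)))" for j x
    have lin: "(\<Sum>j<N. c * (A j - B j) * D j) = c * ((\<Sum>j<N. A j * D j) - (\<Sum>j<N. B j * D j))"
      for c :: 'a and A B D
      by (simp add: mult.assoc left_diff_distrib sum_subtractf sum_distrib_left[symmetric])
    have "(\<lambda>x. s (q j x) 1) \<in> jfix" if j: "j < N" for j
    proof (rule jfixI)
      have "(\<lambda>x. if i = j then 1 - ramp x else 0 :: 'a) \<in> C01"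
        by (cases "i = j") (simp_all add: C01_const C01_diff ramp_C01)
      moreover have "(\<lambda>x. \<Sum>l<K. G i l x * hav (\<alpha> l j x)) \<in> C01"
        using ij(1) j \<alpha> by (intro C01_sum C01_mult GC jfix_C01) auto
      ultimately show "q j \<in> C01"
        unfolding q_def[abs_def] by (intro C01_mult C01_diff C01_const ramp_C01)
      have "\<exists>c. G i l 0 * hav (\<alpha> l j 0) = c *\<^sub>C 1" if l: "l < K" for l
      proof -
        obtain c d where "G i l 0 = c *\<^sub>C 1" "hav (\<alpha> l j 0) = d *\<^sub>C 1"
          using G[rule_format, OF ij(1)] jrow_0 l jfix_0[OF \<alpha>[OF j]] by (metis K_def)
        then show ?thesis by (auto simp: mult_scaleC_left mult_scaleC_right scaleC_scaleC)
      qed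
      then obtain c where c: "\<And>l. l < K \<Longrightarrow> G i l 0 * hav (\<alpha> l j 0) = c l *\<^sub>C 1" by metis
      have "q j 0 = ((if i = j then 1 else 0) - (\<Sum>l<K. c l)) *\<^sub>C 1"
        by (simp add: q_def ramp_0 c complex_vector.scale_left_diff_distrib complex_vector.scale_sum_left)
      then show "\<exists>c. q j 0 = c *\<^sub>C 1" by blast
      show "s (q j 1) 1 \<in> range \<delta>" by (simp add: q_def ramp_1 cbilinear_zero_left[OF sb] \<delta>_range(1))
    qed
    moreover have "(\<Sum>j<N. hav (s (q j x) 1) * G j l x) = 0" if l: "l < K" for l x
    proof -
      have "(\<Sum>j<N. q j x * G j l x) = (1 - ramp x) * ((\<Sum>j<N. (if i = j then 1 - ramp x else 0) * G j l x)
          - (\<Sum>j<N. (\<Sum>k<K. G i k x * hav (\<alpha> k j x)) * G j l x))"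
        unfolding q_def by (rule lin)
      also have "(\<Sum>j<N. (if i = j then 1 - ramp x else 0) * G j l x) = (1 - ramp x) * G i l x"
        using ij(1) by (simp add: if_distrib[where f = "\<lambda>c. c * _"] cong: if_cong)
      also have "(\<Sum>j<N. (\<Sum>k<K. G i k x * hav (\<alpha> k j x)) * G j l x) = (\<Sum>k<K. G i k x * (\<Sum>j<N. hav (\<alpha> k j x) * G j l x))"
        by (rule mat_assoc[symmetric])
      also have "\<dots> = G i l x * (1 - ramp x)"
        using l by (simp add: \<alpha>G if_distrib[where f = "\<lambda>c. _ * c"] cong: if_cong)
      finally show ?thesis by (simp add: hav_left left_diff_distrib right_diff_distrib ramp_commute)
    qed
    ultimately have "(\<lambda>x. s (q j x) 1) = 0"
      using indep[rule_format, of "\<lambda>j x. s (q j x) 1" j] ij(2) by (simp add: K_def)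
    then have "s (q j x) 1 = 0" by (simp add: fun_eq_iff)
    then have "q j x = 0" using hav_left[of "q j x"] by (simp add: complex_vector.linear_0[OF hav_lin])
    then show ?thesis by (simp add: q_def)
  qed
  \<comment> \<open>For x < 1 the factor 1 - x cancels: G \<alpha> = (1 - x) 1, hence \<alpha> = (1
    - x) \<gamma>, and a second cancellation gives G \<gamma> = 1.\<close>
  have G\<gamma>: "(\<Sum>k<K. G i k x * \<gamma> k j x) = (if i = j then 1 else 0)" if ij: "i < N" "j < N" and x: "x \<in> {0..<1}" for i j x
  proof -
    define c where "c = complex_of_real (1 - x)"
    have c: "c \<noteq> 0" using x by (auto simp: c_def)
    have r: "1 - ramp x = c *\<^sub>C (1 :: 'a)"
      unfolding c_def using x by (subst of_real_scaleC[symmetric]) (simp add: ramp_eq)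
    have G\<alpha>': "(\<Sum>l<K. G i l x * hav (\<alpha> l j x)) = (if i = j then c *\<^sub>C 1 else 0)" if "i < N" "j < N" for i j
      using G\<alpha>[OF that, of x] c unfolding r by (simp add: mult_scaleC_left)
    have "hav (\<alpha> k j x) = c *\<^sub>C \<gamma> k j x" if k: "k < K" for k
    proof -
      have "(\<Sum>i<N. \<gamma> k i x * (\<Sum>l<K. G i l x * hav (\<alpha> l j x))) = (\<Sum>l<K. (\<Sum>i<N. \<gamma> k i x * G i l x) * hav (\<alpha> l j x))"
        by (rule mat_assoc)
      also have "\<dots> = hav (\<alpha> k j x)" using k by (simp add: \<gamma>G kronecker_sum_left)
      also have "(\<Sum>i<N. \<gamma> k i x * (\<Sum>l<K. G i l x * hav (\<alpha> l j x))) = c *\<^sub>C \<gamma> k j x"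
        using ij(2) by (simp add: G\<alpha>' if_distrib[where f = "\<lambda>c. _ * c"] mult_scaleC_right cong: if_cong)
      finally show ?thesis by simp
    qed
    then have "(if i = j then c *\<^sub>C 1 else 0) = c *\<^sub>C (\<Sum>k<K. G i k x * \<gamma> k j x)"
      using G\<alpha>'[OF ij] by (simp add: mult_scaleC_right complex_vector.scale_sum_right)
    with c show ?thesis by (cases "i = j") (auto dest: sym)
  qed
  \<comment> \<open>The product is continuous on [0,1] and constant on the dense subset [0,1), which
    settles the point 1.\<close>
  have G\<gamma>1: "(\<Sum>k<K. G i k x * \<gamma> k j x) = (if i = j then 1 else 0)" if ij: "i < N" "j < N" and x: "x \<in> {0..1}" for i j x
  proof -
    have "(\<lambda>x. \<Sum>k<K. G i k x * \<gamma> k j x) \<in> C01" using ij by (intro C01_sum C01_mult GC \<gamma>C) auto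
    then have cont: "continuous_on (closure {0..<1}) (\<lambda>x. \<Sum>k<K. G i k x * \<gamma> k j x)" by (simp add: C01_cts)
    show ?thesis by (rule continuous_constant_on_closure[OF cont]) (use G\<gamma>[OF ij] x in auto)
  qed
  show ?thesis by (rule that[of N m G \<gamma>]) (use G \<gamma>G G\<gamma>1 in \<open>auto simp: K_def\<close>)
qed

theorem stably_free_K1_trivial:
  assumes free: "free_coaction s \<delta>" and sf: "stably_free jfix left_action jmod"
    and \<theta>: "cstar_hom \<theta>" and eq: "\<And>y. min_tensor_map s t \<theta> id (\<delta> y) = \<Delta> (\<theta> y)"
    and bU: "block_matrix n U" and bW: "block_matrix n W"
  shows "K1_class U = K1_class mat_id"
proof -
  obtain N m and G \<gamma> :: "nat \<Rightarrow> nat \<Rightarrow> real \<Rightarrow> 'a" where G: "\<forall>i<N. \<exists>p \<in> jmod \<times> free_module jfix m. G i = jrow p"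
    and \<gamma>G: "\<forall>i<n + m. \<forall>j<n + m. \<forall>x\<in>{0..1}. (\<Sum>k<N. \<gamma> i k x * G k j x) = (if i = j then 1 else 0)"
    and G\<gamma>: "\<forall>i<N. \<forall>j<N. \<forall>x\<in>{0..1}. (\<Sum>k<n + m. G i k x * \<gamma> k j x) = (if i = j then 1 else 0)"
    using stably_free_inverse[OF free sf] by blast
  \<comment> \<open>Zero outside the block of size N by n + m, because
    \<open>clutching_trivial\<close> asks for continuity of every entry.\<close>
  define g where "g x i l = (if i < N \<and> l < n + m then \<theta> (G i l x) else 0)" for x i l
  define gi where "gi x l i = \<theta> (\<gamma> l i x)" for x l i
  have \<theta>01: "\<theta> (if P then 1 else 0) = (if P then 1 else 0)" for P
    by (simp add: cstar_hom_one[OF \<theta>] complex_vector.linear_0[OF cstar_hom_clinear[OF \<theta>]])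
  have \<theta>c: "\<theta> (c *\<^sub>C 1) = c *\<^sub>C 1" for c
    by (simp add: complex_vector.linear_scale[OF cstar_hom_clinear[OF \<theta>]] cstar_hom_one[OF \<theta>])
  note fibre = equivariant_hom_fibre[OF \<theta> eq]
  show ?thesis
  proof (rule clutching_trivial[OF h bU bW _ UW WU, of "n + m" g N gi])
    show "continuous_on {0..1} (\<lambda>x. g x i j)" for i j
    proof (cases "i < N \<and> j < n + m")
      case True
      then have "G i j \<in> C01" using G[rule_format, of i] jrow_C01 by auto
      then show ?thesis using True
        by (simp add: g_def C01_cts[OF C01_linear[OF cstar_hom_bounded_linear[OF \<theta>]]])
    next
      case False
      then have "g x i j = 0" for x by (auto simp: g_def)
      then show ?thesis by simp
    qed
    show "(\<Sum>l<n + m. g x i l * gi x l j) = (if i = j then 1 else 0)" if "x \<in> {0..1}" "i < N" "j < N" for x i j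
      using arg_cong[OF G\<gamma>[rule_format, OF that(2,3,1)], of \<theta>] that(2)
      by (simp add: g_def gi_def cstar_hom_sum[OF \<theta>] cstar_hom_mult[OF \<theta>] \<theta>01)
    show "(\<Sum>l<N. gi x i l * g x l j) = (if i = j then 1 else 0)" if "x \<in> {0..1}" "i < n + m" "j < n + m" for x i j
      using arg_cong[OF \<gamma>G[rule_format, OF that(2,3,1)], of \<theta>] that(3)
      by (simp add: g_def gi_def cstar_hom_sum[OF \<theta>] cstar_hom_mult[OF \<theta>] \<theta>01)
    show "\<exists>c. g 0 i l = c *\<^sub>C 1" if il: "i < N" "l < n + m" for i l
    proof -
      obtain c where "G i l 0 = c *\<^sub>C 1" using G[rule_format, OF il(1)] jrow_0 il(2) by metis
      then show ?thesis using il by (auto simp: g_def \<theta>c)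
    qed
    show "\<exists>c. (\<Sum>l<n. g 1 i l * W l k) = c *\<^sub>C 1" if ik: "i < N" "k < n" for i k
    proof -
      have "good_row (\<lambda>l. G i l 1)" using G[rule_format, OF ik(1)] jrow_1(1) by auto
      from fibre(2)[OF this ik(2)] show ?thesis using ik by (simp add: g_def)
    qed
    show "\<exists>c. g 1 i l = c *\<^sub>C 1" if il: "i < N" "n \<le> l" "l < n + m" for i l
    proof -
      have "s (G i l 1) 1 \<in> range \<delta>" using G[rule_format, OF il(1)] jrow_1(2)[OF _ il(2,3)] by auto
      then obtain y where "\<delta> y = s (G i l 1) 1" by (metis imageE)
      from fibre(1)[OF this] show ?thesis using il by (simp add: g_def)
    qed
  qed simp
qed

end

text \<open>Since A and H are carried by different types, (A, \<delta>) = (H, \<Delta>) is expressed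
  by an equivariant isomorphism \<theta>.\<close>

theorem theorem3p3:
  fixes tHH :: "'h::cstar_algebra \<Rightarrow> 'h \<Rightarrow> 'hh::cstar_algebra"
    and tHH_H :: "'hh \<Rightarrow> 'h \<Rightarrow> 'hhh::cstar_algebra"
    and tH_HH :: "'h \<Rightarrow> 'hh \<Rightarrow> 'hhh"
    and \<Delta> :: "'h \<Rightarrow> 'hh"
    and coV :: "'v::complex_vector \<Rightarrow> ('h, 'v) atensor"
    and n :: nat and e :: "nat \<Rightarrow> 'v" and U :: "nat \<Rightarrow> nat \<Rightarrow> 'h"
    and tAH :: "'a::cstar_algebra \<Rightarrow> 'h \<Rightarrow> 'ah::cstar_algebra"
    and tAH_H :: "'ah \<Rightarrow> 'h \<Rightarrow> 'ahh::cstar_algebra"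
    and tA_HH :: "'a \<Rightarrow> 'hh \<Rightarrow> 'ahh"
    and \<delta> :: "'a \<Rightarrow> 'ah"
  assumes "compact_quantum_group tHH tHH_H tH_HH \<Delta>"
    and "left_comodule tHH \<Delta> coV"
    and "rep_matrix coV n e U"
    and "K1_class U \<in> K1 - {K1_class mat_id}"
    and "coaction tHH \<Delta> tAH tAH_H tA_HH \<delta>"
    and "free_coaction tAH \<delta>"
    and "(\<exists>\<theta> :: 'a \<Rightarrow> 'h. cstar_hom \<theta> \<and> bij \<theta> \<and> min_tensor_map tAH tHH \<theta> id \<circ> \<delta> = \<Delta> \<circ> \<theta>)
      \<or> (\<exists>\<phi> :: 'a \<Rightarrow> complex. cstar_hom \<phi>)"
  shows "let B = join tAH \<delta>; tB = join_tensor tAH_H; \<delta>B = join_coaction \<Delta> tAH tA_HH;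
      P = peter_weyl (hopf_algebra tHH \<Delta>) B tB \<delta>B
    in \<not> stably_free (fixed_points B tB \<delta>B) left_action (cotensor P tB \<delta>B coV)"
proof -
  note cqg = assms(1) and comod = assms(2) and rep = assms(3) and K1 = assms(4) and coact = assms(5)
    and free = assms(6) and \<theta>\<phi> = assms(7)
  have hom\<Delta>: "cstar_hom \<Delta>" using cqg by (simp add: compact_quantum_group_def)
  have bil: "cbilinear tHH" using cqg by (auto simp: compact_quantum_group_def min_tensor3_def dest: min_tensor_cbilinear)
  obtain h where h: "cstate h" and haar: "\<And>d. act tHH \<Delta> h d = h d *\<^sub>C 1" using haar_state[OF cqg] by blast
  have basis: "inj_on e {..<n}" "cindependent (e ` {..<n})" "cspan (e ` {..<n}) = UNIV"
    and bU: "block_matrix n U" and Ue: "\<And>i. i < n \<Longrightarrow> coV (e i) = (\<Sum>j<n. atens (U i j) (e j))"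
    using rep by (auto simp: rep_matrix_def)
  have cV: "clinear coV" and rng: "range coV \<subseteq> atensor_of (hopf_algebra tHH \<Delta>) UNIV"
    and coass: "\<And>v. atensor_map \<Delta> id (coV v) = atensor_lift (\<lambda>h w. atensor_map (tHH h) id (coV w)) (coV v)"
    using comod by (auto simp: left_comodule_def)
  have crd: "coord n e j (coV (e i)) = U i j" if "i < n" "j < n" for i j
    using coord_sum[OF basis that(2)] by (simp add: Ue that(1))
  \<comment> \<open>Comparing coordinates in the coassociativity of the comodule shows that U is a
    corepresentation matrix.\<close>
  have corep: "\<Delta> (U i j) = (\<Sum>k<n. tHH (U i k) (U k j))" if ij: "i < n" "j < n" for i j
    using arg_cong[OF coass[of "e i"], of "coord n e j"]
    by (simp add: coord_map[OF basis cstar_hom_clinear[OF hom\<Delta>]] coord_coaction[OF basis cV Ue bil ij(2)] crd ij)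
  have UO: "U i j \<in> hopf_algebra tHH \<Delta>" if ij: "i < n" "j < n" for i j
    using coord_atensor_of[OF basis complex_vector.subspace_span, of "coV (e i)" _ UNIV j] rng crd[OF ij]
    unfolding hopf_algebra_def by auto
  \<comment> \<open>That the class of U lies in \<open>K1\<close> already makes U invertible, and
    the inverse can be taken in size n.\<close>
  obtain W where bW: "block_matrix n W"
    and UW: "\<And>i j. i < n \<Longrightarrow> j < n \<Longrightarrow> (\<Sum>k<n. U i k * W k j) = (if i = j then 1 else 0)"
    and WU: "\<And>i j. i < n \<Longrightarrow> j < n \<Longrightarrow> (\<Sum>k<n. W i k * U k j) = (if i = j then 1 else 0)"
    using K1_class_GL[of U] K1 GL_block_inverse[OF _ bU] by blast
  \<comment> \<open>Either the given isomorphism or the slice of \<delta> by the character.\<close>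
  obtain \<theta> where \<theta>: "cstar_hom \<theta>" and eq: "\<And>y. min_tensor_map tAH tHH \<theta> id (\<delta> y) = \<Delta> (\<theta> y)"
    using \<theta>\<phi> character_equivariant_hom[OF coact hom\<Delta>] by (auto simp: fun_eq_iff)
  interpret comodule_of_coaction tHH \<Delta> tAH tAH_H tA_HH \<delta> h n U W coV e "hopf_algebra tHH \<Delta>"
    by (intro comodule_of_coaction.intro rep_of_coaction.intro comodule_of_coaction_axioms.intro) (fact coact hom\<Delta> h haar corep UW WU cV Ue UO basis)+
  show ?thesis
    unfolding Let_def using stably_free_K1_trivial[OF free _ \<theta> eq bU bW] K1 by blast
qed

end
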